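(* Let $\Gamma$ be a non-trivial finite subgroup of $\mathrm{SU}(2)$ and define $$Q_1:(Z\otimes\mathbb{R}^3)^\circ\to\mathbb{Z},\qquad Q_1(\zeta)=\#\{u\in\mathbb{P}^1\mid \pi_\zeta^{-1}(u)\text{ contains a rational curve}\},$$ where $\pi_\zeta:\mathrm{Z}(X_\zeta)\to\mathbb{P}^1$ is the twistor space of $(X_\zeta,g_\zeta)$. Then $Q_1$ is lower semi-continuous, that is, for every $\zeta_0\in(Z\otimes\mathbb{R}^3)^\circ$, $$\liminf_{\zeta\to\zeta_0}Q_1(\zeta)\ge Q_1(\zeta_0).$$
   Context: Root data. Let $\Gamma<\mathrm{SU}(2)$ be a non-trivial finite group. The exceptional locus of the minimal resolution $\widetilde{\mathbb{C}^2/\Gamma}\to\mathbb{C}^2/\Gamma$ is a union of $r$ rational curves whose dual graph is an ADE Dynkin diagram; $\mathfrak{h}$ denotes the associated real Cartan algebra, $\Phi\subset\mathfrak{h}^*$ the associated irreducible root system, and $\theta_1,\dots,\theta_r$ the simple roots. HyperKähler quotients. Let $Q=\mathbb{C}^2$ be the natural representation of $\Gamma$ and $R$ the regular representation, with invariant Hermitian inner products. Put $M(\Gamma)=\mathrm{Hom}_\Gamma(R,Q\otimes R)$; in an orthonormal basis of $Q$ its elements are pairs $(\alpha,\beta)$ of endomorphisms of $R$, and $M(\Gamma)$ is a flat hyperKähler space with $I(\alpha,\beta)=(\mathrm{i}\alpha,\mathrm{i}\beta)$, $J(\alpha,\beta)=(-\beta^*,\alpha^* )$, $K=IJ$. The group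 $\mathrm{U}(\Gamma)$ of $\Gamma$-equivariant unitary automorphisms of $R$ modulo the scalars $\mathrm{U}(1)$ acts by conjugation, preserving this structure; $\mathfrak{U}(\Gamma)$ is its Lie algebra and $\mu_{\mathbb{H}}:M(\Gamma)\to\mathfrak{U}(\Gamma)^*\otimes\mathbb{R}^3$ is the hyperKähler moment map (components ordered according to $I,J,K$) with $\mu_{\mathbb{H}}(0)=0$. $Z$ is the dual of the centre of $\mathfrak{U}(\Gamma)$, viewed as the coadjoint-invariant elements of $\mathfrak{U}(\Gamma)^*$. By the McKay correspondence the simple roots $\theta_k$ correspond to the non-trivial irreducible representations $R_k$ of $\Gamma$, with $n_k=\dim R_k$; if $\pi_k$ is the projection of $R$ onto its $R_k$-isotypic part, the classes of $\mathrm{i}\pi_1,\dots,\mathrm{i}\pi_r$ form a basis of the centre of $\mathfrak{U}(\Gamma)$, and $\rho:Z\to\mathfrak{h}$ is the linear isomorphism with $\theta_k(\rho(\xi))=\xi(\mathrm{i}\pi_k)/n_k$. For $\theta\in\Phi$ put $D_\theta=\ker(\theta\circ\rho)\subset Z$, and $$(Z\otimes\mathbb{R}^3)^\circ=(Z\otimes\mathbb{R}^3)\setminus\bigcup_{\theta\in\Phi}(D_\theta\otimes\mathbb{R}^3),$$ an open subset of the real vector space $Z\otimes\mathbb{R}^3$. For $\zeta\in(Z\otimes\mathbb{R}^3)^\circ$ the hyperKähler quotient $X_\zeta=\mu_{\mathbb{H}}^{-1}(\zeta)/\mathrm{U}(\Gamma)$ is a smooth 4-manifold with quotient hyperKähler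 metric $g_\zeta$, and $I_\zeta,J_\zeta,K_\zeta$ are the complex structures induced by $I,J,K$. Twistor space. $\mathrm{Z}(X_\zeta)$ is the complex threefold with underlying manifold $X_\zeta\times\mathbb{S}^2$ whose complex structure at $(x,(a,b,c))$ is $(aI_\zeta+bJ_\zeta+cK_\zeta)$ on $T_xX_\zeta$ and the standard complex structure of $\mathbb{S}^2\simeq\mathbb{P}^1$ on $T\mathbb{S}^2$; $\pi_\zeta$ is the holomorphic projection to $\mathbb{P}^1$. Thus the fibres of $\pi_\zeta$ are exactly the complex surfaces $(X_\zeta,aI_\zeta+bJ_\zeta+cK_\zeta)$, $(a,b,c)\in\mathbb{S}^2$. A rational curve in a complex surface is the image of a holomorphic embedding of $\mathbb{P}^1$. *)

theory Defs
  imports "HOL-Analysis.Analysis" "HOL-Algebra.Group"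
begin

section \<open>The group and its regular representation\<close>

definition conj_transpose :: "complex^'a^'b \<Rightarrow> complex^'b^'a" where
  "conj_transpose A = transpose (map_matrix cnj A)"

definition SU2 :: "(complex^2^2) monoid" where
  "SU2 = \<lparr>carrier = {A. conj_transpose A ** A = mat 1 \<and> det A = 1},
          monoid.mult = (**), one = mat 1\<rparr>"

text \<open>
  A finite subgroup \<open>\<Gamma>\<close> of \<open>SU2\<close> is handled through an enumeration \<open>\<gamma> :: 'g \<Rightarrow> complex^2^2\<close> of its
  elements by a finite type. The regular representation \<open>R\<close> is then \<open>complex^'g\<close>, with the standard
  Hermitian inner product (for which the group elements form an orthonormal basis), and an
  endomorphism of \<open>R\<close> is a matrix.
\<close>

type_synonym 'g End = "complex^'g^'g"

text \<open>\<open>R(\<gamma> g)\<close> sends the basis vector of \<open>\<gamma> j\<close> to that of \<open>\<gamma> g \<gamma> j\<close>.\<close>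

definition reg :: "('g::finite \<Rightarrow> complex^2^2) \<Rightarrow> 'g \<Rightarrow> 'g End" where
  "reg \<gamma> g = (\<chi> i j. if \<gamma> i = \<gamma> g ** \<gamma> j then 1 else 0)"

definition commutant :: "('g::finite \<Rightarrow> complex^2^2) \<Rightarrow> 'g End set" where
  "commutant \<gamma> = {A. \<forall>g. A ** reg \<gamma> g = reg \<gamma> g ** A}"


section \<open>The flat hyperKaehler space\<close>

text \<open>
  In the standard basis of \<open>Q = complex^2\<close> a map \<open>R \<rightarrow> Q \<otimes> R\<close> is \<open>v \<mapsto> e\<^sub>1 \<otimes> \<alpha> v + e\<^sub>2 \<otimes> \<beta> v\<close>. The two
  equations are the components of \<open>(Q(\<gamma> g) \<otimes> R(\<gamma> g)) (\<alpha>, \<beta>) = (\<alpha>, \<beta>) R(\<gamma> g)\<close>. The real part of the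
  Hermitian inner product is the inner product of the type \<open>'g End \<times> 'g End\<close>.
\<close>

definition M_space :: "('g::finite \<Rightarrow> complex^2^2) \<Rightarrow> ('g End \<times> 'g End) set" where
  "M_space \<gamma> = {(\<alpha>, \<beta>). \<forall>g.
     reg \<gamma> g ** (mat (\<gamma> g $ 1 $ 1) ** \<alpha> + mat (\<gamma> g $ 1 $ 2) ** \<beta>) = \<alpha> ** reg \<gamma> g \<and>
     reg \<gamma> g ** (mat (\<gamma> g $ 2 $ 1) ** \<alpha> + mat (\<gamma> g $ 2 $ 2) ** \<beta>) = \<beta> ** reg \<gamma> g}"

definition I_op :: "'g::finite End \<times> 'g End \<Rightarrow> 'g End \<times> 'g End" where
  "I_op m = (mat \<i> ** fst m, mat \<i> ** snd m)"

definition J_op :: "'g::finite End \<times> 'g End \<Rightarrow> 'g End \<times> 'g End" where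
  "J_op m = (- conj_transpose (snd m), conj_transpose (fst m))"

definition K_op :: "'g::finite End \<times> 'g End \<Rightarrow> 'g End \<times> 'g End" where
  "K_op m = I_op (J_op m)"

definition cplx_op :: "real^3 \<Rightarrow> 'g::finite End \<times> 'g End \<Rightarrow> 'g End \<times> 'g End" where
  "cplx_op u m = u $ 1 *\<^sub>R I_op m + u $ 2 *\<^sub>R J_op m + u $ 3 *\<^sub>R K_op m"


section \<open>The group action, its Lie algebra and the moment map\<close>

text \<open>
  The scalars \<open>U(1)\<close> act trivially, so the orbits of \<open>U(\<Gamma>)\<close> are those of the group \<open>unitaries \<gamma>\<close>,
  and \<open>U(\<Gamma>)\<close> is the quotient of the latter by the scalars. Likewise, the Lie algebra of \<open>U(\<Gamma>)\<close> is
  the quotient of \<open>lie \<gamma>\<close> by the imaginary multiples of the identity.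
\<close>

definition unitaries :: "('g::finite \<Rightarrow> complex^2^2) \<Rightarrow> 'g End set" where
  "unitaries \<gamma> = {u \<in> commutant \<gamma>. conj_transpose u ** u = mat 1}"

definition lie :: "('g::finite \<Rightarrow> complex^2^2) \<Rightarrow> 'g End set" where
  "lie \<gamma> = {X \<in> commutant \<gamma>. conj_transpose X = - X}"

definition act :: "'g::finite End \<Rightarrow> 'g End \<times> 'g End \<Rightarrow> 'g End \<times> 'g End" where
  "act u m = (u ** fst m ** matrix_inv u, u ** snd m ** matrix_inv u)"

definition orbit :: "('g::finite \<Rightarrow> complex^2^2) \<Rightarrow> 'g End \<times> 'g End \<Rightarrow> ('g End \<times> 'g End) set" where
  "orbit \<gamma> m = (\<lambda>u. act u m) ` unitaries \<gamma>"

definition inf_act :: "'g::finite End \<Rightarrow> 'g End \<times> 'g End \<Rightarrow> 'g End \<times> 'g End" where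
  "inf_act X m = (X ** fst m - fst m ** X, X ** snd m - snd m ** X)"

text \<open>
  The dual of the Lie algebra of \<open>U(\<Gamma>)\<close>: linear functionals on \<open>lie \<gamma>\<close> that vanish on the scalars,
  extended by \<open>0\<close> to all matrices. Such functionals carry the topology of pointwise convergence,
  which on this finite-dimensional space is the usual vector space topology.
\<close>

definition lie_dual :: "('g::finite \<Rightarrow> complex^2^2) \<Rightarrow> ('g End \<Rightarrow> real) set" where
  "lie_dual \<gamma> = {\<xi>.
     (\<forall>X\<in>lie \<gamma>. \<forall>Y\<in>lie \<gamma>. \<forall>a b. \<xi> (a *\<^sub>R X + b *\<^sub>R Y) = a * \<xi> X + b * \<xi> Y) \<and>
     (\<forall>t::real. \<xi> (mat (\<i> * of_real t)) = 0) \<and>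
     (\<forall>X. X \<notin> lie \<gamma> \<longrightarrow> \<xi> X = 0)}"

text \<open>
  The component of the moment map for the complex structure \<open>T\<close>, normalised to vanish at \<open>0\<close>. The
  convention is \<open>d\<langle>\<mu>, X\<rangle>(v) = \<omega>(X\<cdot>m, v)\<close> with \<open>\<omega>(v, w) = g(T v, w)\<close>, which is the content of the
  lemma \<open>moment_map_derivative\<close> below.
\<close>

definition moment_comp ::
  "('g::finite \<Rightarrow> complex^2^2) \<Rightarrow> ('g End \<times> 'g End \<Rightarrow> 'g End \<times> 'g End) \<Rightarrow>
   'g End \<times> 'g End \<Rightarrow> 'g End \<Rightarrow> real" where
  "moment_comp \<gamma> T m = (\<lambda>X. if X \<in> lie \<gamma> then (T (inf_act X m) \<bullet> m) / 2 else 0)"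

definition moment_map ::
  "('g::finite \<Rightarrow> complex^2^2) \<Rightarrow> 'g End \<times> 'g End \<Rightarrow>
   ('g End \<Rightarrow> real) \<times> ('g End \<Rightarrow> real) \<times> ('g End \<Rightarrow> real)" where
  "moment_map \<gamma> m = (moment_comp \<gamma> I_op m, moment_comp \<gamma> J_op m, moment_comp \<gamma> K_op m)"

definition level ::
  "('g::finite \<Rightarrow> complex^2^2) \<Rightarrow> ('g End \<Rightarrow> real) \<times> ('g End \<Rightarrow> real) \<times> ('g End \<Rightarrow> real) \<Rightarrow>
   ('g End \<times> 'g End) set" where
  "level \<gamma> \<zeta> = {m \<in> M_space \<gamma>. moment_map \<gamma> m = \<zeta>}"

definition X_quot ::
  "('g::finite \<Rightarrow> complex^2^2) \<Rightarrow> ('g End \<Rightarrow> real) \<times> ('g End \<Rightarrow> real) \<times> ('g End \<Rightarrow> real) \<Rightarrow>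
   ('g End \<times> 'g End) set set" where
  "X_quot \<gamma> \<zeta> = orbit \<gamma> ` level \<gamma> \<zeta>"


section \<open>Irreducible representations, roots and the generic locus\<close>

text \<open>Irreducible representations of \<open>\<Gamma>\<close> are realised as submodules of \<open>R\<close>.\<close>

definition submodule :: "('g::finite \<Rightarrow> complex^2^2) \<Rightarrow> (complex^'g) set \<Rightarrow> bool" where
  "submodule \<gamma> W \<longleftrightarrow> vec.subspace W \<and> (\<forall>g. \<forall>w\<in>W. reg \<gamma> g *v w \<in> W)"

definition irreducible_submodule :: "('g::finite \<Rightarrow> complex^2^2) \<Rightarrow> (complex^'g) set \<Rightarrow> bool" where
  "irreducible_submodule \<gamma> W \<longleftrightarrow> submodule \<gamma> W \<and> W \<noteq> {0} \<and>
     (\<forall>W'. submodule \<gamma> W' \<and> W' \<subseteq> W \<longrightarrow> W' = {0} \<or> W' = W)"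

definition trivial_submodule :: "('g::finite \<Rightarrow> complex^2^2) \<Rightarrow> (complex^'g) set \<Rightarrow> bool" where
  "trivial_submodule \<gamma> W \<longleftrightarrow> (\<forall>g. \<forall>w\<in>W. reg \<gamma> g *v w = w)"

definition isomorphic_submodules ::
  "('g::finite \<Rightarrow> complex^2^2) \<Rightarrow> (complex^'g) set \<Rightarrow> (complex^'g) set \<Rightarrow> bool" where
  "isomorphic_submodules \<gamma> W W' \<longleftrightarrow>
     (\<exists>f. Vector_Spaces.linear (*s) (*s) f \<and> bij_betw f W W' \<and>
          (\<forall>g. \<forall>w\<in>W. f (reg \<gamma> g *v w) = reg \<gamma> g *v f w))"

definition nontrivial_irreps ::
  "('g::finite \<Rightarrow> complex^2^2) \<Rightarrow> nat \<Rightarrow> (nat \<Rightarrow> (complex^'g) set) \<Rightarrow> bool" where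
  "nontrivial_irreps \<gamma> r Rep \<longleftrightarrow>
     (\<forall>k\<in>{1..r}. irreducible_submodule \<gamma> (Rep k) \<and> \<not> trivial_submodule \<gamma> (Rep k)) \<and>
     (\<forall>k\<in>{1..r}. \<forall>l\<in>{1..r}. k \<noteq> l \<longrightarrow> \<not> isomorphic_submodules \<gamma> (Rep k) (Rep l)) \<and>
     (\<forall>W. irreducible_submodule \<gamma> W \<and> \<not> trivial_submodule \<gamma> W \<longrightarrow>
          (\<exists>k\<in>{1..r}. isomorphic_submodules \<gamma> W (Rep k)))"

definition isotypic_part ::
  "('g::finite \<Rightarrow> complex^2^2) \<Rightarrow> (complex^'g) set \<Rightarrow> (complex^'g) set" where
  "isotypic_part \<gamma> W =
     vec.span (\<Union>{W'. irreducible_submodule \<gamma> W' \<and> isomorphic_submodules \<gamma> W' W})"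

definition isotypic_proj :: "('g::finite \<Rightarrow> complex^2^2) \<Rightarrow> (complex^'g) set \<Rightarrow> 'g End" where
  "isotypic_proj \<gamma> W = (THE P.
     (\<forall>v\<in>isotypic_part \<gamma> W. P *v v = v) \<and>
     (\<forall>W'. irreducible_submodule \<gamma> W' \<and> \<not> isomorphic_submodules \<gamma> W' W \<longrightarrow>
           (\<forall>v\<in>isotypic_part \<gamma> W'. P *v v = 0)))"

text \<open>
  The multiplicities \<open>dim Hom\<^sub>\<Gamma>(R\<^sub>k, Q \<otimes> R\<^sub>l)\<close> of the McKay graph. Extending by zero on the orthogonal
  complement of \<open>R\<^sub>k\<close> embeds this space of homomorphisms into \<open>M(\<Gamma>) = Hom\<^sub>\<Gamma>(R, Q \<otimes> R)\<close>; \<open>dim\<close> is the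
  real dimension, i.e. twice the complex one.
\<close>

definition McKay_mult ::
  "('g::finite \<Rightarrow> complex^2^2) \<Rightarrow> (complex^'g) set \<Rightarrow> (complex^'g) set \<Rightarrow> nat" where
  "McKay_mult \<gamma> V W = dim {(\<alpha>, \<beta>) \<in> M_space \<gamma>.
      (\<forall>v\<in>V. \<alpha> *v v \<in> W \<and> \<beta> *v v \<in> W) \<and>
      (\<forall>v\<in>orthogonal_comp V. \<alpha> *v v = 0 \<and> \<beta> *v v = 0)} div 2"

text \<open>
  By the McKay correspondence the dual graph of the exceptional locus is the McKay graph of the
  non-trivial irreducible representations, so this is the Cartan matrix.
\<close>

definition cartan ::
  "('g::finite \<Rightarrow> complex^2^2) \<Rightarrow> (nat \<Rightarrow> (complex^'g) set) \<Rightarrow> nat \<Rightarrow> nat \<Rightarrow> real" where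
  "cartan \<gamma> Rep k l = (if k = l then 2 else 0) - real (McKay_mult \<gamma> (Rep k) (Rep l))"

text \<open>
  The real Cartan algebra is \<open>\<real>\<^sup>r\<close> in the coordinates given by the simple roots: an element is a
  function \<open>h :: nat \<Rightarrow> real\<close>, of which only the values on \<open>{1..r}\<close> matter, and the simple root
  \<open>\<theta>\<^sub>k\<close> is \<open>h \<mapsto> h k\<close>. The simple coroot of \<open>\<theta>\<^sub>k\<close> is the element whose coordinates are the values
  \<open>\<theta>\<^sub>l(\<theta>\<^sub>k\<^sup>\<or>)\<close>, and the roots are the images of the simple roots under the Weyl group, i.e. under
  compositions of the simple reflections \<open>\<theta> \<mapsto> \<theta> - \<theta>(\<theta>\<^sub>k\<^sup>\<or>) \<theta>\<^sub>k\<close>.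
\<close>

definition simple_root :: "nat \<Rightarrow> (nat \<Rightarrow> real) \<Rightarrow> real" where
  "simple_root k h = h k"

definition simple_coroot ::
  "('g::finite \<Rightarrow> complex^2^2) \<Rightarrow> nat \<Rightarrow> (nat \<Rightarrow> (complex^'g) set) \<Rightarrow> nat \<Rightarrow> nat \<Rightarrow> real" where
  "simple_coroot \<gamma> r Rep k = (\<lambda>l. if l \<in> {1..r} then cartan \<gamma> Rep k l else 0)"

inductive_set roots ::
  "('g::finite \<Rightarrow> complex^2^2) \<Rightarrow> nat \<Rightarrow> (nat \<Rightarrow> (complex^'g) set) \<Rightarrow> ((nat \<Rightarrow> real) \<Rightarrow> real) set"
  for \<gamma> r Rep where
    simple: "k \<in> {1..r} \<Longrightarrow> simple_root k \<in> roots \<gamma> r Rep"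
  | reflect: "\<theta> \<in> roots \<gamma> r Rep \<Longrightarrow> k \<in> {1..r} \<Longrightarrow>
      (\<lambda>h. \<theta> h - \<theta> (simple_coroot \<gamma> r Rep k) * simple_root k h) \<in> roots \<gamma> r Rep"

definition Z_space :: "('g::finite \<Rightarrow> complex^2^2) \<Rightarrow> ('g End \<Rightarrow> real) set" where
  "Z_space \<gamma> = {\<xi> \<in> lie_dual \<gamma>.
     \<forall>u\<in>unitaries \<gamma>. \<forall>X\<in>lie \<gamma>. \<xi> (u ** X ** matrix_inv u) = \<xi> X}"

definition rho ::
  "('g::finite \<Rightarrow> complex^2^2) \<Rightarrow> nat \<Rightarrow> (nat \<Rightarrow> (complex^'g) set) \<Rightarrow> ('g End \<Rightarrow> real) \<Rightarrow> nat \<Rightarrow> real"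
  where
  "rho \<gamma> r Rep \<xi> = (\<lambda>k. if k \<in> {1..r}
     then \<xi> (mat \<i> ** isotypic_proj \<gamma> (Rep k)) / real (vec.dim (Rep k)) else 0)"

definition D_hyp ::
  "('g::finite \<Rightarrow> complex^2^2) \<Rightarrow> nat \<Rightarrow> (nat \<Rightarrow> (complex^'g) set) \<Rightarrow>
   ((nat \<Rightarrow> real) \<Rightarrow> real) \<Rightarrow> ('g End \<Rightarrow> real) set" where
  "D_hyp \<gamma> r Rep \<theta> = {\<xi> \<in> Z_space \<gamma>. \<theta> (rho \<gamma> r Rep \<xi>) = 0}"

definition Z3_reg ::
  "('g::finite \<Rightarrow> complex^2^2) \<Rightarrow> nat \<Rightarrow> (nat \<Rightarrow> (complex^'g) set) \<Rightarrow>
   (('g End \<Rightarrow> real) \<times> ('g End \<Rightarrow> real) \<times> ('g End \<Rightarrow> real)) set" where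
  "Z3_reg \<gamma> r Rep = Z_space \<gamma> \<times> Z_space \<gamma> \<times> Z_space \<gamma> -
     (\<Union>\<theta>\<in>roots \<gamma> r Rep. D_hyp \<gamma> r Rep \<theta> \<times> D_hyp \<gamma> r Rep \<theta> \<times> D_hyp \<gamma> r Rep \<theta>)"


section \<open>The twistor space and rational curves\<close>

definition twistor_space ::
  "('g::finite \<Rightarrow> complex^2^2) \<Rightarrow> ('g End \<Rightarrow> real) \<times> ('g End \<Rightarrow> real) \<times> ('g End \<Rightarrow> real) \<Rightarrow>
   (('g End \<times> 'g End) set \<times> (real^3)) set" where
  "twistor_space \<gamma> \<zeta> = X_quot \<gamma> \<zeta> \<times> sphere 0 1"

text \<open>The fibre over \<open>u\<close> of the projection of the twistor space to the sphere.\<close>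

definition twistor_fibre ::
  "('g::finite \<Rightarrow> complex^2^2) \<Rightarrow> ('g End \<Rightarrow> real) \<times> ('g End \<Rightarrow> real) \<times> ('g End \<Rightarrow> real) \<Rightarrow>
   real^3 \<Rightarrow> (('g End \<times> 'g End) set \<times> (real^3)) set" where
  "twistor_fibre \<gamma> \<zeta> u = {p \<in> twistor_space \<gamma> \<zeta>. snd p = u}"

text \<open>
  The tangent space of the quotient at the orbit of \<open>m\<close> is represented by the horizontal space, i.e.
  the orthogonal complement, in the tangent space of the level set at \<open>m\<close>, of the tangent space
  \<open>vertical \<gamma> m\<close> of the orbit. The horizontal space is invariant under \<open>I\<close>, \<open>J\<close>, \<open>K\<close>, whose
  restrictions are by definition the complex structures of the quotient. Horizontal projection
  represents the differential of the projection from the level set to the quotient.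
\<close>

definition vertical ::
  "('g::finite \<Rightarrow> complex^2^2) \<Rightarrow> 'g End \<times> 'g End \<Rightarrow> ('g End \<times> 'g End) set" where
  "vertical \<gamma> m = (\<lambda>X. inf_act X m) ` lie \<gamma>"

definition horizontal_proj ::
  "('g::finite \<Rightarrow> complex^2^2) \<Rightarrow> 'g End \<times> 'g End \<Rightarrow> 'g End \<times> 'g End \<Rightarrow> 'g End \<times> 'g End" where
  "horizontal_proj \<gamma> m v = (THE h. h \<in> orthogonal_comp (vertical \<gamma> m) \<and> v - h \<in> vertical \<gamma> m)"

text \<open>
  Tangent vectors of the twistor space at \<open>(orbit \<gamma> m, u)\<close> are pairs of a horizontal vector at \<open>m\<close>
  and a vector orthogonal to \<open>u\<close>. On the second factor, \<open>u \<times> _\<close> is the standard complex structure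
  of the sphere.
\<close>

definition twistor_tangent ::
  "('g::finite \<Rightarrow> complex^2^2) \<Rightarrow> ('g End \<times> 'g End) \<times> (real^3) \<Rightarrow>
   ('g End \<times> 'g End) \<times> (real^3) \<Rightarrow> ('g End \<times> 'g End) \<times> (real^3)" where
  "twistor_tangent \<gamma> p v = (horizontal_proj \<gamma> (fst p) (fst v), snd v)"

definition twistor_J ::
  "('g::finite End \<times> 'g End) \<times> (real^3) \<Rightarrow>
   ('g End \<times> 'g End) \<times> (real^3) \<Rightarrow> ('g End \<times> 'g End) \<times> (real^3)" where
  "twistor_J p v = (cplx_op (snd p) (fst v), cross3 (snd p) (snd v))"

text \<open>
  A map \<open>f\<close> from the complex line to the twistor space is holomorphic and an immersion if near every
  point it has a differentiable lift \<open>F\<close> to the product of the level set with the sphere such that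
  the differential of \<open>f\<close>, i.e. the projected differential of \<open>F\<close>, is complex linear and injective.
  As the level set is a principal bundle over the quotient, local lifts of differentiable maps
  always exist, so that this is complex differentiability of \<open>f\<close> itself.
\<close>

definition holomorphic_immersion ::
  "('g::finite \<Rightarrow> complex^2^2) \<Rightarrow> ('g End \<Rightarrow> real) \<times> ('g End \<Rightarrow> real) \<times> ('g End \<Rightarrow> real) \<Rightarrow>
   (complex \<Rightarrow> ('g End \<times> 'g End) set \<times> (real^3)) \<Rightarrow> bool" where
  "holomorphic_immersion \<gamma> \<zeta> f \<longleftrightarrow> (\<forall>z0. \<exists>S F. open S \<and> z0 \<in> S \<and>
     (\<forall>z\<in>S. F z \<in> level \<gamma> \<zeta> \<times> sphere 0 1 \<and> f z = (orbit \<gamma> (fst (F z)), snd (F z)) \<and>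
        (\<exists>F'. (F has_derivative F') (at z) \<and>
           (\<forall>w. twistor_tangent \<gamma> (F z) (F' (\<i> * w)) =
                twistor_J (F z) (twistor_tangent \<gamma> (F z) (F' w))) \<and>
           (\<forall>w. w \<noteq> 0 \<longrightarrow> twistor_tangent \<gamma> (F z) (F' w) \<noteq> 0))))"

text \<open>The complex projective line is \<open>complex option\<close>, \<open>None\<close> being the point at infinity, with the
  two standard charts. As it is compact, an embedding is an injective immersion.\<close>

definition P1_chart0 :: "complex \<Rightarrow> complex option" where
  "P1_chart0 z = Some z"

definition P1_chart_infinity :: "complex \<Rightarrow> complex option" where
  "P1_chart_infinity z = (if z = 0 then None else Some (1 / z))"

definition holomorphic_embedding_P1 ::
  "('g::finite \<Rightarrow> complex^2^2) \<Rightarrow> ('g End \<Rightarrow> real) \<times> ('g End \<Rightarrow> real) \<times> ('g End \<Rightarrow> real) \<Rightarrow>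
   (complex option \<Rightarrow> ('g End \<times> 'g End) set \<times> (real^3)) \<Rightarrow> bool" where
  "holomorphic_embedding_P1 \<gamma> \<zeta> f \<longleftrightarrow> inj f \<and>
     holomorphic_immersion \<gamma> \<zeta> (f \<circ> P1_chart0) \<and>
     holomorphic_immersion \<gamma> \<zeta> (f \<circ> P1_chart_infinity)"

text \<open>The fibre is a complex submanifold of the twistor space, so a rational curve in the fibre is the
  image of a holomorphic embedding into the twistor space which takes values in the fibre.\<close>

definition rational_curve_in_fibre ::
  "('g::finite \<Rightarrow> complex^2^2) \<Rightarrow> ('g End \<Rightarrow> real) \<times> ('g End \<Rightarrow> real) \<times> ('g End \<Rightarrow> real) \<Rightarrow>
   real^3 \<Rightarrow> (('g End \<times> 'g End) set \<times> (real^3)) set \<Rightarrow> bool" where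
  "rational_curve_in_fibre \<gamma> \<zeta> u C \<longleftrightarrow>
     (\<exists>f. holomorphic_embedding_P1 \<gamma> \<zeta> f \<and> range f = C) \<and> C \<subseteq> twistor_fibre \<gamma> \<zeta> u"

definition rational_fibres ::
  "('g::finite \<Rightarrow> complex^2^2) \<Rightarrow> ('g End \<Rightarrow> real) \<times> ('g End \<Rightarrow> real) \<times> ('g End \<Rightarrow> real) \<Rightarrow>
   (real^3) set" where
  "rational_fibres \<gamma> \<zeta> = {u \<in> sphere 0 1. \<exists>C. rational_curve_in_fibre \<gamma> \<zeta> u C}"

definition Q1 ::
  "('g::finite \<Rightarrow> complex^2^2) \<Rightarrow> ('g End \<Rightarrow> real) \<times> ('g End \<Rightarrow> real) \<times> ('g End \<Rightarrow> real) \<Rightarrow> int" where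
  "Q1 \<gamma> \<zeta> = int (card (rational_fibres \<gamma> \<zeta>))"


section \<open>The moment map condition\<close>

lemma conj_transpose_nth [simp]: "conj_transpose A $ i $ j = cnj (A $ j $ i)"
  by (simp add: conj_transpose_def transpose_def)

lemma inner_End: "A \<bullet> B = Re (\<Sum>i\<in>UNIV. \<Sum>j\<in>UNIV. A $ i $ j * cnj (B $ i $ j))"
  for A B :: "'g::finite End"
  by (simp add: inner_vec_def inner_complex_def)

lemma End_inner_mult_left: "(X ** A) \<bullet> B = A \<bullet> (conj_transpose X ** B)"
  for A B X :: "'g::finite End"
proof -
  have "(\<Sum>i\<in>UNIV. \<Sum>j\<in>UNIV. (X ** A) $ i $ j * cnj (B $ i $ j))
      = (\<Sum>i\<in>UNIV. \<Sum>j\<in>UNIV. \<Sum>k\<in>UNIV. X $ i $ k * A $ k $ j * cnj (B $ i $ j))"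
    by (simp add: matrix_matrix_mult_def sum_distrib_right)
  also have "\<dots> = (\<Sum>i\<in>UNIV. \<Sum>k\<in>UNIV. \<Sum>j\<in>UNIV. X $ i $ k * A $ k $ j * cnj (B $ i $ j))"
    by (rule sum.cong[OF refl], rule sum.swap)
  also have "\<dots> = (\<Sum>k\<in>UNIV. \<Sum>i\<in>UNIV. \<Sum>j\<in>UNIV. X $ i $ k * A $ k $ j * cnj (B $ i $ j))"
    by (rule sum.swap)
  also have "\<dots> = (\<Sum>k\<in>UNIV. \<Sum>j\<in>UNIV. \<Sum>i\<in>UNIV. X $ i $ k * A $ k $ j * cnj (B $ i $ j))"
    by (rule sum.cong[OF refl], rule sum.swap)
  also have "\<dots> = (\<Sum>k\<in>UNIV. \<Sum>j\<in>UNIV. A $ k $ j * cnj ((conj_transpose X ** B) $ k $ j))"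
    by (simp add: matrix_matrix_mult_def sum_distrib_left mult_ac)
  finally show ?thesis by (simp add: inner_End)
qed

lemma inner_conj_transpose: "conj_transpose A \<bullet> conj_transpose B = A \<bullet> B"
  for A B :: "'g::finite End"
proof -
  have "conj_transpose A \<bullet> conj_transpose B = (\<Sum>i\<in>UNIV. \<Sum>j\<in>UNIV. A $ j $ i \<bullet> B $ j $ i)"
    by (simp add: inner_vec_def inner_complex_def)
  also have "\<dots> = A \<bullet> B" unfolding inner_vec_def by (rule sum.swap)
  finally show ?thesis .
qed

lemma conj_transpose_mult: "conj_transpose (A ** B) = conj_transpose B ** conj_transpose A"
  for A B :: "'g::finite End"
  by (simp add: vec_eq_iff matrix_matrix_mult_def mult.commute)

lemma conj_transpose_simps [simp]:
  fixes A B :: "'g::finite End"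
  shows "conj_transpose (conj_transpose A) = A"
    "conj_transpose (- A) = - conj_transpose A"
    "conj_transpose (A - B) = conj_transpose A - conj_transpose B"
    "conj_transpose (A + B) = conj_transpose A + conj_transpose B"
    "conj_transpose (c *\<^sub>R A) = c *\<^sub>R conj_transpose A"
  by (simp_all add: vec_eq_iff)

lemma End_inner_mult_right: "(A ** X) \<bullet> B = A \<bullet> (B ** conj_transpose X)"
  for A B X :: "'g::finite End"
proof -
  have "(A ** X) \<bullet> B = (conj_transpose X ** conj_transpose A) \<bullet> conj_transpose B"
    by (simp only: inner_conj_transpose flip: conj_transpose_mult)
  also have "\<dots> = conj_transpose A \<bullet> conj_transpose (B ** conj_transpose X)"
    by (simp add: End_inner_mult_left conj_transpose_mult)
  finally show ?thesis by (simp only: inner_conj_transpose)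
qed

lemma mat_i_mult: "mat \<i> ** A = (\<chi> i j. \<i> * A $ i $ j)" for A :: "'g::finite End"
  by (simp add: vec_eq_iff matrix_matrix_mult_def mat_def if_distrib if_distribR cong: if_cong)

lemma mat_i_comm: "X ** (mat \<i> ** A) = mat \<i> ** (X ** A)" "(mat \<i> ** A) ** X = mat \<i> ** (A ** X)"
  for A X :: "'g::finite End"
  unfolding mat_i_mult
  by (simp_all add: vec_eq_iff matrix_matrix_mult_def sum_distrib_left mult_ac)

lemma conj_transpose_mat_i: "conj_transpose (mat \<i> ** A) = - (mat \<i> ** conj_transpose A)"
  for A :: "'g::finite End"
  by (simp add: mat_i_mult vec_eq_iff)

lemma inner_mat_i: "(mat \<i> ** A) \<bullet> B = - (A \<bullet> (mat \<i> ** B))" for A B :: "'g::finite End"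
proof -
  have "(\<i> * a) \<bullet> b = - (a \<bullet> (\<i> * b))" for a b :: complex
    by (simp add: inner_complex_def)
  then show ?thesis by (simp add: mat_i_mult inner_vec_def sum_negf)
qed

lemma mat_i_linear [simp]:
  fixes A B :: "'g::finite End"
  shows "mat \<i> ** (A - B) = mat \<i> ** A - mat \<i> ** B" "mat \<i> ** (- A) = - (mat \<i> ** A)"
    "mat \<i> ** (mat \<i> ** A) = - A" "mat \<i> ** (A + B) = mat \<i> ** A + mat \<i> ** B"
    "mat \<i> ** (c *\<^sub>R A) = c *\<^sub>R (mat \<i> ** A)"
  by (simp_all add: mat_i_mult vec_eq_iff algebra_simps)

lemma quaternion_relations:
  "I_op (I_op m) = - m" "J_op (J_op m) = - m" "K_op (K_op m) = - m"
  "I_op (J_op m) = K_op m" "J_op (I_op m) = - K_op m"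
  by (cases m; simp add: I_op_def J_op_def K_op_def conj_transpose_mat_i)+

lemma structures_skew:
  "I_op v \<bullet> w = - (v \<bullet> I_op w)" "J_op v \<bullet> w = - (v \<bullet> J_op w)" "K_op v \<bullet> w = - (v \<bullet> K_op w)"
proof -
  have J: "J_op v \<bullet> w = - (v \<bullet> J_op w)" for v w :: "'g::finite End \<times> 'g End"
  proof -
    have "conj_transpose A \<bullet> B = A \<bullet> conj_transpose B" for A B :: "'g End"
      using inner_conj_transpose[of A "conj_transpose B"] by simp
    then show ?thesis by (cases v; cases w) (simp add: J_op_def)
  qed
  have I: "I_op v \<bullet> w = - (v \<bullet> I_op w)" for v w :: "'g::finite End \<times> 'g End"
    by (cases v; cases w) (simp add: I_op_def inner_mat_i)
  show "I_op v \<bullet> w = - (v \<bullet> I_op w)" "J_op v \<bullet> w = - (v \<bullet> J_op w)" by (rule I, rule J)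
  have "K_op v \<bullet> w = v \<bullet> J_op (I_op w)" by (simp add: K_op_def I J)
  then show "K_op v \<bullet> w = - (v \<bullet> K_op w)" by (simp add: quaternion_relations)
qed

lemma inf_act_skew:
  assumes "X \<in> lie \<gamma>"
  shows "inf_act X v \<bullet> w = - (v \<bullet> inf_act X w)"
proof -
  have X: "conj_transpose X = - X" using assms by (simp add: lie_def)
  have neg: "(- X) ** A = - (X ** A)" "A ** (- X) = - (A ** X)" for A :: "'a End"
    by (simp_all add: vec_eq_iff matrix_matrix_mult_def sum_negf)
  show ?thesis
    by (cases v; cases w)
       (simp add: inf_act_def inner_diff_left inner_diff_right End_inner_mult_left[where X = X]
          End_inner_mult_right[where X = X] X neg)
qed

lemma inf_act_commute:
  assumes "X \<in> lie \<gamma>"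
  shows "I_op (inf_act X v) = inf_act X (I_op v)" "J_op (inf_act X v) = inf_act X (J_op v)"
    "K_op (inf_act X v) = inf_act X (K_op v)"
proof -
  have X: "conj_transpose X = - X" using assms by (simp add: lie_def)
  have neg: "(- X) ** A = - (X ** A)" "A ** (- X) = - (A ** X)"
    "X ** (- A) = - (X ** A)" "(- A) ** X = - (A ** X)" for A :: "'a End"
    by (simp_all add: vec_eq_iff matrix_matrix_mult_def sum_negf)
  have I: "I_op (inf_act X v) = inf_act X (I_op v)" for v
    by (simp add: I_op_def inf_act_def mat_i_comm)
  have J: "J_op (inf_act X v) = inf_act X (J_op v)" for v
    by (simp add: J_op_def inf_act_def conj_transpose_mult X neg)
  show "I_op (inf_act X v) = inf_act X (I_op v)" "J_op (inf_act X v) = inf_act X (J_op v)"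
    "K_op (inf_act X v) = inf_act X (K_op v)"
    by (simp_all add: I J K_op_def)
qed

lemma structures_linear: "linear I_op" "linear J_op" "linear K_op"
  by (auto intro!: linearI simp: I_op_def J_op_def K_op_def)

lemma inf_act_linear: "linear (inf_act X)"
proof -
  have s: "X ** (c *\<^sub>R A) = c *\<^sub>R (X ** A)" "(c *\<^sub>R A) ** X = c *\<^sub>R (A ** X)" for c and A :: "'a End"
    by (simp_all add: vec_eq_iff matrix_matrix_mult_def scaleR_sum_right)
  have a: "X ** (A + B) = X ** A + X ** B" "(A + B) ** X = A ** X + B ** X" for A B :: "'a End"
    by (simp_all add: vec_eq_iff matrix_matrix_mult_def sum.distrib distrib_left distrib_right)
  show ?thesis by (rule linearI) (simp_all add: inf_act_def s a scaleR_diff_right)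
qed

theorem moment_map_derivative:
  fixes \<gamma> :: "'g::finite \<Rightarrow> complex^2^2"
  assumes T: "T \<in> {I_op, J_op, K_op}" and X: "X \<in> lie \<gamma>"
  shows "((\<lambda>m. moment_comp \<gamma> T m X) has_derivative (\<lambda>v. T (inf_act X m) \<bullet> v)) (at m)"
proof -
  have "linear (\<lambda>m. T (inf_act X m))"
    using T linear_compose[OF inf_act_linear structures_linear(1)]
      linear_compose[OF inf_act_linear structures_linear(2)]
      linear_compose[OF inf_act_linear structures_linear(3)] by (auto simp: o_def)
  then have bl: "bounded_linear (\<lambda>m. T (inf_act X m))" by (rule linear_conv_bounded_linear[THEN iffD1])
  have sym: "T (inf_act X v) \<bullet> m = T (inf_act X m) \<bullet> v" for v
  proof -
    have skew: "T v \<bullet> w = - (v \<bullet> T w)" for v w using T structures_skew by blast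
    have "T (inf_act X v) = inf_act X (T v)" using T inf_act_commute[OF X] by blast
    then have "T (inf_act X v) \<bullet> m = v \<bullet> T (inf_act X m)"
      by (simp add: inf_act_skew[OF X] skew)
    then show ?thesis by (simp add: inner_commute)
  qed
  have "((\<lambda>m. T (inf_act X m) \<bullet> m) has_derivative
      (\<lambda>v. T (inf_act X m) \<bullet> v + T (inf_act X v) \<bullet> m)) (at m)"
    by (rule has_derivative_inner[OF bounded_linear_imp_has_derivative[OF bl] has_derivative_ident])
  then have "((\<lambda>m. T (inf_act X m) \<bullet> m) has_derivative (\<lambda>v. 2 * (T (inf_act X m) \<bullet> v))) (at m)"
    by (simp add: sym)
  from has_derivative_mult_right[OF this, of "1 / 2"]
  have "((\<lambda>m. (T (inf_act X m) \<bullet> m) / 2) has_derivative (\<lambda>v. T (inf_act X m) \<bullet> v)) (at m)"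
    by simp
  then show ?thesis using X by (simp add: moment_comp_def)
qed

lemma moment_map_zero: "moment_map \<gamma> 0 = (\<lambda>_. 0, \<lambda>_. 0, \<lambda>_. 0)"
  by (auto simp: moment_map_def moment_comp_def fun_eq_iff)

end

theory Submission
 imports Defs "HOL-Complex_Analysis.Cauchy_Integral_Formula"
begin

text \<open>
 A unit quaternion \<open>(x, y)\<close> above a point \<open>u\<close> of the sphere (Hopf map) rotates the complex structure of
 the fibre over \<open>u\<close> into \<open>I\<close> and the level \<open>\<zeta>\<close> into a Hermitian central matrix \<open>T\<close> and a complex one
 \<open>L\<close>. The points of the fibre become the equivariant pairs \<open>m\<close> with \<open>om m m = L\<close>, up to complex gauge
 transformations, that satisfy the stability condition given by \<open>T\<close>. Submodules correspond to projections
 \<open>P\<close> in the commutant. The Euler form \<open>N\<close> of their classes is the affine Cartan form of the McKay graph: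
 bricks have norm two, and the classes of norm two are roots up to sign and the regular representation.

 Traces of words in the two components of \<open>m\<close> are invariant holomorphic functions, constant on a rational
 curve, and they separate simple modules; so a rational curve contains a non-simple point
 (\<open>rational_curve_not_simple\<close>). Conversely, let \<open>P\<close> be a submodule of a non-simple point that is least for a
 generic refinement of the stability condition. It and its quotient are bricks of norm two without
 homomorphisms between them, and all their nonsplit extensions are stable (\<open>least_submodule\<close>). A continuity
 argument solves the real moment map equation on all of these (\<open>good_pair_exists\<close>), and the extension classes
 contain a complex plane, whose lines form a rational curve (\<open>rational_curve_of_good\<close>).

 For such a pair \<open>L\<close> vanishes on \<open>P\<close>, that is, \<open>u\<close> is one of the two directions of the vector of values of
 \<open>\<zeta>\<close> on \<open>P\<close>. There are finitely many classes, so finitely many such fibres. When \<open>\<zeta>\<close> moves, that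
 direction moves continuously, \<open>L\<close> keeps vanishing on \<open>P\<close> there, and the pair deforms because the conditions
 on it are open (\<open>good_open\<close>). So every rational curve persists in a nearby fibre, and the number of these
 fibres cannot drop.
\<close>

section \<open>Matrices and pairs of matrices\<close>

notation conj_transpose ("_\<^sup>H" [1000] 999)

definition cs :: "complex => 'n::finite End => 'n End" (infixr "\<odot>" 75) where
 "c \<odot> A = (\<chi> i j. c * A $ i $ j)"

lemma cs_nth [simp]: "(c \<odot> A) $ i $ j = c * A $ i $ j" by (simp add: cs_def)

lemma mat_mult_eq_cs: "mat c ** A = c \<odot> A" by (simp add: vec_eq_iff matrix_matrix_mult_def mat_def if_distrib if_distribR cong: if_cong)

lemma cs_simps [simp]:
 "1 \<odot> A = A" "0 \<odot> A = 0" "c \<odot> (0::'n::finite End) = 0" "(- 1) \<odot> A = - A"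
 "c \<odot> d \<odot> A = (c * d) \<odot> A" "c \<odot> - A = - (c \<odot> A)"
 "(- c) \<odot> A = - (c \<odot> A)" by (simp_all add: vec_eq_iff)

lemma cs_distribs:
 "c \<odot> (A + B) = c \<odot> A + c \<odot> B" "c \<odot> (A - B) = c \<odot> A - c \<odot> B"
 "(c + d) \<odot> A = c \<odot> A + d \<odot> A" "(c - d) \<odot> A = c \<odot> A - d \<odot> A" by (simp_all add: vec_eq_iff algebra_simps)

lemma cs_of_real: "of_real r \<odot> A = r *\<^sub>R A" by (simp add: vec_eq_iff scaleR_conv_of_real[where 'a = complex])

lemma cs_eq_0_iff: "c \<odot> A = 0 \<longleftrightarrow> c = 0 \<or> A = 0" by (auto simp: vec_eq_iff)

lemma adj_cs: "(c \<odot> A)\<^sup>H = cnj c \<odot> A\<^sup>H" by (simp add: vec_eq_iff)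

lemma adj_mat: "(mat c)\<^sup>H = mat (cnj c)" by (simp add: vec_eq_iff mat_def)

lemma adj_0 [simp]: "0\<^sup>H = (0::'n::finite End)" by (simp add: vec_eq_iff)

lemma mult_cs: "A ** (c \<odot> B) = c \<odot> (A ** B)" "(c \<odot> A) ** B = c \<odot> (A ** B)"
 by (simp_all add: vec_eq_iff matrix_matrix_mult_def sum_distrib_left mult_ac)

lemma mult_diff: "A ** (B - C) = A ** B - A ** C" "(B - C) ** A = B ** A - C ** A"
 for A B C :: "'n::finite End" by (simp_all add: vec_eq_iff matrix_matrix_mult_def sum_subtractf algebra_simps)

lemma mult_neg: "A ** (- B) = - (A ** B)" "(- A) ** B = - (A ** B)"
 for A B :: "'n::finite End" by (simp_all add: vec_eq_iff matrix_matrix_mult_def sum_negf)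

lemma mult_zero [simp]: "A ** 0 = 0" "0 ** A = 0" for A :: "'n::finite End" by (simp_all add: vec_eq_iff matrix_matrix_mult_def)

lemma mult_scaleR: "A ** (r *\<^sub>R B) = r *\<^sub>R (A ** B)" "(r *\<^sub>R A) ** B = r *\<^sub>R (A ** B)"
 for A B :: "'n::finite End" by (simp_all add: vec_eq_iff matrix_matrix_mult_def scaleR_sum_right)

lemma matrix_add_rdistrib: "(B + C) ** A = B ** A + C ** A" for A B C :: "'n::finite End"
 by (simp add: vec_eq_iff matrix_matrix_mult_def sum.distrib algebra_simps)

lemma mult_sum: "A ** (\<Sum>x\<in>S. f x) = (\<Sum>x\<in>S. A ** f x)" "(\<Sum>x\<in>S. f x) ** A = (\<Sum>x\<in>S. f x ** A)"
 for A :: "'n::finite End" by (induction S rule: infinite_finite_induct)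
   (simp_all add: matrix_add_ldistrib matrix_add_rdistrib)

lemmas mm_assoc = matrix_mul_assoc
lemmas assoc_r = mm_assoc[symmetric]
lemmas mv_assoc = matrix_vector_mul_assoc
lemmas mv_diff = matrix_vector_mult_diff_rdistrib
lemmas mv_add_right = matrix_vector_right_distrib
lemmas adj_mult = conj_transpose_mult

lemmas mm = matrix_add_ldistrib matrix_add_rdistrib mult_diff mult_neg mult_cs mult_scaleR
 assoc_r

lemma mult_id [simp]: "A ** mat 1 = A" "mat 1 ** A = A" for A :: "'n::finite End" by simp_all

lemma trace_cs [simp]: "trace (c \<odot> A) = c * trace A" by (simp add: trace_def sum_distrib_left)

lemma trace_scaleR [simp]: "trace (r *\<^sub>R A) = r *\<^sub>R trace A" for A :: "'n::finite End" by (simp add: trace_def scaleR_sum_right)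

lemma trace_neg [simp]: "trace (- A) = - trace A" for A :: "'n::finite End" by (simp add: trace_def sum_negf)

lemma trace_zero [simp]: "trace (0::'n::finite End) = 0" by (simp add: trace_def)

lemma trace_sum: "trace (\<Sum>x\<in>S. f x) = (\<Sum>x\<in>S. trace (f x))" for f :: "'a => 'n::finite End"
 by (induction S rule: infinite_finite_induct) (simp_all add: trace_add)

lemma trace_adj: "trace (A\<^sup>H) = cnj (trace A)" for A :: "'n::finite End" by (simp add: trace_def)

lemma trace_mat: "trace (mat c :: 'n::finite End) = of_nat CARD('n) * c" by (simp add: trace_def mat_def)

lemma trace_rotate: "trace (A ** B ** C) = trace (B ** C ** A)" for A B C :: "'n::finite End" by (metis mm_assoc trace_mul_sym)

lemma inner_trace: "A \<bullet> B = Re (trace (A ** B\<^sup>H))" for A B :: "'n::finite End" by (simp add: inner_End trace_def matrix_matrix_mult_def)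

lemma inner_cs: "(c \<odot> A) \<bullet> B = A \<bullet> (cnj c \<odot> B)" by (simp add: inner_trace adj_cs mm)

lemma Re_trace_mult_adj: "Re (trace (A ** A\<^sup>H)) = (norm A)\<^sup>2" for A :: "'n::finite End"
 by (simp flip: inner_trace add: power2_norm_eq_inner)

lemma linear_mult: "linear (%A::'n::finite End. B ** A)" "linear (%A::'n End. A ** B)" for B :: "'n::finite End" by (auto intro!: linearI simp: mm)

lemma linear_adj: "linear (conj_transpose :: 'n::finite End => 'n End)" by (auto intro!: linearI)

lemma linear_cs: "linear (%A::'n::finite End. c \<odot> A)"
 by (auto intro!: linearI simp: cs_distribs vec_eq_iff scaleR_conv_of_real[where 'a = complex])

lemma linear_trace: "linear (trace :: 'n::finite End => complex)" by (auto intro!: linearI simp: trace_add)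

lemma bb_mult: "bounded_bilinear ((**) :: 'n::finite End => 'n End => 'n End)"
proof -
 have "bilinear ((**) :: 'n End => 'n End => 'n End)" by (simp add: bilinear_def linear_mult)
 thus ?thesis by (simp add: bilinear_conv_bounded_bilinear)
qed

subsection \<open>Pairs\<close>

type_synonym 'n pair = "'n End \<times> 'n End"

definition lm :: "'n::finite End => 'n pair => 'n pair" (infixr "|>" 70) where
 "X |> m = (X ** fst m, X ** snd m)"

definition rm :: "'n::finite pair => 'n End => 'n pair" (infixl "<|" 71) where
 "m <| X = (fst m ** X, snd m ** X)"

definition ps :: "complex => 'n::finite pair => 'n pair" (infixr "\<cdot>" 75) where
 "c \<cdot> m = (c \<odot> fst m, c \<odot> snd m)"

text \<open>The complex symplectic pairing of pairs of matrices, with values in matrices.\<close>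

definition om :: "'n::finite pair => 'n pair => 'n End" where
 "om m n = fst m ** snd n - snd m ** fst n"

definition lip :: "'n::finite pair => 'n pair => 'n End" where
 "lip m n = fst m ** (fst n)\<^sup>H + snd m ** (snd n)\<^sup>H"

definition rip :: "'n::finite pair => 'n pair => 'n End" where
 "rip m n = (fst n)\<^sup>H ** fst m + (snd n)\<^sup>H ** snd m"

definition rmom :: "'n::finite pair => 'n End" where
 "rmom m = lip m m - rip m m"

lemmas pair_defs = lm_def rm_def ps_def om_def lip_def rip_def rmom_def J_op_def

lemma fst_lm [simp]: "fst (X |> m) = X ** fst m" "snd (X |> m) = X ** snd m"
 "fst (m <| X) = fst m ** X" "snd (m <| X) = snd m ** X"
 "fst (c \<cdot> m) = c \<odot> fst m" "snd (c \<cdot> m) = c \<odot> snd m"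
 "fst (J_op m) = - (snd m)\<^sup>H" "snd (J_op m) = (fst m)\<^sup>H" by (simp_all add: pair_defs)

lemma inf_act_eq: "inf_act X m = (X |> m) - (m <| X)" by (simp add: inf_act_def pair_defs)

lemma I_op_eq: "I_op m = \<i> \<cdot> m" by (simp add: I_op_def pair_defs mat_mult_eq_cs)

lemma lm_simps:
 "X |> Y |> m = (X ** Y) |> m" "m <| X <| Y = m <| (X ** Y)" "(X |> m) <| Y = X |> (m <| Y)"
 "mat 1 |> m = m" "m <| mat 1 = m" "0 |> m = 0" "m <| 0 = 0" "X |> 0 = 0" "0 <| X = 0" by (simp_all add: prod_eq_iff mm)

lemma lm_distribs:
 "X |> (m + n) = (X |> m) + (X |> n)" "(m + n) <| X = m <| X + n <| X"
 "X |> (m - n) = (X |> m) - (X |> n)" "(m - n) <| X = m <| X - n <| X"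
 "(X + Y) |> m = (X |> m) + (Y |> m)" "m <| (X + Y) = m <| X + m <| Y"
 "(X - Y) |> m = (X |> m) - (Y |> m)" "m <| (X - Y) = m <| X - m <| Y"
 "X |> (- m) = - (X |> m)" "(- m) <| X = - (m <| X)"
 "(- X) |> m = - (X |> m)" "m <| (- X) = - (m <| X)" by (simp_all add: prod_eq_iff mm)

lemma lm_scale:
 "X |> (c \<cdot> m) = c \<cdot> (X |> m)" "(c \<cdot> m) <| X = c \<cdot> (m <| X)"
 "(c \<odot> X) |> m = c \<cdot> (X |> m)" "m <| (c \<odot> X) = c \<cdot> (m <| X)"
 "X |> (r *\<^sub>R m) = r *\<^sub>R (X |> m)" "(r *\<^sub>R m) <| X = r *\<^sub>R (m <| X)"
 "(r *\<^sub>R X) |> m = r *\<^sub>R (X |> m)" "m <| (r *\<^sub>R X) = r *\<^sub>R (m <| X)" by (simp_all add: prod_eq_iff mm)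

lemma ps_simps [simp]:
 "1 \<cdot> m = m" "0 \<cdot> m = 0" "c \<cdot> (0::'n::finite pair) = 0" "c \<cdot> d \<cdot> m = (c * d) \<cdot> m"
 "c \<cdot> (- m) = - (c \<cdot> m)" "(- c) \<cdot> m = - (c \<cdot> m)" by (simp_all add: prod_eq_iff)

lemma ps_distribs:
 "c \<cdot> (m + n) = c \<cdot> m + c \<cdot> n" "c \<cdot> (m - n) = c \<cdot> m - c \<cdot> n"
 "(c + d) \<cdot> m = c \<cdot> m + d \<cdot> m" "(c - d) \<cdot> m = c \<cdot> m - d \<cdot> m" by (simp_all add: prod_eq_iff cs_distribs)

lemma ps_of_real: "of_real r \<cdot> m = r *\<^sub>R m" by (simp add: prod_eq_iff cs_of_real)

lemma ps_eq_0_iff: "c \<cdot> m = 0 \<longleftrightarrow> c = 0 \<or> m = 0" by (auto simp: prod_eq_iff cs_eq_0_iff)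

lemma inner_ps: "(c \<cdot> m) \<bullet> n = m \<bullet> (cnj c \<cdot> n)" by (simp add: inner_prod_def inner_cs)

lemma om_distribs:
 "om (m + n) k = om m k + om n k" "om k (m + n) = om k m + om k n"
 "om (m - n) k = om m k - om n k" "om k (m - n) = om k m - om k n"
 "om (- m) k = - om m k" "om k (- m) = - om k m"
 "om (c \<cdot> m) k = c \<odot> om m k" "om k (c \<cdot> m) = c \<odot> om k m"
 "om (r *\<^sub>R m) k = r *\<^sub>R om m k" "om k (r *\<^sub>R m) = r *\<^sub>R om k m"
 "om 0 k = 0" "om k 0 = 0" by (simp_all add: om_def mm cs_distribs algebra_simps)

lemma om_mult: "om (X |> m) n = X ** om m n" "om m (n <| X) = om m n ** X"
 "om (m <| X) n = om m (X |> n)" by (simp_all add: om_def mm)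

lemma lip_om: "lip m n = om m (J_op n)" and rip_om: "rip m n = - om (J_op n) m" by (simp_all add: pair_defs mm)

lemma adj_lip: "(lip m n)\<^sup>H = lip n m" "(rip m n)\<^sup>H = rip n m" by (simp_all add: pair_defs adj_mult)

lemma adj_rmom: "(rmom m)\<^sup>H = rmom m" by (simp add: rmom_def adj_lip)

lemma trace_lip_rip: "trace (lip m n) = trace (rip m n)" by (simp add: lip_def rip_def trace_add trace_mul_sym[of "fst m"] trace_mul_sym[of "snd m"])

lemma trace_rmom: "trace (rmom m) = 0" by (simp add: rmom_def trace_sub trace_lip_rip)

lemma trace_om: "trace (om m m) = 0" by (simp add: om_def trace_sub trace_mul_sym[of "fst m"])

lemma inner_lm: "(X |> m) \<bullet> n = X \<bullet> lip n m" and inner_rm: "(m <| X) \<bullet> n = X \<bullet> rip n m"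
proof -
 show "(X |> m) \<bullet> n = X \<bullet> lip n m" by (simp add: inner_prod_def lip_def inner_add_right End_inner_mult_right)
 show "(m <| X) \<bullet> n = X \<bullet> rip n m" by (simp add: inner_prod_def rip_def inner_add_right End_inner_mult_left)
qed

lemma inner_lm': "(X |> m) \<bullet> n = m \<bullet> (X\<^sup>H |> n)" and inner_rm': "(m <| X) \<bullet> n = m \<bullet> (n <| X\<^sup>H)"
 by (simp_all add: inner_prod_def End_inner_mult_left[where X = X] End_inner_mult_right[where X = X])

lemma J_mult: "J_op (X |> m) = J_op m <| X\<^sup>H" "J_op (m <| X) = X\<^sup>H |> J_op m" by (simp_all add: prod_eq_iff adj_mult mm)

lemma J_ps: "J_op (c \<cdot> m) = cnj c \<cdot> J_op m" by (simp add: prod_eq_iff adj_cs)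

lemma J_distribs: "J_op (m + n) = J_op m + J_op n" "J_op (m - n) = J_op m - J_op n"
 "J_op (- m) = - J_op m" "J_op (0::'n::finite pair) = 0" "J_op (J_op m) = - m" by (simp_all add: prod_eq_iff)

lemma inner_J: "J_op m \<bullet> J_op n = m \<bullet> n" "J_op m \<bullet> n = - (m \<bullet> J_op n)"
proof -
 show *: "J_op m \<bullet> n = - (m \<bullet> J_op n)" for m n :: "'a pair" by (rule structures_skew)
 show "J_op m \<bullet> J_op n = m \<bullet> n" using *[of m "J_op n"] by (simp add: J_distribs)
qed

lemma lip_J: "lip (J_op n) m = - (om m n)\<^sup>H" and rip_J: "rip (J_op n) m = (om n m)\<^sup>H" by (simp_all add: pair_defs adj_mult mm)

lemma linear_pair:
 "linear (%m. X |> m)" "linear (%m. m <| X)" "linear (%m. c \<cdot> m)" "linear (%X. X |> m)"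
 "linear (%X. m <| X)" "linear (%m. om m n)" "linear (%m. om n m)"
 by (rule linearI; simp add: lm_distribs lm_scale ps_distribs om_distribs flip: ps_of_real cs_of_real;
   simp add: ps_of_real cs_of_real mult.commute)+

section \<open>The group, its commutant and the quaternionic module\<close>

locale mckay =
 fixes \<gamma> :: "'g::finite => complex^2^2"
 assumes inj_\<gamma>: "inj \<gamma>"
  and ex_mult: "!!g h. \<exists>k. \<gamma> k = \<gamma> g ** \<gamma> h"
  and ex_one: "\<exists>e. \<gamma> e = mat 1"
  and unitary_\<gamma>: "!!g. (\<gamma> g)\<^sup>H ** \<gamma> g = mat 1"
  and det_\<gamma>: "!!g. det (\<gamma> g) = 1"
  and nontrivial: "range \<gamma> ~= {mat 1}"
begin

definition gm :: "'g => 'g => 'g" where "gm g h = (SOME k. \<gamma> k = \<gamma> g ** \<gamma> h)"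
definition ge :: 'g where "ge = (SOME e. \<gamma> e = mat 1)"
definition gi :: "'g => 'g" where "gi g = (SOME h. \<gamma> h ** \<gamma> g = mat 1)"

lemma \<gamma>_gm: "\<gamma> (gm g h) = \<gamma> g ** \<gamma> h" unfolding gm_def by (rule someI_ex, rule ex_mult)

lemma \<gamma>_ge: "\<gamma> ge = mat 1" unfolding ge_def by (rule someI_ex, rule ex_one)

lemma unitary_\<gamma>': "\<gamma> g ** (\<gamma> g)\<^sup>H = mat 1" using unitary_\<gamma> matrix_left_right_inverse by blast

lemma ex_inv: "\<exists>h. \<gamma> h ** \<gamma> g = mat 1"
proof -
 have "inj (%h. gm h g)"
 proof (rule injI)
  fix h h' assume "gm h g = gm h' g"
  hence "\<gamma> h ** \<gamma> g = \<gamma> h' ** \<gamma> g" by (metis \<gamma>_gm)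
  hence "\<gamma> h ** \<gamma> g ** (\<gamma> g)\<^sup>H = \<gamma> h' ** \<gamma> g ** (\<gamma> g)\<^sup>H" by simp
  hence "\<gamma> h = \<gamma> h'" by (simp add: assoc_r unitary_\<gamma>')
  thus "h = h'" using inj_\<gamma> by (simp add: inj_eq)
 qed
 hence "surj (%h. gm h g)" by (simp add: finite_UNIV_inj_surj)
 then obtain h where "gm h g = ge" by (metis surjD)
 hence "\<gamma> h ** \<gamma> g = mat 1" by (metis \<gamma>_ge \<gamma>_gm)
 thus ?thesis ..
qed

lemma \<gamma>_gi: "\<gamma> (gi g) = (\<gamma> g)\<^sup>H"
proof -
 have "\<gamma> (gi g) ** \<gamma> g = mat 1" unfolding gi_def by (rule someI_ex, rule ex_inv)
 hence "\<gamma> (gi g) ** (\<gamma> g ** (\<gamma> g)\<^sup>H) = (\<gamma> g)\<^sup>H" by (simp add: mm_assoc)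
 thus ?thesis by (simp add: unitary_\<gamma>')
qed

lemma \<gamma>_eq_iff: "\<gamma> g = \<gamma> h \<longleftrightarrow> g = h" using inj_\<gamma> by (simp add: inj_eq)

lemma group_simps [simp]:
 "gm ge g = g" "gm g ge = g" "gm (gi g) g = ge" "gm g (gi g) = ge" "gi (gi g) = g" "gi ge = ge"
 "gm (gi g) (gm g h) = h" "gm g (gm (gi g) h) = h" "gm (gm h g) (gi g) = h"
 by (simp_all flip: \<gamma>_eq_iff add: \<gamma>_gm \<gamma>_gi \<gamma>_ge unitary_\<gamma> unitary_\<gamma>' mm_assoc)
   (simp_all add: assoc_r unitary_\<gamma>' adj_mat)

lemma gm_assoc: "gm (gm g h) k = gm g (gm h k)" by (simp flip: \<gamma>_eq_iff add: \<gamma>_gm mm_assoc)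

lemma gi_gm: "gi (gm g h) = gm (gi h) (gi g)" by (simp flip: \<gamma>_eq_iff add: \<gamma>_gm \<gamma>_gi adj_mult)

lemma bij_gi: "bij gi" by (rule o_bij[of gi]) auto
lemma bij_gm: "bij (gm g)" "bij (%h. gm h g)" by (rule o_bij[of "gm (gi g)"]; force) (rule o_bij[of "%h. gm h (gi g)"]; simp add: fun_eq_iff gm_assoc)

lemma sum_gi: "(\<Sum>g\<in>UNIV. f (gi g)) = (\<Sum>g\<in>UNIV. f g)" using sum.reindex_bij_betw[OF bij_gi] .
lemma sum_gm: "(\<Sum>h\<in>UNIV. f (gm g h)) = (\<Sum>h\<in>UNIV. f h)" "(\<Sum>h\<in>UNIV. f (gm h g)) = (\<Sum>h\<in>UNIV. f h)"
 using sum.reindex_bij_betw[OF bij_gm(1)] sum.reindex_bij_betw[OF bij_gm(2)] by blast+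

abbreviation R :: "'g => 'g End" where "R \<equiv> reg \<gamma>"
abbreviation "lieG \<equiv> lie \<gamma>"
abbreviation "orb \<equiv> orbit \<gamma>"
abbreviation "vert \<equiv> vertical \<gamma>"
abbreviation \<C> :: "'g End set" where "\<C> \<equiv> commutant \<gamma>"
abbreviation \<M> :: "'g pair set" where "\<M> \<equiv> M_space \<gamma>"

lemma reg_nth: "R g $ i $ j = (if i = gm g j then 1 else 0)" by (simp add: reg_def flip: \<gamma>_gm \<gamma>_eq_iff)

lemma reg_gm: "R (gm g h) = R g ** R h" by (simp add: vec_eq_iff matrix_matrix_mult_def reg_nth gm_assoc if_distrib[of "%x. _ * x"] cong: if_cong)

lemma reg_ge: "R ge = mat 1" by (simp add: vec_eq_iff reg_nth mat_def)

lemma adj_reg: "(R g)\<^sup>H = R (gi g)"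
proof -
 have "(j = gm g i) = (i = gm (gi g) j)" for i j by auto
 thus ?thesis by (simp add: vec_eq_iff reg_nth)
qed

lemma reg_inverse: "R g ** R (gi g) = mat 1" "R (gi g) ** R g = mat 1" by (simp_all flip: reg_gm reg_ge)

lemma trace_reg: "trace (R g) = (if g = ge then of_nat CARD('g) else 0)"
proof (cases "g = ge")
 case False
 have "i ~= gm g i" for i
 proof
  assume "i = gm g i"
  hence "gm i (gi i) = gm (gm g i) (gi i)" by simp
  thus False using False by (simp add: gm_assoc)
 qed
 thus ?thesis using False by (simp add: trace_def reg_nth)
qed (simp add: reg_ge trace_mat)

lemma CD: "X \<in> \<C> ==> X ** R g = R g ** X" by (simp add: commutant_def)

lemma C_closed:
 "mat 1 \<in> \<C>" "0 \<in> \<C>" "X \<in> \<C> ==> Y \<in> \<C> ==> X + Y \<in> \<C>" "X \<in> \<C> ==> Y \<in> \<C> ==> X - Y \<in> \<C>"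
 "X \<in> \<C> ==> - X \<in> \<C>" "X \<in> \<C> ==> Y \<in> \<C> ==> X ** Y \<in> \<C>" "X \<in> \<C> ==> c \<odot> X \<in> \<C>"
 "X \<in> \<C> ==> r *\<^sub>R X \<in> \<C>" "mat c \<in> \<C>"
proof -
 show "X ** Y \<in> \<C>" if "X \<in> \<C>" "Y \<in> \<C>" using that unfolding commutant_def by (auto simp: assoc_r) (metis mm_assoc)
 have "mat c ** A = A ** mat c" for A :: "'g End" by (metis mat_mult_eq_cs mult_cs(1) mult_id)
 thus "mat c \<in> \<C>" by (simp add: commutant_def)
qed (auto simp: commutant_def mm)

lemma C_adj: "X \<in> \<C> ==> X\<^sup>H \<in> \<C>"
proof -
 assume X: "X \<in> \<C>"
 have "X\<^sup>H ** R g = R g ** X\<^sup>H" for g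
 proof -
  have "(X ** R (gi g))\<^sup>H = (R (gi g) ** X)\<^sup>H" using CD[OF X] by simp
  thus ?thesis by (simp add: adj_mult adj_reg)
 qed
 thus ?thesis by (simp add: commutant_def)
qed

lemma subspace_C: "subspace \<C>" by (simp add: subspace_def C_closed)

lemma M_iff: "m \<in> \<M> \<longleftrightarrow> (\<forall>g.
   R g ** (\<gamma> g $ 1 $ 1 \<odot> fst m + \<gamma> g $ 1 $ 2 \<odot> snd m) = fst m ** R g \<and>
   R g ** (\<gamma> g $ 2 $ 1 \<odot> fst m + \<gamma> g $ 2 $ 2 \<odot> snd m) = snd m ** R g)" by (cases m) (simp add: M_space_def mat_mult_eq_cs)

lemma MD:
 assumes "m \<in> \<M>"
 shows "fst m ** R g = \<gamma> g $ 1 $ 1 \<odot> (R g ** fst m) + \<gamma> g $ 1 $ 2 \<odot> (R g ** snd m)"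
  "snd m ** R g = \<gamma> g $ 2 $ 1 \<odot> (R g ** fst m) + \<gamma> g $ 2 $ 2 \<odot> (R g ** snd m)" using assms by (simp_all add: M_iff mm)

lemma \<gamma>_entries: "\<gamma> g $ 2 $ 2 = cnj (\<gamma> g $ 1 $ 1)" "\<gamma> g $ 2 $ 1 = - cnj (\<gamma> g $ 1 $ 2)"
proof -
 let ?a = "\<gamma> g $ 1 $ 1" and ?b = "\<gamma> g $ 1 $ 2" and ?c = "\<gamma> g $ 2 $ 1" and ?d = "\<gamma> g $ 2 $ 2"
 have u: "?a * cnj ?a + ?b * cnj ?b = 1" "?a * cnj ?c + ?b * cnj ?d = 0"
  "?c * cnj ?a + ?d * cnj ?b = 0" using unitary_\<gamma>'[of g] by (simp_all add: vec_eq_iff matrix_matrix_mult_def mat_def sum_2 forall_2)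
 have d: "?a * ?d - ?b * ?c = 1" using det_\<gamma>[of g] by (simp add: det_2)
 have "?d = ?d * (?a * cnj ?a + ?b * cnj ?b)" by (simp add: u)
 also have "... = cnj ?a * (?a * ?d - ?b * ?c) + ?b * (?c * cnj ?a + ?d * cnj ?b)" by algebra
 also have "... = cnj ?a" by (simp add: d u)
 finally show "?d = cnj ?a" .
 have "?c = ?c * (?a * cnj ?a + ?b * cnj ?b)" by (simp add: u)
 also have "... = ?a * (?c * cnj ?a + ?d * cnj ?b) - cnj ?b * (?a * ?d - ?b * ?c)" by algebra
 also have "... = - cnj ?b" by (simp add: d u)
 finally show "?c = - cnj ?b" .
qed

lemma \<gamma>_det: "\<gamma> g $ 1 $ 1 * \<gamma> g $ 2 $ 2 - \<gamma> g $ 1 $ 2 * \<gamma> g $ 2 $ 1 = 1"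
 using det_\<gamma>[of g] by (simp add: det_2)

lemma M_closed:
 "0 \<in> \<M>" "m \<in> \<M> ==> n \<in> \<M> ==> m + n \<in> \<M>" "m \<in> \<M> ==> n \<in> \<M> ==> m - n \<in> \<M>"
 "m \<in> \<M> ==> - m \<in> \<M>" "m \<in> \<M> ==> c \<cdot> m \<in> \<M>"
proof -
 show "m + n \<in> \<M>" if "m \<in> \<M>" "n \<in> \<M>" unfolding M_iff by (simp add: mm MD[OF that(1)] MD[OF that(2)] cs_distribs)
 show "m - n \<in> \<M>" if "m \<in> \<M>" "n \<in> \<M>" unfolding M_iff by (simp add: mm MD[OF that(1)] MD[OF that(2)] cs_distribs)
 show "- m \<in> \<M>" if "m \<in> \<M>" unfolding M_iff by (simp add: mm MD[OF that])
 show "c \<cdot> m \<in> \<M>" if "m \<in> \<M>" unfolding M_iff by (simp add: mm MD[OF that] cs_distribs mult.commute)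
qed (simp add: M_iff)

lemma M_scaleR: "m \<in> \<M> ==> r *\<^sub>R m \<in> \<M>" using M_closed(5)[of m "of_real r"] by (simp add: ps_of_real)

lemma subspace_M: "subspace \<M>" by (simp add: subspace_def M_closed M_scaleR)

lemma M_mult:
 assumes "X \<in> \<C>" "m \<in> \<M>"
 shows "X |> m \<in> \<M>" "m <| X \<in> \<M>"
proof -
 have c: "R g ** (X ** A) = X ** (R g ** A)" for g and A :: "'g End" by (metis CD[OF assms(1)] mm_assoc)
 have a: "A ** R g = B ==> A ** (R g ** C) = B ** C" for g and A B C :: "'g End" by (simp add: mm_assoc)
 show "X |> m \<in> \<M>" unfolding M_iff by (simp add: mm c MD[OF assms(2)])
 show "m <| X \<in> \<M>" unfolding M_iff by (simp add: mm CD[OF assms(1)] a[OF MD(1)[OF assms(2)]] a[OF MD(2)[OF assms(2)]])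
qed

lemma M_J:
 assumes "m \<in> \<M>"
 shows "J_op m \<in> \<M>"
proof -
 have *: "cnj (\<gamma> g $ k $ 1) \<odot> (R g ** (fst m)\<^sup>H) + cnj (\<gamma> g $ k $ 2) \<odot> (R g ** (snd m)\<^sup>H) = A\<^sup>H ** R g"
  if "R g ** (\<gamma> g $ k $ 1 \<odot> fst m + \<gamma> g $ k $ 2 \<odot> snd m) = A ** R g" for g k A
 proof -
  from that have "(R g ** (\<gamma> g $ k $ 1 \<odot> fst m + \<gamma> g $ k $ 2 \<odot> snd m))\<^sup>H = (A ** R g)\<^sup>H" by simp
  hence "(cnj (\<gamma> g $ k $ 1) \<odot> (fst m)\<^sup>H + cnj (\<gamma> g $ k $ 2) \<odot> (snd m)\<^sup>H) ** R (gi g) = R (gi g) ** A\<^sup>H"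
   by (simp add: adj_mult adj_reg adj_cs)
  hence "R g ** (cnj (\<gamma> g $ k $ 1) \<odot> (fst m)\<^sup>H + cnj (\<gamma> g $ k $ 2) \<odot> (snd m)\<^sup>H) = A\<^sup>H ** R g"
   by (metis mm_assoc mult_id reg_inverse)
  thus ?thesis by (simp add: mm)
 qed
 have 1: "R g ** (\<gamma> g $ 1 $ 1 \<odot> fst m + \<gamma> g $ 1 $ 2 \<odot> snd m) = fst m ** R g"
  "R g ** (\<gamma> g $ 2 $ 1 \<odot> fst m + \<gamma> g $ 2 $ 2 \<odot> snd m) = snd m ** R g" for g using assms by (simp_all add: M_iff)
 show ?thesis unfolding M_iff using *[OF 1(1)] *[OF 1(2)] \<gamma>_entries by (auto simp: mm algebra_simps)
qed

lemma om_C: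
 assumes "m \<in> \<M>" "n \<in> \<M>"
 shows "om m n \<in> \<C>"
proof -
 have "om m n ** R g = R g ** om m n" for g
 proof -
  have a: "A ** R g = B ==> A ** (R g ** C) = B ** C" for A B C :: "'g End" by (simp add: mm_assoc)
  have "om m n ** R g = (\<gamma> g $ 1 $ 1 * \<gamma> g $ 2 $ 2 - \<gamma> g $ 1 $ 2 * \<gamma> g $ 2 $ 1) \<odot> (R g ** om m n)" unfolding om_def
   by (simp add: mm MD[OF assms(2)] a[OF MD(1)[OF assms(1)]] a[OF MD(2)[OF assms(1)]])
     (simp add: vec_eq_iff algebra_simps)
  thus ?thesis by (simp add: \<gamma>_det)
 qed
 thus ?thesis by (simp add: commutant_def)
qed

lemma lip_C: "m \<in> \<M> ==> n \<in> \<M> ==> lip m n \<in> \<C>" and rip_C: "m \<in> \<M> ==> n \<in> \<M> ==> rip m n \<in> \<C>"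
 by (simp_all add: lip_om rip_om om_C M_J C_closed)

lemma rmom_C: "m \<in> \<M> ==> rmom m \<in> \<C>" by (simp add: rmom_def lip_C rip_C C_closed)

end

section \<open>Dimensions\<close>

lemma inner_sandwich: "(A ** X ** B) \<bullet> Y = X \<bullet> (A\<^sup>H ** Y ** B\<^sup>H)" for A B X Y :: "'n::finite End"
 by (simp only: assoc_r End_inner_mult_left[where X = A] End_inner_mult_right[where X = B])

lemma dim_range_orthogonal_projection:
 fixes p :: "'a::euclidean_space => 'a"
 assumes "linear p" and idem: "!!x. p (p x) = p x" and self: "!!x y. p x \<bullet> y = x \<bullet> p y"
 shows "real (dim (range p)) = (\<Sum>b\<in>Basis. p b \<bullet> b)"
proof -
 obtain B where B: "pairwise orthogonal B" "!!x. x \<in> B ==> norm x = 1" "independent B"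
  "card B = dim (range p)" "span B = range p" "B \<subseteq> range p"
  using orthonormal_basis_subspace[of "range p"] assms(1) by (metis linear_subspace_image subspace_UNIV)
 have fin: "finite B" using B(3) by (rule independent_imp_finite)
 have expand: "p x = (\<Sum>w\<in>B. (x \<bullet> w) *\<^sub>R w)" for x
 proof -
  have "p w = w" if "w \<in> B" for w using B(6) that idem by auto
  hence "(\<Sum>w\<in>B. (x \<bullet> w) *\<^sub>R w) = (\<Sum>w\<in>B. (p x \<bullet> w) *\<^sub>R w)" by (simp add: self)
  also have "... = p x" by (rule orthonormal_basis_expand[OF B(1)]) (use B fin in auto)
  finally show ?thesis by simp
 qed
 have "(\<Sum>b\<in>Basis. p b \<bullet> b) = (\<Sum>b\<in>Basis. \<Sum>w\<in>B. (w \<bullet> b) * (w \<bullet> b))"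
  by (intro sum.cong refl, subst expand) (simp add: inner_sum_right inner_commute)
 also have "... = (\<Sum>w\<in>B. w \<bullet> w)" by (subst sum.swap) (simp add: euclidean_inner[of w w for w])
 also have "... = real (dim (range p))" using B(2) by (simp add: B(4)[symmetric] norm_eq_1)
 finally show ?thesis by simp
qed

lemma dim_kernel_image:
 fixes f :: "'a::euclidean_space => 'b::euclidean_space"
 assumes "linear f" "subspace S"
 shows "dim {x \<in> S. f x = 0} + dim (f ` S) = dim S"
proof -
 let ?K = "{x \<in> S. f x = 0}" and ?T = "{y \<in> S. \<forall>x\<in>{x \<in> S. f x = 0}. orthogonal x y}"
 have K: "subspace ?K" using assms by (auto simp: subspace_def linear_add linear_cmul linear_0)
 have T: "subspace ?T" using assms(2) by (auto simp: subspace_def orthogonal_def inner_add_right)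
 have "inj_on f ?T"
 proof (subst linear_injective_on_subspace_0[OF assms(1) T], intro ballI impI)
  fix x assume x: "x \<in> ?T" "f x = 0"
  hence "orthogonal x x" by blast
  thus "x = 0" by (simp add: orthogonal_def)
 qed
 hence "dim (f ` ?T) = dim ?T" by (rule dim_image_eq[OF assms(1), of ?T, unfolded span_eq_iff[THEN iffD2, OF T]])
 moreover have "f ` S = f ` ?T"
 proof
  show "f ` S \<subseteq> f ` ?T"
  proof
   fix y assume "y \<in> f ` S"
   then obtain x where x: "x \<in> S" "y = f x" by blast
   obtain k t where k: "k \<in> span ?K" "!!w. w \<in> span ?K ==> orthogonal t w" "x = k + t"
    by (rule orthogonal_subspace_decomp_exists[of ?K x]) blast
   have k': "k \<in> ?K" using k(1) unfolding span_eq_iff[THEN iffD2, OF K] .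
   have "t = x - k" using k by simp
   hence "t \<in> S" using x k' assms(2) by (simp add: subspace_diff)
   moreover have "orthogonal w t" if "w \<in> ?K" for w using k(2)[OF span_base[OF that]] by (simp add: orthogonal_commute)
   ultimately have "t \<in> ?T" by blast
   moreover have "y = f t" using x k' \<open>t = x - k\<close> by (simp add: linear_diff[OF assms(1)])
   ultimately show "y \<in> f ` ?T" by blast
  qed
 qed auto
 ultimately show ?thesis using dim_subspace_orthogonal_to_vectors[OF K assms(2)] by simp
qed

lemma dim_orthogonal_subspaces_le:
 fixes A B S :: "'a::euclidean_space set"
 assumes "subspace A" "subspace S" "A \<subseteq> S" "B \<subseteq> S" "!!a b. a \<in> A ==> b \<in> B ==> a \<bullet> b = 0"
 shows "dim A + dim B \<le> dim S"
proof -
 have "dim B \<le> dim {y \<in> S. \<forall>x\<in>A. orthogonal x y}" using assms by (intro dim_subset) (auto simp: orthogonal_def)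
 thus ?thesis using dim_subspace_orthogonal_to_vectors[OF assms(1-3)] by simp
qed

text \<open>If \<open>n\<close> operators move every vector through an orthogonal frame and their adjoints permute the
 frames up to sign, an invariant subspace splits off frames until nothing is left.\<close>

lemma dim_dvd_frame:
 fixes S :: "'a::euclidean_space set" and u :: "nat => 'a => 'a"
 assumes "n > 0"
  and orth: "\<forall>i<n. \<forall>j<n. \<forall>x. u i x \<bullet> u j x = (if i = j then x \<bullet> x else 0)"
  and adj: "\<forall>i<n. \<forall>j<n. \<exists>k<n. \<forall>x y. \<bar>u i x \<bullet> u j y\<bar> = \<bar>u k x \<bullet> y\<bar>"
  and "subspace S" "\<forall>i<n. \<forall>x\<in>S. u i x \<in> S"
 shows "n dvd dim S" using assms(4,5)
proof (induction "dim S" arbitrary: S rule: less_induct)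
 case less
 show ?case
 proof (cases "S = {0}")
  case False
  then obtain v where v: "v \<in> S" "v ~= 0" using subspace_0[OF less.prems(1)] by blast
  let ?A = "(%i. u i v) ` {..<n}"
  let ?T = "{y \<in> S. \<forall>x\<in>span ?A. orthogonal x y}"
  have "pairwise orthogonal ?A" using orth by (auto simp: pairwise_def orthogonal_def)
  moreover have nz: "u i v \<bullet> u i v ~= 0" if "i < n" for i using orth that v by simp
  hence "0 \<notin> ?A" by auto
  ultimately have "independent ?A" by (rule pairwise_orthogonal_independent)
  moreover have "inj_on (%i. u i v) {..<n}"
  proof (rule inj_onI, rule ccontr)
   fix i j assume a: "i \<in> {..<n}" "j \<in> {..<n}" "u i v = u j v" "i ~= j"
   have "u i v \<bullet> u j v = 0" using orth a(1,2,4) by simp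
   thus False using nz[of j] a(2,3) by simp
  qed
  ultimately have d: "dim (span ?A) = n" by (simp add: dim_eq_card_independent card_image)
  have "span ?A \<subseteq> S" by (rule span_minimal) (use v less.prems in auto)
  from dim_subspace_orthogonal_to_vectors[OF subspace_span less.prems(1) this] have eq: "dim ?T + n = dim S" unfolding d .
  have T: "?T = {y \<in> S. \<forall>i<n. u i v \<bullet> y = 0}"
  proof (intro Collect_cong conj_cong refl iffI ballI allI impI)
   fix y i assume "\<forall>x\<in>span ?A. orthogonal x y" "i < n"
   thus "u i v \<bullet> y = 0" by (simp add: span_base orthogonal_def)
  next
   fix x y assume a: "\<forall>i<n. u i v \<bullet> y = 0" "x \<in> span ?A"
   have "orthogonal y x" by (rule orthogonal_to_span[OF a(2)]) (use a(1) in \<open>auto simp: orthogonal_def inner_commute\<close>)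
   thus "orthogonal x y" by (simp add: orthogonal_commute)
  qed
  have "n dvd dim ?T"
  proof (rule less.hyps)
   show "dim ?T < dim S" using eq assms(1) by simp
   show "subspace ?T" using less.prems(1) by (auto simp: subspace_def orthogonal_def inner_add_right)
   show "\<forall>j<n. \<forall>y\<in>?T. u j y \<in> ?T" unfolding T
   proof (intro allI impI ballI CollectI conjI)
    fix i j y assume y: "y \<in> {y \<in> S. \<forall>i<n. u i v \<bullet> y = 0}" and ij: "j < n" "i < n"
    obtain k where "k < n" "\<bar>u i v \<bullet> u j y\<bar> = \<bar>u k v \<bullet> y\<bar>" using adj ij by blast
    thus "u i v \<bullet> u j y = 0" using y by simp
   qed (use less.prems(2) in auto)
  qed
  hence "n dvd dim ?T + n" by simp
  thus ?thesis unfolding eq .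
 qed simp
qed

lemma quaternionic_dim:
 fixes S :: "'n::finite pair set"
 assumes "subspace S" "!!x. x \<in> S ==> I_op x \<in> S"
 shows "even (dim S)" "(!!x. x \<in> S ==> J_op x \<in> S) ==> 4 dvd dim S"
proof -
 have rel: "I_op (I_op x) = - x" "J_op (J_op x) = - x" "J_op (I_op x) = - K_op x" "I_op (J_op x) = K_op x"
  "K_op (K_op x) = - x" "I_op (K_op x) = - J_op x" "J_op (K_op x) = I_op x" "K_op (I_op x) = J_op x" "K_op (J_op x) = - I_op x"
  for x :: "'n pair" by (simp_all add: K_op_def I_op_eq J_ps quaternion_relations(2)[unfolded I_op_eq] linear_neg[OF structures_linear(2)])
 have mv: "x \<bullet> I_op y = - (I_op x \<bullet> y)" "x \<bullet> J_op y = - (J_op x \<bullet> y)" "x \<bullet> K_op y = - (K_op x \<bullet> y)" for x y :: "'n pair"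
  by (simp_all add: structures_skew[of x])
 have s: "I_op x \<bullet> x = 0" "J_op x \<bullet> x = 0" "K_op x \<bullet> x = 0" for x :: "'n pair"
  using mv[of x x] by (simp_all add: inner_commute)
 have "2 dvd dim S" by (rule dim_dvd_frame[of 2 "(!) [id, I_op]", OF _ _ _ assms(1)])
    (use assms(2) in \<open>simp_all add: numeral_2_eq_2 All_less_Suc Ex_less_Suc mv rel s del: split_paired_All\<close>)
 thus "even (dim S)" by simp
 assume J: "!!x. x \<in> S ==> J_op x \<in> S"
 have "K_op x \<in> S" if "x \<in> S" for x by (simp add: K_op_def assms(2) J that)
 thus "4 dvd dim S" by (intro dim_dvd_frame[of 4 "(!) [id, I_op, J_op, K_op]", OF _ _ _ assms(1)])
    (use assms(2) J in \<open>simp_all add: numeral_eq_Suc All_less_Suc Ex_less_Suc mv rel s del: split_paired_All\<close>)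
qed

lemma dim_complex_line:
 fixes S :: "'n::finite End set"
 assumes "!!X. X \<in> S ==> \<exists>c. X = c \<odot> P" shows "dim S \<le> 2"
proof -
 have "S \<subseteq> span {P, \<i> \<odot> P}"
 proof
  fix X assume "X \<in> S"
  then obtain c where "X = c \<odot> P" using assms by blast
  hence "X = Re c *\<^sub>R P + Im c *\<^sub>R (\<i> \<odot> P)"
   by (subst (asm) complex_eq[of c]) (simp add: cs_distribs mult.commute flip: cs_of_real)
  also have "... \<in> span {P, \<i> \<odot> P}" by (intro span_add span_scale span_base) auto
  finally show "X \<in> span {P, \<i> \<odot> P}" .
 qed
 hence "dim S \<le> card {P, \<i> \<odot> P}" by (rule dim_le_card) simp
 also have "... \<le> 2" by (simp add: card_insert_if)
 finally show ?thesis .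
qed

lemma sum_Basis_vec:
 "(\<Sum>b\<in>(Basis::('a::euclidean_space^'n) set). f b) = (\<Sum>i\<in>UNIV. \<Sum>u\<in>Basis. f (axis i u))"
proof -
 have "(\<Sum>b\<in>(Basis::('a^'n) set). f b) = (\<Sum>p\<in>UNIV \<times> Basis. f (axis (fst p) (snd p)))"
 proof (rule sum.reindex_cong[of "%p. axis (fst p) (snd p)"])
  show "inj_on (%p. axis (fst p) (snd p)) ((UNIV::'n set) \<times> (Basis::'a set))" by (force simp: inj_on_def axis_eq_axis)
  show "(Basis::('a^'n) set) = (%p. axis (fst p) (snd p)) ` (UNIV \<times> Basis)" by (force simp: Basis_vec_def image_iff)
 qed auto
 thus ?thesis by (simp add: sum.cartesian_product case_prod_unfold)
qed

lemma sum_Basis_pair: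
 "(\<Sum>b\<in>(Basis::('a::euclidean_space \<times> 'b::euclidean_space) set). f b)
  = (\<Sum>i\<in>Basis. f (i, 0)) + (\<Sum>i\<in>Basis. f (0, i))"
proof -
 have "inj_on (%u. (u::'a,0::'b)) Basis" "inj_on (%u. (0::'a,u::'b)) Basis" by (auto intro!: inj_onI Pair_inject)
 thus ?thesis unfolding Basis_prod_def by (subst sum.union_disjoint) (auto simp: Basis_prod_def sum.reindex)
qed

lemma trace_conjugation: "(\<Sum>b\<in>Basis. (A ** b ** B) \<bullet> b) = 2 * Re (trace A * trace B)"
 for A B :: "'n::finite End"
proof -
 have e: "(A ** axis i (axis j u) ** B) \<bullet> axis i (axis j u) = (A $ i $ i * u * B $ j $ j) \<bullet> u" for i j u
 proof -
  have "(A ** axis i (axis j u)) $ k $ l = (if l = j then A $ k $ i * u else 0)" for k l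
   by (simp add: matrix_matrix_mult_def axis_def if_distrib[of "%v. v $ _"] if_distrib[of "%x. _ * x"] cong: if_cong)
  hence "(A ** axis i (axis j u) ** B) $ k $ l = A $ k $ i * u * B $ j $ l" for k l
   by (simp add: matrix_matrix_mult_def[of "A ** _"] if_distrib[of "%x. x * _"] cong: if_cong)
  thus ?thesis by (simp add: inner_axis)
 qed
 have c: "(\<Sum>u\<in>Basis. (x * u * y) \<bullet> u) = 2 * Re (x * y)" for x y :: complex
  by (simp add: Basis_complex_def inner_complex_def algebra_simps)
 have "(\<Sum>b\<in>Basis. (A ** b ** B) \<bullet> b) = (\<Sum>i\<in>UNIV. \<Sum>j\<in>UNIV. 2 * Re (A $ i $ i * B $ j $ j))"
  by (simp only: sum_Basis_vec e c)
 also have "... = 2 * Re (\<Sum>i\<in>UNIV. \<Sum>j\<in>UNIV. A $ i $ i * B $ j $ j)" by (simp only: Re_sum sum_distrib_left)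
 finally show ?thesis by (simp only: trace_def sum_product)
qed

section \<open>Characters of projections\<close>

context mckay
begin

definition order :: real where "order = real CARD('g)"

lemma order_pos: "order > 0" by (simp add: order_def)

definition avg :: "('g => 'a::real_vector) => 'a" where "avg f = (1 / order) *\<^sub>R (\<Sum>g\<in>UNIV. f g)"

lemma avg_gm: "avg (%h. f (gm g h)) = avg f" "avg (%h. f (gm h g)) = avg f"
 and avg_gi: "avg (%h. f (gi h)) = avg f" by (simp_all add: avg_def sum_gm sum_gi)

lemma avg_const: "avg (%_. c) = c" by (simp add: avg_def order_def sum_constant_scaleR)

lemma linear_avg: "linear T ==> T (avg f) = avg (%g. T (f g))" by (simp add: avg_def linear_cmul linear_sum)

text \<open>Averaging over the group projects onto the invariants, whose dimension is therefore the average
 of the traces.\<close>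

lemma dim_invariants:
 fixes T :: "'g => 'a::euclidean_space => 'a"
 assumes lin: "!!g. linear (T g)" and act: "!!g h x. T (gm g h) x = T g (T h x)"
  and T1: "!!x. T ge x = x" and adj: "!!g x y. T g x \<bullet> y = x \<bullet> T (gi g) y"
  and q: "linear q" "!!x. q (q x) = q x" "!!x y. q x \<bullet> y = x \<bullet> q y"
  and comm: "!!g x. T g (q x) = q (T g x)"
 shows "real (dim {x. q x = x \<and> (\<forall>g. T g x = x)}) = avg (%g. \<Sum>b\<in>Basis. T g (q b) \<bullet> b)"
proof -
 define p where "p x = avg (%g. T g (q x))" for x
 have linp: "linear p" unfolding p_def avg_def by (rule linearI) (simp_all add: linear_add[OF lin] linear_add[OF q(1)] linear_cmul[OF lin]
    linear_cmul[OF q(1)] sum.distrib scaleR_add_right scaleR_sum_right mult.commute)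
 have qp: "q (p x) = p x" for x by (simp add: p_def linear_avg[OF q(1)] flip: comm) (simp add: comm q(2))
 have Tp: "T h (p x) = p x" for h x using avg_gm(1)[of "%g. T g (q x)" h] by (simp add: p_def linear_avg[OF lin] act)
 have pfix: "p x = x" if "q x = x" "\<forall>g. T g x = x" for x by (simp add: p_def that avg_const)
 have "range p = {x. q x = x \<and> (\<forall>g. T g x = x)}" using qp Tp pfix by (auto simp: image_iff) (metis)
 moreover have "p x \<bullet> y = x \<bullet> p y" for x y
 proof -
  have "p x \<bullet> y = avg (%g. x \<bullet> T (gi g) (q y))" by (simp add: p_def avg_def inner_sum_left adj q(3) flip: comm)
  also have "... = x \<bullet> p y" by (simp only: avg_gi[of "%g. x \<bullet> T g (q y)"]) (simp add: p_def avg_def inner_sum_right)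
  finally show ?thesis .
 qed
 ultimately have "real (dim {x. q x = x \<and> (\<forall>g. T g x = x)}) = (\<Sum>b\<in>Basis. p b \<bullet> b)"
  using dim_range_orthogonal_projection[OF linp] qp Tp pfix by metis
 also have "... = avg (%g. \<Sum>b\<in>Basis. T g (q b) \<bullet> b)" by (simp add: p_def avg_def inner_sum_left sum_distrib_left sum.swap[of _ UNIV])
 finally show ?thesis .
qed

text \<open>Orthogonal projections in the commutant correspond to submodules of the regular representation.\<close>

definition Pr :: "'g End set" where
 "Pr = {P \<in> \<C>. P\<^sup>H = P \<and> P ** P = P}"

definition ch :: "'g End => 'g => complex" where
 "ch P g = trace (P ** R g)"

definition cor :: "'g End => 'g End => 'g End set" where
 "cor P Q = {X \<in> \<C>. Q ** X ** P = X}"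

definition corM :: "'g End => 'g End => 'g pair set" where
 "corM P Q = {m \<in> \<M>. Q |> m <| P = m}"

text \<open>The character of the two-dimensional representation.\<close>

definition ch2 :: "'g => real" where
 "ch2 g = 2 * Re (\<gamma> g $ 1 $ 1)"

definition N :: "'g End => 'g End => real" where
 "N P Q = real (dim (cor P Q)) - real (dim (corM P Q)) / 2"

lemma PrD: "P \<in> Pr ==> P \<in> \<C>" "P \<in> Pr ==> P\<^sup>H = P" "P \<in> Pr ==> P ** P = P"
 "P \<in> Pr ==> P ** (P ** A) = P ** A" by (simp_all add: Pr_def mm_assoc)

lemma C_left: "X \<in> \<C> ==> R g ** (X ** A) = X ** (R g ** A)" by (simp add: mm_assoc CD)

lemma Pr_0_1: "0 \<in> Pr" "mat 1 \<in> Pr" by (simp_all add: Pr_def C_closed adj_mat)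

lemma Pr_compl: "P \<in> Pr ==> mat 1 - P \<in> Pr" by (simp add: Pr_def C_closed adj_mat mm)

lemma Pr_compl_simps:
 assumes "P \<in> Pr"
 shows "P ** (mat 1 - P) = 0" "(mat 1 - P) ** P = 0" "P ** ((mat 1 - P) ** A) = 0"
  "(mat 1 - P) ** (P ** A) = 0"
proof -
 show a: "P ** (mat 1 - P) = 0" "(mat 1 - P) ** P = 0" by (simp_all add: mm PrD[OF assms])
 show "P ** ((mat 1 - P) ** A) = 0" "(mat 1 - P) ** (P ** A) = 0" by (simp_all add: mm_assoc a)
qed

lemma Pr_norm: "P \<in> Pr ==> Re (trace P) = (norm P)\<^sup>2" using Re_trace_mult_adj[of P] by (simp add: PrD)

lemma Pr_trace_real: "P \<in> Pr ==> trace P = of_real (Re (trace P))" using trace_adj[of P] by (simp add: PrD complex_eq_iff)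

lemma corD:
 assumes "X \<in> cor P Q" "P \<in> Pr" "Q \<in> Pr"
 shows "X \<in> \<C>" "Q ** X = X" "X ** P = X" "Q ** (X ** A) = X ** A" "X ** (P ** A) = X ** A"
proof -
 have X: "X = Q ** X ** P" and C: "X \<in> \<C>" using assms(1) by (simp_all add: cor_def)
 show "X \<in> \<C>" by (rule C)
 show a: "Q ** X = X" by (subst (1 2) X) (simp add: mm_assoc PrD[OF assms(3)])
 show b: "X ** P = X" by (subst (1 2) X) (simp add: assoc_r PrD[OF assms(2)])
 show "Q ** (X ** A) = X ** A" "X ** (P ** A) = X ** A" by (simp_all add: mm_assoc a b)
qed

lemma corI: "X \<in> \<C> ==> Q ** X = X ==> X ** P = X ==> X \<in> cor P Q" by (simp add: cor_def)

lemma cor_mult: "X \<in> \<C> ==> P \<in> Pr ==> Q \<in> Pr ==> Q ** X ** P \<in> cor P Q" by (rule corI) (simp_all add: C_closed PrD assoc_r)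

lemma corMD:
 assumes "m \<in> corM P Q" "P \<in> Pr" "Q \<in> Pr"
 shows "m \<in> \<M>" "Q |> m = m" "m <| P = m"
proof -
 have X: "m = Q |> m <| P" and C: "m \<in> \<M>" using assms(1) by (simp_all add: corM_def)
 show "m \<in> \<M>" by (rule C)
 show "Q |> m = m" by (subst (1 2) X) (simp add: lm_simps PrD[OF assms(3)])
 show "m <| P = m" by (subst (1 2) X) (simp add: lm_simps PrD[OF assms(2)])
qed

lemma corMI: "m \<in> \<M> ==> Q |> m = m ==> m <| P = m ==> m \<in> corM P Q" by (simp add: corM_def)

lemma corM_mult: "m \<in> \<M> ==> P \<in> Pr ==> Q \<in> Pr ==> Q |> m <| P \<in> corM P Q" by (rule corMI) (simp_all add: M_mult PrD lm_simps)

lemma corM_J: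
 assumes "P \<in> Pr" "Q \<in> Pr" "m \<in> corM P Q" shows "J_op m \<in> corM Q P"
proof (rule corMI)
 show "P |> J_op m = J_op m" using arg_cong[OF corMD(3)[OF assms(3,1,2)], of J_op] by (simp add: J_mult PrD[OF assms(1)])
 show "J_op m <| Q = J_op m" using arg_cong[OF corMD(2)[OF assms(3,1,2)], of J_op] by (simp add: J_mult PrD[OF assms(2)])
qed (use assms corMD M_J in blast)

lemma subspace_cor: "P \<in> Pr ==> Q \<in> Pr ==> subspace (cor P Q)" by (auto simp: subspace_def cor_def mm C_closed)

lemma subspace_corM: "P \<in> Pr ==> Q \<in> Pr ==> subspace (corM P Q)"
 by (auto simp: subspace_def corM_def lm_distribs lm_scale lm_simps M_closed M_scaleR)

lemma corM_ps: "m \<in> corM P Q ==> c \<cdot> m \<in> corM P Q" by (auto simp: corM_def lm_scale M_closed)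

lemma cor_cs: "X \<in> cor P Q ==> c \<odot> X \<in> cor P Q" by (auto simp: cor_def mm C_closed)

lemma dim_cor:
 assumes P: "P \<in> Pr" and Q: "Q \<in> Pr"
 shows "real (dim (cor P Q)) = avg (%g. 2 * Re (ch Q g * cnj (ch P g)))"
proof -
 have "cor P Q = {X. Q ** X ** P = X \<and> (\<forall>g. R g ** X ** R (gi g) = X)}"
 proof -
  have "X ** R g = R g ** X \<longleftrightarrow> R g ** X ** R (gi g) = X" for X g by (metis mm_assoc mult_id reg_inverse)
  thus ?thesis by (auto simp: cor_def commutant_def)
 qed
 also have "real (dim ...) = avg (%g. \<Sum>b\<in>Basis. (R g ** (Q ** b ** P) ** R (gi g)) \<bullet> b)"
 proof (rule dim_invariants)
  show "linear (%X. R g ** X ** R (gi g))" "linear (%X. Q ** X ** P)" for g by (auto intro!: linearI simp: mm)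
  show "R (gm g h) ** X ** R (gi (gm g h)) = R g ** (R h ** X ** R (gi h)) ** R (gi g)" for g h X by (simp add: reg_gm gi_gm assoc_r)
  show "R ge ** X ** R (gi ge) = X" for X by (simp add: reg_ge)
  show "(R g ** X ** R (gi g)) \<bullet> Y = X \<bullet> (R (gi g) ** Y ** R (gi (gi g)))" for g X Y by (simp add: inner_sandwich adj_reg)
  show "Q ** (Q ** X ** P) ** P = Q ** X ** P" for X by (simp add: PrD[OF Q] PrD[OF P] assoc_r)
  show "(Q ** X ** P) \<bullet> Y = X \<bullet> (Q ** Y ** P)" for X Y by (simp add: inner_sandwich PrD[OF Q] PrD[OF P])
  show "R g ** (Q ** X ** P) ** R (gi g) = Q ** (R g ** X ** R (gi g)) ** P" for g X
   by (simp add: assoc_r C_left[OF PrD(1)[OF Q]] CD[OF PrD(1)[OF P]])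
 qed
 also have "... = avg (%g. 2 * Re (ch Q g * cnj (ch P g)))"
 proof -
  have "(\<Sum>b\<in>Basis. (R g ** (Q ** b ** P) ** R (gi g)) \<bullet> b) = 2 * Re (ch Q g * cnj (ch P g))" for g
  proof -
   have 1: "trace (R g ** Q) = ch Q g" by (simp add: ch_def trace_mul_sym[of "R g" Q])
   have 2: "trace (P ** R (gi g)) = cnj (ch P g)" using trace_adj[of "P ** R g"] trace_mul_sym[of P "R (gi g)"]
    by (simp add: ch_def adj_mult adj_reg PrD[OF P])
   have "(\<Sum>b\<in>Basis. (R g ** (Q ** b ** P) ** R (gi g)) \<bullet> b)
     = (\<Sum>b\<in>Basis. ((R g ** Q) ** b ** (P ** R (gi g))) \<bullet> b)" by (simp add: assoc_r)
   thus ?thesis by (simp only: trace_conjugation 1 2)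
  qed
  thus ?thesis by simp
 qed
 finally show ?thesis .
qed

text \<open>The action of the group on pairs whose invariants are the equivariant ones.\<close>

definition gact :: "'g => 'g pair => 'g pair" where
 "gact g m = (R g ** (\<gamma> g $ 1 $ 1 \<odot> fst m + \<gamma> g $ 1 $ 2 \<odot> snd m) ** R (gi g),
   R g ** (\<gamma> g $ 2 $ 1 \<odot> fst m + \<gamma> g $ 2 $ 2 \<odot> snd m) ** R (gi g))"

lemma gact_fixed_iff: "m \<in> \<M> \<longleftrightarrow> (\<forall>g. gact g m = m)"
proof -
 have "X ** R (gi g) = Y \<longleftrightarrow> X = Y ** R g" for X Y :: "'g End" and g by (auto simp: assoc_r reg_inverse)
 thus ?thesis unfolding M_iff gact_def prod_eq_iff by simp
qed

lemma \<gamma>_gm_entries: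
 "\<gamma> (gm g h) $ i $ j = \<gamma> g $ i $ 1 * \<gamma> h $ 1 $ j + \<gamma> g $ i $ 2 * \<gamma> h $ 2 $ j"
 by (simp add: \<gamma>_gm matrix_matrix_mult_def sum_2)

lemma dim_corM:
 assumes P: "P \<in> Pr" and Q: "Q \<in> Pr"
 shows "real (dim (corM P Q)) = avg (%g. 2 * ch2 g * Re (ch Q g * cnj (ch P g)))"
proof -
 have "corM P Q = {m. Q |> m <| P = m \<and> (\<forall>g. gact g m = m)}" by (auto simp: corM_def gact_fixed_iff)
 also have "real (dim ...) = avg (%g. \<Sum>b\<in>Basis. gact g (Q |> b <| P) \<bullet> b)"
 proof (rule dim_invariants)
  show "linear (gact g)" for g by (auto intro!: linearI simp: gact_def mm cs_distribs vec_eq_iff scaleR_conv_of_real[where 'a = complex]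
     algebra_simps)
  show "linear (%m. Q |> m <| P)" by (rule linearI) (simp_all add: lm_distribs lm_scale)
  show "gact (gm g h) m = gact g (gact h m)" for g h m by (simp add: gact_def reg_gm gi_gm \<gamma>_gm_entries mm cs_distribs algebra_simps)
  show "gact ge m = m" for m
  proof -
   have "\<gamma> ge $ 1 $ 1 = 1" "\<gamma> ge $ 1 $ 2 = 0" "\<gamma> ge $ 2 $ 1 = 0" "\<gamma> ge $ 2 $ 2 = 1" by (simp_all add: \<gamma>_ge mat_def)
   thus ?thesis by (simp add: gact_def reg_ge)
  qed
  show "gact g m \<bullet> n = m \<bullet> gact (gi g) n" for g m n by (simp add: gact_def inner_prod_def inner_sandwich adj_reg)
     (simp add: \<gamma>_gi inner_cs mm inner_add_left inner_add_right)
  show "Q |> (Q |> m <| P) <| P = Q |> m <| P" for m by (simp add: lm_simps PrD[OF Q] PrD[OF P])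
  show "(Q |> m <| P) \<bullet> n = m \<bullet> (Q |> n <| P)" for m n by (simp add: inner_lm' inner_rm' PrD[OF Q] PrD[OF P] lm_simps)
  show "gact g (Q |> m <| P) = Q |> (gact g m) <| P" for g m
  proof -
   have "R g ** (Q ** X ** P) ** R (gi g) = Q ** (R g ** X ** R (gi g)) ** P" for X by (simp add: assoc_r C_left[OF PrD(1)[OF Q]] CD[OF PrD(1)[OF P]])
   from this[of "\<gamma> g $ 1 $ 1 \<odot> fst m + \<gamma> g $ 1 $ 2 \<odot> snd m"]
    this[of "\<gamma> g $ 2 $ 1 \<odot> fst m + \<gamma> g $ 2 $ 2 \<odot> snd m"]
   show ?thesis by (simp add: gact_def prod_eq_iff mm)
  qed
 qed
 also have "... = avg (%g. 2 * ch2 g * Re (ch Q g * cnj (ch P g)))"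
 proof -
  have "(\<Sum>b\<in>Basis. gact g (Q |> b <| P) \<bullet> b) = 2 * ch2 g * Re (ch Q g * cnj (ch P g))" for g
  proof -
   have 1: "trace (R g ** Q) = ch Q g" by (simp add: ch_def trace_mul_sym[of "R g" Q])
   have 2: "trace (P ** R (gi g)) = cnj (ch P g)" using trace_adj[of "P ** R g"] trace_mul_sym[of P "R (gi g)"]
    by (simp add: ch_def adj_mult adj_reg PrD[OF P])
   have t: "(\<Sum>b\<in>Basis. (R g ** (c \<odot> (Q ** b ** P)) ** R (gi g)) \<bullet> b) = 2 * Re (c * (ch Q g * cnj (ch P g)))" for c
   proof -
    have "(\<Sum>b\<in>Basis. (R g ** (c \<odot> (Q ** b ** P)) ** R (gi g)) \<bullet> b)
      = (\<Sum>b\<in>Basis. ((c \<odot> (R g ** Q)) ** b ** (P ** R (gi g))) \<bullet> b)" by (simp add: mm)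
    thus ?thesis by (simp only: trace_conjugation trace_cs 1 2 mult.assoc)
   qed
   have "(\<Sum>b\<in>Basis. gact g (Q |> b <| P) \<bullet> b) =
     (\<Sum>b\<in>Basis. (R g ** (\<gamma> g $ 1 $ 1 \<odot> (Q ** b ** P)) ** R (gi g)) \<bullet> b) +
     (\<Sum>b\<in>Basis. (R g ** (\<gamma> g $ 2 $ 2 \<odot> (Q ** b ** P)) ** R (gi g)) \<bullet> b)"
    unfolding sum_Basis_pair gact_def by (simp add: inner_prod_def assoc_r)
   also have "... = 2 * ch2 g * Re (ch Q g * cnj (ch P g))" unfolding t \<gamma>_entries ch2_def by (simp add: algebra_simps)
   finally show ?thesis .
  qed
  thus ?thesis by simp
 qed
 finally show ?thesis .
qed

lemma N_eq:
 assumes "P \<in> Pr" "Q \<in> Pr"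
 shows "N P Q = avg (%g. (2 - ch2 g) * Re (ch Q g * cnj (ch P g)))"
proof -
 have "N P Q = avg (%g. 2 * Re (ch Q g * cnj (ch P g))) - avg (%g. 2 * ch2 g * Re (ch Q g * cnj (ch P g))) / 2"
  unfolding N_def dim_cor[OF assms] dim_corM[OF assms] ..
 also have "... = avg (%g. (2 - ch2 g) * Re (ch Q g * cnj (ch P g)))" unfolding avg_def
  by (simp add: sum_distrib_left sum_divide_distrib sum_subtractf[symmetric] del: times_complex.sel complex_cnj)
    (simp only: left_diff_distrib diff_divide_distrib)
 finally show ?thesis .
qed

end

lemma dim_product:
 fixes S :: "'a::euclidean_space set" and T :: "'b::euclidean_space set"
 assumes "subspace S" "subspace T"
 shows "dim (S \<times> T) = dim S + dim T"
proof -
 have sub: "subspace (S \<times> T)" using assms by (auto simp: subspace_def zero_prod_def)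
 have "{x \<in> S \<times> T. fst x = 0} = Pair 0 ` T" using subspace_0[OF assms(1)] by auto
 moreover have "dim (Pair (0::'a) ` T) = dim T" by (rule dim_image_eq) (auto intro!: linearI simp: inj_on_def)
 moreover have "fst ` (S \<times> T) = S" using subspace_0[OF assms(2)] by force
 ultimately show ?thesis using dim_kernel_image[OF linear_fst sub] by simp
qed

context mckay
begin

section \<open>The quadratic form of the commutant\<close>

lemma \<gamma>_norm: "(cmod (\<gamma> g $ 1 $ 1))\<^sup>2 + (cmod (\<gamma> g $ 1 $ 2))\<^sup>2 = 1" unfolding cmod_power2
 using arg_cong[OF \<gamma>_det[of g], of Re] by (simp add: \<gamma>_entries flip: power2_eq_square)

lemma ch2_le: "ch2 g \<le> 2" and ch2_eq: "ch2 g = 2 ==> g = ge"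
proof -
 have le: "cmod (\<gamma> g $ 1 $ 1) \<le> 1"
 proof (rule power2_le_imp_le)
  show "(cmod (\<gamma> g $ 1 $ 1))\<^sup>2 \<le> 1\<^sup>2"
   using \<gamma>_norm[of g] zero_le_power2[of "cmod (\<gamma> g $ 1 $ 2)"] unfolding power_one by linarith
 qed simp
 thus "ch2 g \<le> 2" using complex_Re_le_cmod[of "\<gamma> g $ 1 $ 1"] by (simp add: ch2_def)
 show "g = ge" if "ch2 g = 2"
 proof -
  have re: "Re (\<gamma> g $ 1 $ 1) = 1" using that by (simp add: ch2_def)
  hence "cmod (\<gamma> g $ 1 $ 1) = 1" using le complex_Re_le_cmod[of "\<gamma> g $ 1 $ 1"] by simp
  hence b: "\<gamma> g $ 1 $ 2 = 0" and "(Re (\<gamma> g $ 1 $ 1))\<^sup>2 + (Im (\<gamma> g $ 1 $ 1))\<^sup>2 = 1"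
   using \<gamma>_norm[of g] by (simp_all add: cmod_def complex_eq_iff)
  hence a: "\<gamma> g $ 1 $ 1 = 1" using re by (simp add: complex_eq_iff)
  have "\<gamma> g = mat 1" using a b \<gamma>_entries[of g] by (simp add: vec_eq_iff forall_2 mat_def)
  thus ?thesis by (metis \<gamma>_ge \<gamma>_eq_iff)
 qed
qed

text \<open>The projection onto the trivial submodule, which is the line of constant vectors.\<close>

definition triv :: "'g End" where "triv = avg R"

lemma triv_nth: "triv $ i $ j = of_real (1 / order)"
proof -
 have "(i = gm g j) = (g = gm i (gi j))" for g by (auto simp: gm_assoc)
 hence "(\<Sum>g\<in>UNIV. R g) $ i $ j = (\<Sum>g\<in>UNIV. if g = gm i (gi j) then 1 else 0)" by (simp add: reg_nth)
 thus ?thesis unfolding triv_def avg_def by (simp add: scaleR_conv_of_real[where 'a = complex])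
qed

lemma trace_triv: "trace triv = 1" by (simp add: trace_def triv_nth order_def)

lemma reg_triv: "R g ** triv = triv" using avg_gm(1)[of R g] by (simp add: triv_def linear_avg[OF linear_mult(1)] reg_gm)

lemma triv_C: "X \<in> \<C> ==> triv ** X = X ** triv" unfolding triv_def avg_def by (simp add: mm mult_sum CD)

lemma triv_Pr: "triv \<in> Pr"
proof -
 have 1: "triv ** triv = triv" "triv\<^sup>H = triv" by (simp_all add: vec_eq_iff matrix_matrix_mult_def triv_nth order_def)
 moreover have "triv ** R g = triv" for g using arg_cong[OF reg_triv[of "gi g"], of conj_transpose] by (simp add: adj_mult adj_reg 1)
 ultimately show ?thesis by (simp add: Pr_def commutant_def reg_triv)
qed

lemma triv_sandwich: obtains s where "triv ** X ** triv = s \<odot> triv"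
proof
 show "triv ** X ** triv = (\<Sum>k\<in>UNIV. \<Sum>l\<in>UNIV. of_real (1 / order) * X $ l $ k) \<odot> triv"
  by (simp add: vec_eq_iff matrix_matrix_mult_def triv_nth sum_distrib_right sum_divide_distrib)
qed

lemma Pr_triv:
 assumes P: "P \<in> Pr"
 obtains "triv ** P = 0" | "triv ** P = triv"
proof -
 obtain s where s: "triv ** P ** triv = s \<odot> triv" by (rule triv_sandwich)
 have c: "triv ** P = P ** triv" by (rule triv_C[OF PrD(1)[OF P]])
 have sJ: "triv ** P = s \<odot> triv" using s by (simp add: c assoc_r PrD(3)[OF triv_Pr])
 have "(s * s) \<odot> triv = (triv ** P) ** (triv ** P)" unfolding sJ by (simp add: mm PrD(3)[OF triv_Pr])
 also have "... = triv ** (P ** (triv ** P))" by (simp only: assoc_r)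
 also have "P ** (triv ** P) = triv ** P" by (simp only: c) (simp add: PrD(4)[OF P])
 also have "triv ** (triv ** P) = triv ** P" by (rule PrD(4)[OF triv_Pr])
 finally have "trace ((s * s) \<odot> triv) = trace (s \<odot> triv)" by (simp add: sJ)
 hence "s * s = s" by (simp add: trace_triv)
 then consider "s = 0" | "s = 1" by auto
 thus ?thesis using sJ that by cases auto
qed

text \<open>If the character of a projection vanishes off the identity, the multiplicity of the trivial
 representation is \<open>trace P / |\<Gamma>|\<close>, and it is at most one.\<close>

lemma free_projection:
 assumes P: "P \<in> Pr" and z: "!!g. g ~= ge ==> ch P g = 0"
 shows "P = 0 \<or> P = mat 1"
proof -
 have "trace (triv ** P) = of_real (1 / order) * (\<Sum>g\<in>UNIV. trace (R g ** P))"
  unfolding triv_def avg_def by (simp add: mm mult_sum trace_sum scaleR_conv_of_real[where 'a = complex])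
 also have "(\<Sum>g\<in>UNIV. trace (R g ** P)) = (\<Sum>g\<in>UNIV. if g = ge then trace P else 0)"
  using z by (intro sum.cong refl) (auto simp: ch_def trace_mul_sym[of "R _"] reg_ge)
 finally have tr: "trace (triv ** P) = of_real (1 / order) * trace P" by simp
 show ?thesis
 proof (cases rule: Pr_triv[OF P])
  case 1
  hence "trace P = 0" using tr order_pos by simp
  thus ?thesis using Pr_norm[OF P] by simp
 next
  case 2
  hence "trace P = of_real order" using tr order_pos by (simp add: trace_triv field_simps)
  hence "trace (mat 1 - P) = 0" by (simp add: trace_sub trace_mat order_def)
  thus ?thesis using Pr_norm[OF Pr_compl[OF P]] by simp
 qed
qed

lemma N_self: "P \<in> Pr ==> N P P = avg (%g. (2 - ch2 g) * (cmod (ch P g))\<^sup>2)"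
proof -
 have "Re (z * cnj z) = (cmod z)\<^sup>2" for z by (simp add: cmod_power2 flip: power2_eq_square)
 thus "P \<in> Pr ==> ?thesis" by (simp only: N_eq)
qed

text \<open>The form is an average of nonnegative terms; they all vanish only if the character vanishes off the
 identity, as for multiples of the regular representation.\<close>

lemma N_pos:
 assumes P: "P \<in> Pr" "P ~= 0" "P ~= mat 1"
 shows "N P P > 0"
proof -
 have nn: "(2 - ch2 g) * (cmod (ch P g))\<^sup>2 \<ge> 0" for g using ch2_le[of g] by simp
 obtain g where g: "g ~= ge" "ch P g ~= 0" using free_projection[OF P(1)] P by blast
 hence "(2 - ch2 g) * (cmod (ch P g))\<^sup>2 > 0" using ch2_le[of g] ch2_eq[of g] by (intro mult_pos_pos) (auto simp: less_le)
 hence "(\<Sum>g\<in>UNIV. (2 - ch2 g) * (cmod (ch P g))\<^sup>2) > 0" using nn by (intro sum_pos2[of _ g]) auto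
 thus ?thesis using order_pos by (simp add: N_self[OF P(1)] avg_def)
qed

lemma N_commute: "P \<in> Pr ==> Q \<in> Pr ==> N P Q = N Q P" by (simp add: N_eq mult.commute)

lemma ch_compl: "ch (mat 1 - P) g = (if g = ge then of_real order else 0) - ch P g" by (simp add: ch_def mm trace_sub trace_reg order_def)

text \<open>The regular representation lies in the kernel of the form.\<close>

lemma N_compl:
 assumes "P \<in> Pr" "Q \<in> Pr"
 shows "N P (mat 1 - Q) = - N P Q"
proof -
 have "(2 - ch2 g) * Re (ch (mat 1 - Q) g * cnj (ch P g)) = - ((2 - ch2 g) * Re (ch Q g * cnj (ch P g)))" for g
 proof (cases "g = ge")
  case True
  hence "ch2 g = 2" by (simp add: ch2_def \<gamma>_ge mat_def)
  thus ?thesis by simp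
 qed (simp add: ch_compl algebra_simps)
 hence "N P (mat 1 - Q) = avg (%g. - ((2 - ch2 g) * Re (ch Q g * cnj (ch P g))))" by (simp only: N_eq[OF assms(1) Pr_compl[OF assms(2)]])
 thus ?thesis by (simp only: N_eq[OF assms] avg_def sum_negf) simp
qed

lemma even_dim_cor:
 assumes P: "P \<in> Pr" shows "even (dim (cor P P))"
proof -
 have s: "(\<i> \<odot> X) \<bullet> X = 0" for X :: "'g End" using inner_cs[of \<i> X X] by (simp add: cs_simps(6) inner_commute)
 have a: "X \<bullet> (\<i> \<odot> Y) = - ((\<i> \<odot> X) \<bullet> Y)" for X Y :: "'g End" by (simp add: inner_cs)
 have "2 dvd dim (cor P P)" by (rule dim_dvd_frame[of 2 "(!) [id, (\<odot>) \<i>]", OF _ _ _ subspace_cor[OF P P]])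
    (simp_all add: numeral_2_eq_2 All_less_Suc Ex_less_Suc cor_cs a s)
 thus ?thesis by simp
qed

lemma N_even:
 assumes P: "P \<in> Pr"
 obtains k :: int where "N P P = 2 * of_int k"
proof -
 have "4 dvd dim (corM P P)" using quaternionic_dim(2)[OF subspace_corM[OF P P]] corM_J[OF P P] by (simp add: I_op_eq corM_ps)
 then obtain a where a: "dim (corM P P) = 4 * a" by (rule dvdE)
 obtain b where "dim (cor P P) = 2 * b" using even_dim_cor[OF P] by (rule evenE)
 hence "N P P = 2 * of_int (int b - int a)" using a by (simp add: N_def)
 thus ?thesis by (rule that)
qed

text \<open>Positivity and evenness leave no smaller value; evenness holds because the equivariant pairs form a
 quaternionic vector space.\<close>

lemma N_eq_2:
 assumes "P \<in> Pr" "P ~= 0" "P ~= mat 1" "N P P \<le> 2"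
 shows "N P P = 2"
proof -
 obtain k :: int where "N P P = 2 * of_int k" using N_even[OF assms(1)] .
 thus ?thesis using N_pos[OF assms(1-3)] assms(4) by simp
qed

section \<open>Homomorphisms and extensions\<close>

text \<open>The difference of the two compositions of \<open>X\<close> with module structures \<open>m\<close> and \<open>n\<close>; it vanishes on
 homomorphisms, and its values are the coboundaries of extensions.\<close>

definition DD :: "'g pair => 'g pair => 'g End => 'g pair" where
 "DD n m X = n <| X - (X |> m)"

lemma linear_DD: "linear (DD n m)" by (rule linearI) (simp_all add: DD_def lm_distribs lm_scale scaleR_diff_right)

lemma DD_cs: "DD n m (c \<odot> X) = c \<cdot> DD n m X" by (simp add: DD_def lm_scale ps_distribs)

lemma inner_J_DD: "v \<bullet> J_op (DD m n Y) = - (Y\<^sup>H \<bullet> (om v m + om n v))"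
proof -
 have "J_op (DD m n Y) = (Y\<^sup>H |> J_op m) - (J_op n <| Y\<^sup>H)" by (simp add: DD_def J_distribs J_mult)
 moreover have "v \<bullet> (Y\<^sup>H |> J_op m) = - (Y\<^sup>H \<bullet> om v m)"
  using inner_lm[of "Y\<^sup>H" "J_op m" v] by (simp add: inner_commute lip_om J_distribs om_distribs)
 moreover have "v \<bullet> (J_op n <| Y\<^sup>H) = Y\<^sup>H \<bullet> om n v"
  using inner_rm[of "J_op n" "Y\<^sup>H" v] by (simp add: inner_commute rip_om J_distribs om_distribs)
 ultimately show ?thesis by (simp add: inner_diff_right inner_add_right)
qed

lemma om_DD: "om (DD n m X) m + om n (DD n m X) = om n n ** X - X ** om m m" by (simp add: DD_def om_distribs om_mult)

lemma DD_cor: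
 assumes "P \<in> Pr" "Q \<in> Pr" "m \<in> corM P P" "n \<in> corM Q Q" "X \<in> cor P Q"
 shows "DD n m X \<in> corM P Q"
proof -
 note m = corMD[OF assms(3,1,1)] and n = corMD[OF assms(4,2,2)] and X = corD[OF assms(5,1,2)]
 have "Q |> (n <| X) = n <| X" using n(2) by (metis lm_simps(3))
 moreover have "X |> m <| P = X |> m" using m(3) by (simp add: lm_simps)
 ultimately show ?thesis unfolding DD_def by (intro corMI) (simp_all add: M_closed M_mult m n X lm_distribs lm_simps)
qed

lemma dim_cor_commute: "P \<in> Pr ==> Q \<in> Pr ==> dim (cor P Q) = dim (cor Q P)"
proof -
 assume P: "P \<in> Pr" and Q: "Q \<in> Pr"
 have "real (dim (cor P Q)) = real (dim (cor Q P))" by (simp add: dim_cor[OF P Q] dim_cor[OF Q P] mult.commute)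
 thus ?thesis by simp
qed

text \<open>Coboundaries in one direction are orthogonal to the rotated coboundaries in the other direction.
 This bounds the Euler form by the dimensions of the two spaces of homomorphisms.\<close>

lemma euler_inequality:
 assumes P: "P \<in> Pr" and Q: "Q \<in> Pr" and m: "m \<in> corM P P" and n: "n \<in> corM Q Q"
  and central: "!!X. X \<in> cor P Q ==> om n n ** X = X ** om m m"
 shows "2 * N P Q \<le> real (dim {X \<in> cor P Q. DD n m X = 0}) + real (dim {Y \<in> cor Q P. DD m n Y = 0})"
proof -
 let ?A = "DD n m ` cor P Q" and ?B = "DD m n ` cor Q P"
 have lJ: "linear (J_op :: 'g pair => 'g pair)" by (rule structures_linear)
 have "dim ?A + dim (J_op ` ?B) \<le> dim (corM P Q)"
 proof (rule dim_orthogonal_subspaces_le)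
  show "subspace ?A" by (intro linear_subspace_image linear_DD subspace_cor P Q)
  show "subspace (corM P Q)" by (intro subspace_corM P Q)
  show "?A \<subseteq> corM P Q" using DD_cor[OF P Q m n] by blast
  show "J_op ` ?B \<subseteq> corM P Q" using DD_cor[OF Q P n m] corM_J[OF Q P] by blast
  show "a \<bullet> b = 0" if "a \<in> ?A" "b \<in> J_op ` ?B" for a b using that central by (auto simp: inner_J_DD om_DD)
 qed
 moreover have "dim (J_op ` ?B) = dim ?B" by (intro dim_image_eq lJ inj_onI) (metis J_distribs(5) neg_equal_iff_equal)
 moreover have "dim {X \<in> cor P Q. DD n m X = 0} + dim ?A = dim (cor P Q)" by (intro dim_kernel_image linear_DD subspace_cor P Q)
 moreover have "dim {Y \<in> cor Q P. DD m n Y = 0} + dim ?B = dim (cor Q P)" by (intro dim_kernel_image linear_DD subspace_cor P Q)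
 ultimately show ?thesis using dim_cor_commute[OF P Q] by (simp add: N_def)
qed

text \<open>The Euler form of a module with itself is at most twice the complex dimension of its endomorphisms.\<close>

lemma brick_N_le:
 assumes P: "P \<in> Pr" and m: "m \<in> corM P P"
  and central: "!!X. X \<in> cor P P ==> om m m ** X = X ** om m m"
  and brick: "!!X. X \<in> cor P P ==> DD m m X = 0 ==> \<exists>c. X = c \<odot> P"
 shows "N P P \<le> 2"
proof -
 have "dim {X \<in> cor P P. DD m m X = 0} \<le> 2" by (rule dim_complex_line[of _ P]) (use brick in blast)
 thus ?thesis using euler_inequality[OF P P m m central] by simp
qed

end

section \<open>Projections onto invariant subspaces\<close>

lemma vec_scaleR_eq: "r *\<^sub>R v = complex_of_real r *s v" by (simp add: vec_eq_iff scaleR_conv_of_real[where 'a = complex])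

lemma vec_subspace_real: "vec.subspace W ==> subspace W" for W :: "(complex^'n) set" by (simp add: vec.subspace_def subspace_def vec_scaleR_eq)

lemma inner_matrix_vector: "(A *v v) \<bullet> w = v \<bullet> (A\<^sup>H *v w)" for A :: "'n::finite End"
proof -
 have e: "x \<bullet> y = Re (\<Sum>i\<in>UNIV. x $ i * cnj (y $ i))" for x y :: "complex^'n" by (simp add: inner_vec_def inner_complex_def)
 have "(\<Sum>i\<in>UNIV. (A *v v) $ i * cnj (w $ i)) = (\<Sum>i\<in>UNIV. \<Sum>j\<in>UNIV. A $ i $ j * v $ j * cnj (w $ i))"
  by (simp add: matrix_vector_mult_def sum_distrib_right)
 also have "... = (\<Sum>j\<in>UNIV. \<Sum>i\<in>UNIV. A $ i $ j * v $ j * cnj (w $ i))" by (rule sum.swap)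
 also have "... = (\<Sum>j\<in>UNIV. v $ j * cnj ((A\<^sup>H *v w) $ j))" by (simp add: matrix_vector_mult_def sum_distrib_left mult_ac)
 finally show ?thesis by (simp only: e)
qed

lemma cs_vec: "(c \<odot> A) *v v = c *s (A *v v)" by (simp add: vec_eq_iff matrix_vector_mult_def sum_distrib_left mult_ac)

lemma inner_vec_cs: "(c *s v) \<bullet> w = v \<bullet> (cnj c *s w)" for v w :: "complex^'n"
 by (simp add: inner_vec_def inner_complex_def algebra_simps)

lemma matrix_eqI: "(!!v. A *v v = B *v v) ==> A = B" for A B :: "'n::finite End" by (simp add: matrix_eq)

lemma projection_exists:
 fixes W :: "(complex^'n::finite) set"
 assumes W: "vec.subspace W"
 obtains P :: "'n End" where "P\<^sup>H = P" "P ** P = P" "!!v. P *v v \<in> W" "!!v. v \<in> W ==> P *v v = v"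
  "!!v w. w \<in> W ==> (v - P *v v) \<bullet> w = 0"
proof -
 have WR: "subspace W" using W by (rule vec_subspace_real)
 have "\<exists>y. y \<in> W \<and> (\<forall>w\<in>W. (x - y) \<bullet> w = 0)" for x
 proof -
  obtain y z where "y \<in> span W" "!!w. w \<in> span W ==> orthogonal z w" "x = y + z" by (rule orthogonal_subspace_decomp_exists[of W x]) blast
  thus ?thesis unfolding span_eq_iff[THEN iffD2, OF WR] by (intro exI[of _ y]) (auto simp: orthogonal_def)
 qed
 then obtain p where p: "!!x. p x \<in> W" "!!x w. w \<in> W ==> (x - p x) \<bullet> w = 0" by metis
 have uniq: "y = p x" if "y \<in> W" "!!w. w \<in> W ==> (x - y) \<bullet> w = 0" for x y
 proof -
  have "y - p x \<in> W" using that(1) p(1) WR by (simp add: subspace_diff)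
  hence "(y - p x) \<bullet> (y - p x) = 0" using p(2)[of "y - p x" x] that(2)[of "y - p x"] by (simp add: inner_diff_left)
  thus ?thesis by simp
 qed
 have "Vector_Spaces.linear (*s) (*s) p"
 proof (unfold Vector_Spaces.linear_iff, intro conjI allI vec.vector_space_axioms)
  show "p (x + y) = p x + p y" for x y
  proof (rule uniq[symmetric])
   show "p x + p y \<in> W" by (rule vec.subspace_add[OF W p(1) p(1)])
   show "(x + y - (p x + p y)) \<bullet> w = 0" if "w \<in> W" for w
    using p(2)[OF that, of x] p(2)[OF that, of y] by (simp add: inner_diff_left inner_add_left)
  qed
  show "p (c *s x) = c *s p x" for c x
  proof (rule uniq[symmetric])
   show "c *s p x \<in> W" by (rule vec.subspace_scale[OF W p(1)])
   show "(c *s x - c *s p x) \<bullet> w = 0" if "w \<in> W" for w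
   proof -
    have "cnj c *s w \<in> W" by (rule vec.subspace_scale[OF W that])
    moreover have "c *s x - c *s p x = c *s (x - p x)" by (simp add: vec_eq_iff algebra_simps)
    ultimately show ?thesis by (simp only: inner_vec_cs p(2))
   qed
  qed
 qed
 hence P: "matrix p *v v = p v" for v by (rule matrix_works)
 have pW: "p v = v" if "v \<in> W" for v using uniq[of v v] that by simp
 show ?thesis
 proof
  show "matrix p ** matrix p = matrix p" by (rule matrix_eqI) (simp add: P pW p flip: mv_assoc)
  show "(matrix p)\<^sup>H = matrix p"
  proof (rule matrix_eqI)
   fix v
   have "((matrix p)\<^sup>H *v v) \<bullet> w = (matrix p *v v) \<bullet> w" for w
   proof -
    have "((matrix p)\<^sup>H *v v) \<bullet> w = v \<bullet> p w" using inner_matrix_vector[of "matrix p" w v] by (simp add: P inner_commute)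
    also have "... = p v \<bullet> p w" using p(2)[OF p(1)[of w], of v] by (simp add: inner_diff_left)
    also have "... = p v \<bullet> w" using p(2)[OF p(1)[of v], of w] by (simp add: inner_diff_left inner_diff_right inner_commute)
    finally show ?thesis by (simp add: P)
   qed
   thus "(matrix p)\<^sup>H *v v = matrix p *v v" using vector_eq_rdot by blast
  qed
 qed (use P p pW in auto)
qed

section \<open>Eigenvectors\<close>

lemma norm_vec_cs: "norm (c *s v) = cmod c * norm v" for v :: "complex^'n" by (simp add: norm_vec_def norm_mult L2_set_right_distrib)

text \<open>If \<open>A - c\<close> were injective on the invariant subspace \<open>V\<close> for all \<open>c\<close>, the resolvent applied to a
 nonzero vector of \<open>V\<close> would be an entire function vanishing at infinity.\<close>

lemma eigenvector_exists:
 fixes A :: "'n::finite End"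
 assumes V: "vec.subspace V" and V0: "V ~= {0}" and AV: "!!v. v \<in> V ==> A *v v \<in> V"
 obtains c v where "v \<in> V" "v ~= 0" "A *v v = c *s v"
proof (rule ccontr)
 assume "\<not> thesis"
 note eigen = that
 have no: "A *v v ~= c *s v" if "v \<in> V" "v ~= 0" for c v using eigen that \<open>\<not> thesis\<close> by blast
 obtain P :: "'n End" where PH: "P\<^sup>H = P" and P: "P ** P = P" "!!v. P *v v \<in> V" "!!v. v \<in> V ==> P *v v = v"
  and Porth: "!!v w. w \<in> V ==> (v - P *v v) \<bullet> w = 0" by (rule projection_exists[OF V]) blast
 obtain w where w: "w \<in> V" "w ~= 0" using V0 vec.subspace_0[OF V] by auto
 define G where "G c = A ** P - c \<odot> P + (mat 1 - P)" for c
 have Gv: "G c *v v = (A *v (P *v v) - c *s (P *v v)) + (v - P *v v)" for c v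
  by (simp add: G_def matrix_vector_mult_add_rdistrib mv_diff cs_vec mv_assoc)
 have PG: "P *v (G c *v v) = A *v (P *v v) - c *s (P *v v)" for c v
 proof -
  have "A *v (P *v v) - c *s (P *v v) \<in> V" by (intro vec.subspace_diff V AV vec.subspace_scale P)
  hence "P *v (A *v (P *v v) - c *s (P *v v)) = A *v (P *v v) - c *s (P *v v)" by (rule P(3))
  moreover have "P *v (v - P *v v) = 0" by (simp add: matrix_vector_mult_diff_distrib mv_assoc P(1))
  ultimately show ?thesis unfolding Gv by (simp add: mv_add_right)
 qed
 have inj: "v = 0" if "G c *v v = 0" for c v
 proof -
  have "A *v (P *v v) = c *s (P *v v)" using PG[of c v] that by simp
  hence "P *v v = 0" using no P(2) by blast
  thus ?thesis using that Gv[of c v] by simp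
 qed
 hence det: "det (G c) ~= 0" for c by (metis invertible_det_nz invertible_left_inverse matrix_left_invertible_ker)
 define f where "f c = (\<chi> k. det (\<chi> i j. if j = k then w $ i else G c $ i $ j) / det (G c))" for c
 have Gf: "G c *v f c = w" for c using cramer[OF det[of c], of "f c" w] by (simp add: f_def)
 have "f c $ k = 0" for c k
 proof (rule Liouville_weak[where f = "%c. f c $ k"])
  have Gh: "(%c. G c $ i $ j) holomorphic_on UNIV" for i j unfolding G_def by (simp add: holomorphic_intros)
  have "(%c. det (G c)) holomorphic_on UNIV" unfolding det_def by (intro holomorphic_intros Gh)
  moreover have "(%c. det (\<chi> i j. if j = k then w $ i else G c $ i $ j)) holomorphic_on UNIV"
  proof -
   have "(%c. if j = k then w $ i else G c $ i $ j) holomorphic_on UNIV" for i j using Gh by (cases "j = k") auto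
   thus ?thesis unfolding det_def by (simp add: holomorphic_on_sum holomorphic_on_mult holomorphic_on_prod)
  qed
  ultimately show "(%c. f c $ k) holomorphic_on UNIV" unfolding f_def by (simp add: holomorphic_on_divide det)
  obtain K where K: "!!v. norm (A *v v) \<le> K * norm v"
   using linear_bounded[of "%v. A *v v"] by (metis bounded_linear.linear matrix_vector_mul_bounded_linear)
  have bound: "norm (f c $ k) \<le> norm w / (cmod c - K)" if "cmod c > K" for c
  proof -
   have "A *v (P *v f c) - c *s (P *v f c) = w" using PG[of c "f c"] Gf P(3)[OF w(1)] by simp
   moreover from this have "f c = P *v f c" using Gv[of c "f c"] Gf[of c] by simp
   ultimately have "c *s f c = A *v f c - w" by (simp add: algebra_simps)
   hence "cmod c * norm (f c) = norm (A *v f c - w)" by (simp flip: norm_vec_cs)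
   also have "... \<le> K * norm (f c) + norm w" using K[of "f c"] norm_triangle_ineq4[of "A *v f c" w] by linarith
   finally have "(cmod c - K) * norm (f c) \<le> norm w" by (simp add: algebra_simps)
   hence "norm (f c) \<le> norm w / (cmod c - K)" using that by (simp add: field_simps)
   thus ?thesis using Finite_Cartesian_Product.norm_nth_le[of "f c" k] by linarith
  qed
  have "((%c. norm w / (cmod c - K)) \<longlongrightarrow> 0) at_infinity" by (rule tendsto_divide_0[OF tendsto_const])
     (auto intro!: filterlim_at_top_imp_at_infinity filterlim_tendsto_add_at_top[of "%_. - K" "- K", simplified add.commute[of _ "cmod _"], simplified]
      filterlim_norm_at_top)
  moreover have "eventually (%c. cmod c > K) at_infinity" by (auto simp: eventually_at_infinity intro: exI[of _ "K + 1"])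
  hence "eventually (%c. norm (f c $ k) \<le> norm w / (cmod c - K)) at_infinity" by eventually_elim (rule bound)
  ultimately show "((%c. f c $ k) \<longlongrightarrow> 0) at_infinity" by (rule Lim_null_comparison[rotated])
 qed
 hence "f 0 = 0" by (simp add: vec_eq_iff)
 thus False using Gf[of 0] w by simp
qed

section \<open>Submodules and projections\<close>

context mckay
begin

definition inv_sub :: "(complex^'g) set => bool" where
 "inv_sub W \<longleftrightarrow> vec.subspace W \<and> (\<forall>g. \<forall>w\<in>W. R g *v w \<in> W)"

lemma Pr_exists:
 assumes "inv_sub W"
 obtains P where "P \<in> Pr" "!!v. P *v v = v \<longleftrightarrow> v \<in> W"
proof -
 have W: "vec.subspace W" "!!g w. w \<in> W ==> R g *v w \<in> W" using assms by (auto simp: inv_sub_def)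
 obtain P :: "'g End" where P: "P\<^sup>H = P" "P ** P = P" "!!v. P *v v \<in> W" "!!v. v \<in> W ==> P *v v = v"
  "!!v w. w \<in> W ==> (v - P *v v) \<bullet> w = 0" by (rule projection_exists[OF W(1)]) blast
 have l: "P ** (R g ** P) = R g ** P" for g by (rule matrix_eqI) (simp add: P W flip: mv_assoc)
 have "R g ** P = P ** R g" for g
 proof -
  have "(P ** (R (gi g) ** P))\<^sup>H = (R (gi g) ** P)\<^sup>H" by (simp only: l)
  hence "P ** (R g ** P) = P ** R g" by (simp add: adj_mult adj_reg P assoc_r)
  thus ?thesis using l[of g] by simp
 qed
 hence "P \<in> Pr" using P by (simp add: Pr_def commutant_def)
 moreover have "P *v v = v \<longleftrightarrow> v \<in> W" for v using P(3)[of v] P(4) by metis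
 ultimately show ?thesis by (rule that)
qed

lemma Pr_fix: "P \<in> Pr ==> P *v (P *v v) = P *v v" by (simp add: mv_assoc PrD)

lemma Pr_le_iff:
 assumes "F \<in> Pr" shows "P ** F = F \<longleftrightarrow> (\<forall>v. F *v v = v --> P *v v = v)"
proof
 show "\<forall>v. F *v v = v --> P *v v = v" if "P ** F = F" using that by (metis mv_assoc)
 show "P ** F = F" if "\<forall>v. F *v v = v --> P *v v = v" by (rule matrix_eqI) (use that Pr_fix[OF assms] in \<open>simp flip: mv_assoc\<close>)
qed

lemma Pr_le_adj: "P \<in> Pr ==> F \<in> Pr ==> P ** F = F \<longleftrightarrow> F ** P = F" by (metis PrD(2) adj_mult)

lemma Pr_eqI:
 assumes "F \<in> Pr" "P \<in> Pr" "!!v. F *v v = v \<longleftrightarrow> P *v v = v" shows "F = P"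
proof -
 have "P ** F = F" "F ** P = P" using Pr_le_iff assms by blast+
 thus ?thesis using Pr_le_adj assms by metis
qed

lemma Pr_eq_0: "P \<in> Pr ==> (!!v. P *v v = v ==> v = 0) ==> P = 0" by (rule matrix_eqI) (metis Pr_fix matrix_vector_mult_0)

lemma C_vec: "X \<in> \<C> ==> X *v (R g *v v) = R g *v (X *v v)" by (simp add: mv_assoc CD)

lemma inv_sub_ker:
 assumes "P \<in> \<C>" "X \<in> \<C>" shows "inv_sub {v. P *v v = v \<and> X *v v = 0}" unfolding inv_sub_def vec.subspace_def
 using assms by (auto simp: mv_add_right vector_scalar_commute C_vec)

lemma inv_sub_image:
 assumes "X \<in> \<C>" shows "inv_sub (range ((*v) X))"
proof -
 have "vec.subspace (range ((*v) X))" unfolding vec.subspace_def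
  by (auto simp: image_iff) (metis matrix_vector_mult_0_right, metis mv_add_right, metis vector_scalar_commute)
 thus ?thesis using assms by (auto simp: inv_sub_def simp flip: C_vec)
qed

lemma inverse_C:
 assumes A: "A \<in> \<C>" and inj: "!!v. A *v v = 0 ==> v = 0"
 obtains B where "B \<in> \<C>" "B ** A = mat 1" "A ** B = mat 1"
proof -
 obtain B where B: "B ** A = mat 1" using inj matrix_left_invertible_ker by blast
 hence B': "A ** B = mat 1" using matrix_left_right_inverse by blast
 have "B ** R g = R g ** B" for g
 proof -
  have "B ** R g = B ** (R g ** A) ** B" by (simp add: assoc_r B')
  also have "... = B ** A ** R g ** B" by (simp add: assoc_r CD[OF A, symmetric])
  finally show ?thesis by (simp add: B)
 qed
 hence "B \<in> \<C>" by (simp add: commutant_def)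
 thus ?thesis using B B' that by blast
qed

text \<open>The left inverse on \<open>L\<close> is \<open>(X\<^sup>* X)\<^sup>-\<^sup>1 X\<^sup>*\<close>, which is again equivariant.\<close>

lemma left_inverse_C:
 assumes X: "X \<in> \<C>" and L: "L \<in> Pr" and inj: "!!v. L *v v = v ==> X *v v = 0 ==> v = 0"
 obtains Z where "Z \<in> \<C>" "Z ** (X ** L) = L" "L ** Z = Z"
proof -
 define Y where "Y = X ** L"
 define A where "A = Y\<^sup>H ** Y + (mat 1 - L)"
 have YC: "Y \<in> \<C>" unfolding Y_def using X PrD(1)[OF L] by (simp add: C_closed)
 have AC: "A \<in> \<C>" unfolding A_def using YC PrD(1)[OF L] by (simp add: C_closed C_adj)
 have YL: "Y ** L = Y" by (simp add: Y_def assoc_r PrD[OF L])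
 have LY: "L ** Y\<^sup>H = Y\<^sup>H" using arg_cong[OF YL, of conj_transpose] by (simp add: adj_mult PrD[OF L])
 have "v = 0" if "A *v v = 0" for v
 proof -
  have "0 = (A *v v) \<bullet> v" using that by simp
  also have "... = (Y *v v) \<bullet> (Y *v v) + ((mat 1 - L) *v v) \<bullet> ((mat 1 - L) *v v)"
  proof -
   have "(mat 1 - L) = (mat 1 - L)\<^sup>H ** (mat 1 - L)" using PrD(2,3)[OF Pr_compl[OF L]] by simp
   hence "A *v v = Y\<^sup>H *v (Y *v v) + (mat 1 - L)\<^sup>H *v ((mat 1 - L) *v v)" by (simp add: A_def matrix_vector_mult_add_rdistrib mv_assoc)
   thus ?thesis by (simp add: inner_add_left inner_matrix_vector)
  qed
  finally have "(Y *v v) \<bullet> (Y *v v) = 0" "((mat 1 - L) *v v) \<bullet> ((mat 1 - L) *v v) = 0" by (metis add_nonneg_eq_0_iff inner_ge_zero)+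
  hence "Y *v v = 0" "L *v v = v" by (simp_all add: mv_diff)
  thus ?thesis using inj by (simp add: Y_def flip: mv_assoc)
 qed
 then obtain B where B: "B \<in> \<C>" "B ** A = mat 1" using inverse_C[OF AC] by metis
 have AL: "A ** (mat 1 - L) = mat 1 - L"
 proof -
  have "Y ** (mat 1 - L) = 0" by (simp add: mm YL)
  thus ?thesis using PrD(3)[OF Pr_compl[OF L]] by (simp add: A_def matrix_add_rdistrib assoc_r)
 qed
 have "B ** (mat 1 - L) = B ** A ** (mat 1 - L)" by (simp only: assoc_r AL)
 hence BL: "B ** (mat 1 - L) = mat 1 - L" by (simp only: B mult_id)
 have "Y\<^sup>H ** Y = A - (mat 1 - L)" by (simp add: A_def)
 hence BY: "B ** (Y\<^sup>H ** Y) = L" by (simp only: mult_diff(1)[of B A] B BL) simp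
 show ?thesis
 proof
  show "L ** (B ** Y\<^sup>H) \<in> \<C>" using B YC PrD(1)[OF L] by (simp add: C_closed C_adj)
  show "L ** (B ** Y\<^sup>H) ** (X ** L) = L" using BY PrD(3)[OF L] by (simp add: assoc_r Y_def)
  show "L ** (L ** (B ** Y\<^sup>H)) = L ** (B ** Y\<^sup>H)" by (simp add: PrD[OF L])
 qed
qed

lemma ch_iso:
 assumes X: "X \<in> \<C>" and L: "L \<in> Pr" and inj: "!!v. L *v v = v ==> X *v v = 0 ==> v = 0"
  and I: "I \<in> Pr" and img: "!!v. I *v v = v \<longleftrightarrow> v \<in> range ((*v) (X ** L))"
 shows "ch L = ch I"
proof
 fix g
 obtain Z where Z: "Z \<in> \<C>" "Z ** (X ** L) = L" using left_inverse_C[OF X L inj] by metis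
 define Y where "Y = X ** L"
 have YC: "Y \<in> \<C>" unfolding Y_def using X PrD(1)[OF L] by (simp add: C_closed)
 have IY: "I ** Y = Y" by (rule matrix_eqI) (use img in \<open>auto simp: Y_def simp flip: mv_assoc\<close>)
 have YZI: "Y ** Z ** I = I"
 proof (rule matrix_eqI)
  fix v
  have "I *v v \<in> range ((*v) Y)" using img[of "I *v v"] Pr_fix[OF I] by (simp add: Y_def)
  then obtain u where u: "I *v v = Y *v u" by blast
  have "Y ** Z ** Y = Y" using Z(2) by (simp add: Y_def assoc_r PrD[OF L])
  moreover have "(Y ** Z ** I) *v v = (Y ** Z ** Y) *v u" by (simp add: u flip: mv_assoc)
  ultimately show "(Y ** Z ** I) *v v = I *v v" by (simp add: u)
 qed
 have "ch L g = trace (Z ** Y ** R g)" using Z(2) by (simp add: ch_def Y_def)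
 also have "... = trace (Z ** R g ** Y)" by (simp add: assoc_r CD[OF YC])
 also have "... = trace (Y ** (Z ** R g))" by (rule trace_mul_sym)
 also have "... = trace (I ** (Y ** (Z ** R g)))" by (metis IY mm_assoc)
 also have "... = trace (Y ** (Z ** R g) ** I)" by (rule trace_mul_sym)
 also have "... = trace (Y ** Z ** I ** R g)" by (simp add: assoc_r CD[OF PrD(1)[OF I]])
 also have "... = ch I g" by (simp add: YZI ch_def)
 finally show "ch L g = ch I g" .
qed

lemma Pr_diff:
 assumes "P \<in> Pr" "K \<in> Pr" "P ** K = K" shows "P - K \<in> Pr"
proof -
 have "K ** P = K" using assms Pr_le_adj by blast
 thus ?thesis using assms by (simp add: Pr_def C_closed mm)
qed

text \<open>Rank and nullity, for characters.\<close>

lemma ch_ker_image: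
 assumes P: "P \<in> Pr" and X: "X \<in> \<C>"
 obtains K I where "K \<in> Pr" "!!v. K *v v = v \<longleftrightarrow> P *v v = v \<and> X *v v = 0" "P ** K = K"
  "I \<in> Pr" "!!v. I *v v = v \<longleftrightarrow> v \<in> range ((*v) (X ** P))" "!!g. ch P g = ch K g + ch I g"
proof -
 obtain K where K1: "K \<in> Pr" "!!v. K *v v = v \<longleftrightarrow> v \<in> {v. P *v v = v \<and> X *v v = 0}"
  by (rule Pr_exists[OF inv_sub_ker[OF PrD(1)[OF P] X]]) blast
 hence K: "K \<in> Pr" "!!v. K *v v = v \<longleftrightarrow> P *v v = v \<and> X *v v = 0" by simp_all
 obtain I where I: "I \<in> Pr" "!!v. I *v v = v \<longleftrightarrow> v \<in> range ((*v) (X ** P))"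
  by (rule Pr_exists[OF inv_sub_image[OF C_closed(6)[OF X PrD(1)[OF P]]]]) blast
 have PK: "P ** K = K" using Pr_le_iff[OF K(1)] K(2) by blast
 have L: "P - K \<in> Pr" by (rule Pr_diff[OF P K(1) PK])
 have KP: "K ** P = K" using PK Pr_le_adj[OF P K(1)] by blast
 have XK: "X ** K = 0" by (rule matrix_eqI) (use K(2) Pr_fix[OF K(1)] in \<open>simp flip: mv_assoc\<close>)
 have "ch (P - K) = ch I"
 proof (rule ch_iso[OF X L _ I(1)])
  show "v = 0" if v: "(P - K) *v v = v" "X *v v = 0" for v
  proof -
   have "P *v v = P *v ((P - K) *v v)" using v(1) by simp
   also have "... = (P - K) *v v" by (simp add: mv_assoc mult_diff PrD[OF P] PK)
   finally have "P *v v = v" using v(1) by simp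
   hence "K *v v = v" using K(2) v(2) by blast
   thus ?thesis using v(1) \<open>P *v v = v\<close> by (simp add: mv_diff)
  qed
  show "I *v v = v \<longleftrightarrow> v \<in> range ((*v) (X ** (P - K)))" for v by (simp add: I(2) mult_diff XK)
 qed
 moreover have "ch (P - K) g = ch P g - ch K g" for g by (simp add: ch_def mult_diff trace_sub)
 ultimately have "ch P g = ch K g + ch I g" for g by (metis add.commute diff_add_cancel)
 thus ?thesis using that K PK I by blast
qed

section \<open>Central elements\<close>

definition cen :: "'g End set" where
 "cen = {t \<in> \<C>. \<forall>X\<in>\<C>. t ** X = X ** t}"

lemma cenD: "t \<in> cen ==> t \<in> \<C>" "t \<in> cen ==> X \<in> \<C> ==> t ** X = X ** t" by (simp_all add: cen_def)

lemma cen_eq_sum: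
 assumes t: "t \<in> cen"
 shows "t = (\<Sum>g\<in>UNIV. t $ g $ ge \<odot> R g)"
proof -
 define S :: "'g => 'g End" where "S h = (\<chi> i j. if i = gm j h then 1 else 0)" for h
 have SC: "S h \<in> \<C>" for h
 proof -
  have "(S h ** R g) $ i $ j = (R g ** S h) $ i $ j" for g i j
   by (simp add: matrix_matrix_mult_def reg_nth S_def gm_assoc if_distrib[of "%x. _ * x"] cong: if_cong)
  thus ?thesis by (simp add: commutant_def vec_eq_iff)
 qed
 have "t $ i $ j = t $ (gm i h) $ (gm j h)" for i j h
 proof -
  have "(t ** S h) $ (gm i h) $ j = (S h ** t) $ (gm i h) $ j" using cenD(2)[OF t SC] by simp
  moreover have "(t ** S h) $ (gm i h) $ j = t $ (gm i h) $ (gm j h)"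
   by (simp add: matrix_matrix_mult_def S_def if_distrib[of "%x. _ * x"] cong: if_cong)
  moreover have "(gm i h = gm k h) = (k = i)" for k using bij_gm(2)[of h] by (metis bij_pointE)
  hence "(S h ** t) $ (gm i h) $ j = t $ i $ j" by (simp add: matrix_matrix_mult_def S_def if_distrib[of "%x. x * _"] cong: if_cong)
  ultimately show ?thesis by simp
 qed
 hence "t $ i $ j = t $ (gm i (gi j)) $ ge" for i j by (metis group_simps(4))
 moreover have "(\<Sum>g\<in>UNIV. t $ g $ ge \<odot> R g) $ i $ j = t $ (gm i (gi j)) $ ge" for i j
 proof -
  have "(i = gm g j) = (g = gm i (gi j))" for g by (auto simp: gm_assoc)
  thus ?thesis by (simp add: reg_nth if_distrib[of "%x. _ * x"] cong: if_cong)
 qed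
 ultimately show ?thesis by (simp add: vec_eq_iff)
qed

lemma cen_trace:
 assumes "t \<in> cen"
 shows "trace (t ** P) = (\<Sum>g\<in>UNIV. t $ g $ ge * ch P g)"
 by (subst cen_eq_sum[OF assms]) (simp add: mult_sum mm trace_sum ch_def trace_mul_sym[of P])

lemma cen_trace_add:
 assumes "t \<in> cen" "!!g. ch P g = ch K g + ch I g"
 shows "trace (t ** P) = trace (t ** K) + trace (t ** I)" by (simp add: cen_trace[OF assms(1)] assms(2) algebra_simps sum.distrib)

lemma ch_0: "ch 0 g = 0" by (simp add: ch_def)

lemma cen_closed: "s \<in> cen ==> t \<in> cen ==> s + t \<in> cen" "s \<in> cen ==> t \<in> cen ==> s - t \<in> cen"
 "t \<in> cen ==> c \<odot> t \<in> cen" "t \<in> cen ==> r *\<^sub>R t \<in> cen" "0 \<in> cen" by (auto simp: cen_def C_closed mm)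

section \<open>Submodules and stability\<close>

definition subm :: "'g pair => 'g End => bool" where
 "subm m F \<longleftrightarrow> F \<in> Pr \<and> F |> (m <| F) = m <| F"

definition val :: "'g End => 'g End => real" where
 "val t F = Re (trace (t ** F))"

definition stable :: "'g End => 'g End => 'g pair => bool" where
 "stable t P m \<longleftrightarrow> P \<in> Pr \<and> m \<in> corM P P \<and> P ~= 0 \<and> val t P = 0 \<and>
   (\<forall>F. subm m F \<and> P ** F = F \<and> F ~= 0 \<and> F ~= P --> val t F > 0)"

lemma subm_Pr: "subm m F ==> F \<in> Pr" by (simp add: subm_def)

lemma subm_iff:
 assumes F: "F \<in> Pr"
 shows "subm m F \<longleftrightarrow> (\<forall>v. F *v v = v --> F *v (fst m *v v) = fst m *v v \<and> F *v (snd m *v v) = snd m *v v)"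
proof -
 have "F ** (A ** F) = A ** F \<longleftrightarrow> (\<forall>v. F *v v = v --> F *v (A *v v) = A *v v)" for A
 proof
  show "\<forall>v. F *v v = v --> F *v (A *v v) = A *v v" if e: "F ** (A ** F) = A ** F"
  proof (intro allI impI)
   fix v assume v: "F *v v = v"
   have "(F ** (A ** F)) *v v = (A ** F) *v v" by (simp only: e)
   thus "F *v (A *v v) = A *v v" by (simp add: v flip: mv_assoc)
  qed
  show "F ** (A ** F) = A ** F" if "\<forall>v. F *v v = v --> F *v (A *v v) = A *v v"
   by (rule matrix_eqI) (use that Pr_fix[OF F] in \<open>simp flip: mv_assoc\<close>)
 qed
 thus ?thesis using F by (auto simp: subm_def prod_eq_iff)
qed

lemma subm_0_1: "subm m 0" "subm m (mat 1)" by (simp_all add: subm_def Pr_0_1 lm_simps)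

lemma val_0_1: "val t 0 = 0" "val t (mat 1) = Re (trace t)" by (simp_all add: val_def)

lemma val_add: "t \<in> cen ==> (!!g. ch P g = ch K g + ch I g) ==> val t P = val t K + val t I"
 using cen_trace_add[of t P K I] by (simp add: val_def)

lemma cen_0: "0 \<in> cen" by (rule cen_closed)

lemma hom_kernel_image:
 assumes P: "P \<in> Pr" and Q: "Q \<in> Pr" and m: "m \<in> corM P P" and n: "n \<in> corM Q Q"
  and X: "X \<in> cor P Q" and hom: "DD n m X = 0"
 obtains K I where "subm m K" "P ** K = K" "!!v. K *v v = v \<longleftrightarrow> P *v v = v \<and> X *v v = 0"
  "subm n I" "Q ** I = I" "!!v. I *v v = v \<longleftrightarrow> v \<in> range ((*v) X)"
  "!!g. ch P g = ch K g + ch I g"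
proof -
 have XP: "X ** P = X" and QX: "Q ** X = X" using corD[OF X P Q] by simp_all
 obtain K I where K: "K \<in> Pr" "!!v. K *v v = v \<longleftrightarrow> P *v v = v \<and> X *v v = 0" "P ** K = K"
  and I: "I \<in> Pr" "!!v. I *v v = v \<longleftrightarrow> v \<in> range ((*v) (X ** P))"
  and c: "!!g. ch P g = ch K g + ch I g" by (rule ch_ker_image[OF P corD(1)[OF X P Q]]) blast
 have h: "fst n *v (X *v v) = X *v (fst m *v v)" "snd n *v (X *v v) = X *v (snd m *v v)" for v
  using hom by (simp_all add: DD_def prod_eq_iff mv_assoc)
 have mP: "P *v (fst m *v v) = fst m *v v" "P *v (snd m *v v) = snd m *v v" for v using corMD(2)[OF m P P] by (simp_all add: prod_eq_iff mv_assoc)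
 show ?thesis
 proof
  show "subm m K" unfolding subm_iff[OF K(1)] K(2) using mP by (simp flip: h)
  show "subm n I" unfolding subm_iff[OF I(1)] I(2) XP by (auto simp: h)
  show "Q ** I = I" unfolding Pr_le_iff[OF I(1)] I(2) XP by (auto simp: mv_assoc QX)
  show "I *v v = v \<longleftrightarrow> v \<in> range ((*v) X)" for v using I(2)[of v] unfolding XP .
 qed (use K c in blast)+
qed

text \<open>Schur's lemma for stable modules of the same slope.\<close>

lemma stable_hom:
 assumes t: "t \<in> cen" and S: "stable t P m" and T: "stable t Q n"
  and X: "X \<in> cor P Q" and hom: "DD n m X = 0" and X0: "X ~= 0"
 obtains Z where "Z \<in> cor Q P" "Z ** X = P" "X ** Z = Q" "DD m n Z = 0" "ch P = ch Q"
proof -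
 have P: "P \<in> Pr" "m \<in> corM P P" "val t P = 0" and Q: "Q \<in> Pr" "n \<in> corM Q Q" "val t Q = 0" using S T by (simp_all add: stable_def)
 have Xs: "X ** P = X" "Q ** X = X" using corD[OF X P(1) Q(1)] by simp_all
 obtain K I where K: "subm m K" "P ** K = K" "!!v. K *v v = v \<longleftrightarrow> P *v v = v \<and> X *v v = 0"
  and I: "subm n I" "Q ** I = I" "!!v. I *v v = v \<longleftrightarrow> v \<in> range ((*v) X)"
  and c: "!!g. ch P g = ch K g + ch I g" by (rule hom_kernel_image[OF P(1) Q(1) P(2) Q(2) X hom]) blast
 have "X ** P = 0" if "K = P"
 proof (rule matrix_eqI)
  fix v
  show "(X ** P) *v v = 0 *v v" using K(3)[of "P *v v"] Pr_fix[OF P(1)] that by (simp flip: mv_assoc)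
 qed
 hence KP: "K ~= P" using X0 Xs by auto
 have I0: "I ~= 0"
 proof
  assume "I = 0"
  hence "X *v v = 0" for v using I(3)[of "X *v v"] by simp
  thus False using X0 by (metis matrix_eqI matrix_vector_mult_0)
 qed
 have "val t K + val t I = 0" using val_add[OF t c] P(3) by simp
 moreover have "K ~= 0 ==> val t K > 0" using S K KP by (simp add: stable_def)
 moreover have "I ~= Q ==> val t I > 0" using T I I0 by (simp add: stable_def)
 ultimately have "K = 0" "I = Q" using val_0_1(1)[of t] Q(3) by force+
 have inj: "v = 0" if "P *v v = v" "X *v v = 0" for v using K(3)[of v] that \<open>K = 0\<close> by simp
 obtain Z where Z: "Z \<in> \<C>" "Z ** (X ** P) = P" "P ** Z = Z" by (rule left_inverse_C[OF corD(1)[OF X P(1) Q(1)] P(1) inj]) blast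
 have ZX: "Z ** X = P" using Z(2) Xs(1) by simp
 have XZQ: "X ** (Z ** Q) = Q"
 proof (rule matrix_eqI)
  fix v
  have "Q *v v \<in> range ((*v) X)" using I(3)[of "Q *v v"] \<open>I = Q\<close> Pr_fix[OF Q(1)] by simp
  then obtain u where u: "Q *v v = X *v u" by blast
  have "(X ** (Z ** Q)) *v v = (X ** (Z ** X)) *v u" by (simp add: u flip: mv_assoc)
  thus "(X ** (Z ** Q)) *v v = Q *v v" by (simp add: u ZX Xs)
 qed
 have ZQX: "Z ** Q ** X = P" by (simp add: assoc_r Xs ZX)
 have hom': "m <| (Z ** Q) = (Z ** Q) |> n"
 proof -
  have e: "n <| X = X |> m" using hom by (simp add: DD_def)
  have "(Z ** Q) |> n = (Z ** Q) |> (n <| Q)" using corMD(3)[OF Q(2,1,1)] by simp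
  also have "... = (Z ** Q) |> (n <| X) <| (Z ** Q)" by (simp add: lm_simps XZQ)
  also have "... = (Z ** Q ** X) |> m <| (Z ** Q)" by (simp add: e lm_simps)
  also have "... = m <| (Z ** Q)" using corMD(2)[OF P(2,1,1)] by (simp add: ZQX flip: lm_simps(3))
  finally show ?thesis by simp
 qed
 have "ch P = ch Q" using c \<open>K = 0\<close> \<open>I = Q\<close> by (simp add: ch_0 fun_eq_iff)
 thus ?thesis by (intro that[of "Z ** Q"])
    (use Z PrD(1)[OF Q(1)] Q(1) ZQX XZQ hom' in \<open>simp_all add: corI C_closed assoc_r PrD(3)[OF Q(1)] mm_assoc[of P] DD_def\<close>)
qed

lemma DD_self: "m \<in> corM P P ==> P \<in> Pr ==> DD m m P = 0" using corMD[of m P P] by (simp add: DD_def)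

text \<open>An eigenvector turns the endomorphism minus a scalar into one with a kernel, which must vanish.\<close>

lemma stable_brick:
 assumes t: "t \<in> cen" and S: "stable t P m" and X: "X \<in> cor P P" and hom: "DD m m X = 0"
 shows "\<exists>c. X = c \<odot> P"
proof -
 have P: "P \<in> Pr" "m \<in> corM P P" "P ~= 0" using S by (simp_all add: stable_def)
 let ?V = "{v. P *v v = v}"
 have "vec.subspace ?V" by (auto simp: vec.subspace_def mv_add_right vector_scalar_commute)
 moreover have "?V ~= {0}" using Pr_eq_0[OF P(1)] P(3) by blast
 moreover have "X *v v \<in> ?V" if "v \<in> ?V" for v using corD(2)[OF X P(1) P(1)] by (simp add: mv_assoc)
 ultimately obtain c v where "v \<in> ?V" and v0: "v ~= 0" "X *v v = c *s v" by (rule eigenvector_exists) blast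
 hence v: "P *v v = v" "v ~= 0" "X *v v = c *s v" by simp_all
 have X': "X - c \<odot> P \<in> cor P P" using X P(1) by (auto simp: cor_def mm C_closed PrD)
 have "DD m m (X - c \<odot> P) = 0" using hom DD_self[OF P(2,1)] by (simp add: linear_diff[OF linear_DD] DD_cs)
 moreover have "(X - c \<odot> P) *v v = 0" by (simp add: mv_diff cs_vec v)
 moreover have "v = 0" if h: "DD m m (X - c \<odot> P) = 0" "(X - c \<odot> P) *v v = 0" "X - c \<odot> P ~= 0"
 proof -
  obtain Z where "Z ** (X - c \<odot> P) = P" by (rule stable_hom[OF t S S X' h(1,3)]) blast
  hence "P *v v = Z *v ((X - c \<odot> P) *v v)" by (simp add: mv_assoc)
  thus ?thesis using h(2) v(1) by simp
 qed
 ultimately have "X - c \<odot> P = 0" using v(2) by blast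
 thus ?thesis by auto
qed

lemma stable_N:
 assumes t: "t \<in> cen" and S: "stable t P m" and l: "l \<in> cen" and om: "om m m = l ** P" and P1: "P ~= mat 1"
 shows "N P P = 2"
proof -
 have P: "P \<in> Pr" "m \<in> corM P P" "P ~= 0" using S by (simp_all add: stable_def)
 have "N P P \<le> 2"
 proof (rule brick_N_le[OF P(1,2)])
  fix X assume X: "X \<in> cor P P"
  have "om m m ** X = l ** X" by (simp add: om assoc_r corD[OF X P(1) P(1)])
  also have "... = X ** l" using cenD(2)[OF l] corD(1)[OF X P(1,1)] by simp
  also have "... = X ** (P ** l)" by (simp add: corD[OF X P(1) P(1)])
  also have "... = X ** om m m" using cenD(2)[OF l PrD(1)[OF P(1)]] by (simp add: om)
  finally show "om m m ** X = X ** om m m" .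
 qed (rule stable_brick[OF t S])
 thus ?thesis using N_eq_2 P P1 by blast
qed

subsection \<open>Submodule and quotient module\<close>

lemma subm_quot: "subm m P ==> (mat 1 - P) |> m <| (mat 1 - P) = (mat 1 - P) |> m"
proof -
 assume s: "subm m P"
 have "(mat 1 - P) |> (m <| P) = 0" using s by (simp add: subm_def lm_distribs lm_simps)
 thus ?thesis by (simp add: lm_distribs lm_simps)
qed

lemma subm_corM:
 assumes "m \<in> \<M>" "subm m P"
 shows "m <| P \<in> corM P P" "(mat 1 - P) |> m \<in> corM (mat 1 - P) (mat 1 - P)"
proof -
 have P: "P \<in> Pr" using assms by (simp add: subm_def)
 show "m <| P \<in> corM P P" using assms P by (intro corMI) (auto simp: M_mult PrD lm_simps subm_def)
 show "(mat 1 - P) |> m \<in> corM (mat 1 - P) (mat 1 - P)" using assms Pr_compl[OF P]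
  by (intro corMI) (simp_all add: M_mult PrD(1) subm_quot lm_simps PrD(3)[OF Pr_compl[OF P]])
qed

lemma subm_om:
 assumes "subm m P"
 shows "om (m <| P) (m <| P) = om m m ** P" "om ((mat 1 - P) |> m) ((mat 1 - P) |> m) = (mat 1 - P) ** om m m"
proof -
 have "P |> (m <| P) = m <| P" using assms by (simp add: subm_def)
 thus "om (m <| P) (m <| P) = om m m ** P" by (simp only: om_mult(3)) (simp only: om_mult(2))
 have "om ((mat 1 - P) |> m) ((mat 1 - P) |> m) = om ((mat 1 - P) |> m <| (mat 1 - P)) m" by (simp only: om_mult)
 thus "om ((mat 1 - P) |> m) ((mat 1 - P) |> m) = (mat 1 - P) ** om m m" by (simp only: subm_quot[OF assms] om_mult)
qed

lemma subm_trace_om: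
 assumes "subm m P" shows "trace (om m m ** P) = 0" using subm_om(1)[OF assms] trace_om by metis

lemma subm_of_sub:
 assumes "subm (m <| P) F" "P \<in> Pr" "P ** F = F"
 shows "subm m F" using assms by (simp add: subm_def lm_simps)

lemma subm_of_quot:
 assumes P: "subm m P" and F: "subm ((mat 1 - P) |> m) F" and le: "(mat 1 - P) ** F = F"
 shows "subm m (P + F)" "P ** (P + F) = P"
proof -
 have Pp: "P \<in> Pr" and Fp: "F \<in> Pr" using P F by (simp_all add: subm_def)
 have PF: "P ** F = 0" using le by (simp add: mult_diff)
 have FP: "F ** P = 0" using arg_cong[OF PF, of conj_transpose] by (simp add: adj_mult PrD Pp Fp)
 have "P + F \<in> Pr" using Pp Fp by (simp add: Pr_def C_closed matrix_add_ldistrib matrix_add_rdistrib PF FP)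
 moreover have "(P + F) |> (m <| (P + F)) = m <| (P + F)"
 proof -
  have a: "P |> (m <| P) = m <| P" using P by (simp add: subm_def)
  have b: "F |> (m <| P) = 0" using a FP by (metis lm_simps(1,6))
  have "F |> (((mat 1 - P) |> m) <| F) = ((mat 1 - P) |> m) <| F" using F by (simp only: subm_def)
  hence c: "F |> (m <| F) = m <| F - (P |> (m <| F))" by (simp add: lm_distribs lm_simps FP)
  show ?thesis by (simp add: lm_distribs a b c)
 qed
 ultimately show "subm m (P + F)" by (simp add: subm_def)
 show "P ** (P + F) = P" by (simp add: matrix_add_ldistrib PrD[OF Pp] PF)
qed

definition rk :: "'g End => nat" where "rk F = dim {v. F *v v = v}"

lemma rk_less:
 assumes "F \<in> Pr" "G \<in> Pr" "G ** F = F" "F ~= G"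
 shows "rk F < rk G"
proof -
 have sub: "subspace {v. F *v v = v}" for F :: "'g End" by (rule vec_subspace_real) (auto simp: vec.subspace_def mv_add_right vector_scalar_commute)
 have le: "{v. F *v v = v} \<subseteq> {v. G *v v = v}" using Pr_le_iff[OF assms(1)] assms(3) by blast
 have "rk F ~= rk G"
 proof
  assume "rk F = rk G"
  hence "{v. F *v v = v} = {v. G *v v = v}" using subspace_dim_equal[OF sub sub le] by (simp add: rk_def)
  thus False using Pr_eqI[OF assms(1,2)] assms(4) by blast
 qed
 moreover have "rk F \<le> rk G" unfolding rk_def using le by (rule dim_subset)
 ultimately show ?thesis by simp
qed

lemma rk_le: "rk F \<le> DIM(complex^'g)" unfolding rk_def by (rule dim_subset_UNIV)

section \<open>Irreducible submodules\<close>

text \<open>Irreducible submodules are the stable modules with vanishing structure maps and slope, so Schur's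
 lemma is a special case of the one for stable modules.\<close>

definition irr :: "'g End => bool" where "irr P \<longleftrightarrow> stable 0 P 0"

lemma irr_iff: "irr P \<longleftrightarrow> P \<in> Pr \<and> P ~= 0 \<and> (\<forall>F\<in>Pr. P ** F = F --> F = 0 \<or> F = P)"
 by (auto simp: irr_def stable_def val_def subm_def lm_simps corM_def M_closed)

lemma irr_Pr: "irr P ==> P \<in> Pr" by (simp add: irr_iff)

lemma irr_hom:
 assumes "irr P" "irr Q" "X \<in> cor P Q" "X ~= 0"
 obtains Z where "Z \<in> cor Q P" "Z ** X = P" "X ** Z = Q" "ch P = ch Q"
proof -
 have "DD 0 0 X = 0" by (simp add: DD_def lm_simps)
 from stable_hom[OF cen_0 assms(1,2)[unfolded irr_def] assms(3) this assms(4)] show ?thesis using that by blast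
qed

definition ip :: "'g End => 'g End => real" where
 "ip P Q = avg (%g. Re (ch Q g * cnj (ch P g)))"

lemma dim_cor_ip: "P \<in> Pr ==> Q \<in> Pr ==> real (dim (cor P Q)) = 2 * ip P Q"
 unfolding dim_cor ip_def avg_def by (simp only: sum_distrib_left[symmetric]) simp

lemma irr_ip_self:
 assumes "irr P" shows "ip P P = 1"
proof -
 have P: "P \<in> Pr" "P ~= 0" using assms by (simp_all add: irr_iff)
 have "dim (cor P P) \<le> 2"
 proof (rule dim_complex_line)
  fix X assume "X \<in> cor P P"
  moreover have "DD 0 0 X = 0" by (simp add: DD_def lm_simps)
  ultimately show "\<exists>c. X = c \<odot> P" by (rule stable_brick[OF cen_0 assms[unfolded irr_def]])
 qed
 moreover have "P \<in> cor P P" using P by (intro corI) (simp_all add: PrD)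
 hence "dim (cor P P) ~= 0" using P(2) by (auto simp: dim_eq_0)
 moreover have "even (dim (cor P P))" by (rule even_dim_cor[OF P(1)])
 moreover have "n \<le> 2 ==> n ~= 0 ==> even n ==> n = 2" for n :: nat by presburger
 ultimately have "dim (cor P P) = 2" by blast
 thus ?thesis using dim_cor_ip[OF P(1) P(1)] by linarith
qed
lemma irr_ip_other:
 assumes "irr P" "irr Q" "ch P ~= ch Q" shows "ip P Q = 0"
proof -
 have "X = 0" if X: "X \<in> cor P Q" for X
 proof (rule ccontr)
  assume "X ~= 0"
  show False by (rule irr_hom[OF assms(1,2) X \<open>X ~= 0\<close>]) (use assms(3) in blast)
 qed
 hence "cor P Q \<subseteq> {0}" by blast
 hence "dim (cor P Q) = 0" by (simp only: dim_eq_0)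
 thus ?thesis using dim_cor_ip[OF irr_Pr[OF assms(1)] irr_Pr[OF assms(2)]] by linarith
qed

lemma irr_exists:
 assumes "P \<in> Pr" "P ~= 0"
 obtains F where "irr F" "P ** F = F"
proof -
 let ?E = "%F. F \<in> Pr \<and> F ~= 0 \<and> P ** F = F"
 obtain F where F: "?E F" and min: "!!G. ?E G ==> rk F \<le> rk G" using ex_has_least_nat[of ?E P rk] assms PrD(3)[OF assms(1)] by blast
 have "G = F" if G: "G \<in> Pr" "F ** G = G" "G ~= 0" for G
 proof (rule ccontr)
  assume "G ~= F"
  hence "rk G < rk F" using rk_less[OF G(1) _ G(2)] F by blast
  moreover have "P ** G = P ** F ** G" by (simp add: assoc_r G)
  hence "P ** G = G" using F G by simp
  ultimately show False using min[of G] G by auto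
 qed
 hence "irr F" using F by (auto simp: irr_iff)
 thus ?thesis using that F by blast
qed

lemma irr_triv: "irr triv" unfolding irr_iff
proof (intro conjI ballI impI)
 show "triv ~= 0" using trace_triv by auto
 show "F = 0 \<or> F = triv" if "F \<in> Pr" "triv ** F = F" for F using that by (cases rule: Pr_triv[OF that(1)]) auto
qed (rule triv_Pr)

lemma ch_triv: "ch triv g = 1"
proof -
 have "triv ** R g = triv" using CD[OF PrD(1)[OF triv_Pr], of g] reg_triv by simp
 thus ?thesis by (simp add: ch_def trace_triv)
qed

lemma submodule_iff: "submodule \<gamma> W \<longleftrightarrow> inv_sub W" by (simp add: submodule_def inv_sub_def)

definition rg :: "'g End => (complex^'g) set" where "rg P = {v. P *v v = v}"

lemma rg_inv: "P \<in> Pr ==> inv_sub (rg P)"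
proof -
 assume P: "P \<in> Pr"
 have "rg P = {v. P *v v = v \<and> 0 *v v = 0}" by (simp add: rg_def)
 thus ?thesis using inv_sub_ker[OF PrD(1)[OF P], of 0] C_closed by simp
qed

lemma Pr_of_sub:
 assumes "inv_sub W" obtains P where "P \<in> Pr" "rg P = W"
proof -
 obtain P where P: "P \<in> Pr" "!!v. P *v v = v \<longleftrightarrow> v \<in> W" by (rule Pr_exists[OF assms]) blast
 hence "rg P = W" by (auto simp: rg_def)
 thus ?thesis using that P by blast
qed

lemma rg_le: "F \<in> Pr ==> P ** F = F \<longleftrightarrow> rg F \<subseteq> rg P" by (auto simp: Pr_le_iff rg_def)

lemma rg_inj: "F \<in> Pr ==> P \<in> Pr ==> rg F = rg P ==> F = P" by (rule Pr_eqI) (auto simp: rg_def set_eq_iff)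

lemma rg_0: "rg 0 = {0}" by (auto simp: rg_def)

lemma irreducible_iff:
 assumes P: "P \<in> Pr" shows "irreducible_submodule \<gamma> (rg P) \<longleftrightarrow> irr P"
proof -
 have "(\<forall>W'. inv_sub W' \<and> W' \<subseteq> rg P --> W' = {0} \<or> W' = rg P) \<longleftrightarrow>
   (\<forall>F\<in>Pr. P ** F = F --> F = 0 \<or> F = P)"
 proof
  assume h: "\<forall>W'. inv_sub W' \<and> W' \<subseteq> rg P --> W' = {0} \<or> W' = rg P"
  show "\<forall>F\<in>Pr. P ** F = F --> F = 0 \<or> F = P"
  proof (intro ballI impI)
   fix F assume F: "F \<in> Pr" "P ** F = F"
   hence "rg F = {0} \<or> rg F = rg P" using h rg_inv[OF F(1)] rg_le[OF F(1)] by blast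
   thus "F = 0 \<or> F = P" using rg_inj[OF F(1)] Pr_0_1(1) P rg_0 by metis
  qed
 next
  assume h: "\<forall>F\<in>Pr. P ** F = F --> F = 0 \<or> F = P"
  show "\<forall>W'. inv_sub W' \<and> W' \<subseteq> rg P --> W' = {0} \<or> W' = rg P"
  proof (intro allI impI)
   fix W' assume W: "inv_sub W' \<and> W' \<subseteq> rg P"
   then obtain F where F: "F \<in> Pr" "rg F = W'" using Pr_of_sub by blast
   hence "F = 0 \<or> F = P" using h W rg_le by blast
   thus "W' = {0} \<or> W' = rg P" using F rg_0 by auto
  qed
 qed
 moreover have "rg P ~= {0} \<longleftrightarrow> P ~= 0" using rg_inj[OF P Pr_0_1(1)] rg_0 by auto
 ultimately show ?thesis unfolding irreducible_submodule_def submodule_iff irr_iff using P rg_inv by blast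
qed

lemma isomorphic_if_hom:
 assumes "P \<in> Pr" "Q \<in> Pr" "X \<in> cor P Q" "Z \<in> cor Q P" "Z ** X = P" "X ** Z = Q"
 shows "isomorphic_submodules \<gamma> (rg P) (rg Q)" unfolding isomorphic_submodules_def
proof (intro exI conjI)
 show "Vector_Spaces.linear (*s) (*s) ((*v) X)" by (rule matrix_vector_mul_linear_gen)
 show "bij_betw ((*v) X) (rg P) (rg Q)"
 proof (rule bij_betw_byWitness[where f' = "(*v) Z"])
  show "\<forall>a\<in>rg P. Z *v (X *v a) = a" "\<forall>a\<in>rg Q. X *v (Z *v a) = a" using assms by (simp_all add: rg_def mv_assoc)
  show "(*v) X ` rg P \<subseteq> rg Q" "(*v) Z ` rg Q \<subseteq> rg P"
   using corD(2)[OF assms(3,1,2)] corD(2)[OF assms(4,2,1)] by (auto simp: rg_def mv_assoc)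
 qed
 show "\<forall>g. \<forall>w\<in>rg P. X *v (R g *v w) = R g *v (X *v w)" using C_vec corD(1)[OF assms(3,1,2)] by simp
qed

lemma ch_isomorphic:
 assumes P: "P \<in> Pr" and Q: "Q \<in> Pr" and iso: "isomorphic_submodules \<gamma> (rg P) (rg Q)"
 shows "ch P = ch Q"
proof -
 obtain f where f: "Vector_Spaces.linear (*s) (*s) f" "bij_betw f (rg P) (rg Q)"
  "!!g w. w \<in> rg P ==> f (R g *v w) = R g *v f w" using iso by (auto simp: isomorphic_submodules_def)
 define X where "X = matrix f ** P"
 have X: "X *v v = f (P *v v)" for v using matrix_works[OF f(1)] by (simp add: X_def flip: mv_assoc)
 have PP: "P *v v \<in> rg P" for v using Pr_fix[OF P] by (simp add: rg_def)
 have XC: "X \<in> \<C>" unfolding commutant_def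
 proof (intro CollectI allI matrix_eqI)
  fix g v
  show "(X ** R g) *v v = (R g ** X) *v v" using f(3)[OF PP, of g v] by (simp add: X C_vec[OF PrD(1)[OF P]] flip: mv_assoc)
 qed
 have f0: "f 0 = 0" using X[of 0] by simp
 show ?thesis
 proof (rule ch_iso[OF XC P _ Q])
  show "v = 0" if "P *v v = v" "X *v v = 0" for v
  proof -
   have "v \<in> rg P" "0 \<in> rg P" "f v = f 0" using that f0 by (simp_all add: rg_def X)
   thus ?thesis using bij_betw_imp_inj_on[OF f(2)] by (auto dest: inj_onD)
  qed
  show "Q *v v = v \<longleftrightarrow> v \<in> range ((*v) (X ** P))" for v
  proof -
   have "range ((*v) (X ** P)) = f ` rg P" using PP Pr_fix[OF P] by (auto simp: X rg_def image_iff simp flip: mv_assoc) metis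
   thus ?thesis using bij_betw_imp_surj_on[OF f(2)] by (auto simp: rg_def)
  qed
 qed
qed

lemma irr_isomorphic_iff:
 assumes "irr P" "irr Q"
 shows "isomorphic_submodules \<gamma> (rg P) (rg Q) \<longleftrightarrow> ch P = ch Q"
proof
 show "ch P = ch Q" if "isomorphic_submodules \<gamma> (rg P) (rg Q)" using ch_isomorphic irr_Pr assms that by blast
 show "isomorphic_submodules \<gamma> (rg P) (rg Q)" if "ch P = ch Q"
 proof -
  have "ip P Q = 1" using irr_ip_self[OF assms(1)] that by (simp add: ip_def)
  hence "dim (cor P Q) ~= 0" using dim_cor_ip[of P Q] irr_Pr assms by fastforce
  then obtain X where "X \<in> cor P Q" "X ~= 0" by (auto simp: dim_eq_0)
  thus ?thesis using irr_hom[OF assms] isomorphic_if_hom irr_Pr assms by metis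
 qed
qed

lemma trivial_iff:
 assumes "irr P" shows "trivial_submodule \<gamma> (rg P) \<longleftrightarrow> P = triv"
proof
 assume t: "trivial_submodule \<gamma> (rg P)"
 have P: "P \<in> Pr" "P ~= 0" using assms by (simp_all add: irr_iff)
 have "R g ** P = P" for g by (rule matrix_eqI) (use t Pr_fix[OF P(1)] in \<open>auto simp: trivial_submodule_def rg_def simp flip: mv_assoc\<close>)
 hence "triv ** P = P" unfolding triv_def using linear_avg[OF linear_mult(2)[of P], of R] avg_const by simp
 thus "P = triv" using P(2) by (cases rule: Pr_triv[OF P(1)]) auto
next
 assume "P = triv"
 thus "trivial_submodule \<gamma> (rg P)" unfolding trivial_submodule_def rg_def by (metis (mono_tags, lifting) mv_assoc mem_Collect_eq reg_triv)
qed

end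

text \<open>From here on, a numbering of the nontrivial irreducible representations is given; the trivial one
 gets the number \<open>0\<close>.\<close>

locale mckay_irr = mckay \<gamma> for \<gamma> :: "'g::finite => complex^2^2" +
 fixes r :: nat and Rep :: "nat => (complex^'g) set"
 assumes irreps: "nontrivial_irreps \<gamma> r Rep"
begin

definition Pk :: "nat => 'g End" where
 "Pk k = (if k = 0 then triv else SOME P. P \<in> Pr \<and> rg P = Rep k)"

lemma Pk_rg: assumes "k \<in> {1..r}" shows "Pk k \<in> Pr" "rg (Pk k) = Rep k"
proof -
 have "inv_sub (Rep k)" using irreps assms by (auto simp: nontrivial_irreps_def irreducible_submodule_def submodule_iff)
 hence "\<exists>P. P \<in> Pr \<and> rg P = Rep k" using Pr_of_sub by metis
 hence "(SOME P. P \<in> Pr \<and> rg P = Rep k) \<in> Pr \<and> rg (SOME P. P \<in> Pr \<and> rg P = Rep k) = Rep k" by (rule someI_ex)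
 moreover have "Pk k = (SOME P. P \<in> Pr \<and> rg P = Rep k)" using assms by (simp add: Pk_def)
 ultimately have "Pk k \<in> Pr \<and> rg (Pk k) = Rep k" by (simp only:)
 thus "Pk k \<in> Pr" "rg (Pk k) = Rep k" by auto
qed

lemma Pk_irr: "k \<le> r ==> irr (Pk k)"
proof (cases "k = 0")
 case False
 assume "k \<le> r"
 with False have k: "k \<in> {1..r}" by simp
 have "irreducible_submodule \<gamma> (Rep k)" using irreps k by (auto simp: nontrivial_irreps_def)
 thus ?thesis using irreducible_iff[OF Pk_rg(1)[OF k]] Pk_rg(2)[OF k] by simp
qed (simp add: Pk_def irr_triv)

lemma Pk_Pr: "k \<le> r ==> Pk k \<in> Pr" using Pk_irr irr_Pr by blast

lemma Pk_ch_inj: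
 assumes "k \<le> r" "l \<le> r" "k ~= l" shows "ch (Pk k) ~= ch (Pk l)"
proof -
 have nontriv: "Pk j ~= triv" if "j \<in> {1..r}" for j
 proof -
  have "\<not> trivial_submodule \<gamma> (Rep j)" using irreps that by (auto simp: nontrivial_irreps_def)
  thus ?thesis using trivial_iff[OF Pk_irr[of j]] Pk_rg(2)[OF that] that by auto
 qed
 have triv_unique: "P = triv" if "irr P" "ch P = ch triv" for P
 proof -
  have P: "P \<in> Pr" using that irr_Pr by blast
  have "trace (triv ** P) = avg (ch P)" unfolding triv_def avg_def
   by (simp add: mm mult_sum trace_sum scaleR_conv_of_real[where 'a = complex] ch_def trace_mul_sym[of P])
  also have "... = 1" unfolding that(2) using avg_const[of "1::complex"] by (simp add: ch_triv[abs_def])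
  finally have "triv ** P = triv" by (cases rule: Pr_triv[OF P]) auto
  moreover have "P ** triv = triv" using calculation triv_C[OF PrD(1)[OF P]] by simp
  ultimately show ?thesis using that(1) triv_Pr irr_triv by (auto simp: irr_iff)
 qed
 show ?thesis
 proof (cases "k = 0 \<or> l = 0")
  case True
  then consider "k = 0" "l \<in> {1..r}" | "l = 0" "k \<in> {1..r}" using assms by force
  thus ?thesis
  proof cases
   case 1
   thus ?thesis using triv_unique[OF Pk_irr[of l]] nontriv[of l] by (auto simp: Pk_def[of 0])
  next
   case 2
   thus ?thesis using triv_unique[OF Pk_irr[of k]] nontriv[of k] by (auto simp: Pk_def[of 0])
  qed
 next
  case False
  hence "k \<in> {1..r}" "l \<in> {1..r}" using assms by auto
  hence "\<not> isomorphic_submodules \<gamma> (rg (Pk k)) (rg (Pk l))" using irreps assms(3) Pk_rg by (auto simp: nontrivial_irreps_def)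
  thus ?thesis using irr_isomorphic_iff[OF Pk_irr Pk_irr] assms by blast
 qed
qed

lemma irr_class:
 assumes "irr P" obtains k where "k \<le> r" "ch P = ch (Pk k)"
proof (cases "P = triv")
 case True
 thus ?thesis using that[of 0] by (simp add: Pk_def)
next
 case False
 have P: "P \<in> Pr" using assms irr_Pr by blast
 have "irreducible_submodule \<gamma> (rg P)" "\<not> trivial_submodule \<gamma> (rg P)" using assms False irreducible_iff[OF P] trivial_iff by blast+
 then obtain k where k: "k \<in> {1..r}" "isomorphic_submodules \<gamma> (rg P) (Rep k)" using irreps by (auto simp: nontrivial_irreps_def)
 hence "ch P = ch (Pk k)" using ch_isomorphic[OF P Pk_rg(1)[OF k(1)]] Pk_rg(2)[OF k(1)] by simp
 thus ?thesis using that[of k] k by simp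
qed

lemma Pk_ip: "k \<le> r ==> l \<le> r ==> ip (Pk k) (Pk l) = (if k = l then 1 else 0)" using irr_ip_self irr_ip_other Pk_irr Pk_ch_inj by simp

lemma ch_decompose:
 assumes "P \<in> Pr"
 obtains d :: "nat => nat" where "!!g. ch P g = (\<Sum>k\<le>r. of_nat (d k) * ch (Pk k) g)" "!!k. d k \<le> rk P"
proof -
 have "\<exists>d::nat => nat. (\<forall>g. ch P g = (\<Sum>k\<le>r. of_nat (d k) * ch (Pk k) g)) \<and> (\<forall>k. d k \<le> rk P)" using assms
 proof (induction "rk P" arbitrary: P rule: less_induct)
  case less
  show ?case
  proof (cases "P = 0")
   case True
   thus ?thesis by (intro exI[of _ "%_. 0"]) (simp add: ch_0)
  next
   case False
   obtain F where F: "irr F" "P ** F = F" by (rule irr_exists[OF less.prems False]) blast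
   obtain j where j: "j \<le> r" "ch F = ch (Pk j)" by (rule irr_class[OF F(1)]) blast
   have Fp: "F \<in> Pr" "F ~= 0" using F(1) by (simp_all add: irr_iff)
   have Q: "P - F \<in> Pr" by (rule Pr_diff[OF less.prems Fp(1) F(2)])
   have lt: "rk (P - F) < rk P" by (rule rk_less[OF Q less.prems]) (use Fp F PrD[OF less.prems] in \<open>auto simp: mult_diff\<close>)
   obtain d where d: "!!g. ch (P - F) g = (\<Sum>k\<le>r. of_nat (d k) * ch (Pk k) g)" "!!k. d k \<le> rk (P - F)" using less.hyps[OF lt Q] by auto
   have "ch P g = (\<Sum>k\<le>r. of_nat ((d(j := Suc (d j))) k) * ch (Pk k) g)" for g
   proof -
    have "(\<Sum>k\<le>r. of_nat ((d(j := Suc (d j))) k) * ch (Pk k) g) =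
      (\<Sum>k\<le>r. of_nat (d k) * ch (Pk k) g + (if k = j then ch (Pk j) g else 0))" by (rule sum.cong) (auto simp: algebra_simps)
    also have "... = ch (P - F) g + ch F g" using j by (simp add: sum.distrib d)
    also have "... = ch P g" by (simp add: ch_def mult_diff trace_sub)
    finally show ?thesis by simp
   qed
   moreover have "(d(j := Suc (d j))) k \<le> rk P" for k using d(2)[of k] lt by auto
   ultimately show ?thesis by blast
  qed
 qed
 thus ?thesis using that by blast
qed

lemma finite_classes: "finite (ch ` Pr)"
proof -
 define B where "B = DIM(complex^'g)"
 let ?S = "{d::nat => nat. \<forall>k. (k \<in> {..r} --> d k \<in> {..B}) \<and> (k \<notin> {..r} --> d k = 0)}"
 have "finite ?S" by (rule finite_set_of_finite_funs) auto
 moreover have "ch ` Pr \<subseteq> (%d g. \<Sum>k\<le>r. of_nat (d k) * ch (Pk k) g) ` ?S"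
 proof
  fix c assume "c \<in> ch ` Pr"
  then obtain P where P: "P \<in> Pr" "c = ch P" by blast
  obtain d :: "nat => nat" where d: "!!g. ch P g = (\<Sum>k\<le>r. of_nat (d k) * ch (Pk k) g)" "!!k. d k \<le> rk P"
   by (rule ch_decompose[OF P(1)]) blast
  let ?d = "%k. if k \<le> r then d k else 0"
  have "d k \<le> B" for k unfolding B_def using d(2)[of k] rk_le[of P] by (rule order_trans)
  hence dS: "?d \<in> ?S" by simp
  have "(\<Sum>k\<le>r. of_nat (?d k) * ch (Pk k) g) = (\<Sum>k\<le>r. of_nat (d k) * ch (Pk k) g)" for g by (rule sum.cong) auto
  hence c: "c = (%g. \<Sum>k\<le>r. of_nat (?d k) * ch (Pk k) g)" unfolding P(2) by (intro ext) (simp only: d(1))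
  show "c \<in> (%d g. \<Sum>k\<le>r. of_nat (d k) * ch (Pk k) g) ` ?S" unfolding c by (rule imageI[OF dS])
 qed
 ultimately show ?thesis by (rule finite_subset[rotated, OF finite_imageI])
qed

end

section \<open>Real and complex dimension\<close>

lemma real_dim_le_complex_dim:
 fixes W :: "(complex^'n::finite) set"
 assumes W: "vec.subspace W"
 shows "dim W \<le> 2 * vec.dim W"
proof -
 obtain B where B: "B \<subseteq> W" "vec.independent B" "W \<subseteq> vec.span B" "card B = vec.dim W" by (rule vec.basis_exists)
 have fin: "finite B" using B(2) by (rule vec.finiteI_independent)
 let ?B = "B \<union> (*s) \<i> ` B"
 have "W \<subseteq> span ?B"
 proof
  fix w assume "w \<in> W"
  hence "w \<in> vec.span B" using B by blast
  then obtain c where w: "w = (\<Sum>b\<in>B. c b *s b)" using vec.span_finite[OF fin] by auto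
  have "c b *s b \<in> span ?B" if "b \<in> B" for b
  proof -
   have "c b *s b = Re (c b) *\<^sub>R b + Im (c b) *\<^sub>R (\<i> *s b)" by (simp add: vec_eq_iff complex_eq_iff)
   thus ?thesis using that by (auto intro!: span_add span_scale intro: span_base)
  qed
  thus "w \<in> span ?B" unfolding w by (rule span_sum)
 qed
 hence "dim W \<le> card ?B" using fin by (intro dim_le_card) auto
 also have "... \<le> card B + card B" using card_Un_le[of B "(*s) \<i> ` B"] card_image_le[OF fin, of "(*s) \<i>"] by linarith
 finally show ?thesis using B(4) by simp
qed

text \<open>For complementary subspaces both inequalities are equalities.\<close>

lemma complex_dim_projection:
 fixes P :: "'n::finite End"
 assumes P: "P\<^sup>H = P" "P ** P = P"
 shows "real (vec.dim {v. P *v v = v}) = Re (trace P)"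
proof -
 let ?W = "{v. P *v v = v}" and ?V = "{v. P *v v = 0}"
 have W: "vec.subspace ?W" and V: "vec.subspace ?V" by (auto simp: vec.subspace_def mv_add_right vector_scalar_commute)
 have "vec.dim {x + y |x y. x \<in> ?W \<and> y \<in> ?V} + vec.dim (?W \<inter> ?V) = vec.dim ?W + vec.dim ?V" by (rule vec.dim_sums_Int[OF W V])
 moreover have "?W \<inter> ?V = {0}" by auto
 ultimately have "vec.dim ?W + vec.dim ?V \<le> CARD('n)"
  using vec.dim_subset_UNIV[of "{x + y |x y. x \<in> ?W \<and> y \<in> ?V}"] by (simp add: card_cart_basis vec.dimension_def)
 moreover have "dim ?W + dim ?V = 2 * CARD('n)"
 proof -
  have "linear ((*v) P)" by (rule matrix_vector_mul_linear)
  moreover have "range ((*v) P) = ?W" using P(2) by (auto simp: image_iff mv_assoc) metis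
  ultimately show ?thesis using dim_kernel_image[of "(*v) P" UNIV] by (simp add: mult.commute)
 qed
 ultimately have "dim ?W = 2 * vec.dim ?W" using real_dim_le_complex_dim[OF W] real_dim_le_complex_dim[OF V] by linarith
 moreover have "real (dim ?W) = 2 * Re (trace P)"
 proof -
  have "range ((*v) P) = ?W" using P(2) by (auto simp: image_iff mv_assoc) metis
  moreover have "real (dim (range ((*v) P))) = (\<Sum>b\<in>Basis. (P *v b) \<bullet> b)" by (rule dim_range_orthogonal_projection)
     (use P in \<open>auto simp: matrix_vector_mul_linear mv_assoc inner_matrix_vector\<close>)
  moreover have "(\<Sum>b\<in>Basis. (P *v b) \<bullet> b) = 2 * Re (trace P)"
  proof -
   have "(P *v axis i u) \<bullet> axis i u = (P $ i $ i * u) \<bullet> u" for i u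
    by (simp add: matrix_vector_mult_def axis_def inner_axis if_distrib[of "%x. _ * x"] cong: if_cong)
      (simp add: inner_vec_def if_distrib[of "%x. _ \<bullet> x"] cong: if_cong)
   thus ?thesis by (simp add: sum_Basis_vec trace_def Basis_complex_def inner_complex_def sum.distrib sum_distrib_left)
  qed
  ultimately show ?thesis by simp
 qed
 ultimately show ?thesis by simp
qed

context mckay_irr
begin

section \<open>The isotypic projections\<close>

lemma ch_gi: "P \<in> Pr ==> ch P (gi g) = cnj (ch P g)" using trace_adj[of "P ** R g"] trace_mul_sym[of P "R (gi g)"]
 by (simp add: ch_def adj_mult adj_reg PrD)

lemma ch_conj: "P \<in> Pr ==> ch P (gm (gm h g) (gi h)) = ch P g"
proof -
 assume P: "P \<in> Pr"
 have "ch P (gm (gm h g) (gi h)) = trace ((P ** R h ** R g) ** R (gi h))" by (simp add: ch_def reg_gm assoc_r)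
 also have "... = trace (R (gi h) ** (P ** R h ** R g))" by (rule trace_mul_sym)
 also have "... = ch P g" by (simp add: CD[OF PrD(1)[OF P]] ch_def mm_assoc reg_inverse)
 finally show ?thesis .
qed

definition Ek :: "nat => 'g End" where
 "Ek k = trace (Pk k) \<odot> avg (%g. cnj (ch (Pk k) g) \<odot> R g)"

lemma mult_avg: "A ** avg f = avg (%g. A ** f g)" "avg f ** A = avg (%g. f g ** A)" for A :: "'g End"
 by (simp_all add: linear_avg[OF linear_mult(1)] linear_avg[OF linear_mult(2), of _ A])

lemma Ek_comm: "X \<in> \<C> ==> Ek k ** X = X ** Ek k" by (simp add: Ek_def mm mult_avg CD)

lemma Ek_C: assumes "k \<le> r" shows "Ek k \<in> \<C>"
proof -
 have "R h ** Ek k = Ek k ** R h" for h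
 proof -
  have "R h ** avg (%g. cnj (ch (Pk k) g) \<odot> R g) = avg (%g. cnj (ch (Pk k) (gm (gm h g) (gi h))) \<odot> R (gm h g))"
   by (simp add: mult_avg mm reg_gm ch_conj[OF Pk_Pr[OF assms]])
  also have "... = avg (%g. cnj (ch (Pk k) (gm g (gi h))) \<odot> R g)" by (rule avg_gm(1)[of "%g. cnj (ch (Pk k) (gm g (gi h))) \<odot> R g"])
  also have "... = avg (%g. cnj (ch (Pk k) (gm (gm g h) (gi h))) \<odot> R (gm g h))" by (rule avg_gm(2)[symmetric])
  also have "... = avg (%g. cnj (ch (Pk k) g) \<odot> R g) ** R h" by (simp add: mult_avg mm reg_gm gm_assoc)
  finally show ?thesis by (simp add: Ek_def mm)
 qed
 thus ?thesis by (simp add: commutant_def)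
qed

lemma avg_ch_real: "P \<in> Pr ==> Q \<in> Pr ==> avg (%g. ch Q g * cnj (ch P g)) = of_real (ip P Q)"
proof -
 assume P: "P \<in> Pr" and Q: "Q \<in> Pr"
 let ?a = "avg (%g. ch Q g * cnj (ch P g))"
 have "?a = avg (%g. ch Q (gi g) * cnj (ch P (gi g)))" by (rule avg_gi[symmetric])
 also have "... = cnj ?a" by (simp add: ch_gi P Q avg_def scaleR_conv_of_real)
 finally have "Im ?a = 0" by (simp add: complex_eq_iff)
 moreover have "Re ?a = ip P Q" by (simp add: avg_def ip_def)
 ultimately show ?thesis by (simp add: complex_eq_iff)
qed

lemma Ek_irr:
 assumes k: "k \<le> r" and F: "irr F"
 shows "Ek k ** F = (if ch F = ch (Pk k) then F else 0)"
proof -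
 have Fp: "F \<in> Pr" "F ~= 0" using F by (simp_all add: irr_iff)
 have "F ** (Ek k ** F) ** F = Ek k ** F" by (simp add: Ek_comm[OF PrD(1)[OF Fp(1)]] mm_assoc PrD(3)[OF Fp(1)])
    (simp add: assoc_r PrD[OF Fp(1)] Ek_comm[OF PrD(1)[OF Fp(1)]])
 hence "Ek k ** F \<in> cor F F" using Ek_C[OF k] PrD(1)[OF Fp(1)] by (simp add: cor_def C_closed)
 moreover have "DD 0 0 (Ek k ** F) = 0" by (simp add: DD_def lm_simps)
 ultimately obtain c where c: "Ek k ** F = c \<odot> F" using stable_brick[OF cen_0 F[unfolded irr_def]] by blast
 have trF: "trace F ~= 0" using Pr_norm[OF Fp(1)] Fp(2) by auto
 have "c * trace F = trace (Ek k ** F)" by (simp add: c)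
 also have "... = trace (Pk k) * avg (%g. ch F g * cnj (ch (Pk k) g))"
  by (simp add: Ek_def mm mult_avg linear_avg[OF linear_trace] ch_def trace_mul_sym[of _ F] mult.commute)
 also have "... = trace (Pk k) * of_real (ip (Pk k) F)" by (simp add: avg_ch_real[OF Pk_Pr[OF k] Fp(1)])
 also have "... = (if ch F = ch (Pk k) then trace F else 0)"
 proof (cases "ch F = ch (Pk k)")
  case True
  hence "ip (Pk k) F = 1" using irr_ip_self[OF F] by (simp add: ip_def)
  moreover have "trace F = trace (Pk k)" using fun_cong[OF True, of ge] by (simp add: ch_def reg_ge)
  ultimately show ?thesis using True by simp
 next
  case False
  hence "ip (Pk k) F = 0" using irr_ip_other[OF Pk_irr[OF k] F] by auto
  thus ?thesis using False by simp
 qed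
 finally show ?thesis using trF by (auto simp: c split: if_splits)
qed

lemma matrix_eq_on_irr:
 fixes A B :: "'g End"
 assumes "!!F. irr F ==> A ** F = B ** F" shows "A = B"
proof -
 have "A ** P = B ** P" if "P \<in> Pr" for P using that
 proof (induction "rk P" arbitrary: P rule: less_induct)
  case less
  show ?case
  proof (cases "P = 0")
   case False
   obtain F where F: "irr F" "P ** F = F" by (rule irr_exists[OF less.prems False]) blast
   have Fp: "F \<in> Pr" "F ~= 0" using F(1) by (simp_all add: irr_iff)
   have Q: "P - F \<in> Pr" by (rule Pr_diff[OF less.prems Fp(1) F(2)])
   have "rk (P - F) < rk P" by (rule rk_less[OF Q less.prems]) (use Fp F PrD[OF less.prems] in \<open>auto simp: mult_diff\<close>)
   hence "A ** (P - F) = B ** (P - F)" using less.hyps Q by blast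
   thus ?thesis using assms[OF F(1)] by (simp add: mult_diff)
  qed simp
 qed
 from this[OF Pr_0_1(2)] show ?thesis by simp
qed

lemma isotypic_part_eq:
 assumes F: "irr F"
 shows "isotypic_part \<gamma> (rg F) = vec.span (\<Union>{rg G |G. irr G \<and> ch G = ch F})"
proof -
 have "{W'. irreducible_submodule \<gamma> W' \<and> isomorphic_submodules \<gamma> W' (rg F)} = {rg G |G. irr G \<and> ch G = ch F}"
 proof (intro equalityI subsetI)
  fix W' assume "W' \<in> {W'. irreducible_submodule \<gamma> W' \<and> isomorphic_submodules \<gamma> W' (rg F)}"
  hence W: "irreducible_submodule \<gamma> W'" "isomorphic_submodules \<gamma> W' (rg F)" by simp_all
  hence "inv_sub W'" by (simp add: irreducible_submodule_def submodule_iff)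
  then obtain G where G: "G \<in> Pr" "rg G = W'" by (rule Pr_of_sub)
  hence "irr G" using W irreducible_iff by blast
  thus "W' \<in> {rg G |G. irr G \<and> ch G = ch F}" using G W irr_isomorphic_iff[OF _ F] by blast
 next
  fix W' assume "W' \<in> {rg G |G. irr G \<and> ch G = ch F}"
  then obtain G where "W' = rg G" "irr G" "ch G = ch F" by blast
  thus "W' \<in> {W'. irreducible_submodule \<gamma> W' \<and> isomorphic_submodules \<gamma> W' (rg F)}"
   using irr_isomorphic_iff[OF _ F] irreducible_iff[OF irr_Pr] by blast
 qed
 thus ?thesis by (simp add: isotypic_part_def)
qed

text \<open>The character formula gives a central element that is the identity on one isotypic part and zero on
 the others.\<close>

lemma isotypic_proj_eq:
 assumes k: "k \<in> {1..r}"
 shows "isotypic_proj \<gamma> (Rep k) = Ek k"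
proof -
 have kr: "k \<le> r" using k by simp
 have Rk: "Rep k = rg (Pk k)" using Pk_rg[OF k] by simp
 have sub: "vec.subspace {v. A *v v = v}" "vec.subspace {v. A *v v = 0}" for A :: "'g End"
  by (auto simp: vec.subspace_def mv_add_right vector_scalar_commute)
 have E1: "Ek k *v v = v" if v: "v \<in> isotypic_part \<gamma> (Rep k)" for v
 proof -
  have "\<Union>{rg G |G. irr G \<and> ch G = ch (Pk k)} \<subseteq> {v. Ek k *v v = v}"
  proof clarsimp
   fix v G assume G: "v \<in> rg G" "irr G" "ch G = ch (Pk k)"
   hence "(Ek k ** G) *v v = G *v v" using Ek_irr[OF kr G(2)] by simp
   thus "Ek k *v v = v" using G(1) by (simp add: rg_def flip: mv_assoc)
  qed
  from vec.span_minimal[OF this sub(1)] show ?thesis using v unfolding Rk isotypic_part_eq[OF Pk_irr[OF kr]] by blast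
 qed
 have E0: "Ek k *v v = 0"
  if W: "irreducible_submodule \<gamma> W'" "\<not> isomorphic_submodules \<gamma> W' (Rep k)" and v: "v \<in> isotypic_part \<gamma> W'" for W' v
 proof -
  have "inv_sub W'" using W by (simp add: irreducible_submodule_def submodule_iff)
  then obtain F where F: "F \<in> Pr" "rg F = W'" by (rule Pr_of_sub)
  have Fi: "irr F" using W F irreducible_iff by blast
  have ne: "ch F ~= ch (Pk k)" using W(2) irr_isomorphic_iff[OF Fi Pk_irr[OF kr]] F Rk by auto
  have "\<Union>{rg G |G. irr G \<and> ch G = ch F} \<subseteq> {v. Ek k *v v = 0}"
  proof clarsimp
   fix v G assume G: "v \<in> rg G" "irr G" "ch G = ch F"
   hence "(Ek k ** G) *v v = 0" using Ek_irr[OF kr G(2)] ne by simp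
   thus "Ek k *v v = 0" using G(1) by (simp add: rg_def flip: mv_assoc)
  qed
  from vec.span_minimal[OF this sub(2)] show ?thesis using v unfolding F(2)[symmetric] isotypic_part_eq[OF Fi] by blast
 qed
 show ?thesis unfolding isotypic_proj_def
 proof (rule the_equality)
  show "(\<forall>v\<in>isotypic_part \<gamma> (Rep k). Ek k *v v = v) \<and>
   (\<forall>W'. irreducible_submodule \<gamma> W' \<and> \<not> isomorphic_submodules \<gamma> W' (Rep k) -->
    (\<forall>v\<in>isotypic_part \<gamma> W'. Ek k *v v = 0))" using E1 E0 by blast
 next
  fix P
  assume P: "(\<forall>v\<in>isotypic_part \<gamma> (Rep k). P *v v = v) \<and>
   (\<forall>W'. irreducible_submodule \<gamma> W' \<and> \<not> isomorphic_submodules \<gamma> W' (Rep k) -->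
    (\<forall>v\<in>isotypic_part \<gamma> W'. P *v v = 0))"
  show "P = Ek k"
  proof (rule matrix_eq_on_irr, rule matrix_eqI)
   fix F v assume F: "irr F"
   have Fv: "F *v v \<in> rg F" using Pr_fix[OF irr_Pr[OF F]] by (simp add: rg_def)
   have part: "F *v v \<in> isotypic_part \<gamma> (rg F)" unfolding isotypic_part_eq[OF F] by (rule vec.span_base) (use F Fv in blast)
   show "(P ** F) *v v = (Ek k ** F) *v v"
   proof (cases "ch F = ch (Pk k)")
    case True
    hence "isotypic_part \<gamma> (rg F) = isotypic_part \<gamma> (Rep k)"
     unfolding Rk isotypic_part_eq[OF F] isotypic_part_eq[OF Pk_irr[OF kr]] by simp
    thus ?thesis using part P E1 by (simp flip: mv_assoc)
   next
    case False
    hence "irreducible_submodule \<gamma> (rg F)" "\<not> isomorphic_submodules \<gamma> (rg F) (Rep k)"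
     using irreducible_iff[OF irr_Pr[OF F]] F irr_isomorphic_iff[OF F Pk_irr[OF kr]] Rk by auto
    thus ?thesis using part P E0 by (simp flip: mv_assoc)
   qed
  qed
 qed
qed

lemma trace_Ek:
 assumes t: "t \<in> cen" and k: "k \<le> r"
 shows "trace (t ** Ek k) = trace (Pk k) * trace (t ** Pk k)"
proof -
 have "trace (t ** R g) = of_real order * t $ (gi g) $ ge" for g
 proof -
  have "trace (t ** R g) = (\<Sum>h\<in>UNIV. t $ h $ ge * trace (R (gm h g)))" by (subst cen_eq_sum[OF t]) (simp add: mult_sum mm trace_sum reg_gm)
  also have "... = (\<Sum>h\<in>UNIV. if h = gi g then of_real order * t $ (gi g) $ ge else 0)"
  proof (rule sum.cong)
   fix h
   have "gm h g = ge \<longleftrightarrow> h = gi g" by (metis group_simps(1,3,9) gm_assoc group_simps(2,4))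
   thus "t $ h $ ge * trace (R (gm h g)) = (if h = gi g then of_real order * t $ (gi g) $ ge else 0)" by (simp add: trace_reg order_def)
  qed simp
  finally show ?thesis by simp
 qed
 hence "trace (t ** Ek k) = trace (Pk k) * avg (%g. of_real order * (cnj (ch (Pk k) g) * t $ (gi g) $ ge))"
  by (simp add: Ek_def mm mult_avg linear_avg[OF linear_trace] mult_ac)
 also have "avg (%g. of_real order * (cnj (ch (Pk k) g) * t $ (gi g) $ ge)) =
   (\<Sum>g\<in>UNIV. ch (Pk k) (gi g) * t $ (gi g) $ ge)"
  using order_pos by (simp add: avg_def ch_gi[OF Pk_Pr[OF k]] scaleR_conv_of_real flip: sum_distrib_left)
 also have "... = trace (t ** Pk k)" using sum_gi[of "%g. ch (Pk k) g * t $ g $ ge"] by (simp add: cen_trace[OF t] mult.commute)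
 finally show ?thesis .
qed

lemma isotypic_trace:
 assumes t: "t \<in> cen" and k: "k \<in> {1..r}"
 shows "Re (trace (t ** isotypic_proj \<gamma> (Rep k))) / real (vec.dim (Rep k)) = val t (Pk k)"
proof -
 have kr: "k \<le> r" using k by simp
 have P: "Pk k \<in> Pr" "Pk k ~= 0" using Pk_irr[OF kr] by (simp_all add: irr_iff)
 have d: "real (vec.dim (Rep k)) = Re (trace (Pk k))" using complex_dim_projection[OF PrD(2,3)[OF P(1)]] Pk_rg(2)[OF k] by (simp add: rg_def)
 have "Re (trace (t ** isotypic_proj \<gamma> (Rep k))) = Re (trace (Pk k)) * val t (Pk k)"
 proof -
  obtain a :: real where "trace (Pk k) = of_real a" using Pr_trace_real[OF P(1)] by blast
  thus ?thesis unfolding isotypic_proj_eq[OF k] trace_Ek[OF t kr] val_def by simp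
 qed
 moreover have "Re (trace (Pk k)) ~= 0" using Pr_norm[OF P(1)] P(2) by simp
 ultimately show ?thesis by (simp add: d)
qed

end

section \<open>The root lattice\<close>

lemma even_symmetric_sum:
 fixes f :: "'a => 'a => int"
 assumes "finite A" "!!k l. k \<in> A ==> l \<in> A ==> f k l = f l k" "!!k. k \<in> A ==> even (f k k)"
 shows "even (\<Sum>k\<in>A. \<Sum>l\<in>A. f k l)" using assms
proof (induction A rule: finite_induct)
 case (insert a A)
 have "(\<Sum>k\<in>insert a A. \<Sum>l\<in>insert a A. f k l)
   = f a a + (\<Sum>l\<in>A. f a l) + (\<Sum>k\<in>A. f k a) + (\<Sum>k\<in>A. \<Sum>l\<in>A. f k l)" using insert(1,2) by (simp add: sum.distrib)
 also have "(\<Sum>k\<in>A. f k a) = (\<Sum>l\<in>A. f a l)" using insert.prems by (intro sum.cong) auto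
 finally show ?case using insert by simp
qed simp

context mckay_irr
begin

lemma avg_sum: "avg (%g. \<Sum>k\<in>S. f k g) = (\<Sum>k\<in>S. avg (f k))" unfolding avg_def by (subst sum.swap) (simp add: scaleR_sum_right)

lemma avg_cmult: "avg (%g. c * f g) = c * avg f" for c :: "'a::real_algebra" by (simp add: avg_def flip: sum_distrib_left)

definition Ci :: "nat => nat => int" where
 "Ci k l = (if k = l then 2 else 0) - int (McKay_mult \<gamma> (Rep k) (Rep l))"

lemma cartan_Ci: "cartan \<gamma> Rep k l = of_int (Ci k l)" by (simp add: cartan_def Ci_def)

lemma corM_rg:
 assumes P: "P \<in> Pr" and Q: "Q \<in> Pr"
 shows "corM P Q = {(\<alpha>, \<beta>) \<in> \<M>. (\<forall>v\<in>rg P. \<alpha> *v v \<in> rg Q \<and> \<beta> *v v \<in> rg Q) \<and>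
   (\<forall>v\<in>orthogonal_comp (rg P). \<alpha> *v v = 0 \<and> \<beta> *v v = 0)}"
proof -
 have comp: "orthogonal_comp (rg P) = {v. P *v v = 0}"
 proof -
  have "v \<in> orthogonal_comp (rg P) \<longleftrightarrow> P *v v = 0" for v
  proof
   assume v: "v \<in> orthogonal_comp (rg P)"
   have "P *v v \<in> rg P" using Pr_fix[OF P] by (simp add: rg_def)
   hence "(P *v v) \<bullet> v = 0" using v by (simp add: orthogonal_comp_def orthogonal_def)
   hence "(P *v v) \<bullet> (P *v v) = 0" using inner_matrix_vector[of P "P *v v" v] Pr_fix[OF P] PrD(2)[OF P] by (simp add: inner_commute)
   thus "P *v v = 0" by simp
  next
   assume v: "P *v v = 0"
   have "w \<bullet> v = 0" if "P *v w = w" for w using inner_matrix_vector[of P w v] that v PrD(2)[OF P] by simp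
   thus "v \<in> orthogonal_comp (rg P)" by (simp add: orthogonal_comp_def orthogonal_def rg_def)
  qed
  thus ?thesis by blast
 qed
 have "Q ** (A ** P) = A \<longleftrightarrow> (\<forall>v\<in>rg P. A *v v \<in> rg Q) \<and> (\<forall>v\<in>{v. P *v v = 0}. A *v v = 0)" for A
 proof
  assume A: "Q ** (A ** P) = A"
  have Av: "A *v v = Q *v (A *v (P *v v))" for v using arg_cong[OF A, of "%B. B *v v"] by (simp flip: mv_assoc)
  have "Q *v (A *v v) = A *v v" for v using Av[of v] Pr_fix[OF Q] by metis
  moreover have "A *v v = 0" if "P *v v = 0" for v using Av[of v] that by simp
  ultimately show "(\<forall>v\<in>rg P. A *v v \<in> rg Q) \<and> (\<forall>v\<in>{v. P *v v = 0}. A *v v = 0)" by (simp add: rg_def)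
 next
  assume A: "(\<forall>v\<in>rg P. A *v v \<in> rg Q) \<and> (\<forall>v\<in>{v. P *v v = 0}. A *v v = 0)"
  show "Q ** (A ** P) = A"
  proof (rule matrix_eqI)
   fix v
   have "P *v (v - P *v v) = 0" by (simp add: matrix_vector_mult_diff_distrib Pr_fix[OF P])
   hence "A *v (v - P *v v) = 0" using A by blast
   hence "A *v v = A *v (P *v v)" by (simp add: matrix_vector_mult_diff_distrib)
   moreover have "Q *v (A *v (P *v v)) = A *v (P *v v)" using A Pr_fix[OF P] by (simp add: rg_def)
   ultimately show "(Q ** (A ** P)) *v v = A *v v" by (simp flip: mv_assoc)
  qed
 qed
 thus ?thesis unfolding comp by (auto simp: corM_def prod_eq_iff)
qed

lemma N_Ci:
 assumes "k \<in> {1..r}" "l \<in> {1..r}"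
 shows "N (Pk k) (Pk l) = of_int (Ci k l)"
proof -
 have P: "Pk k \<in> Pr" "Pk l \<in> Pr" using assms Pk_rg by auto
 have "even (dim (corM (Pk k) (Pk l)))" by (rule quaternionic_dim(1)[OF subspace_corM[OF P]]) (simp add: I_op_eq corM_ps)
 then obtain j where j: "dim (corM (Pk k) (Pk l)) = 2 * j" by (rule evenE)
 moreover have "McKay_mult \<gamma> (Rep k) (Rep l) = dim (corM (Pk k) (Pk l)) div 2"
  unfolding McKay_mult_def corM_rg[OF P] Pk_rg(2)[OF assms(1)] Pk_rg(2)[OF assms(2)] ..
 ultimately have "real (dim (corM (Pk k) (Pk l))) / 2 = real (McKay_mult \<gamma> (Rep k) (Rep l))" by simp
 moreover have "real (dim (cor (Pk k) (Pk l))) = (if k = l then 2 else 0)" using dim_cor_ip[OF P] Pk_ip assms by simp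
 ultimately show ?thesis by (simp add: N_def Ci_def)
qed

lemma Pk_proper: "k \<in> {1..r} ==> Pk k ~= 0 \<and> Pk k ~= mat 1"
proof
 assume k: "k \<in> {1..r}"
 have i: "irr (Pk k)" using Pk_irr k by simp
 thus "Pk k ~= 0" by (simp add: irr_iff)
 show "Pk k ~= mat 1"
 proof
  assume "Pk k = mat 1"
  hence "triv = 0 \<or> triv = Pk k" using i triv_Pr by (auto simp: irr_iff)
  hence "triv = Pk k" using irr_triv by (auto simp: irr_iff)
  thus False using Pk_ch_inj[of 0 k] k by (simp add: Pk_def[of 0])
 qed
qed

lemma Ci_diag: "k \<in> {1..r} ==> Ci k k = 2"
proof -
 assume k: "k \<in> {1..r}"
 have "N (Pk k) (Pk k) = 2" by (rule N_eq_2) (use k Pk_rg Pk_proper N_Ci[OF k k] in \<open>auto simp: Ci_def\<close>)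
 thus ?thesis using N_Ci[OF k k] by simp
qed

lemma Ci_off_diag: "k ~= l ==> Ci k l \<le> 0" by (simp add: Ci_def)

lemma Ci_sym: "k \<in> {1..r} ==> l \<in> {1..r} ==> Ci k l = Ci l k"
proof -
 assume k: "k \<in> {1..r}" and l: "l \<in> {1..r}"
 have "real_of_int (Ci k l) = of_int (Ci l k)" using N_Ci[OF k l] N_Ci[OF l k] N_commute[OF Pk_rg(1)[OF k] Pk_rg(1)[OF l]] by simp
 thus ?thesis by simp
qed

definition bform :: "(nat => int) => (nat => int) => int" where
 "bform u v = (\<Sum>k\<in>{1..r}. \<Sum>l\<in>{1..r}. u k * v l * Ci k l)"

lemma bform_simps:
 "bform (%k. u k + w k) v = bform u v + bform w v" "bform u (%k. v k + w k) = bform u v + bform u w"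
 "bform (%k. u k - w k) v = bform u v - bform w v" "bform u (%k. v k - w k) = bform u v - bform u w"
 by (simp_all add: bform_def algebra_simps sum.distrib sum_subtractf)

lemma bform_sym: "bform u v = bform v u" unfolding bform_def by (subst sum.swap) (auto intro!: sum.cong simp: Ci_sym mult_ac)

lemma bform_even: "even (bform v v)" unfolding bform_def by (rule even_symmetric_sum) (auto simp: Ci_sym Ci_diag mult_ac)

definition chv :: "(nat => int) => 'g => complex" where
 "chv v g = (\<Sum>k\<in>{1..r}. of_int (v k) * ch (Pk k) g)"

lemma bform_avg: "of_int (bform v v) = avg (%g. (2 - ch2 g) * (cmod (chv v g))\<^sup>2)"
proof -
 have c2: "(cmod z)\<^sup>2 = Re (z * cnj z)" for z :: complex by (simp add: cmod_power2 flip: power2_eq_square)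
 have "(of_int (bform v v) :: real) = (\<Sum>k\<in>{1..r}. \<Sum>l\<in>{1..r}. of_int (v k) * of_int (v l) * N (Pk k) (Pk l))"
  unfolding bform_def by (simp add: N_Ci)
 also have "... = (\<Sum>k\<in>{1..r}. \<Sum>l\<in>{1..r}. avg (%g. (2 - ch2 g) * Re (of_int (v l) * ch (Pk l) g * cnj (of_int (v k) * ch (Pk k) g))))"
 proof (intro sum.cong refl)
  fix k l assume "k \<in> {1..r}" "l \<in> {1..r}"
  hence "of_int (v k) * of_int (v l) * N (Pk k) (Pk l) =
    avg (%g. (of_int (v k) * of_int (v l)) * ((2 - ch2 g) * Re (ch (Pk l) g * cnj (ch (Pk k) g))))" by (simp only: N_eq Pk_rg avg_cmult)
  also have "... = avg (%g. (2 - ch2 g) * Re (of_int (v l) * ch (Pk l) g * cnj (of_int (v k) * ch (Pk k) g)))"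
   by (rule arg_cong[where f = avg]) (simp add: fun_eq_iff algebra_simps)
  finally show "of_int (v k) * of_int (v l) * N (Pk k) (Pk l) =
   avg (%g. (2 - ch2 g) * Re (of_int (v l) * ch (Pk l) g * cnj (of_int (v k) * ch (Pk k) g)))" .
 qed
 also have "... = avg (%g. \<Sum>k\<in>{1..r}. \<Sum>l\<in>{1..r}. (2 - ch2 g) * Re (of_int (v l) * ch (Pk l) g * cnj (of_int (v k) * ch (Pk k) g)))"
  by (simp only: avg_sum)
 also have "(%g. \<Sum>k\<in>{1..r}. \<Sum>l\<in>{1..r}. (2 - ch2 g) * Re (of_int (v l) * ch (Pk l) g * cnj (of_int (v k) * ch (Pk k) g)))
   = (%g. (2 - ch2 g) * (cmod (chv v g))\<^sup>2)"
 proof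
  fix g
  have "chv v g * cnj (chv v g) = (\<Sum>k\<in>{1..r}. \<Sum>l\<in>{1..r}. of_int (v l) * ch (Pk l) g * cnj (of_int (v k) * ch (Pk k) g))"
   unfolding chv_def cnj_sum by (subst sum_product) (rule sum.swap)
  thus "(\<Sum>k\<in>{1..r}. \<Sum>l\<in>{1..r}. (2 - ch2 g) * Re (of_int (v l) * ch (Pk l) g * cnj (of_int (v k) * ch (Pk k) g)))
   = (2 - ch2 g) * (cmod (chv v g))\<^sup>2" unfolding c2 by (simp only: Re_sum sum_distrib_left)
 qed
 finally show ?thesis .
qed

lemma avg_ch_Pk: "k \<in> {1..r} ==> avg (ch (Pk k)) = 0"
 using avg_ch_real[of triv "Pk k"] Pk_ip[of 0 k] Pk_rg[of k] triv_Pr by (simp add: ch_triv Pk_def[of 0])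

lemma bform_nonneg: "bform v v \<ge> 0"
proof -
 have "(\<Sum>g\<in>UNIV. (2 - ch2 g) * (cmod (chv v g))\<^sup>2) \<ge> 0" using ch2_le by (intro sum_nonneg mult_nonneg_nonneg) auto
 hence "(of_int (bform v v) :: real) \<ge> 0" unfolding bform_avg avg_def using order_pos by simp
 thus ?thesis by simp
qed

lemma bform_definite:
 assumes "bform v v = 0" "k \<in> {1..r}" shows "v k = 0"
proof -
 have "avg (%g. (2 - ch2 g) * (cmod (chv v g))\<^sup>2) = 0" using assms bform_avg[of v] by simp
 hence "(\<Sum>g\<in>UNIV. (2 - ch2 g) * (cmod (chv v g))\<^sup>2) = 0" using order_pos by (simp add: avg_def)
 hence z: "(2 - ch2 g) * (cmod (chv v g))\<^sup>2 = 0" for g using ch2_le by (subst (asm) sum_nonneg_eq_0_iff) auto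
 have off: "chv v g = 0" if "g ~= ge" for g using z[of g] ch2_eq[of g] that by auto
 have "avg (chv v) = (\<Sum>k\<in>{1..r}. of_int (v k) * avg (ch (Pk k)))" unfolding chv_def by (simp only: avg_sum avg_cmult)
 also have "... = 0" by (simp add: avg_ch_Pk)
 finally have "(\<Sum>g\<in>UNIV. chv v g) = 0" using order_pos by (simp add: avg_def)
 moreover have "(\<Sum>g\<in>UNIV. chv v g) = (\<Sum>g\<in>UNIV. if g = ge then chv v ge else 0)" using off by (intro sum.cong) auto
 ultimately have "chv v ge = 0" by simp
 hence all: "chv v g = 0" for g using off by (cases "g = ge") auto
 have "0 = avg (%g. chv v g * cnj (ch (Pk k) g))" by (simp add: all avg_const)
 also have "... = (\<Sum>l\<in>{1..r}. of_int (v l) * avg (%g. ch (Pk l) g * cnj (ch (Pk k) g)))"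
  unfolding chv_def sum_distrib_right by (simp only: avg_sum avg_cmult mult.assoc)
 also have "... = (\<Sum>l\<in>{1..r}. if l = k then of_int (v k) else 0)"
 proof (rule sum.cong)
  fix l assume l: "l \<in> {1..r}"
  thus "of_int (v l) * avg (%g. ch (Pk l) g * cnj (ch (Pk k) g)) = (if l = k then of_int (v k) else 0)"
   using avg_ch_real[OF Pk_rg(1)[OF assms(2)] Pk_rg(1)[OF l]] Pk_ip[of k l] assms(2) by auto
 qed simp
 also have "... = of_int (v k)" using assms(2) by simp
 finally show ?thesis by (metis of_int_0_eq_iff)
qed

definition lin :: "(nat => int) => (nat => real) => real" where
 "lin v h = (\<Sum>k\<in>{1..r}. of_int (v k) * h k)"

definition unit :: "nat => nat => int" where
 "unit k l = (if l = k then 1 else 0)"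

lemma bform_unit:
 assumes "k \<in> {1..r}"
 shows "bform v (unit k) = (\<Sum>l\<in>{1..r}. v l * Ci l k)" "bform (unit k) (unit k) = 2"
proof -
 show a: "bform v (unit k) = (\<Sum>l\<in>{1..r}. v l * Ci l k)" for v unfolding bform_def using assms
  by (intro sum.cong refl) (simp add: unit_def if_distrib[of "%x. _ * x"] if_distrib[of "%x. x * _"] cong: if_cong)
 have "bform (unit k) (unit k) = (\<Sum>l\<in>{1..r}. if l = k then Ci k k else 0)" unfolding a by (intro sum.cong refl) (simp add: unit_def)
 thus "bform (unit k) (unit k) = 2" using assms by (simp add: Ci_diag)
qed

lemma lin_coroot: "k \<in> {1..r} ==> lin v (simple_coroot \<gamma> r Rep k) = of_int (bform v (unit k))" unfolding lin_def bform_unit of_int_sum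
 by (intro sum.cong refl) (simp add: simple_coroot_def cartan_Ci Ci_sym)

text \<open>A positive vector of norm two is a simple root, or pairs positively with some simple root and is the
 reflection of a smaller such vector.\<close>

lemma positive_root:
 assumes "!!k. k \<in> {1..r} ==> v k \<ge> 0" "bform v v = 2"
 shows "lin v \<in> roots \<gamma> r Rep" using assms
proof (induction "nat (\<Sum>k\<in>{1..r}. v k)" arbitrary: v rule: less_induct)
 case less
 have "bform v v = (\<Sum>k\<in>{1..r}. v k * bform v (unit k))"
  unfolding bform_def[of v v] by (subst sum.swap) (auto intro!: sum.cong simp: bform_unit sum_distrib_left mult_ac)
 hence "(\<Sum>k\<in>{1..r}. v k * bform v (unit k)) > 0" using less.prems by simp
 then obtain k where k: "k \<in> {1..r}" "v k * bform v (unit k) > 0" by (meson not_less sum_nonpos)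
 hence vk: "v k \<ge> 1" "bform v (unit k) \<ge> 1" using less.prems(1)[OF k(1)] by (auto simp: zero_less_mult_iff)
 let ?w = "%l. v l - unit k l"
 have w: "bform ?w ?w = 4 - 2 * bform v (unit k)" using bform_sym[of "unit k" v] less.prems(2) bform_unit(2)[OF k(1)] by (simp add: bform_simps)
 show ?case
 proof (cases "bform v (unit k) = 1")
  case True
  have pos: "?w l \<ge> 0" if "l \<in> {1..r}" for l using less.prems(1)[OF that] vk by (simp add: unit_def)
  have "(\<Sum>l\<in>{1..r}. ?w l) = (\<Sum>l\<in>{1..r}. v l) - 1" using k(1) by (simp add: sum_subtractf unit_def)
  moreover have "(\<Sum>l\<in>{1..r}. ?w l) \<ge> 0" by (rule sum_nonneg) (rule pos)
  ultimately have "nat (\<Sum>l\<in>{1..r}. ?w l) < nat (\<Sum>l\<in>{1..r}. v l)" by simp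
  hence "lin ?w \<in> roots \<gamma> r Rep" using less.hyps[of ?w] pos w True by simp
  from roots.reflect[OF this k(1)]
  have "(%h. lin ?w h - lin ?w (simple_coroot \<gamma> r Rep k) * simple_root k h) \<in> roots \<gamma> r Rep" .
  moreover have "lin ?w (simple_coroot \<gamma> r Rep k) = - 1" by (simp add: lin_coroot[OF k(1)] bform_simps bform_unit(2)[OF k(1)] True)
  moreover have "lin ?w h + h k = lin v h" for h
  proof -
   have "lin v h - lin ?w h = (\<Sum>l\<in>{1..r}. if l = k then h k else 0)"
    unfolding lin_def sum_subtractf[symmetric] by (intro sum.cong refl) (simp add: unit_def algebra_simps)
   thus ?thesis using k(1) by simp
  qed
  ultimately show ?thesis by (simp add: simple_root_def)
 next
  case False
  hence "bform ?w ?w \<le> 0" using vk w by simp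
  hence "bform ?w ?w = 0" using bform_nonneg[of ?w] by simp
  hence "v l = unit k l" if "l \<in> {1..r}" for l using bform_definite[OF _ that] by fastforce
  hence "lin v h = (\<Sum>l\<in>{1..r}. if l = k then h k else 0)" for h unfolding lin_def by (intro sum.cong refl) (simp add: unit_def)
  hence "lin v = simple_root k" using k(1) by (simp add: fun_eq_iff simple_root_def)
  thus ?thesis using roots.simple[OF k(1)] by simp
 qed
qed

text \<open>The positive and the negative part pair nonpositively and have even norms, so one of them vanishes.\<close>

lemma root_of_norm_2:
 assumes "bform v v = 2"
 shows "lin v \<in> roots \<gamma> r Rep \<or> lin (%k. - v k) \<in> roots \<gamma> r Rep"
proof -
 define p where "p k = max (v k) 0" for k
 define n where "n k = max (- v k) 0" for k
 have v: "v = (%k. p k - n k)" by (auto simp: p_def n_def fun_eq_iff max_def)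
 have "bform p n \<le> 0" unfolding bform_def
 proof (intro sum_nonpos)
  fix k l assume "k \<in> {1..r}" "l \<in> {1..r}"
  show "p k * n l * Ci k l \<le> 0"
  proof (cases "k = l")
   case False
   hence "Ci k l \<le> 0" by (rule Ci_off_diag)
   moreover have "p k * n l \<ge> 0" by (simp add: p_def n_def)
   ultimately show ?thesis by (simp add: mult_nonneg_nonpos)
  qed (simp add: p_def n_def max_def)
 qed
 moreover have "bform v v = bform p p + bform n n - 2 * bform p n" unfolding v by (simp add: bform_simps bform_sym[of n p])
 ultimately have le: "bform p p + bform n n \<le> 2" using assms by simp
 moreover have "bform p p \<ge> 0" "bform n n \<ge> 0" "even (bform p p)" "even (bform n n)" using bform_nonneg bform_even by blast+
 ultimately consider "bform p p = 0" | "bform n n = 0" by (cases "bform p p = 0"; cases "bform n n = 0") (auto elim!: evenE)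
 thus ?thesis
 proof cases
  case 1
  hence "- v k \<ge> 0" if "k \<in> {1..r}" for k using bform_definite[OF 1 that] by (simp add: p_def max_def split: if_splits)
  moreover have "bform (%k. - v k) (%k. - v k) = 2" using assms by (simp add: bform_def)
  ultimately show ?thesis using positive_root[of "%k. - v k"] by auto
 next
  case 2
  hence "v k \<ge> 0" if "k \<in> {1..r}" for k using bform_definite[OF 2 that] by (simp add: n_def max_def split: if_splits)
  thus ?thesis using positive_root[of v] assms by auto
 qed
qed

lemma ch_one_decompose:
 obtains n :: "nat => nat" where "!!g. ch (mat 1) g = (\<Sum>k\<le>r. of_nat (n k) * ch (Pk k) g)" "n 0 = 1"
proof -
 obtain n :: "nat => nat" where n: "!!g. ch (mat 1) g = (\<Sum>k\<le>r. of_nat (n k) * ch (Pk k) g)" by (rule ch_decompose[OF Pr_0_1(2)]) blast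
 have P0: "Pk 0 = triv" by (simp add: Pk_def)
 have "avg (ch (mat 1)) = (\<Sum>k\<le>r. of_nat (n k) * avg (ch (Pk k)))" unfolding n by (simp only: avg_sum avg_cmult)
 also have "... = (\<Sum>k\<le>r. if k = 0 then of_nat (n 0) else 0)"
 proof (rule sum.cong)
  fix k assume "k \<in> {..r}"
  moreover have "avg (ch (Pk 0)) = 1" using avg_const[of "1::complex"] by (simp add: P0 ch_triv[abs_def])
  ultimately show "of_nat (n k) * avg (ch (Pk k)) = (if k = 0 then of_nat (n 0) else 0)" using avg_ch_Pk[of k] by auto
 qed simp
 finally have "avg (ch (mat 1)) = of_nat (n 0)" by simp
 moreover have "avg (ch (mat 1)) = 1"
 proof -
  have "(\<Sum>g\<in>UNIV. ch (mat 1) g) = (\<Sum>g\<in>UNIV. if g = ge then of_real order else 0)"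
   by (intro sum.cong) (auto simp: ch_def trace_reg order_def)
  thus ?thesis using order_pos by (simp add: avg_def scaleR_conv_of_real)
 qed
 ultimately have "n 0 = 1" by (metis of_nat_1 of_nat_eq_iff)
 thus ?thesis using n that by blast
qed

text \<open>Subtracting a multiple of the regular representation, which is in the kernel of the form, turns the
 class into an integral vector of norm two on the nontrivial irreducible representations.\<close>

lemma root_of_class:
 assumes P: "P \<in> Pr" and N: "N P P = 2"
 obtains \<theta> where "\<theta> \<in> roots \<gamma> r Rep"
  "!!t h. t \<in> cen ==> trace t = 0 ==> (!!k. k \<in> {1..r} ==> h k = val t (Pk k)) ==> \<bar>\<theta> h\<bar> = \<bar>val t P\<bar>"
proof -
 obtain d :: "nat => nat" where d: "!!g. ch P g = (\<Sum>k\<le>r. of_nat (d k) * ch (Pk k) g)" by (rule ch_decompose[OF P]) blast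
 obtain n :: "nat => nat" where n: "!!g. ch (mat 1) g = (\<Sum>k\<le>r. of_nat (n k) * ch (Pk k) g)" "n 0 = 1" by (rule ch_one_decompose) blast
 define v where "v k = int (d k) - int (d 0) * int (n k)" for k
 have split: "(\<Sum>k\<le>r. f k) = f 0 + (\<Sum>k\<in>{1..r}. f k)" for f :: "nat => complex" by (simp add: atMost_atLeast0 sum.atLeast_Suc_atMost)
 have chv: "chv v g = ch P g - of_nat (d 0) * ch (mat 1) g" for g
  unfolding chv_def d n(1) split v_def by (simp add: n(2) algebra_simps sum_subtractf sum_distrib_left)
 have e: "(2 - ch2 g) * (cmod (chv v g))\<^sup>2 = (2 - ch2 g) * (cmod (ch P g))\<^sup>2" for g
 proof (cases "g = ge")
  case True
  hence "ch2 g = 2" by (simp add: ch2_def \<gamma>_ge mat_def)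
  thus ?thesis by simp
 next
  case False
  hence "ch (mat 1) g = 0" by (simp add: ch_def trace_reg)
  thus ?thesis by (simp add: chv)
 qed
 have "real_of_int (bform v v) = 2" using N by (simp only: bform_avg N_self[OF P] e)
 hence b2: "bform v v = 2" by simp
 have lv: "lin v h = val t P" if t: "t \<in> cen" "trace t = 0" "!!k. k \<in> {1..r} ==> h k = val t (Pk k)" for t h
 proof -
  have tr: "trace (t ** Q) = (\<Sum>k\<le>r. of_nat (c k) * trace (t ** Pk k))"
   if "!!g. ch Q g = (\<Sum>k\<le>r. of_nat (c k) * ch (Pk k) g)" for Q and c :: "nat => nat" unfolding cen_trace[OF t(1)] that sum_distrib_left
   by (subst sum.swap) (simp add: mult_ac)
  have "trace (t ** P) = trace (t ** P) - of_nat (d 0) * trace (t ** mat 1)" using t(2) by simp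
  also have "... = (\<Sum>k\<in>{1..r}. of_int (v k) * trace (t ** Pk k))"
   unfolding tr[OF d] tr[OF n(1)] split v_def by (simp add: n(2) algebra_simps sum_subtractf sum_distrib_left)
  finally have "val t P = (\<Sum>k\<in>{1..r}. of_int (v k) * val t (Pk k))" by (simp add: val_def)
  thus ?thesis unfolding lin_def using t(3) by simp
 qed
 have "lin (%k. - v k) h = - lin v h" for h by (simp add: lin_def sum_negf)
 from root_of_norm_2[OF b2] show ?thesis
 proof
  assume "lin v \<in> roots \<gamma> r Rep"
  thus ?thesis
  proof (rule that)
   fix t h assume "t \<in> cen" "trace t = 0" "!!k. k \<in> {1..r} ==> h k = val t (Pk k)"
   hence "lin v h = val t P" by (rule lv)
   thus "\<bar>lin v h\<bar> = \<bar>val t P\<bar>" by simp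
  qed
 next
  assume "lin (%k. - v k) \<in> roots \<gamma> r Rep"
  thus ?thesis
  proof (rule that)
   fix t h assume "t \<in> cen" "trace t = 0" "!!k. k \<in> {1..r} ==> h k = val t (Pk k)"
   hence "lin v h = val t P" by (rule lv)
   thus "\<bar>lin (%k. - v k) h\<bar> = \<bar>val t P\<bar>" by (simp add: \<open>!!h. lin (%k. - v k) h = - lin v h\<close>)
  qed
 qed
qed

end

section \<open>Orthogonal projections\<close>

lemma orth_projection:
 fixes S :: "'a::euclidean_space set"
 assumes S: "subspace S"
 obtains p where "linear p" "!!x. p x \<in> S" "!!x. x \<in> S ==> p x = x" "!!x y. p x \<bullet> y = x \<bullet> p y"
proof -
 obtain B where B: "B \<subseteq> S" "pairwise orthogonal B" "!!x. x \<in> B ==> norm x = 1" "independent B" "card B = dim S" "span B = S"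
  using orthonormal_basis_subspace[OF S] by metis
 let ?p = "%x. \<Sum>b\<in>B. (x \<bullet> b) *\<^sub>R b"
 show ?thesis
 proof (rule that[of ?p])
  show "linear ?p" by (rule linearI) (simp_all add: inner_add_left scaleR_add_left sum.distrib scaleR_sum_right)
  show "?p x \<in> S" for x using B(1) S by (intro subspace_sum subspace_scale) auto
  show "?p x = x" if "x \<in> S" for x by (rule orthonormal_basis_expand[OF B(2,3)]) (simp_all add: B(6) that independent_imp_finite[OF B(4)])
  show "?p x \<bullet> y = x \<bullet> ?p y" for x y unfolding inner_sum_left inner_sum_right by (simp add: inner_commute mult.commute)
 qed
qed

lemma orthogonal_decomposition:
 fixes x :: "'a::euclidean_space"
 assumes "subspace S"
 obtains s where "s \<in> S" "!!y. y \<in> S ==> (x - s) \<bullet> y = 0"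
proof -
 obtain y z where "y \<in> span S" "!!w. w \<in> span S ==> orthogonal z w" "x = y + z" by (rule orthogonal_subspace_decomp_exists[of S x]) blast
 thus ?thesis unfolding span_eq_iff[THEN iffD2, OF assms] by (intro that[of y]) (simp_all add: orthogonal_def)
qed

context mckay
begin

section \<open>Central levels as central matrices\<close>

lemma subspace_lie: "subspace (lieG)" by (auto simp: subspace_def lie_def C_closed)

text \<open>An orthonormal basis makes the representing matrix of a functional continuous in the functional.\<close>

definition lieB :: "'g End set" where
 "lieB = (SOME B. B \<subseteq> lieG \<and> pairwise orthogonal B \<and> (\<forall>b\<in>B. norm b = 1) \<and> independent B \<and> span B = lieG)"

text \<open>The matrix that represents a functional on the Lie algebra.\<close>

definition tz :: "('g End => real) => 'g End" where
 "tz \<xi> = (\<Sum>b\<in>lieB. \<xi> b *\<^sub>R b)"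

lemma lieB: "finite lieB" "lieB \<subseteq> lieG"
 "(!!x y a b. x \<in> lieG ==> y \<in> lieG ==> \<xi> (a *\<^sub>R x + b *\<^sub>R y) = a * \<xi> x + b * \<xi> y) ==>
   x \<in> lieG ==> \<xi> x = tz \<xi> \<bullet> x"
proof -
 have "\<exists>B \<subseteq> lieG. pairwise orthogonal B \<and> (\<forall>b\<in>B. norm b = 1) \<and> independent B \<and> span B = lieG"
  using orthonormal_basis_subspace[OF subspace_lie] by metis
 from someI_ex[OF this, folded lieB_def]
 have B: "lieB \<subseteq> lieG" "pairwise orthogonal lieB" "!!b. b \<in> lieB ==> norm b = 1" "independent lieB" "span lieB = lieG" by blast+
 show fB: "finite lieB" using B(4) by (rule independent_imp_finite)
 show "lieB \<subseteq> lieG" by (rule B(1))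
 assume lin: "!!x y a b. x \<in> lieG ==> y \<in> lieG ==> \<xi> (a *\<^sub>R x + b *\<^sub>R y) = a * \<xi> x + b * \<xi> y" and x: "x \<in> lieG"
 have sum: "\<xi> (\<Sum>b\<in>F. c b *\<^sub>R b) = (\<Sum>b\<in>F. c b * \<xi> b)" if "F \<subseteq> lieB" for F c
  using finite_subset[OF that fB] that
 proof (induction F rule: finite_induct)
  case empty
  show ?case using lin[of x x 0 0] x by simp
 next
  case (insert b F)
  have "(\<Sum>b\<in>F. c b *\<^sub>R b) \<in> lieG" using insert.prems B(1) by (intro subspace_sum subspace_scale subspace_lie) auto
  thus ?case using lin[of b _ "c b" 1] insert B(1) by auto
 qed
 have "(\<Sum>b\<in>lieB. (x \<bullet> b) *\<^sub>R b) = x" by (rule orthonormal_basis_expand[OF B(2,3) _ fB]) (simp_all add: B(5) x)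
 with sum[OF subset_refl, of "%b. x \<bullet> b"] have "\<xi> x = (\<Sum>b\<in>lieB. (x \<bullet> b) * \<xi> b)" by simp
 thus "\<xi> x = tz \<xi> \<bullet> x" by (simp add: tz_def inner_sum_left mult.commute inner_commute[of x])
qed

lemma tz_lie: "tz \<xi> \<in> lieG" unfolding tz_def using lieB(2) by (intro subspace_sum[OF subspace_lie] subspace_scale[OF subspace_lie]) auto

lemma lieI: "X \<in> \<C> ==> X\<^sup>H = - X ==> X \<in> lieG" and lieD: "X \<in> lieG ==> X \<in> \<C>" "X \<in> lieG ==> X\<^sup>H = - X"
 by (simp_all add: lie_def)

lemma tz_apply: "\<xi> \<in> lie_dual \<gamma> ==> X \<in> lieG ==> \<xi> X = tz \<xi> \<bullet> X" by (rule lieB(3)) (simp_all add: lie_dual_def)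

lemma lie_eqI:
 assumes "A \<in> lieG" "B \<in> lieG" "!!X. X \<in> lieG ==> A \<bullet> X = B \<bullet> X" shows "A = B"
proof -
 have "A - B \<in> lieG" using assms(1,2) subspace_diff[OF subspace_lie] by blast
 from assms(3)[OF this] have "(A - B) \<bullet> (A - B) = 0" by (simp add: inner_diff_left)
 thus ?thesis by simp
qed

lemma matrix_inv_eq: "A ** B = mat 1 ==> matrix_inv A = B" for A B :: "'g End"
proof -
 assume AB: "A ** B = mat 1"
 hence BA: "B ** A = mat 1" using matrix_left_right_inverse by blast
 have "A ** matrix_inv A = mat 1 \<and> matrix_inv A ** A = mat 1" unfolding matrix_inv_def by (rule someI[of _ B]) (simp add: AB BA)
 hence "matrix_inv A = (B ** A) ** matrix_inv A" by (simp add: BA)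
 thus ?thesis using \<open>A ** matrix_inv A = mat 1 \<and> _\<close> by (simp add: assoc_r)
qed

lemma unitariesD: assumes "u \<in> unitaries \<gamma>"
 shows "u \<in> \<C>" "u\<^sup>H ** u = mat 1" "u ** u\<^sup>H = mat 1" "matrix_inv u = u\<^sup>H"
proof -
 show 1: "u \<in> \<C>" "u\<^sup>H ** u = mat 1" using assms by (simp_all add: unitaries_def)
 show 2: "u ** u\<^sup>H = mat 1" using 1(2) matrix_left_right_inverse by blast
 show "matrix_inv u = u\<^sup>H" by (rule matrix_inv_eq[OF 2])
qed

lemma act_eq: "u \<in> unitaries \<gamma> ==> act u m = u |> (m <| u\<^sup>H)" by (simp add: act_def unitariesD pair_defs assoc_r)

lemma adj_inner: "A\<^sup>H \<bullet> B = A \<bullet> B\<^sup>H" for A B :: "'g End" using inner_conj_transpose[of A "B\<^sup>H"] by simp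

text \<open>Ad-invariance makes the representing matrix commute with all unitary elements, in particular with
 the Cayley transforms of the elements of the Lie algebra; these recover the Lie algebra.\<close>

lemma tz_cen:
 assumes \<xi>: "\<xi> \<in> Z_space \<gamma>"
 shows "tz \<xi> \<in> cen" "trace (tz \<xi>) = 0" "(tz \<xi>)\<^sup>H = - tz \<xi>"
proof -
 let ?t = "tz \<xi>"
 have d: "\<xi> \<in> lie_dual \<gamma>" using \<xi> by (simp add: Z_space_def)
 have t: "?t \<in> lieG" by (rule tz_lie)
 show sk: "?t\<^sup>H = - ?t" using t by (rule lieD)
 have u: "?t ** u = u ** ?t" if u: "u \<in> unitaries \<gamma>" for u
 proof -
  note U = unitariesD[OF u]
  have L: "u ** X ** u\<^sup>H \<in> lieG" "u\<^sup>H ** X ** u \<in> lieG" if "X \<in> lieG" for X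
   using lieD[OF that] U(1) by (auto intro!: lieI C_closed C_adj simp: adj_mult mm)
  have "u\<^sup>H ** ?t ** u = ?t"
  proof (rule lie_eqI[OF L(2)[OF t] t])
   fix X assume X: "X \<in> lieG"
   have "(u\<^sup>H ** ?t ** u) \<bullet> X = ?t \<bullet> (u ** X ** u\<^sup>H)" by (simp add: inner_sandwich)
   also have "... = \<xi> (u ** X ** matrix_inv u)" using tz_apply[OF d L(1)[OF X]] U(4) by simp
   also have "... = \<xi> X" using \<xi> X u by (simp add: Z_space_def)
   also have "... = ?t \<bullet> X" by (rule tz_apply[OF d X])
   finally show "(u\<^sup>H ** ?t ** u) \<bullet> X = ?t \<bullet> X" .
  qed
  hence "u ** (u\<^sup>H ** ?t ** u) = u ** ?t" by simp
  thus ?thesis by (simp add: mm_assoc U(3))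
 qed
 have c: "?t ** X = X ** ?t" if X: "X \<in> lieG" for X
 proof -
  note X' = lieD[OF X]
  have inj: "v = 0" if "(mat 1 - X) *v v = 0" for v
  proof -
   have e: "X *v v = v" using that by (simp add: mv_diff)
   have "(X *v v) \<bullet> v = v \<bullet> ((- X) *v v)" by (simp add: inner_matrix_vector X'(2))
   also have "(- X) *v v = - (X *v v)" by (simp add: vec_eq_iff matrix_vector_mult_def sum_negf)
   finally have "v \<bullet> v = 0" by (simp add: e)
   thus ?thesis by simp
  qed
  have "mat 1 - X \<in> \<C>" by (simp add: C_closed X')
  from inverse_C[OF this inj] obtain B where B: "B \<in> \<C>" "B ** (mat 1 - X) = mat 1" "(mat 1 - X) ** B = mat 1" by metis
  define A where "A = (mat 1 + X) ** B"
  have BH: "B\<^sup>H ** (mat 1 + X) = mat 1"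
  proof -
   have "((mat 1 - X) ** B)\<^sup>H = mat 1" by (simp add: B adj_mat)
   thus ?thesis by (simp add: adj_mult X' adj_mat)
  qed
  have "A\<^sup>H ** A = B\<^sup>H ** ((mat 1 - X) ** (mat 1 + X)) ** B" unfolding A_def by (simp add: adj_mult X' adj_mat assoc_r)
  also have "(mat 1 - X) ** (mat 1 + X) = (mat 1 + X) ** (mat 1 - X)" by (simp add: mm)
  also have "B\<^sup>H ** ... ** B = (B\<^sup>H ** (mat 1 + X)) ** ((mat 1 - X) ** B)" by (simp only: assoc_r)
  also have "... = mat 1" by (simp add: BH B)
  finally have "A \<in> unitaries \<gamma>" using B X' by (simp add: unitaries_def A_def C_closed)
  from u[OF this] have tA: "?t ** A = A ** ?t" .
  have "X ** B = B - mat 1" using B(3) by (simp add: mm algebra_simps)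
  hence "A = B + B - mat 1" unfolding A_def by (simp add: matrix_add_rdistrib)
  hence "?t ** (B + B - mat 1) = (B + B - mat 1) ** ?t" using tA by simp
  hence "?t ** B + ?t ** B - ?t = B ** ?t + B ** ?t - ?t" by (simp only: mult_diff matrix_add_ldistrib matrix_add_rdistrib mult_id)
  hence tB: "?t ** B = B ** ?t" by (simp add: vec_eq_iff)
  have "(mat 1 - X) ** (?t ** B) ** (mat 1 - X) = (mat 1 - X) ** (B ** ?t) ** (mat 1 - X)" by (simp only: tB)
  hence "(mat 1 - X) ** ?t ** (B ** (mat 1 - X)) = ((mat 1 - X) ** B) ** ?t ** (mat 1 - X)" by (simp only: assoc_r)
  hence "(mat 1 - X) ** ?t = ?t ** (mat 1 - X)" by (simp only: B mult_id)
  thus ?thesis by (simp add: mm)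
 qed
 show "?t \<in> cen" unfolding cen_def
 proof (safe)
  show "?t \<in> \<C>" using t by (rule lieD)
  fix X assume X: "X \<in> \<C>"
  let ?A = "X - X\<^sup>H" and ?B = "\<i> \<odot> (X + X\<^sup>H)"
  have "?A \<in> lieG" "?B \<in> lieG" using X by (auto intro!: lieI C_closed C_adj simp: adj_cs cs_distribs)
  from c[OF this(1)] c[OF this(2)]
  have 1: "?t ** X - ?t ** X\<^sup>H = X ** ?t - X\<^sup>H ** ?t" and "\<i> \<odot> (?t ** X + ?t ** X\<^sup>H) = \<i> \<odot> (X ** ?t + X\<^sup>H ** ?t)" by (simp_all add: mm)
  from arg_cong[OF this(2), of "%A. (- \<i>) \<odot> A"] have 2: "?t ** X + ?t ** X\<^sup>H = X ** ?t + X\<^sup>H ** ?t" by simp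
  have "2 *\<^sub>R (?t ** X) = (?t ** X - ?t ** X\<^sup>H) + (?t ** X + ?t ** X\<^sup>H)" by (simp add: vec_eq_iff scaleR_2)
  also have "... = 2 *\<^sub>R (X ** ?t)" unfolding 1 2 by (simp add: vec_eq_iff scaleR_2)
  finally have "2 *\<^sub>R (?t ** X) = 2 *\<^sub>R (X ** ?t)" .
  thus "?t ** X = X ** ?t" by simp
 qed
 have mc: "mat c = c \<odot> (mat 1 :: 'g End)" for c using mat_mult_eq_cs[of c "mat 1"] by simp
 have mi: "mat \<i> \<in> lieG" unfolding mc[of \<i>] by (rule lieI) (simp_all add: C_closed adj_cs adj_mat)
 have "\<forall>t::real. \<xi> (mat (\<i> * of_real t)) = 0" using d by (simp add: lie_dual_def)
 from this[rule_format, of 1] have "\<xi> (mat \<i>) = 0" by simp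
 hence "?t \<bullet> mat \<i> = 0" using tz_apply[OF d mi] by simp
 hence im: "Im (trace ?t) = 0" unfolding mc[of \<i>] by (simp add: inner_trace adj_cs adj_mat mm)
 have "cnj (trace ?t) = - trace ?t" using trace_adj[of ?t] sk by simp
 hence "Re (trace ?t) = 0" by (simp add: complex_eq_iff)
 with im show "trace ?t = 0" by (simp add: complex_eq_iff)
qed

lemma continuous_tz: "continuous_on UNIV tz" unfolding tz_def by (intro continuous_intros continuous_on_product_coordinates)

definition TT :: "('g End => real) \<times> ('g End => real) \<times> ('g End => real) => 'g End" where
 "TT \<zeta> = (2 * \<i>) \<odot> tz (fst \<zeta>)"
definition LL :: "('g End => real) \<times> ('g End => real) \<times> ('g End => real) => 'g End" where
 "LL \<zeta> = - tz (fst (snd \<zeta>)) - \<i> \<odot> tz (snd (snd \<zeta>))"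

definition Lev :: "'g End => 'g End => 'g pair set" where
 "Lev T L = {m \<in> \<M>. rmom m = T \<and> om m m = L}"

abbreviation "Z3 \<equiv> Z_space \<gamma> \<times> Z_space \<gamma> \<times> Z_space \<gamma>"

lemma moment_inner:
 assumes X: "X \<in> lieG" and m: "m \<in> \<M>"
 shows "moment_comp \<gamma> I_op m X = ((- \<i> / 2) \<odot> rmom m) \<bullet> X"
  "moment_comp \<gamma> J_op m X = ((1 / 2) \<odot> ((om m m)\<^sup>H - om m m)) \<bullet> X"
  "moment_comp \<gamma> K_op m X = ((\<i> / 2) \<odot> ((om m m)\<^sup>H + om m m)) \<bullet> X"
proof -
 have XH: "X\<^sup>H = - X" using lieD[OF X] by blast
 have i1: "inf_act X m \<bullet> n = X \<bullet> (lip n m - rip n m)" for n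
  by (simp add: inf_act_eq inner_diff_left inner_lm inner_rm inner_diff_right)
 have sk: "X \<bullet> W = ((1/2) \<odot> (W - W\<^sup>H)) \<bullet> X" for W
 proof -
  have "W\<^sup>H \<bullet> X = - (W \<bullet> X)" by (simp add: adj_inner XH)
  hence "(W - W\<^sup>H) \<bullet> X = 2 * (X \<bullet> W)" by (simp add: inner_diff_left inner_commute[of X W])
  moreover have "(1/2) \<odot> (W - W\<^sup>H) = (1/2) *\<^sub>R (W - W\<^sup>H)" using cs_of_real[of "1/2"] by simp
  ultimately show ?thesis by simp
 qed
 have "I_op (inf_act X m) \<bullet> m = - (inf_act X m \<bullet> I_op m)" by (rule structures_skew)
 also have "... = X \<bullet> (- (lip (I_op m) m - rip (I_op m) m))" by (simp only: i1 inner_minus_right)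
 also have "- (lip (I_op m) m - rip (I_op m) m) = - (\<i> \<odot> rmom m)" by (simp add: I_op_eq lip_def rip_def rmom_def mm cs_distribs)
 finally have "I_op (inf_act X m) \<bullet> m = X \<bullet> (- (\<i> \<odot> rmom m))" .
 hence "moment_comp \<gamma> I_op m X = ((1/2) *\<^sub>R (- (\<i> \<odot> rmom m))) \<bullet> X" using X by (simp add: moment_comp_def inner_commute)
 also have "(1/2) *\<^sub>R (- (\<i> \<odot> rmom m)) = (- \<i> / 2) \<odot> rmom m" using cs_of_real[of "1/2" "- (\<i> \<odot> rmom m)"] by simp
 finally show "moment_comp \<gamma> I_op m X = ((- \<i> / 2) \<odot> rmom m) \<bullet> X" .
 have "J_op (inf_act X m) \<bullet> m = - (inf_act X m \<bullet> J_op m)" by (rule structures_skew)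
 also have "... = 2 * (X \<bullet> (om m m)\<^sup>H)" by (simp only: i1 lip_J rip_J inner_diff_right inner_minus_right)
 finally have "J_op (inf_act X m) \<bullet> m = 2 * (X \<bullet> (om m m)\<^sup>H)" .
 thus "moment_comp \<gamma> J_op m X = ((1 / 2) \<odot> ((om m m)\<^sup>H - om m m)) \<bullet> X"
  using X sk[of "(om m m)\<^sup>H"] by (simp add: moment_comp_def)
 have "K_op (inf_act X m) \<bullet> m = - (inf_act X m \<bullet> K_op m)" by (rule structures_skew)
 also have "K_op m = \<i> \<cdot> J_op m" by (simp add: K_op_def I_op_eq)
 also have "- (inf_act X m \<bullet> (\<i> \<cdot> J_op m)) = 2 * (X \<bullet> (\<i> \<odot> (om m m)\<^sup>H))"
 proof -
  have "lip (\<i> \<cdot> J_op m) m = \<i> \<odot> lip (J_op m) m" "rip (\<i> \<cdot> J_op m) m = \<i> \<odot> rip (J_op m) m"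
   by (simp_all add: lip_def rip_def mm cs_distribs)
  thus ?thesis by (simp only: i1 lip_J rip_J inner_diff_right cs_simps inner_minus_right)
 qed
 finally have "K_op (inf_act X m) \<bullet> m = 2 * (X \<bullet> (\<i> \<odot> (om m m)\<^sup>H))" .
 thus "moment_comp \<gamma> K_op m X = ((\<i> / 2) \<odot> ((om m m)\<^sup>H + om m m)) \<bullet> X"
  using X sk[of "\<i> \<odot> (om m m)\<^sup>H"] by (simp add: moment_comp_def adj_cs cs_distribs)
qed

lemma level_eq:
 assumes \<zeta>: "\<zeta> \<in> Z3"
 shows "level \<gamma> \<zeta> = Lev (TT \<zeta>) (LL \<zeta>)"
proof -
 obtain a b c where z: "\<zeta> = (a, b, c)" by (cases \<zeta>)
 have Z: "a \<in> Z_space \<gamma>" "b \<in> Z_space \<gamma>" "c \<in> Z_space \<gamma>" using \<zeta> z by auto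
 have comp: "moment_comp \<gamma> T m = \<xi> \<longleftrightarrow> W = tz \<xi>"
  if "\<xi> \<in> Z_space \<gamma>" "W \<in> lieG" "!!X. X \<in> lieG ==> moment_comp \<gamma> T m X = W \<bullet> X" for \<xi> W T m
 proof
  have d: "\<xi> \<in> lie_dual \<gamma>" using that(1) by (simp add: Z_space_def)
  show "W = tz \<xi>" if "moment_comp \<gamma> T m = \<xi>"
  proof (rule lie_eqI[OF \<open>W \<in> lieG\<close> tz_lie])
   fix X assume X: "X \<in> lieG"
   show "W \<bullet> X = tz \<xi> \<bullet> X" using \<open>!!X. X \<in> lieG ==> moment_comp \<gamma> T m X = W \<bullet> X\<close>[OF X] tz_apply[OF d X] that by simp
  qed
  show "moment_comp \<gamma> T m = \<xi>" if W: "W = tz \<xi>"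
  proof
   fix X show "moment_comp \<gamma> T m X = \<xi> X"
   proof (cases "X \<in> lieG")
    case True thus ?thesis using \<open>!!X. X \<in> lieG ==> moment_comp \<gamma> T m X = W \<bullet> X\<close>[OF True] tz_apply[OF d True] W by simp
   next
    case False thus ?thesis using d by (simp add: moment_comp_def lie_dual_def)
   qed
  qed
 qed
 have "moment_map \<gamma> m = \<zeta> \<longleftrightarrow> rmom m = TT \<zeta> \<and> om m m = LL \<zeta>" if m: "m \<in> \<M>" for m
 proof -
  let ?w = "om m m"
  let ?A = "(- \<i> / 2) \<odot> rmom m" and ?B = "(1 / 2) \<odot> (?w\<^sup>H - ?w)" and ?C = "(\<i> / 2) \<odot> (?w\<^sup>H + ?w)"
  have L: "?A \<in> lieG" "?B \<in> lieG" "?C \<in> lieG"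
   using rmom_C[OF m] om_C[OF m m] by (auto intro!: lieI C_closed C_adj simp: adj_cs adj_rmom cs_distribs)
  have "moment_map \<gamma> m = \<zeta> \<longleftrightarrow> ?A = tz a \<and> ?B = tz b \<and> ?C = tz c" unfolding moment_map_def z prod.inject
   using comp[OF Z(1) L(1) moment_inner(1)[OF _ m]] comp[OF Z(2) L(2) moment_inner(2)[OF _ m]]
    comp[OF Z(3) L(3) moment_inner(3)[OF _ m]] by simp
  also have "?A = tz a \<longleftrightarrow> rmom m = TT \<zeta>"
  proof
   assume "?A = tz a"
   hence "TT \<zeta> = (2 * \<i>) \<odot> ?A" by (simp add: TT_def z)
   thus "rmom m = TT \<zeta>" by simp
  qed (simp add: TT_def z)
  also have "?B = tz b \<and> ?C = tz c \<longleftrightarrow> ?w = LL \<zeta>"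
  proof
   assume "?B = tz b \<and> ?C = tz c"
   hence "LL \<zeta> = - ?B - \<i> \<odot> ?C" by (simp add: LL_def z)
   also have "... = ?w" by (simp add: vec_eq_iff algebra_simps)
   finally show "?w = LL \<zeta>" by simp
  next
   assume w: "?w = LL \<zeta>"
   have H: "?w\<^sup>H = tz b - \<i> \<odot> tz c" by (simp add: w LL_def z adj_cs tz_cen Z)
   show "?B = tz b \<and> ?C = tz c" unfolding H unfolding w LL_def z by (simp add: vec_eq_iff algebra_simps)
  qed
  finally show ?thesis .
 qed
 thus ?thesis by (auto simp: level_def Lev_def)
qed

lemma TT_LL:
 assumes "\<zeta> \<in> Z3"
 shows "TT \<zeta> \<in> cen" "LL \<zeta> \<in> cen" "(TT \<zeta>)\<^sup>H = TT \<zeta>" "trace (TT \<zeta>) = 0" "trace (LL \<zeta>) = 0"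
proof -
 obtain a b c where z: "\<zeta> = (a, b, c)" by (cases \<zeta>)
 have Z: "a \<in> Z_space \<gamma>" "b \<in> Z_space \<gamma>" "c \<in> Z_space \<gamma>" using assms z by auto
 show "TT \<zeta> \<in> cen" unfolding TT_def z by (simp add: cen_closed tz_cen Z)
 have "LL \<zeta> = (- 1) \<odot> tz b - \<i> \<odot> tz c" by (simp add: LL_def z)
 thus "LL \<zeta> \<in> cen" by (simp only:) (intro cen_closed tz_cen Z)
 show "(TT \<zeta>)\<^sup>H = TT \<zeta>" "trace (TT \<zeta>) = 0" "trace (LL \<zeta>) = 0"
  by (simp_all add: TT_def LL_def z adj_cs tz_cen Z trace_sub)
qed

end

context mckay_irr
begin

lemma adj_Ek: assumes "k \<le> r" shows "(Ek k)\<^sup>H = Ek k"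
proof -
 note P = Pk_Pr[OF assms]
 have "(avg (%g. cnj (ch (Pk k) g) \<odot> R g))\<^sup>H = avg (%g. (cnj (ch (Pk k) g) \<odot> R g)\<^sup>H)" by (rule linear_avg[OF linear_adj])
 also have "... = avg (%g. cnj (ch (Pk k) (gi g)) \<odot> R (gi g))" by (simp add: adj_cs adj_reg ch_gi[OF P])
 also have "... = avg (%g. cnj (ch (Pk k) g) \<odot> R g)" by (rule avg_gi)
 finally have a: "(avg (%g. cnj (ch (Pk k) g) \<odot> R g))\<^sup>H = avg (%g. cnj (ch (Pk k) g) \<odot> R g)" .
 have "cnj (trace (Pk k)) = trace (Pk k)" by (subst (1 2) Pr_trace_real[OF P]) simp
 thus ?thesis unfolding Ek_def adj_cs a by simp
qed

lemma rho_eq: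
 assumes \<xi>: "\<xi> \<in> Z_space \<gamma>" and k: "k \<in> {1..r}"
 shows "rho \<gamma> r Rep \<xi> k = val ((- \<i>) \<odot> tz \<xi>) (Pk k)"
proof -
 have kr: "k \<le> r" using k by simp
 let ?E = "isotypic_proj \<gamma> (Rep k)"
 have E: "?E = Ek k" by (rule isotypic_proj_eq[OF k])
 have l: "mat \<i> ** ?E \<in> lieG" unfolding E mat_mult_eq_cs by (rule lieI) (simp_all add: C_closed Ek_C[OF kr] adj_cs adj_Ek[OF kr])
 have "\<xi> (mat \<i> ** ?E) = tz \<xi> \<bullet> (\<i> \<odot> ?E)" using tz_apply[OF _ l] \<xi> by (simp add: Z_space_def mat_mult_eq_cs)
 also have "... = Re (trace (((- \<i>) \<odot> tz \<xi>) ** ?E))" by (simp add: inner_trace adj_cs E adj_Ek[OF kr] mm)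
 finally have "\<xi> (mat \<i> ** ?E) / real (vec.dim (Rep k)) = val ((- \<i>) \<odot> tz \<xi>) (Pk k)"
  using isotypic_trace[OF cen_closed(3)[OF tz_cen(1)[OF \<xi>], of "- \<i>"] k] by simp
 thus ?thesis using k by (simp add: rho_def)
qed

text \<open>Classes of norm two are roots up to sign, so a generic level does not vanish on them.\<close>

lemma regular:
 assumes \<zeta>: "\<zeta> \<in> Z3_reg \<gamma> r Rep" and P: "P \<in> Pr" and N: "N P P = 2"
 shows "trace (TT \<zeta> ** P) ~= 0 \<or> trace (LL \<zeta> ** P) ~= 0"
proof -
 obtain a b c where z: "\<zeta> = (a, b, c)" by (cases \<zeta>)
 have Z: "a \<in> Z_space \<gamma>" "b \<in> Z_space \<gamma>" "c \<in> Z_space \<gamma>" using \<zeta> z by (auto simp: Z3_reg_def)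
 obtain \<theta> where \<theta>: "\<theta> \<in> roots \<gamma> r Rep"
  "!!t h. t \<in> cen ==> trace t = 0 ==> (!!k. k \<in> {1..r} ==> h k = val t (Pk k)) ==> \<bar>\<theta> h\<bar> = \<bar>val t P\<bar>"
  by (rule root_of_class[OF P N]) blast
 have v: "\<bar>\<theta> (rho \<gamma> r Rep \<xi>)\<bar> = \<bar>val ((- \<i>) \<odot> tz \<xi>) P\<bar>" if "\<xi> \<in> Z_space \<gamma>" for \<xi>
  by (rule \<theta>(2)[OF cen_closed(3)[OF tz_cen(1)[OF that]]]) (simp_all add: tz_cen that rho_eq)
 have D: "\<xi> \<in> D_hyp \<gamma> r Rep \<theta> \<longleftrightarrow> val ((- \<i>) \<odot> tz \<xi>) P = 0" if "\<xi> \<in> Z_space \<gamma>" for \<xi>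
  using v[OF that] that by (auto simp: D_hyp_def)
 have im: "val ((- \<i>) \<odot> tz \<xi>) P = Im (trace (tz \<xi> ** P))" for \<xi> by (simp add: val_def mm)
 have re: "Re (trace (tz \<xi> ** P)) = 0" if "\<xi> \<in> Z_space \<gamma>" for \<xi>
 proof -
  have "cnj (trace (tz \<xi> ** P)) = trace ((tz \<xi> ** P)\<^sup>H)" by (simp add: trace_adj)
  also have "... = trace (P ** (- tz \<xi>))" by (simp add: adj_mult PrD[OF P] tz_cen[OF that])
  also have "... = - trace (tz \<xi> ** P)" by (simp add: mm trace_mul_sym[of P])
  finally show ?thesis by (simp add: complex_eq_iff)
 qed
 show ?thesis
 proof (rule ccontr)
  assume "\<not> ?thesis"
  hence 1: "trace (TT \<zeta> ** P) = 0" and 2: "trace (LL \<zeta> ** P) = 0" by auto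
  have "trace (tz a ** P) = 0" using 1 by (simp add: TT_def z mm)
  moreover have "- trace (tz b ** P) - \<i> * trace (tz c ** P) = 0" using 2 by (simp add: LL_def z mm trace_sub)
  hence "trace (tz b ** P) = - \<i> * trace (tz c ** P)" by algebra
  hence "trace (tz b ** P) = 0 \<and> trace (tz c ** P) = 0" using re[OF Z(2)] re[OF Z(3)] by (simp add: complex_eq_iff)
  ultimately have "a \<in> D_hyp \<gamma> r Rep \<theta>" "b \<in> D_hyp \<gamma> r Rep \<theta>" "c \<in> D_hyp \<gamma> r Rep \<theta>"
   using Z by (simp_all add: D val_def mm)
  thus False using \<zeta> \<theta>(1) z by (auto simp: Z3_reg_def)
 qed
qed

end

context mckay
begin

section \<open>Rotation of the complex structures\<close>

text \<open>Right multiplication by a unit quaternion. It commutes with the group action, permutes the three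
 complex structures of the hyperKaehler space and the levels of the moment map.\<close>

definition rot :: "complex => complex => 'g pair => 'g pair" where
 "rot x y m = x \<cdot> m + y \<cdot> J_op m"

definition lam :: "complex => complex => 'g End => 'g End => 'g End" where
 "lam x y T L = x\<^sup>2 \<odot> L + (x * y) \<odot> T - y\<^sup>2 \<odot> L\<^sup>H"
definition tau :: "complex => complex => 'g End => 'g End => 'g End" where
 "tau x y T L = (x * cnj x - y * cnj y) \<odot> T - (2 * x * cnj y) \<odot> L - (2 * y * cnj x) \<odot> L\<^sup>H"

text \<open>The complex structure that a unit quaternion moves to \<open>I\<close> (the Hopf map).\<close>

definition hopf :: "complex => complex => real^3" where
 "hopf x y = vector [(cmod x)\<^sup>2 - (cmod y)\<^sup>2, Re (2 * \<i> * cnj x * y), Im (2 * \<i> * cnj x * y)]"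

lemma S_forms: "om m (J_op m) + om (J_op m) m = rmom m" "om (J_op m) (J_op m) = - (om m m)\<^sup>H"
 by (simp_all add: rmom_def lip_om rip_om) (simp add: om_def adj_mult mm)

lemma om_rot: "om (rot x y m) (rot x y m) = lam x y (rmom m) (om m m)"
proof -
 have "om (rot x y m) (rot x y m) = x\<^sup>2 \<odot> om m m + (x * y) \<odot> (om m (J_op m) + om (J_op m) m) + y\<^sup>2 \<odot> om (J_op m) (J_op m)"
  by (simp add: rot_def om_distribs cs_distribs power2_eq_square mult.commute)
 thus ?thesis by (simp add: S_forms lam_def)
qed

lemma rmom_rot: "rmom (rot x y m) = tau x y (rmom m) (om m m)"
proof -
 have J: "J_op (rot x y m) = cnj x \<cdot> J_op m - cnj y \<cdot> m" by (simp add: rot_def J_distribs J_ps)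
 have "rmom (rot x y m) = om (rot x y m) (J_op (rot x y m)) + om (J_op (rot x y m)) (rot x y m)" by (simp add: S_forms)
 also have "... = (x * cnj x - y * cnj y) \<odot> (om m (J_op m) + om (J_op m) m) - (2 * x * cnj y) \<odot> om m m + (2 * y * cnj x) \<odot> om (J_op m) (J_op m)"
  unfolding J unfolding rot_def by (simp add: om_distribs vec_eq_iff algebra_simps)
 finally show ?thesis by (simp add: S_forms tau_def)
qed

context
 fixes x y :: complex
 assumes unit: "(cmod x)\<^sup>2 + (cmod y)\<^sup>2 = 1"
begin

lemma unit': "x * cnj x + y * cnj y = 1" using unit by (metis complex_norm_square of_real_1 of_real_add)

lemma rot_inverse: "rot (cnj x) (- y) (rot x y m) = m" "rot x y (rot (cnj x) (- y) m) = m"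
proof -
 have "(x * cnj x + y * cnj y) \<cdot> m = m" unfolding unit' by simp
 thus "rot (cnj x) (- y) (rot x y m) = m" "rot x y (rot (cnj x) (- y) m) = m" by (simp_all add: rot_def J_distribs J_ps ps_distribs mult.commute)
qed

lemma hopf_relations:
 "\<i> * x = \<i> * of_real (hopf x y $ 1) * x - y * cnj (Complex (hopf x y $ 2) (hopf x y $ 3))"
 "\<i> * y = x * Complex (hopf x y $ 2) (hopf x y $ 3) - \<i> * of_real (hopf x y $ 1) * y"
proof -
 have h: "of_real (hopf x y $ 1) = x * cnj x - y * cnj y" "Complex (hopf x y $ 2) (hopf x y $ 3) = 2 * \<i> * cnj x * y"
  by (simp_all add: hopf_def complex_norm_square[symmetric] complex_eq_iff)
 have 1: "\<i> * x = \<i> * x * (x * cnj x + y * cnj y)" "\<i> * y = \<i> * y * (x * cnj x + y * cnj y)" by (simp_all add: unit')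
 show "\<i> * x = \<i> * of_real (hopf x y $ 1) * x - y * cnj (Complex (hopf x y $ 2) (hopf x y $ 3))"
  unfolding h by (subst 1(1)) (simp add: algebra_simps)
 show "\<i> * y = x * Complex (hopf x y $ 2) (hopf x y $ 3) - \<i> * of_real (hopf x y $ 1) * y" unfolding h by (subst 1(2)) (simp add: algebra_simps)
qed

lemma hopf_sphere: "hopf x y \<in> sphere 0 1"
proof -
 have "(hopf x y $ 1)\<^sup>2 + (cmod (2 * \<i> * cnj x * y))\<^sup>2 = ((cmod x)\<^sup>2 + (cmod y)\<^sup>2)\<^sup>2"
  by (simp add: hopf_def norm_mult power_mult_distrib) (simp add: power2_eq_square algebra_simps)
 moreover have "(hopf x y $ 2)\<^sup>2 + (hopf x y $ 3)\<^sup>2 = (cmod (2 * \<i> * cnj x * y))\<^sup>2" by (simp only: cmod_power2 hopf_def vector_3)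
 ultimately have "(hopf x y $ 1)\<^sup>2 + (hopf x y $ 2)\<^sup>2 + (hopf x y $ 3)\<^sup>2 = 1" unfolding unit by simp
 hence "norm (hopf x y) = 1" by (simp add: norm_eq_sqrt_inner inner_vec_def sum_3 power2_eq_square)
 thus ?thesis by simp
qed

lemma cplx_op_eq: "cplx_op u m = (\<i> * of_real (u $ 1)) \<cdot> m + Complex (u $ 2) (u $ 3) \<cdot> J_op m"
 by (simp add: cplx_op_def K_op_def I_op_eq Complex_eq ps_distribs mult.commute flip: ps_of_real)

lemma rot_cplx: "rot x y (cplx_op (hopf x y) m) = I_op (rot x y m)"
proof -
 have "rot x y (cplx_op (hopf x y) m)
   = (\<i> * of_real (hopf x y $ 1) * x - y * cnj (Complex (hopf x y $ 2) (hopf x y $ 3))) \<cdot> m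
   + (x * Complex (hopf x y $ 2) (hopf x y $ 3) - \<i> * of_real (hopf x y $ 1) * y) \<cdot> J_op m"
  unfolding cplx_op_eq rot_def by (simp add: J_distribs J_ps ps_distribs algebra_simps del: complex_cnj)
 also have "... = I_op (rot x y m)" unfolding hopf_relations[symmetric] by (simp add: I_op_eq rot_def ps_distribs)
 finally show ?thesis .
qed

lemma inner_rot: "rot x y m \<bullet> rot x y n = m \<bullet> n"
proof -
 have a: "(c \<cdot> m) \<bullet> (c \<cdot> n) = (cmod c)\<^sup>2 * (m \<bullet> n)" for c and m n :: "'g pair"
 proof -
  have "cnj c * c = of_real ((cmod c)\<^sup>2)" by (simp only: complex_norm_square mult.commute)
  thus ?thesis by (simp add: inner_ps ps_of_real del: of_real_power)
 qed
 have b: "(x \<cdot> m) \<bullet> (y \<cdot> J_op n) + (y \<cdot> J_op m) \<bullet> (x \<cdot> n) = 0"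
 proof -
  have "(x \<cdot> m) \<bullet> (y \<cdot> J_op n) = ((x * cnj y) \<cdot> m) \<bullet> J_op n" by (simp add: inner_ps)
  also have "... = - (J_op ((x * cnj y) \<cdot> m) \<bullet> n)" by (simp add: inner_J(2))
  also have "J_op ((x * cnj y) \<cdot> m) \<bullet> n = (y \<cdot> J_op m) \<bullet> (x \<cdot> n)" by (simp add: J_ps inner_ps mult.commute)
  finally show ?thesis by simp
 qed
 have "rot x y m \<bullet> rot x y n = (cmod x)\<^sup>2 * (m \<bullet> n) + (cmod y)\<^sup>2 * (m \<bullet> n) +
   ((x \<cdot> m) \<bullet> (y \<cdot> J_op n) + (y \<cdot> J_op m) \<bullet> (x \<cdot> n))"
  unfolding rot_def inner_add_left inner_add_right a inner_J(1) by simp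
 thus ?thesis unfolding b by (simp add: unit flip: distrib_right)
qed

lemma linear_rot: "linear (rot x y)" by (rule linearI) (simp_all add: rot_def J_distribs ps_distribs J_ps mult.commute flip: ps_of_real)

lemma rot_M: "rot x y m \<in> \<M> \<longleftrightarrow> m \<in> \<M>"
proof
 show "rot x y m \<in> \<M>" if "m \<in> \<M>" using that by (simp add: rot_def M_closed M_J)
 have "rot (cnj x) (- y) n \<in> \<M>" if "n \<in> \<M>" for n using that by (simp add: rot_def M_closed M_J)
 from this[of "rot x y m"] show "m \<in> \<M>" if "rot x y m \<in> \<M>" using that by (simp add: rot_inverse)
qed

lemma rot_levels:
 assumes T: "T\<^sup>H = T"
 shows "lam (cnj x) (- y) (tau x y T L) (lam x y T L) = L" "tau (cnj x) (- y) (tau x y T L) (lam x y T L) = T"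
proof -
 have "lam (cnj x) (- y) (tau x y T L) (lam x y T L) = ((x * cnj x + y * cnj y) * (x * cnj x + y * cnj y)) \<odot> L"
  "tau (cnj x) (- y) (tau x y T L) (lam x y T L) = ((x * cnj x + y * cnj y) * (x * cnj x + y * cnj y)) \<odot> T"
  unfolding lam_def tau_def by (simp_all add: adj_cs T vec_eq_iff power2_eq_square algebra_simps)
 thus "lam (cnj x) (- y) (tau x y T L) (lam x y T L) = L" "tau (cnj x) (- y) (tau x y T L) (lam x y T L) = T" by (simp_all add: unit')
qed

lemma rot_Lev:
 assumes T: "T\<^sup>H = T"
 shows "rot x y m \<in> Lev (tau x y T L) (lam x y T L) \<longleftrightarrow> m \<in> Lev T L"
proof
 show "rot x y m \<in> Lev (tau x y T L) (lam x y T L)" if "m \<in> Lev T L" using that by (auto simp: Lev_def rot_M rmom_rot om_rot)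
 assume "rot x y m \<in> Lev (tau x y T L) (lam x y T L)"
 hence h: "m \<in> \<M>" "rmom (rot x y m) = tau x y T L" "om (rot x y m) (rot x y m) = lam x y T L" by (auto simp: Lev_def rot_M)
 have "om m m = lam (cnj x) (- y) (rmom (rot x y m)) (om (rot x y m) (rot x y m))" by (simp add: rot_inverse flip: om_rot)
 moreover have "rmom m = tau (cnj x) (- y) (rmom (rot x y m)) (om (rot x y m) (rot x y m))" by (simp add: rot_inverse flip: rmom_rot)
 ultimately show "m \<in> Lev T L" using h rot_levels[OF T] by (simp add: Lev_def)
qed

lemma rot_adj: "u \<in> \<C> ==> u\<^sup>H = v ==> rot x y (u |> (m <| v)) = u |> (rot x y m <| v)"
 by (auto simp: rot_def J_mult lm_distribs lm_scale lm_simps)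

lemma rot_act: "u \<in> unitaries \<gamma> ==> rot x y (act u m) = act u (rot x y m)" by (simp add: act_eq rot_adj unitariesD)

lemma rot_orbit: "orb (rot x y m) = rot x y ` orb m" unfolding orbit_def image_image by (rule image_cong) (simp_all add: rot_act)

lemma rot_inf_act: "X \<in> lieG ==> rot x y (inf_act X m) = inf_act X (rot x y m)" unfolding inf_act_eq rot_def
 by (simp add: J_distribs J_mult lieD ps_distribs lm_distribs lm_scale)

lemma rot_vertical: "vert (rot x y m) = rot x y ` vert m" unfolding vertical_def image_image by (rule image_cong) (simp_all add: rot_inf_act)

end

section \<open>Horizontal projection\<close>

lemma subspace_vertical: "subspace (vert m)"
proof -
 have "linear (%X. inf_act X m)" by (rule linearI) (simp_all add: inf_act_eq lm_distribs lm_scale scaleR_diff_right)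
 thus ?thesis unfolding vertical_def by (rule linear_subspace_image[OF _ subspace_lie])
qed

abbreviation "hp \<equiv> horizontal_proj \<gamma>"

lemma hp_unique:
 assumes h: "h \<in> orthogonal_comp (vert m)" "v - h \<in> vert m"
 shows "hp m v = h" unfolding horizontal_proj_def
proof (rule the_equality)
 show "h \<in> orthogonal_comp (vert m) \<and> v - h \<in> vert m" using h by blast
 fix k assume k: "k \<in> orthogonal_comp (vert m) \<and> v - k \<in> vert m"
 have "(v - h) - (v - k) \<in> vert m" using k h(2) subspace_diff[OF subspace_vertical] by blast
 hence V: "k - h \<in> vert m" by simp
 have "(k - h) \<bullet> k = 0" "(k - h) \<bullet> h = 0" using V k h(1) by (auto simp: orthogonal_comp_def orthogonal_def)
 hence "(k - h) \<bullet> (k - h) = 0" by (simp add: inner_diff_right)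
 thus "k = h" by simp
qed

lemma hp_spec: "hp m v \<in> orthogonal_comp (vert m)" "v - hp m v \<in> vert m"
proof -
 obtain s where s: "s \<in> vert m" "!!y. y \<in> vert m ==> (v - s) \<bullet> y = 0"
  by (rule orthogonal_decomposition[OF subspace_vertical[of m], of v]) blast
 hence "v - s \<in> orthogonal_comp (vert m)" "v - (v - s) \<in> vert m" by (auto simp: orthogonal_comp_def orthogonal_def inner_commute)
 from hp_unique[OF this] this show "hp m v \<in> orthogonal_comp (vert m)" "v - hp m v \<in> vert m" by simp_all
qed
lemma hp_diff: obtains X where "X \<in> lieG" "v = hp m v + inf_act X m"
proof -
 obtain X where "X \<in> lieG" "v - hp m v = inf_act X m" using hp_spec(2)[of v m] by (auto simp: vertical_def)
 thus ?thesis using that by (metis add.commute diff_add_cancel)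
qed

lemma hp_rot:
 assumes u: "(cmod x)\<^sup>2 + (cmod y)\<^sup>2 = 1"
 shows "hp (rot x y m) (rot x y v) = rot x y (hp m v)"
proof (rule hp_unique)
 show "rot x y (hp m v) \<in> orthogonal_comp (vert (rot x y m))"
  using hp_spec(1)[of m v] by (auto simp: orthogonal_comp_def orthogonal_def rot_vertical[OF u] inner_rot[OF u])
 show "rot x y v - rot x y (hp m v) \<in> vert (rot x y m)"
  unfolding rot_vertical[OF u] linear_diff[OF linear_rot[OF u], symmetric] using hp_spec(2)[of v m] by blast
qed

section \<open>Rational curves in the rotated frame\<close>

definition holo :: "'g End => 'g End => (complex => 'g pair set) => bool" where
 "holo T L \<phi> \<longleftrightarrow> (\<forall>z0. \<exists>S F. open S \<and> z0 \<in> S \<and>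
   (\<forall>z\<in>S. F z \<in> Lev T L \<and> \<phi> z = orb (F z) \<and>
    (\<exists>F'. (F has_derivative F') (at z) \<and>
      (\<forall>w. hp (F z) (F' (\<i> * w)) = I_op (hp (F z) (F' w))) \<and>
      (\<forall>w. w ~= 0 --> hp (F z) (F' w) ~= 0))))"

definition rational_curve :: "'g End => 'g End => (complex option => 'g pair set) => bool" where
 "rational_curve T L f \<longleftrightarrow> inj f \<and> holo T L (f \<circ> P1_chart0) \<and> holo T L (f \<circ> P1_chart_infinity)"

context
 fixes \<zeta> :: "('g End => real) \<times> ('g End => real) \<times> ('g End => real)" and x y :: complex
 assumes \<zeta>: "\<zeta> \<in> Z3" and unit: "(cmod x)\<^sup>2 + (cmod y)\<^sup>2 = 1"
begin

abbreviation "T' \<equiv> tau x y (TT \<zeta>) (LL \<zeta>)"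
abbreviation "L' \<equiv> lam x y (TT \<zeta>) (LL \<zeta>)"

lemma rot_level: "rot x y m \<in> Lev T' L' \<longleftrightarrow> m \<in> level \<gamma> \<zeta>"
 unfolding level_eq[OF \<zeta>] by (rule rot_Lev[OF unit TT_LL(3)[OF \<zeta>]])

lemma holo_of_immersion:
 assumes f: "holomorphic_immersion \<gamma> \<zeta> \<phi>" and u: "!!z. snd (\<phi> z) = hopf x y"
 shows "holo T' L' (%z. rot x y ` fst (\<phi> z))" unfolding holo_def
proof
 fix z0
 obtain S F where S: "open S" "z0 \<in> S" and F: "!!z. z \<in> S ==> F z \<in> level \<gamma> \<zeta> \<times> sphere 0 1 \<and> \<phi> z = (orb (fst (F z)), snd (F z)) \<and>
    (\<exists>F'. (F has_derivative F') (at z) \<and>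
      (\<forall>w. twistor_tangent \<gamma> (F z) (F' (\<i> * w)) =
        twistor_J (F z) (twistor_tangent \<gamma> (F z) (F' w))) \<and>
      (\<forall>w. w ~= 0 --> twistor_tangent \<gamma> (F z) (F' w) ~= 0))" using f unfolding holomorphic_immersion_def by metis
 have F1: "fst (F z) \<in> level \<gamma> \<zeta>" if "z \<in> S" for z using F[OF that, THEN conjunct1] by (cases "F z") simp
 have F2: "\<phi> z = (orb (fst (F z)), snd (F z))" if "z \<in> S" for z using F[OF that] by blast
 have sF: "snd (F z) = hopf x y" if "z \<in> S" for z using F2[OF that] u[of z] by simp
 have r0: "rot x y v = 0 ==> v = 0" for v using rot_inverse(1)[OF unit, of v] by (simp add: rot_def J_distribs)
 show "\<exists>S F. open S \<and> z0 \<in> S \<and> (\<forall>z\<in>S. F z \<in> Lev T' L' \<and> rot x y ` fst (\<phi> z) = orb (F z) \<and>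
    (\<exists>F'. (F has_derivative F') (at z) \<and>
      (\<forall>w. hp (F z) (F' (\<i> * w)) = I_op (hp (F z) (F' w))) \<and>
      (\<forall>w. w ~= 0 --> hp (F z) (F' w) ~= 0)))"
 proof (rule exI[of _ S], rule exI[of _ "%z. rot x y (fst (F z))"], intro conjI ballI S)
  fix z assume z: "z \<in> S"
  show "rot x y (fst (F z)) \<in> Lev T' L'" using F1[OF z] by (simp add: rot_level)
  show "rot x y ` fst (\<phi> z) = orb (rot x y (fst (F z)))" using F2[OF z] by (simp add: rot_orbit[OF unit])
  obtain F' where F': "(F has_derivative F') (at z)"
   "!!w. twistor_tangent \<gamma> (F z) (F' (\<i> * w)) = twistor_J (F z) (twistor_tangent \<gamma> (F z) (F' w))"
   "!!w. w ~= 0 ==> twistor_tangent \<gamma> (F z) (F' w) ~= 0" using F[OF z] by blast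
  have d: "snd (F' w) = 0" for w
  proof -
   have 1: "((%z. snd (F z)) has_derivative (%w. snd (F' w))) (at z)" using F'(1) by (rule has_derivative_snd)
   have "((%z. hopf x y) has_derivative (%w. snd (F' w))) (at z)" by (rule has_derivative_transform_within_open[OF 1 S(1) z]) (simp add: sF)
   from fun_cong[OF has_derivative_unique[OF this has_derivative_const], of w] show ?thesis .
  qed
  show "\<exists>F'. ((%z. rot x y (fst (F z))) has_derivative F') (at z) \<and>
      (\<forall>w. hp (rot x y (fst (F z))) (F' (\<i> * w)) = I_op (hp (rot x y (fst (F z))) (F' w))) \<and>
      (\<forall>w. w ~= 0 --> hp (rot x y (fst (F z))) (F' w) ~= 0)"
  proof (rule exI[of _ "%w. rot x y (fst (F' w))"], intro conjI allI impI)
   show "((%z. rot x y (fst (F z))) has_derivative (%w. rot x y (fst (F' w)))) (at z)"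
    by (rule bounded_linear.has_derivative[OF linear_conv_bounded_linear[THEN iffD1, OF linear_rot[OF unit]] has_derivative_fst[OF F'(1)]])
   fix w :: complex
   have "hp (fst (F z)) (fst (F' (\<i> * w))) = cplx_op (hopf x y) (hp (fst (F z)) (fst (F' w)))"
    using F'(2)[of w] by (simp add: twistor_tangent_def twistor_J_def sF[OF z])
   thus "hp (rot x y (fst (F z))) (rot x y (fst (F' (\<i> * w)))) = I_op (hp (rot x y (fst (F z))) (rot x y (fst (F' w))))"
    by (simp add: hp_rot[OF unit] rot_cplx[OF unit])
   assume "w ~= 0"
   from F'(3)[OF this] have "hp (fst (F z)) (fst (F' w)) ~= 0" unfolding twistor_tangent_def d zero_prod_def fst_conv snd_conv by fast
   thus "hp (rot x y (fst (F z))) (rot x y (fst (F' w))) ~= 0" using r0[of "hp (fst (F z)) (fst (F' w))"] by (auto simp: hp_rot[OF unit])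
  qed
 qed
qed

lemma immersion_of_holo:
 assumes f: "holo T' L' \<phi>"
 shows "holomorphic_immersion \<gamma> \<zeta> (%z. (rot (cnj x) (- y) ` \<phi> z, hopf x y))" unfolding holomorphic_immersion_def
proof
 fix z0
 let ?q = "rot (cnj x) (- y)"
 have unit2: "(cmod (cnj x))\<^sup>2 + (cmod (- y))\<^sup>2 = 1" using unit by simp
 obtain S F where S: "open S" "z0 \<in> S" and F: "!!z. z \<in> S ==> F z \<in> Lev T' L' \<and> \<phi> z = orb (F z) \<and>
    (\<exists>F'. (F has_derivative F') (at z) \<and>
      (\<forall>w. hp (F z) (F' (\<i> * w)) = I_op (hp (F z) (F' w))) \<and>
      (\<forall>w. w ~= 0 --> hp (F z) (F' w) ~= 0))" using f unfolding holo_def by metis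
 have F1: "F z \<in> Lev T' L'" "\<phi> z = orb (F z)" if "z \<in> S" for z using F[OF that] by blast+
 have qI: "?q (I_op v) = cplx_op (hopf x y) (?q v)" for v by (metis rot_cplx[OF unit] rot_inverse[OF unit])
 have r0: "?q v = 0 ==> v = 0" for v using rot_inverse(2)[OF unit, of v] by (simp add: rot_def J_distribs)
 show "\<exists>S F. open S \<and> z0 \<in> S \<and> (\<forall>z\<in>S. F z \<in> level \<gamma> \<zeta> \<times> sphere 0 1 \<and>
    (?q ` \<phi> z, hopf x y) = (orb (fst (F z)), snd (F z)) \<and>
    (\<exists>F'. (F has_derivative F') (at z) \<and>
      (\<forall>w. twistor_tangent \<gamma> (F z) (F' (\<i> * w)) = twistor_J (F z) (twistor_tangent \<gamma> (F z) (F' w))) \<and>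
      (\<forall>w. w ~= 0 --> twistor_tangent \<gamma> (F z) (F' w) ~= 0)))"
 proof (rule exI[of _ S], rule exI[of _ "%z. (?q (F z), hopf x y)"], intro conjI ballI S)
  fix z assume z: "z \<in> S"
  have "rot x y (?q (F z)) \<in> Lev T' L'" using F1(1)[OF z] by (simp add: rot_inverse[OF unit])
  thus "(?q (F z), hopf x y) \<in> level \<gamma> \<zeta> \<times> sphere 0 1" using hopf_sphere[OF unit] by (simp add: rot_level)
  show "(?q ` \<phi> z, hopf x y) = (orb (fst (?q (F z), hopf x y)), snd (?q (F z), hopf x y))" using F1(2)[OF z] by (simp add: rot_orbit[OF unit2])
  obtain F' where F': "(F has_derivative F') (at z)"
   "!!w. hp (F z) (F' (\<i> * w)) = I_op (hp (F z) (F' w))" "!!w. w ~= 0 ==> hp (F z) (F' w) ~= 0" using F[OF z] by blast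
  show "\<exists>F'. ((%z. (?q (F z), hopf x y)) has_derivative F') (at z) \<and>
      (\<forall>w. twistor_tangent \<gamma> (?q (F z), hopf x y) (F' (\<i> * w)) =
       twistor_J (?q (F z), hopf x y) (twistor_tangent \<gamma> (?q (F z), hopf x y) (F' w))) \<and>
      (\<forall>w. w ~= 0 --> twistor_tangent \<gamma> (?q (F z), hopf x y) (F' w) ~= 0)"
  proof (rule exI[of _ "%w. (?q (F' w), 0)"], intro conjI allI impI)
   show "((%z. (?q (F z), hopf x y)) has_derivative (%w. (?q (F' w), 0))) (at z)"
    by (rule has_derivative_Pair[OF bounded_linear.has_derivative[OF linear_conv_bounded_linear[THEN iffD1, OF linear_rot[OF unit2]] F'(1)] has_derivative_const])
   fix w :: complex
   show "twistor_tangent \<gamma> (?q (F z), hopf x y) (?q (F' (\<i> * w)), 0) =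
       twistor_J (?q (F z), hopf x y) (twistor_tangent \<gamma> (?q (F z), hopf x y) (?q (F' w), 0))"
    by (simp add: twistor_tangent_def twistor_J_def hp_rot[OF unit2] F'(2) qI)
   assume "w ~= 0"
   from F'(3)[OF this] show "twistor_tangent \<gamma> (?q (F z), hopf x y) (?q (F' w), 0) ~= 0"
    using r0[of "hp (F z) (F' w)"] by (auto simp: twistor_tangent_def hp_rot[OF unit2] zero_prod_def)
  qed
 qed
qed

lemma rational_fibres_rot:
 "hopf x y \<in> rational_fibres \<gamma> \<zeta> \<longleftrightarrow> (\<exists>f. rational_curve T' L' f)"
proof
 assume "hopf x y \<in> rational_fibres \<gamma> \<zeta>"
 then obtain f where f: "holomorphic_embedding_P1 \<gamma> \<zeta> f" "range f \<subseteq> twistor_fibre \<gamma> \<zeta> (hopf x y)"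
  unfolding rational_fibres_def rational_curve_in_fibre_def by blast
 have s: "snd (f p) = hopf x y" for p using f(2) by (auto simp: twistor_fibre_def)
 have injq: "inj (%A. rot x y ` A)" by (rule inj_on_inverseI[of _ "%A. rot (cnj x) (- y) ` A"]) (simp add: image_image rot_inverse[OF unit])
 have "inj (%p. rot x y ` fst (f p))"
 proof (rule injI)
  fix p q assume "rot x y ` fst (f p) = rot x y ` fst (f q)"
  hence "fst (f p) = fst (f q)" using injq by (simp add: inj_eq)
  hence "f p = f q" using s by (simp add: prod_eq_iff)
  thus "p = q" using f(1) by (simp add: holomorphic_embedding_P1_def inj_eq)
 qed
 hence "rational_curve T' L' (%p. rot x y ` fst (f p))"
  using f(1) holo_of_immersion[of "f \<circ> P1_chart0"] holo_of_immersion[of "f \<circ> P1_chart_infinity"] s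
  unfolding rational_curve_def holomorphic_embedding_P1_def by (simp add: o_def)
 thus "\<exists>f. rational_curve T' L' f" by (rule exI[of _ "%p. rot x y ` fst (f p)"])
next
 assume "\<exists>f. rational_curve T' L' f"
 then obtain f where f: "rational_curve T' L' f" by (rule exE)
 let ?F = "%p. (rot (cnj x) (- y) ` f p, hopf x y)"
 have "holo T' L' (f \<circ> P1_chart0)" "holo T' L' (f \<circ> P1_chart_infinity)" using f by (simp_all add: rational_curve_def)
 from this[THEN immersion_of_holo]
 have i: "holomorphic_immersion \<gamma> \<zeta> (?F \<circ> P1_chart0)" "holomorphic_immersion \<gamma> \<zeta> (?F \<circ> P1_chart_infinity)"
  by (simp_all add: o_def)
 have injq: "inj (%A. rot (cnj x) (- y) ` A)" by (rule inj_on_inverseI[of _ "%A. rot x y ` A"]) (simp add: image_image rot_inverse[OF unit])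
 have "inj ?F"
 proof (rule injI)
  fix p q assume "?F p = ?F q"
  hence "f p = f q" using injq by (simp add: inj_eq)
  thus "p = q" using f by (simp add: rational_curve_def inj_eq)
 qed
 hence e: "holomorphic_embedding_P1 \<gamma> \<zeta> ?F" using i by (simp add: holomorphic_embedding_P1_def)
 have pt: "?F p \<in> twistor_fibre \<gamma> \<zeta> (hopf x y)" for p
 proof -
  have "\<exists>z c. p = c z \<and> (c = P1_chart0 \<or> c = P1_chart_infinity)"
  proof (cases p)
   case None hence "p = P1_chart_infinity 0" by (simp add: P1_chart_infinity_def)
   thus ?thesis by blast
  next
   case (Some a) hence "p = P1_chart0 a" by (simp add: P1_chart0_def)
   thus ?thesis by blast
  qed
  then obtain z c where pc: "p = c z" "c = P1_chart0 \<or> c = P1_chart_infinity" by blast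
  hence h: "holomorphic_immersion \<gamma> \<zeta> (?F \<circ> c)" using i by blast
  from h[unfolded holomorphic_immersion_def, THEN spec, of z]
  have "\<exists>F. F z \<in> level \<gamma> \<zeta> \<times> sphere 0 1 \<and> (?F \<circ> c) z = (orb (fst (F z)), snd (F z))"
   by (elim exE conjE) (drule bspec, assumption, elim conjE, intro exI conjI, assumption+)
  then obtain F where F: "F z \<in> level \<gamma> \<zeta> \<times> sphere 0 1" "(?F \<circ> c) z = (orb (fst (F z)), snd (F z))" by (elim exE conjE)
  have m: "fst (F z) \<in> level \<gamma> \<zeta>" using F(1) by (cases "F z") simp
  have "rot (cnj x) (- y) ` f p = orb (fst (F z))" using F(2) by (simp add: pc(1))
  hence "rot (cnj x) (- y) ` f p \<in> X_quot \<gamma> \<zeta>" using m by (simp add: X_quot_def)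
  thus ?thesis using hopf_sphere[OF unit] by (simp add: twistor_fibre_def twistor_space_def)
 qed
 show "hopf x y \<in> rational_fibres \<gamma> \<zeta>" unfolding rational_fibres_def rational_curve_in_fibre_def
  using e pt hopf_sphere[OF unit] by blast
qed

end

section \<open>Gauge transformations\<close>

definition GL :: "('g End \<times> 'g End) set" where
 "GL = {(g, h). g \<in> \<C> \<and> h \<in> \<C> \<and> g ** h = mat 1 \<and> h ** g = mat 1}"

definition brick :: "'g pair => bool" where
 "brick m \<longleftrightarrow> (\<forall>X\<in>\<C>. X |> m = m <| X --> (\<exists>c. X = mat c))"

text \<open>The solutions of the real moment map equation in a complex gauge orbit.\<close>

definition sol :: "'g End => 'g pair => 'g pair set" where
 "sol T E = {m \<in> \<M>. rmom m = T \<and> (\<exists>g h. (g, h) \<in> GL \<and> m = g |> (E <| h))}"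

lemma GLD: "(g, h) \<in> GL ==> g \<in> \<C>" "(g, h) \<in> GL ==> h \<in> \<C>" "(g, h) \<in> GL ==> g ** h = mat 1"
 "(g, h) \<in> GL ==> h ** g = mat 1" "(g, h) \<in> GL ==> g ** (h ** A) = A" "(g, h) \<in> GL ==> h ** (g ** A) = A" by (auto simp: GL_def mm_assoc)

lemma GL_inv: "(g, h) \<in> GL ==> (h, g) \<in> GL" by (simp add: GL_def)

lemma GL_mult: "(g, h) \<in> GL ==> (g', h') \<in> GL ==> (g' ** g, h ** h') \<in> GL"
 by (simp add: GL_def C_closed assoc_r) (metis mm_assoc mult_id(2))

lemma GL_1: "(mat 1, mat 1) \<in> GL" by (simp add: GL_def C_closed)

lemma GL_of_inverse: "g \<in> \<C> ==> g ** h = mat 1 ==> (g, h) \<in> GL"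
proof -
 assume g: "g \<in> \<C>" and gh: "g ** h = mat 1"
 hence hg: "h ** g = mat 1" using matrix_left_right_inverse by blast
 have "h ** R k = R k ** h" for k
 proof -
  have "h ** (R k ** g) ** h = h ** (g ** R k) ** h" using CD[OF g] by simp
  hence "(h ** R k) ** (g ** h) = (h ** g) ** (R k ** h)" by (simp only: assoc_r)
  thus ?thesis by (simp add: gh hg)
 qed
 thus ?thesis using g gh hg by (simp add: GL_def commutant_def)
qed

lemma gauge_simps:
 "g |> ((g' |> (E <| h')) <| h) = (g ** g') |> (E <| (h' ** h))" by (simp add: prod_eq_iff mm)

lemma gauge_intertwine: "(g, h) \<in> GL ==> m = g |> (E <| h) ==> g |> E = m <| g" by (simp add: prod_eq_iff mm GLD)

lemma gauge_of_intertwine: "(g, h) \<in> GL ==> g |> E = m <| g ==> m = g |> (E <| h)" by (simp add: prod_eq_iff mm_assoc) (simp add: assoc_r GLD)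

lemma gauge_M: "(g, h) \<in> GL ==> E \<in> \<M> ==> g |> (E <| h) \<in> \<M>" by (simp add: M_mult GLD)

lemma gauge_om:
 assumes "(g, h) \<in> GL" "om E E = L" "L \<in> cen"
 shows "om (g |> (E <| h)) (g |> (E <| h)) = L"
proof -
 have "om (g |> (E <| h)) (g |> (E <| h)) = g ** om E E ** h" by (simp add: om_def mm GLD[OF assms(1)])
 also have "... = L ** g ** h" using cenD(2)[OF assms(3) GLD(1)[OF assms(1)]] by (simp add: assms(2))
 finally show ?thesis by (simp add: assoc_r GLD[OF assms(1)])
qed

lemma sol_gauge: assumes "(g, h) \<in> GL" shows "sol T (g |> (E <| h)) = sol T E" unfolding set_eq_iff
proof (rule allI)
 fix m
 have "(\<exists>g' h'. (g', h') \<in> GL \<and> m = g' |> ((g |> (E <| h)) <| h')) \<longleftrightarrow> (\<exists>g' h'. (g', h') \<in> GL \<and> m = g' |> (E <| h'))"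
 proof safe
  fix g' h' assume a: "(g', h') \<in> GL"
  show "\<exists>a b. (a, b) \<in> GL \<and> g' |> ((g |> (E <| h)) <| h') = a |> (E <| b)" using GL_mult[OF assms a] gauge_simps by blast
  have "g' |> (E <| h') = (g' ** h) |> ((g |> (E <| h)) <| (g ** h'))" by (simp add: prod_eq_iff mm GLD[OF assms])
  thus "\<exists>a b. (a, b) \<in> GL \<and> g' |> (E <| h') = a |> ((g |> (E <| h)) <| b)" using GL_mult[OF GL_inv[OF assms] a] by blast
 qed
 thus "m \<in> sol T (g |> (E <| h)) \<longleftrightarrow> m \<in> sol T E" by (simp add: sol_def)
qed

lemma sol_I: "(g, h) \<in> GL ==> E \<in> \<M> ==> rmom (g |> (E <| h)) = T ==> g |> (E <| h) \<in> sol T E" unfolding sol_def using gauge_M by blast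

lemma brick_gauge:
 assumes gh: "(g, h) \<in> GL" and b: "brick E" shows "brick (g |> (E <| h))" unfolding brick_def
proof (intro ballI impI)
 fix X assume X: "X \<in> \<C>" and e: "X |> (g |> (E <| h)) = (g |> (E <| h)) <| X"
 from e have "h |> (X |> (g |> (E <| h))) <| g = h |> ((g |> (E <| h)) <| X) <| g" by simp
 hence "(h ** X ** g) |> E = E <| (h ** X ** g)" by (simp add: prod_eq_iff mm GLD[OF gh])
 moreover have "h ** X ** g \<in> \<C>" using X GLD[OF gh] by (simp add: C_closed)
 ultimately obtain c where c: "h ** X ** g = mat c" using b by (auto simp: brick_def)
 have "X = g ** (h ** X ** g) ** h" by (simp add: mm GLD[OF gh])
 also have "... = g ** (c \<odot> mat 1) ** h" unfolding c using mat_mult_eq_cs[of c "mat 1 :: 'g End"] by simp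
 finally have "X = c \<odot> mat 1" by (simp add: mm GLD[OF gh])
 thus "\<exists>c. X = mat c" using mat_mult_eq_cs[of c "mat 1 :: 'g End"] by (intro exI[of _ c]) simp
qed

section \<open>Uniqueness up to unitary transformations\<close>

text \<open>The Weitzenboeck argument: for two solutions of the real moment map equation at the same central
 level, the squared norms of the two halves of the infinitesimal action agree, so an intertwiner also
 intertwines the adjoints.\<close>

lemma intertwiner_adj:
 assumes T: "T \<in> cen" and k: "k \<in> \<C>" and m: "rmom m = T" and n: "rmom n = T" and kmn: "k |> m = n <| k"
 shows "k\<^sup>H |> n = m <| k\<^sup>H"
proof -
 have nsq: "DD n m k \<bullet> DD n m k = k \<bullet> (rip n n ** k) + k \<bullet> (k ** lip m m) - 2 * ((n <| k) \<bullet> (k |> m))" for n m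
 proof -
  have 1: "(n <| k) \<bullet> (n <| k) = k \<bullet> (rip n n ** k)" by (simp add: inner_rm rip_def mm)
  have 2: "(k |> m) \<bullet> (k |> m) = k \<bullet> (k ** lip m m)" by (simp add: inner_lm lip_def mm)
  show ?thesis unfolding DD_def inner_diff_left inner_diff_right 1 2 by (simp add: inner_commute)
 qed
 have cross: "(J_op n <| k) \<bullet> (k |> J_op m) = (n <| k) \<bullet> (k |> m)"
 proof -
  have "(J_op n <| k) \<bullet> (k |> J_op m) = J_op (k\<^sup>H |> n) \<bullet> J_op (m <| k\<^sup>H)" by (simp add: J_mult)
  also have "... = (k\<^sup>H |> n) \<bullet> (m <| k\<^sup>H)" by (rule inner_J)
  also have "... = n \<bullet> ((k |> m) <| k\<^sup>H)" by (simp add: inner_lm' lm_simps)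
  also have "... = (n <| k) \<bullet> (k |> m)" by (simp add: inner_rm')
  finally show ?thesis .
 qed
 have J: "rip (J_op n) (J_op n) = lip n n" "lip (J_op m) (J_op m) = rip m m" by (simp_all add: rip_om lip_om J_distribs om_distribs)
 have "DD n m k \<bullet> DD n m k - DD (J_op n) (J_op m) k \<bullet> DD (J_op n) (J_op m) k
   = k \<bullet> (k ** rmom m) - k \<bullet> (rmom n ** k)" unfolding nsq cross J by (simp add: rmom_def mm inner_diff_right)
 also have "... = 0" using cenD(2)[OF T k] by (simp add: m n)
 finally have "DD (J_op n) (J_op m) k \<bullet> DD (J_op n) (J_op m) k = 0" using kmn by (simp add: DD_def)
 hence "J_op n <| k = k |> J_op m" by (simp add: DD_def)
 hence "J_op (J_op n <| k) = J_op (k |> J_op m)" by simp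
 thus ?thesis by (simp add: J_mult J_distribs lm_distribs)
qed

text \<open>An intertwiner and its adjoint compose to an endomorphism of a brick, a positive scalar, so a multiple of
 the intertwiner is unitary.\<close>

lemma sol_unique:
 assumes T: "T \<in> cen" and b: "brick E" and m: "m \<in> sol T E" and n: "n \<in> sol T E"
 shows "n \<in> orb m"
proof -
 obtain g h where gh: "(g, h) \<in> GL" "m = g |> (E <| h)" using m by (auto simp: sol_def)
 have "n \<in> sol T m" using n sol_gauge[OF gh(1), of T E] gh(2) by simp
 then obtain k l where kl: "(k, l) \<in> GL" "n = k |> (m <| l)" by (auto simp: sol_def)
 have bm: "brick m" using brick_gauge[OF gh(1) b] gh(2) by simp
 have i: "k |> m = n <| k" by (rule gauge_intertwine[OF kl])
 have mn: "rmom m = T" "rmom n = T" using m n by (simp_all add: sol_def)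
 have j: "k\<^sup>H |> n = m <| k\<^sup>H" by (rule intertwiner_adj[OF T GLD(1)[OF kl(1)] mn i])
 have "(k\<^sup>H ** k) |> m = k\<^sup>H |> (k |> m)" by (simp add: lm_simps)
 also have "... = (k\<^sup>H |> n) <| k" unfolding i by (simp add: lm_simps)
 also have "... = m <| (k\<^sup>H ** k)" unfolding j by (simp add: lm_simps)
 finally have "(k\<^sup>H ** k) |> m = m <| (k\<^sup>H ** k)" .
 moreover have "k\<^sup>H ** k \<in> \<C>" using GLD(1)[OF kl(1)] by (simp add: C_closed C_adj)
 ultimately obtain c where c: "k\<^sup>H ** k = mat c" using bm by (auto simp: brick_def)
 have mc: "mat c = c \<odot> (mat 1 :: 'g End)" for c using mat_mult_eq_cs[of c "mat 1"] by simp
 have tr: "trace (k\<^sup>H ** k) = of_real ((norm k)\<^sup>2)"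
 proof -
  have "Re (trace (k\<^sup>H ** k)) = (norm k)\<^sup>2" by (simp add: trace_mul_sym[of "k\<^sup>H"] Re_trace_mult_adj)
  moreover have "cnj (trace (k\<^sup>H ** k)) = trace (k\<^sup>H ** k)" by (simp flip: trace_adj add: adj_mult)
  hence "Im (trace (k\<^sup>H ** k)) = 0" by (simp add: complex_eq_iff)
  ultimately show ?thesis by (simp add: complex_eq_iff)
 qed
 have k0: "k ~= 0"
 proof
  assume "k = 0"
  hence "trace (mat 1 :: 'g End) = 0" using GLD(3)[OF kl(1)] by (metis mult_zero(2) trace_zero)
  thus False by (simp add: trace_mat)
 qed
 define s where "s = (norm k)\<^sup>2 / order"
 have s: "s > 0" using k0 order_pos by (simp add: s_def)
 have "of_nat CARD('g) * c = of_real ((norm k)\<^sup>2)" using tr unfolding c trace_mat .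
 hence "c = of_real s" by (simp add: s_def order_def field_simps)
 hence ks: "k\<^sup>H ** k = s *\<^sub>R mat 1" using c mc cs_of_real by metis
 define u where "u = (1 / sqrt s) *\<^sub>R k"
 have "u\<^sup>H ** u = mat 1" unfolding u_def using s by (simp add: mm ks)
 hence u: "u \<in> unitaries \<gamma>" using GLD(1)[OF kl(1)] by (simp add: unitaries_def u_def C_closed)
 have "u |> m = n <| u" unfolding u_def lm_scale i ..
 hence "(u |> m) <| u\<^sup>H = n" by (simp add: lm_simps unitariesD[OF u])
 hence "n = act u m" by (simp add: act_eq[OF u] lm_simps)
 thus ?thesis using u by (auto simp: orbit_def)
qed

lemma rmom_unitary: assumes u: "u \<in> unitaries \<gamma>" shows "rmom (u |> (m <| u\<^sup>H)) = u ** rmom m ** u\<^sup>H"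
proof -
 have "u\<^sup>H ** (u ** A) = A" for A :: "'g End" by (simp add: mm_assoc unitariesD[OF u])
 thus ?thesis by (simp add: rmom_def lip_def rip_def adj_mult mm)
qed

lemma unitary_GL: "u \<in> unitaries \<gamma> ==> (u, u\<^sup>H) \<in> GL" by (simp add: GL_def unitariesD C_adj)

lemma sol_orbit:
 assumes T: "T \<in> cen" and b: "brick E" and m: "m \<in> sol T E"
 shows "orb m = sol T E"
proof
 show "sol T E \<subseteq> orb m" using sol_unique[OF T b m] by blast
 show "orb m \<subseteq> sol T E"
 proof
  fix n assume "n \<in> orb m"
  then obtain u where u: "u \<in> unitaries \<gamma>" "n = u |> (m <| u\<^sup>H)" by (auto simp: orbit_def act_eq)
  obtain g h where gh: "(g, h) \<in> GL" "m = g |> (E <| h)" using m by (auto simp: sol_def)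
  have "rmom n = u ** T ** u\<^sup>H" using m by (simp add: u rmom_unitary sol_def)
  also have "... = T ** (u ** u\<^sup>H)" using cenD(2)[OF T unitariesD(1)[OF u(1)]] by (simp add: assoc_r[symmetric])
  finally have "rmom n = T" by (simp add: unitariesD[OF u(1)])
  moreover have "n \<in> \<M>" using m gauge_M[OF unitary_GL[OF u(1)]] by (simp add: u sol_def)
  moreover have "n = (u ** g) |> (E <| (h ** u\<^sup>H))" unfolding u(2) gh(2) gauge_simps ..
  ultimately show "n \<in> sol T E" using GL_mult[OF gh(1) unitary_GL[OF u(1)]] by (auto simp: sol_def)
 qed
qed

section \<open>Continuity\<close>

lemma bb_lm: "bounded_bilinear ((|>) :: 'g End => 'g pair => 'g pair)"
 and bb_rm: "bounded_bilinear ((<|) :: 'g pair => 'g End => 'g pair)"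
 and bb_om: "bounded_bilinear (om :: 'g pair => 'g pair => 'g End)"
 by (simp_all add: bilinear_conv_bounded_bilinear[symmetric] bilinear_def linear_pair)

lemma linear_J: "linear (J_op :: 'g pair => 'g pair)" by (rule structures_linear)

lemma bounded_linear_J: "bounded_linear (J_op :: 'g pair => 'g pair)" using linear_J linear_conv_bounded_linear by blast

lemma rmom_om: "rmom m = om m (J_op m) + om (J_op m) m" by (simp add: S_forms)

lemma tendsto_rmom: "(f \<longlongrightarrow> m) F ==> ((%x. rmom (f x :: 'g pair)) \<longlongrightarrow> rmom m) F" unfolding rmom_om
 by (intro tendsto_add bounded_bilinear.tendsto[OF bb_om] bounded_linear.tendsto[OF bounded_linear_J])

lemma closed_C: "closed \<C>" and closed_M: "closed \<M>" by (simp_all add: closed_subspace subspace_C subspace_M)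

lemma rmom_scaleR: "rmom (c *\<^sub>R m) = c\<^sup>2 *\<^sub>R rmom (m :: 'g pair)"
 unfolding rmom_om linear_scale[OF linear_J] by (simp add: om_distribs power2_eq_square scaleR_add_right)

section \<open>Boundedness of gauge orbits\<close>

text \<open>The polynomial expressions without constant term in a point of the flat space.\<close>

inductive_set words :: "('g pair => 'g End) set" where
 fst: "(%m. fst m) \<in> words"
| snd: "(%m. snd m) \<in> words"
| add: "a \<in> words ==> b \<in> words ==> (%m. a m + b m) \<in> words"
| scale: "a \<in> words ==> (%m. c \<odot> a m) \<in> words"
| grp: "a \<in> words ==> (%m. R g ** a m) \<in> words"
| fst_mult: "a \<in> words ==> (%m. fst m ** a m) \<in> words"
| snd_mult: "a \<in> words ==> (%m. snd m ** a m) \<in> words"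

lemma tendsto_mult_matrix: "((f :: _ => 'g End) \<longlongrightarrow> a) F ==> ((k :: _ => 'g End) \<longlongrightarrow> b) F ==> ((%x. f x ** k x) \<longlongrightarrow> a ** b) F"
 by (rule bounded_bilinear.tendsto[OF bb_mult])

lemma tendsto_cs: "(f \<longlongrightarrow> a) F ==> ((%x. c \<odot> f x :: 'g End) \<longlongrightarrow> c \<odot> a) F"
 by (rule bounded_linear.tendsto[OF linear_conv_bounded_linear[THEN iffD1, OF linear_cs]])

lemma words_tendsto:
 assumes "w \<in> words" "(f \<longlongrightarrow> m) F" shows "((%x. w (f x)) \<longlongrightarrow> w m) F" using assms(1)
proof induction
 case fst show ?case by (rule tendsto_fst[OF assms(2)])
next
 case snd show ?case by (rule tendsto_snd[OF assms(2)])
next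
 case (add a b) thus ?case by (intro tendsto_add)
next
 case (scale a c) thus ?case by (intro tendsto_cs)
next
 case (grp a g) thus ?case by (intro tendsto_mult_matrix tendsto_const)
next
 case (fst_mult a) thus ?case by (intro tendsto_mult_matrix tendsto_fst[OF assms(2)])
next
 case (snd_mult a) thus ?case by (intro tendsto_mult_matrix tendsto_snd[OF assms(2)])
qed

lemma words_0: "w \<in> words ==> w 0 = 0" by (induction rule: words.induct) simp_all

lemma words_gauge:
 assumes "w \<in> words" and gh: "(g, h) \<in> GL" shows "w (g |> (E <| h)) = g ** w E ** h" using assms(1)
proof induction
 case (grp a k)
 have "R k ** (g ** A) = g ** (R k ** A)" for A by (rule C_left[OF GLD(1)[OF gh]])
 thus ?case using grp by (simp add: mm)
qed (simp_all add: mm GLD[OF gh])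

lemma norm_lm_split: "F \<in> Pr ==> val (rmom m) F = (norm (F |> (m <| (mat 1 - F))))\<^sup>2 - (norm ((mat 1 - F) |> (m <| F)))\<^sup>2"
proof -
 assume F: "F \<in> Pr"
 note FD = PrD[OF F] PrD[OF Pr_compl[OF F]]
 let ?G = "mat 1 - F"
 have sq: "(norm (A |> (m <| B)))\<^sup>2 = (A |> (m <| B)) \<bullet> m" if "A \<in> Pr" "B \<in> Pr" for A B
 proof -
  let ?X = "A |> (m <| B)"
  have "A |> ?X = ?X" "?X <| B = ?X" by (simp_all add: lm_simps PrD that)
  hence "?X \<bullet> ?X = m \<bullet> ?X" using inner_lm'[of A "m <| B" ?X] inner_rm'[of m B ?X] by (simp add: PrD that)
  thus ?thesis by (simp add: power2_norm_eq_inner inner_commute)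
 qed
 have "(F |> (m <| ?G)) \<bullet> m - (?G |> (m <| F)) \<bullet> m = (F |> m) \<bullet> m - (m <| F) \<bullet> m"
  by (simp add: lm_distribs lm_simps inner_diff_left)
 also have "... = F \<bullet> rmom m" by (simp add: inner_lm inner_rm rmom_def inner_diff_right)
 also have "... = val (rmom m) F" by (simp add: val_def inner_trace adj_rmom trace_mul_sym[of F])
 finally show ?thesis using sq[OF F Pr_compl[OF F]] sq[OF Pr_compl[OF F] F] by simp
qed

lemma val_rmom_nonneg: "subm m F ==> val (rmom m) F \<ge> 0"
 and rmom_0_split: "subm m F ==> val (rmom m) F = 0 ==> F |> m = m <| F"
proof -
 assume s: "subm m F"
 have F: "F \<in> Pr" using s by (rule subm_Pr)
 have z: "(mat 1 - F) |> (m <| F) = 0" using s by (simp add: subm_def lm_distribs lm_simps)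
 show "val (rmom m) F \<ge> 0" unfolding norm_lm_split[OF F] z by simp
 assume "val (rmom m) F = 0"
 hence "F |> (m <| (mat 1 - F)) = 0" unfolding norm_lm_split[OF F] z by simp
 thus "F |> m = m <| F" using s by (simp add: subm_def lm_distribs lm_simps)
qed

lemma words_submodule:
 obtains F where "F \<in> Pr" "!!x. F *v x = x \<longleftrightarrow> x \<in> (%w. w u *v v) ` words" "subm u F"
  "fst u *v v \<in> (%w. w u *v v) ` words" "snd u *v v \<in> (%w. w u *v v) ` words"
proof -
 define W where "W = (%w. w u *v v) ` words"
 have W_mult: "R g *v x \<in> W" "fst u *v x \<in> W" "snd u *v x \<in> W" "c *s x \<in> W" if xW: "x \<in> W" for x g c
 proof -
  obtain w where w: "w \<in> words" "x = w u *v v" using xW by (auto simp: W_def)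
  show "R g *v x \<in> W" using words.grp[OF w(1), of g] w(2) unfolding W_def by (auto simp: mv_assoc intro!: rev_image_eqI)
  show "fst u *v x \<in> W" using words.fst_mult[OF w(1)] w(2) unfolding W_def by (auto simp: mv_assoc intro!: rev_image_eqI)
  show "snd u *v x \<in> W" using words.snd_mult[OF w(1)] w(2) unfolding W_def by (auto simp: mv_assoc intro!: rev_image_eqI)
  show "c *s x \<in> W" using words.scale[OF w(1), of c] w(2) unfolding W_def by (auto simp: cs_vec intro!: rev_image_eqI)
 qed
 have Wadd: "x + y \<in> W" if "x \<in> W" "y \<in> W" for x y
 proof -
  obtain a b where ab: "a \<in> words" "x = a u *v v" "b \<in> words" "y = b u *v v" using \<open>x \<in> W\<close> \<open>y \<in> W\<close> by (auto simp: W_def)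
  hence "x + y = (%m. a m + b m) u *v v" by (simp add: matrix_vector_mult_add_rdistrib)
  thus ?thesis using words.add[OF ab(1,3)] unfolding W_def by (rule image_eqI)
 qed
 have fW: "fst u *v v \<in> W" "snd u *v v \<in> W" using words.fst words.snd by (auto simp: W_def intro!: rev_image_eqI)
 have "vec.subspace W" unfolding vec.subspace_def using Wadd W_mult(4) W_mult(4)[OF fW(1), of 0] by auto
 hence "inv_sub W" using W_mult(1) by (simp add: inv_sub_def)
 from Pr_exists[OF this] obtain F where F: "F \<in> Pr" "!!x. F *v x = x \<longleftrightarrow> x \<in> W" by blast
 have sF: "subm u F" unfolding subm_iff[OF F(1)] F(2) using W_mult by blast
 show ?thesis by (rule that[OF F[unfolded W_def] sF fW[unfolded W_def]])
qed

text \<open>Such a point is a direct sum of simple ones; in a summand with nonzero structure maps, the words map any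
 vector that they do not kill to the whole summand.\<close>

lemma word_with_fixed_vector:
 assumes u: "u \<in> \<M>" and r0: "rmom u = 0" and u0: "u ~= 0"
 obtains w v where "w \<in> words" "v ~= 0" "w u *v v = v"
proof -
 let ?S = "%P. subm u P \<and> u <| P ~= 0"
 have "?S (mat 1)" using u0 by (simp add: subm_0_1 lm_simps)
 then obtain P where P: "?S P" and min: "!!F. ?S F ==> rk P \<le> rk F" using ex_has_least_nat[of ?S "mat 1" rk] by blast
 have PP: "P \<in> Pr" using P subm_Pr by blast
 have sp: "F |> u = u <| F" if "subm u F" for F by (rule rmom_0_split[OF that]) (simp add: val_def r0)
 have simple: "F = 0 \<or> F = P" if F: "subm u F" "P ** F = F" for F
 proof (rule ccontr)
  assume n: "\<not> (F = 0 \<or> F = P)"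
  note FP = subm_Pr[OF F(1)]
  have D: "P - F \<in> Pr" by (rule Pr_diff[OF PP FP F(2)])
  have Du: "(P - F) |> u = u <| (P - F)" using sp[OF F(1)] sp[of P] P by (simp add: lm_distribs)
  have "(P - F) |> (u <| (P - F)) = ((P - F) |> u) <| (P - F)" by (simp add: lm_simps)
  also have "... = u <| (P - F)" unfolding Du by (simp add: lm_simps PrD[OF D])
  finally have sD: "subm u (P - F)" using D by (simp add: subm_def)
  have "u <| F = 0" using rk_less[OF FP PP F(2)] n min[of F] F(1) by fastforce
  moreover have "u <| (P - F) = 0"
  proof -
   have "P ** (P - F) = P - F" using F(2) PrD[OF PP] by (simp add: mm)
   moreover have "P - F ~= P" using n by simp
   ultimately show ?thesis using rk_less[OF D PP] min[of "P - F"] sD by fastforce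
  qed
  ultimately show False using P by (simp add: lm_distribs)
 qed
 obtain v0 where v0: "\<not> (fst u *v (P *v v0) = 0 \<and> snd u *v (P *v v0) = 0)"
 proof (rule ccontr)
  assume "\<not> thesis"
  hence "fst u *v (P *v v) = 0 \<and> snd u *v (P *v v) = 0" for v using that by blast
  hence "fst u ** P = 0" "snd u ** P = 0" by (auto intro!: matrix_eqI simp: mv_assoc)
  thus False using P by (simp add: prod_eq_iff)
 qed
 define v where "v = P *v v0"
 have Pv: "P *v v = v" unfolding v_def by (rule Pr_fix[OF PP])
 have v0': "v ~= 0" using v0 by (auto simp: v_def)
 define W where "W = (%w. w u *v v) ` words"
 obtain F where F: "F \<in> Pr" "!!x. F *v x = x \<longleftrightarrow> x \<in> W" and sF: "subm u F"
  and fW: "fst u *v v \<in> W" "snd u *v v \<in> W" unfolding W_def by (rule words_submodule[of u v]) blast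
 have Pw: "P *v (w u *v v) = w u *v v" if "w \<in> words" for w using that
 proof induction
  case (grp a g) thus ?case using C_vec[OF PrD(1)[OF PP]] by (simp flip: mv_assoc)
 next
  case (scale a c) thus ?case by (simp add: cs_vec vec.scale)
 next
  case (add a b) thus ?case by (simp add: matrix_vector_mult_add_rdistrib mv_add_right)
 qed (use P subm_iff[OF PP] Pv in \<open>simp_all flip: mv_assoc\<close>)
 have "P ** F = F" unfolding Pr_le_iff[OF F(1)] F(2) using Pw by (auto simp: W_def)
 moreover have "F ~= 0"
 proof
  assume "F = 0"
  hence "x = 0" if "x \<in> W" for x using F(2)[of x] that by simp
  thus False using fW v0 by (auto simp: v_def)
 qed
 ultimately have "F = P" using simple[OF sF] by blast
 hence "v \<in> W" using F(2) Pv by blast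
 then obtain w where "w \<in> words" "v = w u *v v" unfolding W_def by (rule imageE)
 thus ?thesis using that[OF _ v0', of w] by presburger
qed

lemma tendsto_det: "(f \<longlongrightarrow> a) F ==> ((%x. det (f x :: 'g End)) \<longlongrightarrow> det a) F"
 unfolding det_def by (intro tendsto_intros)

text \<open>In a family of gauge transforms of bounded points, bounded real moment maps bound the points: a
 rescaled limit would have only nilpotent words, as these are limits of conjugates of small matrices.\<close>

lemma gauge_bounded:
 assumes E: "!!n. norm (E n) \<le> B" and gh: "!!n. (g n, h n) \<in> GL" and m: "!!n. m n = g n |> (E n <| h n)"
  and M: "!!n. m n \<in> \<M>" and rm: "!!n. norm (rmom (m n)) \<le> B"
 shows "\<exists>K. \<forall>n::nat. norm (m n) \<le> K"
proof (rule ccontr)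
 assume "\<not> ?thesis"
 hence "\<forall>k::nat. \<exists>n. norm (m n) > real k" by (metis not_le)
 then obtain \<nu> where \<nu>: "!!k. norm (m (\<nu> k)) > real k" by metis
 define a where "a k = inverse (norm (m (\<nu> k)))" for k
 have mp: "norm (m (\<nu> k)) > 0" for k using \<nu>[of k] by (meson le_less_trans of_nat_0_le_iff)
 have "filterlim (%k. norm (m (\<nu> k))) at_top sequentially"
  by (rule filterlim_at_top_mono[OF filterlim_real_sequentially], rule always_eventually) (use \<nu> less_imp_le in blast)
 hence a0: "a \<longlonglongrightarrow> 0" unfolding a_def by (rule tendsto_inverse_0_at_top)
 let ?u = "%k. a k *\<^sub>R m (\<nu> k)"
 have S: "\<forall>k. ?u k \<in> sphere 0 1"
 proof
  fix k show "?u k \<in> sphere 0 1" using mp[of k] by (simp add: a_def)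
 qed
 obtain u l where ul: "u \<in> sphere 0 1" "strict_mono l" "(?u \<circ> l) \<longlonglongrightarrow> u"
  by (rule seq_compactE[OF compact_imp_seq_compact[OF compact_sphere] S]) blast
 have al: "(%k. a (l k)) \<longlonglongrightarrow> 0" using LIMSEQ_subseq_LIMSEQ[OF a0 ul(2)] by (simp add: o_def)
 have lim: "(%k. ?u (l k)) \<longlonglongrightarrow> u" using ul(3) by (simp add: o_def)
 have uM: "u \<in> \<M>" by (rule closed_sequentially[OF closed_M _ lim]) (simp add: M M_scaleR)
 have "(%k. rmom (?u (l k))) \<longlonglongrightarrow> rmom u" by (rule tendsto_rmom[OF lim])
 moreover have "(%k. rmom (?u (l k))) \<longlonglongrightarrow> 0"
 proof (rule Lim_null_comparison)
  show "\<forall>\<^sub>F k in sequentially. norm (rmom (?u (l k))) \<le> (a (l k))\<^sup>2 * B"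
   using rm by (intro always_eventually) (simp add: rmom_scaleR mult_left_mono)
  show "(%k. (a (l k))\<^sup>2 * B) \<longlonglongrightarrow> 0" using tendsto_mult[OF tendsto_power[OF al, of 2] tendsto_const[of B]] by simp
 qed
 ultimately have r0: "rmom u = 0" using LIMSEQ_unique by blast
 have u0: "u ~= 0" using ul(1) by auto
 from word_with_fixed_vector[OF uM r0 u0] obtain w v where w: "w \<in> words" "v ~= 0" "w u *v v = v" by blast
 have "(mat 1 - w u) *v v = 0" using w(3) by (simp add: mv_diff)
 hence d0: "det (mat 1 - w u) = 0" using w(2) invertible_det_nz invertible_left_inverse matrix_left_invertible_ker by metis
 have "(%k. det (mat 1 - w (?u (l k)))) \<longlonglongrightarrow> det (mat 1 - w u)"
  by (intro tendsto_det tendsto_diff tendsto_const words_tendsto[OF w(1)] lim)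
 moreover have "det (mat 1 - w (?u (l k))) = det (mat 1 - w (a (l k) *\<^sub>R E (\<nu> (l k))))" for k
 proof -
  let ?g = "g (\<nu> (l k))" and ?h = "h (\<nu> (l k))" and ?E = "a (l k) *\<^sub>R E (\<nu> (l k))"
  have "?u (l k) = ?g |> (?E <| ?h)" by (simp add: m lm_scale)
  hence "mat 1 - w (?u (l k)) = ?g ** (mat 1 - w ?E) ** ?h" using words_gauge[OF w(1) gh] by (simp add: mult_diff GLD[OF gh])
  hence "det (mat 1 - w (?u (l k))) = det (mat 1 - w ?E) * det (?g ** ?h)" by (simp add: det_mul)
  thus ?thesis by (simp add: GLD[OF gh])
 qed
 ultimately have "(%k. det (mat 1 - w (a (l k) *\<^sub>R E (\<nu> (l k))))) \<longlonglongrightarrow> 0" using d0 by simp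
 moreover have aE: "(%k. a (l k) *\<^sub>R E (\<nu> (l k))) \<longlonglongrightarrow> 0"
 proof (rule Lim_null_comparison)
  show "\<forall>\<^sub>F k in sequentially. norm (a (l k) *\<^sub>R E (\<nu> (l k))) \<le> \<bar>a (l k)\<bar> * B"
   using E by (intro always_eventually) (simp add: mult_left_mono)
  show "(%k. \<bar>a (l k)\<bar> * B) \<longlonglongrightarrow> 0" using tendsto_mult[OF tendsto_rabs[OF al] tendsto_const[of B]] by simp
 qed
 moreover have "(%k. det (mat 1 - w (a (l k) *\<^sub>R E (\<nu> (l k))))) \<longlonglongrightarrow> det (mat 1 - w 0)"
  by (intro tendsto_det tendsto_diff tendsto_const words_tendsto[OF w(1)] aE)
 ultimately have "det (mat 1 - w 0) = 0" using LIMSEQ_unique by blast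
 thus False by (simp add: words_0[OF w(1)])
qed

text \<open>Hence solvability is a closed condition on stable points.\<close>

lemma solvable_closed:
 assumes lim: "E \<longlonglongrightarrow> E0" and M: "!!n. E n \<in> \<M>" and T: "T \<in> cen" and st: "stable T (mat 1) E0"
  and ne: "!!n::nat. sol T (E n) ~= {}"
 shows "sol T E0 ~= {}"
proof -
 have "\<forall>n. \<exists>x. x \<in> sol T (E n)" using ne by blast
 from choice[OF this] obtain m where m: "!!n. m n \<in> sol T (E n)" by blast
 have "\<forall>n. \<exists>q. q \<in> GL \<and> m n = fst q |> (E n <| snd q)"
 proof
  fix n
  from m[of n] obtain g h where "(g, h) \<in> GL" "m n = g |> (E n <| h)" by (auto simp: sol_def)
  thus "\<exists>q. q \<in> GL \<and> m n = fst q |> (E n <| snd q)" by (intro exI[of _ "(g, h)"]) simp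
 qed
 from choice[OF this] obtain q where q: "!!n. q n \<in> GL \<and> m n = fst (q n) |> (E n <| snd (q n))" by blast
 define g h where "g n = fst (q n)" and "h n = snd (q n)" for n
 have gh: "(g n, h n) \<in> GL" "m n = g n |> (E n <| h n)" for n using q[of n] by (simp_all add: g_def h_def)
 have mM: "m n \<in> \<M>" "rmom (m n) = T" for n using m[of n] by (simp_all add: sol_def)
 obtain B where B: "!!n. norm (E n) \<le> B" using convergent_imp_Bseq[OF convergentI[OF lim]] by (auto simp: Bseq_def)
 have "\<exists>K. \<forall>n::nat. norm (m n) \<le> K"
  by (rule gauge_bounded[of E "max B (norm T)" g h m]) (use B gh mM in \<open>auto simp: le_max_iff_disj\<close>)
 then obtain K where K: "!!n. norm (m n) \<le> K" by blast
 define k where "k n = (1 / norm (g n)) *\<^sub>R g n" for n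
 have g0: "g n ~= 0" for n
 proof
  assume "g n = 0"
  hence "trace (mat 1 :: 'g End) = 0" using GLD(3)[OF gh(1)[of n]] by (metis mult_zero(2) trace_zero)
  thus False by (simp add: trace_mat)
 qed
 have kn: "norm (k n) = 1" for n using g0 by (simp add: k_def)
 have S: "\<forall>n. (m n, k n) \<in> cball 0 K \<times> sphere 0 1" using K kn by simp
 have sc: "seq_compact (cball (0::'g pair) K \<times> sphere (0::'g End) 1)"
  by (intro compact_imp_seq_compact compact_Times compact_cball compact_sphere)
 obtain q l where q: "q \<in> cball 0 K \<times> sphere 0 1" "strict_mono l" "((%n. (m n, k n)) \<circ> l) \<longlonglongrightarrow> q"
  by (rule seq_compactE[OF sc S]) blast
 obtain m0 k0 where qe: "q = (m0, k0)" by (cases q)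
 have ml: "(%n. m (l n)) \<longlonglongrightarrow> m0" and kl: "(%n. k (l n)) \<longlonglongrightarrow> k0"
  using tendsto_fst[OF q(3)] tendsto_snd[OF q(3)] by (simp_all add: qe o_def)
 have El: "(%n. E (l n)) \<longlonglongrightarrow> E0" using LIMSEQ_subseq_LIMSEQ[OF lim q(2)] by (simp add: o_def)
 have m0M: "m0 \<in> \<M>" by (rule closed_sequentially[OF closed_M _ ml]) (simp add: mM)
 have k0C: "k0 \<in> \<C>" by (rule closed_sequentially[OF closed_C _ kl]) (simp add: k_def C_closed GLD[OF gh(1)])
 have k00: "k0 ~= 0" using q(1) qe by auto
 have rm: "rmom m0 = T" using LIMSEQ_unique[OF tendsto_rmom[OF ml]] by (simp add: mM)
 have eq: "k n |> E n = m n <| k n" for n using gauge_intertwine[OF gh(1) gh(2)] by (simp add: k_def lm_scale)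
 have "(%n. k (l n) |> E (l n)) \<longlonglongrightarrow> k0 |> E0" by (rule bounded_bilinear.tendsto[OF bb_lm kl El])
 moreover have "(%n. m (l n) <| k (l n)) \<longlonglongrightarrow> m0 <| k0" by (rule bounded_bilinear.tendsto[OF bb_rm ml kl])
 ultimately have int: "k0 |> E0 = m0 <| k0" unfolding eq using LIMSEQ_unique by blast
 have E0M: "E0 \<in> \<M>" by (rule closed_sequentially[OF closed_M _ lim]) (simp add: M)
 have c1: "E0 \<in> corM (mat 1) (mat 1)" "m0 \<in> corM (mat 1) (mat 1)" "k0 \<in> cor (mat 1) (mat 1)"
  using E0M m0M k0C by (auto intro!: corMI corI simp: lm_simps)
 have dd: "DD m0 E0 k0 = 0" by (simp add: DD_def int)
 obtain F I where FI: "subm E0 F" "!!v. F *v v = v \<longleftrightarrow> mat 1 *v v = v \<and> k0 *v v = 0"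
  "subm m0 I" "!!g. ch (mat 1) g = ch F g + ch I g" by (rule hom_kernel_image[OF Pr_0_1(2) Pr_0_1(2) c1 dd]) blast
 have "val T (mat 1) = val T F + val T I" by (rule val_add[OF T FI(4)])
 moreover have "val T (mat 1) = 0" using st by (simp add: stable_def)
 moreover have "val T I \<ge> 0" using val_rmom_nonneg[OF FI(3)] rm by simp
 ultimately have "val T F \<le> 0" by linarith
 hence "F = 0 \<or> F = mat 1" using st FI(1) by (force simp: stable_def)
 moreover have "F ~= mat 1"
 proof
  assume "F = mat 1"
  hence "k0 *v v = 0 *v v" for v using FI(2)[of v] by simp
  hence "k0 = 0" by (rule matrix_eqI)
  thus False using k00 by simp
 qed
 ultimately have "F = 0" by blast
 hence "k0 *v v = 0 ==> v = 0" for v using FI(2)[of v] by simp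
 from inverse_C[OF k0C this] obtain j where j: "j \<in> \<C>" "j ** k0 = mat 1" "k0 ** j = mat 1" by metis
 hence "(k0, j) \<in> GL" using k0C by (simp add: GL_def)
 moreover from gauge_of_intertwine[OF this int] have "m0 = k0 |> (E0 <| j)" .
 ultimately have "m0 \<in> sol T E0" using m0M rm by (auto simp: sol_def)
 thus ?thesis by blast
qed

section \<open>Smooth local solutions\<close>

definition herm0 :: "'g End set" where
 "herm0 = {Y \<in> \<C>. Y\<^sup>H = Y \<and> trace Y = 0}"

lemma subspace_herm0: "subspace herm0" by (auto simp: subspace_def herm0_def C_closed trace_add)

lemma rmom_herm0: "m \<in> \<M> ==> rmom m \<in> herm0" by (simp add: herm0_def rmom_C adj_rmom trace_rmom)

definition drm :: "'g pair => 'g pair => 'g End" where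
 "drm m v = om m (J_op v) + om v (J_op m) + om (J_op m) v + om (J_op v) m"

lemma has_derivative_rmom:
 assumes f: "(f has_derivative f') (at x)"
 shows "((%x. rmom (f x)) has_derivative (%h. drm (f x) (f' h))) (at x)"
proof -
 have J: "((%x. J_op (f x)) has_derivative (%h. J_op (f' h))) (at x)" by (rule bounded_linear.has_derivative[OF bounded_linear_J f])
 have "((%x. om (f x) (J_op (f x)) + om (J_op (f x)) (f x)) has_derivative
   (%h. (om (f x) (J_op (f' h)) + om (f' h) (J_op (f x))) + (om (J_op (f x)) (f' h) + om (J_op (f' h)) (f x)))) (at x)"
  by (intro has_derivative_add bounded_bilinear.FDERIV[OF bb_om] f J)
 thus ?thesis unfolding rmom_om drm_def by (simp add: add.assoc)
qed

lemma drm_lip: "drm m v = lip m v + lip v m - rip m v - rip v m" by (simp add: drm_def lip_om rip_om)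

lemma inner_drm:
 assumes Y: "Y\<^sup>H = Y"
 shows "Y \<bullet> drm m v = 2 * ((Y |> m - m <| Y) \<bullet> v)"
proof -
 have a: "Y \<bullet> lip v m = (Y |> m) \<bullet> v" "Y \<bullet> rip v m = (m <| Y) \<bullet> v" by (simp_all add: inner_lm inner_rm)
 have b: "Y \<bullet> lip m v = (Y |> m) \<bullet> v" "Y \<bullet> rip m v = (m <| Y) \<bullet> v"
  using inner_lm'[of Y v m] inner_rm'[of v Y m] by (simp_all add: inner_lm[symmetric] inner_rm[symmetric] Y inner_commute)
 show ?thesis unfolding drm_lip inner_diff_right[of Y] inner_add_right a b by (simp add: inner_diff_left)
qed

text \<open>The linearised real moment map along the Hermitian directions of the complex gauge group is
 positive definite at a brick, so the inverse function theorem solves the real moment map equation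
 near a given solution, smoothly in the point and in the level.\<close>

lemma local_solution:
 assumes m0: "m0 \<in> \<M>" and br: "brick m0"
 obtains S G H where "open S" "(m0, rmom m0) \<in> S"
  "!!m T. (m, T) \<in> S ==> m \<in> \<M> ==> T \<in> herm0 ==> (G (m, T), H (m, T)) \<in> GL \<and> rmom (G (m, T) |> (m <| H (m, T))) = T"
  "!!p. p \<in> S ==> \<exists>G' H'. (G has_derivative G') (at p) \<and> (H has_derivative H') (at p)"
proof -
 obtain p where p: "linear p" "!!x. p x \<in> herm0" "!!x. x \<in> herm0 ==> p x = x" "!!x y. p x \<bullet> y = x \<bullet> p y"
  using orth_projection[OF subspace_herm0] by metis
 have blp: "bounded_linear p" using p(1) linear_conv_bounded_linear by blast
 let ?a = "%q :: 'g pair \<times> 'g End \<times> 'g End \<times> 'g End. mat 1 + p (fst (snd (snd q)))"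
 let ?B = "%q :: 'g pair \<times> 'g End \<times> 'g End \<times> 'g End. snd (snd (snd q))"
 let ?c = "%q. ?a q |> (fst q <| ?B q)"
 let ?f = "%q. (fst q, fst (snd q), p (rmom (?c q) - fst (snd q)) + (fst (snd (snd q)) - p (fst (snd (snd q)))), ?a q ** ?B q)"
 let ?c' = "%q h. ?a q |> (fst q <| ?B h + fst h <| ?B q) + p (fst (snd (snd h))) |> (fst q <| ?B q)"
 let ?f' = "%q h. (fst h, fst (snd h), p (drm (?c q) (?c' q h) - fst (snd h)) + (fst (snd (snd h)) - p (fst (snd (snd h)))),
   ?a q ** ?B h + p (fst (snd (snd h))) ** ?B q)"
 have df: "(?f has_derivative ?f' q) (at q)" for q
 proof -
  note pr = has_derivative_fst[OF has_derivative_ident] has_derivative_fst[OF has_derivative_snd[OF has_derivative_ident]]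
   has_derivative_fst[OF has_derivative_snd[OF has_derivative_snd[OF has_derivative_ident]]]
   has_derivative_snd[OF has_derivative_snd[OF has_derivative_snd[OF has_derivative_ident]]]
  have a: "(?a has_derivative (%h. p (fst (snd (snd h))))) (at q)"
   using has_derivative_add[OF has_derivative_const bounded_linear.has_derivative[OF blp pr(3)]] by simp
  have c: "(?c has_derivative ?c' q) (at q)" by (rule bounded_bilinear.FDERIV[OF bb_lm a bounded_bilinear.FDERIV[OF bb_rm pr(1) pr(4)]])
  show ?thesis by (intro has_derivative_Pair pr(1) pr(2) has_derivative_add has_derivative_diff pr(3)
     bounded_linear.has_derivative[OF blp pr(3)]
     bounded_linear.has_derivative[OF blp has_derivative_diff[OF has_derivative_rmom[OF c] pr(2)]]
     bounded_bilinear.FDERIV[OF bb_mult a pr(4)])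
 qed
 have bl: "bounded_linear (?f' q)" for q using df[of q] by (rule has_derivative_bounded_linear)
 have ap: "blinfun_apply (Blinfun (?f' q)) = ?f' q" for q by (rule bounded_linear_Blinfun_apply[OF bl])
 have cont: "continuous_on UNIV (%q. Blinfun (?f' q))"
 proof (rule continuous_on_blinfun_componentwise)
  fix i
  have ca: "continuous_on UNIV ?a" and cB: "continuous_on UNIV ?B" and cm: "continuous_on UNIV (%q :: 'g pair \<times> 'g End \<times> 'g End \<times> 'g End. fst q)"
   by (intro continuous_intros bounded_linear.continuous_on[OF blp])+
  have cc: "continuous_on UNIV ?c" by (intro bounded_bilinear.continuous_on[OF bb_lm] bounded_bilinear.continuous_on[OF bb_rm] ca cB cm)
  have cc': "continuous_on UNIV (%q. ?c' q i)"
   by (intro continuous_on_add bounded_bilinear.continuous_on[OF bb_lm] bounded_bilinear.continuous_on[OF bb_rm] ca cB cm continuous_on_const)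
  have cd: "continuous_on UNIV (%q. drm (?c q) (?c' q i))" unfolding drm_def
   by (intro continuous_on_add bounded_bilinear.continuous_on[OF bb_om] bounded_linear.continuous_on[OF bounded_linear_J] cc cc')
  show "continuous_on UNIV (%q. blinfun_apply (Blinfun (?f' q)) i)" unfolding ap
   by (intro continuous_on_Pair continuous_on_add continuous_on_diff continuous_on_const bounded_linear.continuous_on[OF blp] cd
     bounded_bilinear.continuous_on[OF bb_mult] ca cB)
 qed
 define q0 where "q0 = (m0, rmom m0, 0 :: 'g End, mat 1 :: 'g End)"
 have p0: "p 0 = 0" using linear_0[OF p(1)] .
 have inj: "inj (?f' q0)"
 proof (rule linear_injective_0[OF bounded_linear.linear[OF bl], THEN iffD2], intro allI impI)
  fix h assume h: "?f' q0 h = 0"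
  obtain dm dT dA dB where he: "h = (dm, dT, dA, dB)" by (cases h)
  have h': "dm = 0" "dT = 0" "p (drm m0 (m0 <| dB + dm <| mat 1 + p dA |> (m0 <| mat 1)) - dT) + (dA - p dA) = 0" "dB + p dA = 0"
   using h unfolding he q0_def by (auto simp: p0 lm_simps zero_prod_def)
  have e: "p (drm m0 (m0 <| dB + p dA |> m0)) + (dA - p dA) = 0" using h'(3) unfolding h'(1,2) by (simp add: lm_simps)
  let ?Y = "p dA"
  have Y: "?Y \<in> herm0" by (rule p(2))
  have YC: "?Y \<in> \<C>" "?Y\<^sup>H = ?Y" "trace ?Y = 0" using Y by (simp_all add: herm0_def)
  have dB: "dB = - ?Y" using h'(4) by (simp add: eq_neg_iff_add_eq_0)
  have v: "m0 <| dB + ?Y |> m0 = ?Y |> m0 - m0 <| ?Y" by (simp add: dB lm_distribs)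
  have "p (p (drm m0 (m0 <| dB + ?Y |> m0)) + (dA - ?Y)) = 0" using e p0 by simp
  hence pz: "p (drm m0 (m0 <| dB + ?Y |> m0)) = 0" by (simp add: linear_add[OF p(1)] linear_diff[OF p(1)] p(2,3))
  hence dA: "dA = ?Y" using e by simp
  have "?Y \<bullet> drm m0 (?Y |> m0 - m0 <| ?Y) = p ?Y \<bullet> drm m0 (?Y |> m0 - m0 <| ?Y)" by (simp add: p(3)[OF Y])
  also have "... = 0" unfolding p(4)[of ?Y] using pz by (simp add: v)
  finally have "?Y |> m0 = m0 <| ?Y" unfolding inner_drm[OF YC(2)] by simp
  then obtain c where c: "?Y = mat c" using br YC(1) by (auto simp: brick_def)
  hence "c = 0" using YC(3) by (simp add: trace_mat)
  hence "?Y = 0" using c mat_mult_eq_cs[of 0 "mat 1 :: 'g End"] by simp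
  thus "h = 0" using dA dB h'(1,2) by (simp add: he zero_prod_def)
 qed
 obtain k where k: "linear k" "k \<circ> ?f' q0 = id" using linear_injective_left_inverse[OF bounded_linear.linear[OF bl] inj] by blast
 have blk: "bounded_linear k" using k(1) linear_conv_bounded_linear by blast
 have kf: "k (?f' q0 h) = h" for h using fun_cong[OF k(2), of h] by simp
 have inv: "Blinfun k o\<^sub>L Blinfun (?f' q0) = id_blinfun"
  by (rule blinfun_eqI) (simp only: blinfun_apply_blinfun_compose ap bounded_linear_Blinfun_apply[OF blk] kf blinfun_apply_id_blinfun id_apply)
 define ff where "ff = ?f"
 define bf where "bf = (%q. Blinfun (?f' q))"
 have df': "(ff has_derivative blinfun_apply (bf q)) (at q)" for q unfolding ff_def bf_def ap by (rule df)
 have cont': "continuous_on UNIV bf" unfolding bf_def by (rule cont)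
 have inv': "Blinfun k o\<^sub>L bf q0 = id_blinfun" unfolding bf_def by (rule inv)
 obtain U V g g' where UV: "open V" "ff q0 \<in> V" "homeomorphism U V ff g" "!!y. y \<in> V ==> (g has_derivative (g' y)) (at y)"
  using inverse_function_theorem[OF open_UNIV df' cont' UNIV_I inv'] by metis
 let ?i = "%x :: 'g pair \<times> 'g End. (fst x, snd x, 0 :: 'g End, mat 1 :: 'g End)"
 have ci: "continuous_on UNIV ?i" by (intro continuous_intros)
 have di: "(?i has_derivative (%h. (fst h, snd h, 0, 0))) (at x)" for x
  by (intro has_derivative_Pair has_derivative_fst has_derivative_snd has_derivative_ident has_derivative_const)
 show ?thesis
 proof (rule that[of "?i -` V" "%x. ?a (g (?i x))" "%x. ?B (g (?i x))"])
  show "open (?i -` V)" by (rule open_vimage[OF UV(1) ci])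
  have "ff q0 = ?i (m0, rmom m0)" unfolding ff_def q0_def by (simp only: fst_conv snd_conv p0 add_0_right lm_simps(4,5) diff_self mult_id)
  thus "(m0, rmom m0) \<in> ?i -` V" using UV(2) by simp
  show "\<exists>G' H'. ((%x. ?a (g (?i x))) has_derivative G') (at x) \<and> ((%x. ?B (g (?i x))) has_derivative H') (at x)"
   if x: "x \<in> ?i -` V" for x
  proof -
   have gi: "((%x. g (?i x)) has_derivative (%h. g' (?i x) (fst h, snd h, 0, 0))) (at x)" using x by (intro has_derivative_compose[OF di] UV(4)) simp
   have "((%x. ?a (g (?i x))) has_derivative (%h. 0 + p (fst (snd (snd (g' (?i x) (fst h, snd h, 0, 0))))))) (at x)"
    by (intro has_derivative_add has_derivative_const bounded_linear.has_derivative[OF blp] has_derivative_fst has_derivative_snd gi)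
   moreover have "((%x. ?B (g (?i x))) has_derivative (%h. snd (snd (snd (g' (?i x) (fst h, snd h, 0, 0)))))) (at x)" by (intro has_derivative_snd gi)
   ultimately show ?thesis by blast
  qed
  fix m T assume mT: "(m, T) \<in> ?i -` V" and m: "m \<in> \<M>" and T: "T \<in> herm0"
  obtain m1 T1 A B where ge: "g (?i (m, T)) = (m1, T1, A, B)" by (cases "g (?i (m, T))")
  have "ff (g (?i (m, T))) = ?i (m, T)" using UV(3) mT unfolding homeomorphism_def by simp
  hence q: "m1 = m" "T1 = T" "p (rmom ((mat 1 + p A) |> (m <| B)) - T) + (A - p A) = 0" "(mat 1 + p A) ** B = mat 1" unfolding ge ff_def by auto
  have pA: "p A \<in> \<C>" using p(2)[of A] by (simp add: herm0_def)
  have GL: "(mat 1 + p A, B) \<in> GL" by (rule GL_of_inverse[OF _ q(4)]) (simp add: C_closed pA)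
  let ?r = "rmom ((mat 1 + p A) |> (m <| B)) - T"
  have r: "?r \<in> herm0" by (rule subspace_diff[OF subspace_herm0 rmom_herm0[OF gauge_M[OF GL m]] T])
  have "p (p ?r + (A - p A)) = 0" using q(3) p0 by simp
  hence "p ?r = 0" by (simp add: linear_add[OF p(1)] linear_diff[OF p(1)] p(2,3))
  hence "?r = 0" using p(3)[OF r] by simp
  thus "(?a (g (?i (m, T))), ?B (g (?i (m, T)))) \<in> GL \<and>
    rmom (?a (g (?i (m, T))) |> (m <| ?B (g (?i (m, T))))) = T" unfolding ge using GL by simp
 qed
qed

text \<open>Hence solvability is an open condition on bricks.\<close>

lemma solvable_open:
 assumes b: "brick E0" and E0: "E0 \<in> \<M>" and ne: "sol T0 E0 ~= {}"
  and lim: "(E \<longlongrightarrow> E0) F" "(T \<longlongrightarrow> T0) F" and ET: "!!x. E x \<in> \<M>" "!!x. T x \<in> herm0"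
 shows "\<forall>\<^sub>F x in F. sol (T x) (E x) ~= {}"
proof -
 obtain m g h where m: "m \<in> \<M>" "rmom m = T0" "(g, h) \<in> GL" "m = g |> (E0 <| h)" using ne by (auto simp: sol_def)
 have "brick m" using brick_gauge[OF m(3) b] m(4) by simp
 from local_solution[OF m(1) this] obtain S G H where S: "open S" "(m, rmom m) \<in> S"
  "!!m T. (m, T) \<in> S ==> m \<in> \<M> ==> T \<in> herm0 ==> (G (m, T), H (m, T)) \<in> GL \<and> rmom (G (m, T) |> (m <| H (m, T))) = T" by metis
 have "((%x. (g |> (E x <| h), T x)) \<longlongrightarrow> (g |> (E0 <| h), T0)) F"
  by (intro tendsto_Pair lim bounded_bilinear.tendsto[OF bb_lm] bounded_bilinear.tendsto[OF bb_rm] tendsto_const)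
 moreover have "(g |> (E0 <| h), T0) \<in> S" using S(2)[unfolded m(2)] m(4) by simp
 ultimately have "\<forall>\<^sub>F x in F. (g |> (E x <| h), T x) \<in> S" using S(1) by (intro topological_tendstoD)
 thus ?thesis
 proof (rule eventually_mono)
  fix x assume "(g |> (E x <| h), T x) \<in> S"
  from S(3)[OF this gauge_M[OF m(3) ET(1)] ET(2)]
  have "sol (T x) (g |> (E x <| h)) ~= {}" using sol_I[OF _ gauge_M[OF m(3) ET(1)]] by blast
  thus "sol (T x) (E x) ~= {}" using sol_gauge[OF m(3)] by simp
 qed
qed

section \<open>Extensions of two bricks\<close>

text \<open>A point that is the direct sum of two non-isomorphic bricks, with class of norm two.\<close>

definition brick_pair :: "'g End => 'g End => 'g pair => bool" where
 "brick_pair L P m \<longleftrightarrow> P \<in> Pr \<and> P ~= 0 \<and> P ~= mat 1 \<and> N P P = 2 \<and> m \<in> \<M> \<and> P |> m = m <| P \<and> om m m = L \<and>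
   (\<forall>X\<in>\<C>. X |> m = m <| X --> (\<exists>c d. X = c \<odot> P + d \<odot> (mat 1 - P)))"

text \<open>The harmonic representatives of the classes of extensions of the quotient by the submodule.\<close>

definition ext :: "'g End => 'g pair => 'g pair set" where
 "ext P m = {e \<in> corM (mat 1 - P) P. om m e + om e m = 0 \<and>
   (\<forall>X\<in>cor (mat 1 - P) P. e \<bullet> (X |> m - m <| X) = 0)}"

definition good :: "'g End => 'g End => 'g End => 'g pair => bool" where
 "good T L P m \<longleftrightarrow> brick_pair L P m \<and> (\<forall>e\<in>ext P m. e ~= 0 --> brick (m + e) \<and> sol T (m + e) ~= {})"

lemma ext_corM: "e \<in> ext P m ==> e \<in> corM (mat 1 - P) P" by (simp add: ext_def)

lemma subspace_ext: assumes P: "P \<in> Pr" shows "subspace (ext P m)"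
proof -
 note s = subspace_corM[OF Pr_compl[OF P] P]
 show ?thesis using s by (auto simp: subspace_def ext_def om_distribs inner_add_left add_eq_0_iff2)
    (simp_all add: add_eq_0_iff2 flip: scaleR_add_right, (metis add.assoc add.left_commute add.right_neutral)+)?
qed

lemma corM_off:
 assumes e: "e \<in> corM (mat 1 - P) P" and P: "P \<in> Pr"
 shows "P |> e = e" "e <| (mat 1 - P) = e" "e <| P = 0" "(mat 1 - P) |> e = 0" "om e e = 0" "e \<in> \<M>"
proof -
 note D = corMD[OF e Pr_compl[OF P] P]
 show 1: "P |> e = e" "e <| (mat 1 - P) = e" "e \<in> \<M>" by (fact D)+
 have "e <| P = e <| (mat 1 - P) <| P" using D by simp
 thus 2: "e <| P = 0" by (simp only: lm_simps Pr_compl_simps[OF P])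
 have "(mat 1 - P) |> e = (mat 1 - P) |> (P |> e)" using D by simp
 thus "(mat 1 - P) |> e = 0" by (simp only: lm_simps Pr_compl_simps[OF P])
 have "om e e = om (e <| P) e" using om_mult(3)[of e P e] D(2) by simp
 thus "om e e = 0" by (simp add: 2 om_distribs)
qed

lemma ext_om: "e \<in> ext P m ==> P \<in> Pr ==> om (m + e) (m + e) = om m m"
proof -
 assume a: "e \<in> ext P m" "P \<in> Pr"
 have "om (m + e) (m + e) = om m m + (om m e + om e m) + om e e" by (simp add: om_distribs)
 also have "om m e + om e m = 0" using a(1) by (simp add: ext_def)
 finally show ?thesis using corM_off(5)[OF ext_corM[OF a(1)] a(2)] by simp
qed

text \<open>A module is a brick if the value of a class function on every proper submodule exceeds half of its
 value on the module: the kernel and the image of a non-invertible endomorphism cannot both be proper.\<close>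

lemma brick_criterion:
 assumes t: "t \<in> cen" and P: "P \<in> Pr" "P ~= 0" and m: "m \<in> corM P P"
  and half: "!!K. subm m K ==> P ** K = K ==> K ~= 0 ==> K ~= P ==> val t P < 2 * val t K"
  and X: "X \<in> cor P P" "DD m m X = 0"
 shows "\<exists>c. X = c \<odot> P"
proof -
 note XD = corD[OF X(1) P(1) P(1)]
 have iP: "inv_sub (rg P)" by (rule rg_inv[OF P(1)])
 have ne: "rg P ~= {0}"
 proof
  assume "rg P = {0}"
  hence "P = 0" using Pr_eq_0[OF P(1)] by (auto simp: rg_def)
  thus False using P(2) by simp
 qed
 have inv: "X *v v \<in> rg P" for v
 proof -
  have "P *v (X *v v) = X *v v" by (simp add: mv_assoc XD)
  thus ?thesis by (simp add: rg_def)
 qed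
 obtain c v where cv: "v \<in> rg P" "v ~= 0" "X *v v = c *s v"
  by (rule eigenvector_exists[of "rg P" X]) (use iP ne inv in \<open>auto simp: inv_sub_def\<close>)
 define Z where "Z = X - c \<odot> P"
 have Pc: "P \<in> cor P P" by (rule corI) (simp_all add: PrD[OF P(1)])
 have Zc: "Z \<in> cor P P" unfolding Z_def using subspace_diff[OF subspace_cor[OF P(1) P(1)] X(1) cor_cs[OF Pc]] .
 have Zd: "DD m m Z = 0" unfolding Z_def linear_diff[OF linear_DD] DD_cs by (simp add: X(2) DD_self[OF m P(1)])
 obtain K I where KI: "subm m K" "P ** K = K" "!!v. K *v v = v \<longleftrightarrow> P *v v = v \<and> Z *v v = 0"
  "subm m I" "P ** I = I" "!!v. I *v v = v \<longleftrightarrow> v \<in> range ((*v) Z)" "!!g. ch P g = ch K g + ch I g"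
  by (rule hom_kernel_image[OF P(1) P(1) m m Zc Zd]) blast
 have K0: "K ~= 0"
 proof
  assume "K = 0"
  have "Z *v v = 0" using cv by (simp add: Z_def mv_diff cs_vec rg_def)
  hence "K *v v = v" using KI(3) cv(1) by (simp add: rg_def)
  thus False using \<open>K = 0\<close> cv(2) by simp
 qed
 have tr: "trace A = 0 ==> A = 0" if "A \<in> Pr" for A using Pr_norm[OF that] by simp
 have tre: "trace P = trace K + trace I" using KI(7)[of ge] by (simp add: ch_def reg_ge)
 have "Z = 0"
 proof (rule ccontr)
  assume "Z ~= 0"
  have I0: "I ~= 0"
  proof
   assume "I = 0"
   hence "Z *v v = 0 *v v" for v using KI(6)[of "Z *v v"] by simp
   thus False using matrix_eqI[of Z 0] \<open>Z ~= 0\<close> by blast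
  qed
  have "I ~= P" using tre tr[OF subm_Pr[OF KI(1)]] K0 by auto
  moreover have "K ~= P" using tre tr[OF subm_Pr[OF KI(4)]] I0 by auto
  ultimately have "val t P < 2 * val t K" "val t P < 2 * val t I" using half KI(1,2,4,5) K0 I0 by blast+
  moreover have "val t P = val t K + val t I" by (rule val_add[OF t KI(7)])
  ultimately show False by linarith
 qed
 thus ?thesis by (auto simp: Z_def)
qed

lemma scale_gauge:
 assumes P: "P \<in> Pr" and m: "P |> m = m <| P" and e: "e \<in> corM (mat 1 - P) P" and c: "c ~= 0"
 obtains g h where "(g, h) \<in> GL" "m + c \<cdot> e = g |> ((m + e) <| h)"
proof -
 define Q where "Q = mat 1 - P"
 have QP: "Q \<in> Pr" unfolding Q_def by (rule Pr_compl[OF P])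
 have PQ: "P ** Q = 0" "Q ** P = 0" unfolding Q_def by (rule Pr_compl_simps[OF P])+
 note ec = corM_off[OF e P, folded Q_def]
 let ?g = "c \<odot> P + Q" and ?h = "(1 / c) \<odot> P + Q"
 have gh: "?g ** ?h = mat 1" using c by (simp add: mm PrD[OF P] PrD[OF QP] PQ) (simp add: Q_def)
 have GL: "(?g, ?h) \<in> GL" by (rule GL_of_inverse[OF _ gh]) (simp add: C_closed PrD[OF P] PrD[OF QP])
 have gm: "?g |> m = m <| ?g" using m by (simp add: lm_distribs lm_scale Q_def lm_simps)
 have "?g |> (m + e) = (m + c \<cdot> e) <| ?g" by (simp add: lm_distribs(1,2) gm) (simp add: lm_distribs lm_scale ec ps_distribs)
 from gauge_of_intertwine[OF GL this] show ?thesis by (rule that[OF GL])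
qed

lemma mat_1_neq_0: "mat 1 ~= (0 :: 'g End)"
proof
 assume "mat 1 = (0 :: 'g End)"
 hence "trace (mat 1 :: 'g End) = 0" by (simp only: trace_zero)
 thus False by (simp add: trace_mat)
qed

lemma absorb:
 fixes A B D :: "'g End"
 shows "A ** B = B ==> B ** D = D ==> A ** D = D" "A ** B = A ==> B ** D = 0 ==> A ** D = 0"
  "B ** A = A ==> D ** B = 0 ==> D ** A = 0" using mm_assoc[of A B D] mm_assoc[of D B A] by simp_all

lemma absorb_pair:
 fixes m :: "'g pair"
 shows "B |> m = m ==> A ** B = 0 ==> A |> m = 0" "m <| B = m ==> B ** A = 0 ==> m <| A = 0"
 using lm_simps(1)[of A B m] lm_simps(2)[of m B A] by (simp_all add: lm_simps(6,7))

lemma cen_corner: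
 assumes L: "L \<in> cen" and P: "P \<in> Pr" and X: "X \<in> cor P P"
 shows "L ** P ** X = X ** (L ** P)" "P ** L ** X = X ** (P ** L)"
proof -
 note D = corD[OF X P P]
 have c: "L ** P = P ** L" "L ** X = X ** L" using cenD(2)[OF L] PrD(1)[OF P] D(1) by blast+
 have "L ** P ** X = L ** X" by (simp add: assoc_r D)
 also have "... = (X ** P) ** L" using c D by simp
 also have "... = X ** (L ** P)" by (simp add: assoc_r c(1))
 finally show "L ** P ** X = X ** (L ** P)" .
 thus "P ** L ** X = X ** (P ** L)" by (simp only: c(1))
qed

lemma trace_Pr_real: "T \<in> cen ==> T\<^sup>H = T ==> F \<in> Pr ==> Im (trace (T ** F)) = 0"
proof -
 assume a: "T \<in> cen" "T\<^sup>H = T" "F \<in> Pr"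
 have "cnj (trace (T ** F)) = trace (F ** T)" by (simp flip: trace_adj add: adj_mult a PrD)
 also have "... = trace (T ** F)" by (rule trace_mul_sym)
 finally show ?thesis by (simp add: complex_eq_iff)
qed

definition tie :: "'g End" where "tie = mat 1 - order *\<^sub>R triv"

lemma tie_cen: "tie \<in> cen" "trace tie = 0"
proof -
 have "mat 1 \<in> cen" by (simp add: cen_def C_closed)
 moreover have "triv \<in> cen" using triv_C PrD(1)[OF triv_Pr] by (simp add: cen_def)
 ultimately show "tie \<in> cen" by (simp add: tie_def cen_closed)
 have "trace tie = of_nat CARD('g) - order *\<^sub>R 1" by (simp add: tie_def trace_sub trace_triv trace_mat)
 thus "trace tie = 0" by (simp add: order_def scaleR_conv_of_real)
qed

lemma val_tie:
 assumes F: "F \<in> Pr"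
 shows "val tie F = Re (trace F) \<or> val tie F = Re (trace F) - order" "0 \<le> Re (trace F)" "Re (trace F) \<le> order"
  "F ~= 0 ==> F ~= mat 1 ==> val tie F ~= 0" "\<bar>val tie F\<bar> \<le> order"
proof -
 have v: "val tie F = Re (trace F) - order * Re (trace (triv ** F))" by (simp add: val_def tie_def mm trace_sub)
 show 1: "val tie F = Re (trace F) \<or> val tie F = Re (trace F) - order" by (rule Pr_triv[OF F]) (simp_all add: v trace_triv)
 have pos: "Re (trace A) \<ge> 0 \<and> (A ~= 0 --> Re (trace A) > 0)" if "A \<in> Pr" for A using Pr_norm[OF that] by simp
 have o: "Re (trace (mat 1 - F)) = order - Re (trace F)" by (simp add: trace_sub trace_mat order_def)
 show 2: "0 \<le> Re (trace F)" "Re (trace F) \<le> order" using pos[OF F] pos[OF Pr_compl[OF F]] o by auto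
 show "val tie F ~= 0" if "F ~= 0" "F ~= mat 1" using pos[OF F] pos[OF Pr_compl[OF F]] o 1 that by auto
 show "\<bar>val tie F\<bar> \<le> order" using 1 2 by auto
qed

lemma val_lin: "val (s + c *\<^sub>R t) F = val s F + c * val t F" by (simp add: val_def mm trace_add)

end

context mckay_irr
begin

text \<open>There are finitely many classes, so a small perturbation keeps all strict comparisons of values.\<close>

lemma tie_breaking:
 assumes T: "T \<in> cen"
 obtains \<epsilon> where "\<epsilon> > 0" "!!P Q. P \<in> Pr ==> Q \<in> Pr ==> val T P < val T Q ==>
  val (T + \<epsilon> *\<^sub>R tie) P < val (T + \<epsilon> *\<^sub>R tie) Q"
proof -
 have "val T ` Pr = (%c. Re (\<Sum>g\<in>UNIV. T $ g $ ge * c g)) ` (ch ` Pr)"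
  unfolding image_image val_def by (rule image_cong) (simp_all add: cen_trace[OF T])
 hence fin: "finite (val T ` Pr)" using finite_classes by simp
 let ?D = "insert 1 {d. d > 0 \<and> (\<exists>x\<in>val T ` Pr. \<exists>y\<in>val T ` Pr. d = y - x)}"
 have "{d. d > 0 \<and> (\<exists>x\<in>val T ` Pr. \<exists>y\<in>val T ` Pr. d = y - x)} \<subseteq> (%(x, y). y - x) ` (val T ` Pr \<times> val T ` Pr)" by auto
 hence fD: "finite ?D" using finite_subset[OF _ finite_imageI[OF finite_cartesian_product[OF fin fin]]] by blast
 define \<delta> where "\<delta> = Min ?D"
 have "\<delta> \<in> ?D" unfolding \<delta>_def by (rule Min_in[OF fD]) simp
 hence d0: "\<delta> > 0" by auto
 define \<epsilon> where "\<epsilon> = \<delta> / (4 * order)"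
 have e0: "\<epsilon> > 0" using d0 order_pos by (simp add: \<epsilon>_def)
 show ?thesis
 proof (rule that[OF e0])
  fix P Q assume PQ: "P \<in> Pr" "Q \<in> Pr" "val T P < val T Q"
  have "val T Q - val T P \<in> ?D" using PQ by auto
  hence "\<delta> \<le> val T Q - val T P" unfolding \<delta>_def by (rule Min_le[OF fD])
  moreover have "\<epsilon> * (val tie P - val tie Q) \<le> \<epsilon> * (2 * order)"
   using val_tie(5)[OF PQ(1)] val_tie(5)[OF PQ(2)] e0 by (intro mult_left_mono) auto
  moreover have "\<epsilon> * (2 * order) = \<delta> / 2" using order_pos by (simp add: \<epsilon>_def)
  ultimately show "val (T + \<epsilon> *\<^sub>R tie) P < val (T + \<epsilon> *\<^sub>R tie) Q"
   unfolding val_lin right_diff_distrib using d0 by linarith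
 qed
qed

end

locale mckay_level = mckay_irr \<gamma> r Rep for \<gamma> :: "'g::finite => complex^2^2" and r Rep +
 fixes T L :: "'g End"
 assumes T: "T \<in> cen" "T\<^sup>H = T" "trace T = 0" and L: "L \<in> cen"
  and reg: "!!P. P \<in> Pr ==> N P P = 2 ==> trace (T ** P) ~= 0 \<or> trace (L ** P) ~= 0"
begin

section \<open>Stability at a generic level\<close>

lemma val_T_1: "val T (mat 1) = 0" by (simp add: val_0_1 T)

text \<open>A least submodule of value zero would be stable, so of norm two, and both parts of the level would vanish
 on its class, which a generic level excludes.\<close>

lemma semistable_stable:
 assumes E: "E \<in> \<M>" "om E E = L" and semi: "!!F. subm E F ==> val T F \<ge> 0"
 shows "stable T (mat 1) E"
proof -
 let ?S = "%F. subm E F \<and> F ~= 0 \<and> F ~= mat 1 \<and> val T F = 0"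
 have no: "\<not> ?S F0" for F0
 proof
  assume "?S F0"
  then obtain F where F: "?S F" and min: "!!G. ?S G ==> rk F \<le> rk G" using ex_has_least_nat[of ?S F0 rk] by blast
  have FP: "F \<in> Pr" using F subm_Pr by blast
  have st: "stable T F (E <| F)" unfolding stable_def
  proof (intro conjI allI impI)
   show "F \<in> Pr" "F ~= 0" "val T F = 0" using F FP by auto
   show "E <| F \<in> corM F F" using subm_corM(1)[OF E(1)] F by blast
   fix G assume G: "subm (E <| F) G \<and> F ** G = G \<and> G ~= 0 \<and> G ~= F"
   hence sG: "subm E G" using subm_of_sub FP by blast
   have "G ~= mat 1" using G F by auto
   moreover have "rk G < rk F" using rk_less[OF subm_Pr[OF sG] FP] G by blast
   ultimately have "val T G ~= 0" using min[of G] sG G by auto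
   thus "val T G > 0" using semi[OF sG] by simp
  qed
  have "N F F = 2" by (rule stable_N[OF T(1) st L]) (use subm_om(1)[of E F] F E(2) in auto)
  moreover have "trace (T ** F) = 0" using F trace_Pr_real[OF T(1,2) FP] by (simp add: val_def complex_eq_iff)
  moreover have "trace (L ** F) = 0" using subm_trace_om[of E F] F E(2) by simp
  ultimately show False using reg[OF FP] by blast
 qed
 show ?thesis unfolding stable_def
 proof (intro conjI allI impI)
  show "mat 1 \<in> Pr" "val T (mat 1) = 0" by (simp_all add: Pr_0_1 val_T_1)
  show "E \<in> corM (mat 1) (mat 1)" using E(1) by (intro corMI) (simp_all add: lm_simps)
  show "mat 1 ~= (0 :: 'g End)" by (simp add: mat_def vec_eq_iff) 
  fix F assume F: "subm E F \<and> mat 1 ** F = F \<and> F ~= 0 \<and> F ~= mat 1"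
  thus "val T F > 0" using semi[of F] no[of F] by auto
 qed
qed

lemma Lev_stable: assumes m: "m \<in> Lev T L" shows "stable T (mat 1) m"
proof (rule semistable_stable)
 show "m \<in> \<M>" "om m m = L" using m by (simp_all add: Lev_def)
 show "val T F \<ge> 0" if "subm m F" for F using val_rmom_nonneg[OF that] m by (simp add: Lev_def)
qed

lemma stable_is_brick: assumes s: "stable T (mat 1) E" shows "brick E" unfolding brick_def
proof (intro ballI impI)
 fix X assume X: "X \<in> \<C>" "X |> E = E <| X"
 have "X \<in> cor (mat 1) (mat 1)" using X(1) by (intro corI) simp_all
 moreover have "DD E E X = 0" using X(2) by (simp add: DD_def)
 ultimately obtain c where "X = c \<odot> mat 1" using stable_brick[OF T(1) s] by blast
 thus "\<exists>c. X = mat c" using mat_mult_eq_cs[of c "mat 1 :: 'g End"] by (intro exI[of _ c]) simp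
qed

section \<open>The least destabilising submodule\<close>

text \<open>A submodule of a non-simple solution whose class is least for a generic refinement of the
 stability condition. Minimality makes the submodule and its quotient non-isomorphic bricks and all their
 nonsplit extensions semistable.\<close>

lemma least_submodule:
 assumes E: "E \<in> Lev T L" and F0: "subm E F0" "F0 ~= 0" "F0 ~= mat 1"
 obtains P m e where "brick_pair L P m" "e \<in> ext P m" "e ~= 0" "sol T (m + e) ~= {}"
  "!!e. e \<in> ext P m ==> e ~= 0 ==> stable T (mat 1) (m + e)"
proof -
 have EM: "E \<in> \<M>" and omE: "om E E = L" and rE: "rmom E = T" using E by (simp_all add: Lev_def)
 have stE: "stable T (mat 1) E" by (rule Lev_stable[OF E])
 obtain \<epsilon> where eps: "\<epsilon> > 0" "!!P Q. P \<in> Pr ==> Q \<in> Pr ==> val T P < val T Q ==>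
  val (T + \<epsilon> *\<^sub>R tie) P < val (T + \<epsilon> *\<^sub>R tie) Q" by (rule tie_breaking[OF T(1)]) blast
 define t where "t = T + \<epsilon> *\<^sub>R tie"
 define f where "f = val t"
 have t: "t \<in> cen" unfolding t_def by (intro cen_closed T tie_cen)
 have mono: "P \<in> Pr ==> Q \<in> Pr ==> f P \<le> f Q ==> val T P \<le> val T Q" for P Q
  using eps(2)[of Q P] unfolding f_def t_def by (meson not_le)
 have f1: "f (mat 1) = 0" by (simp add: f_def val_0_1 t_def trace_add T tie_cen)
 have f0: "f 0 = 0" by (simp add: f_def val_0_1)
 have f_diff: "f (A - B) = f A - f B" "f (A + B) = f A + f B" for A B by (simp_all add: f_def val_def mm trace_sub trace_add)
 have vd: "val T (A - B) = val T A - val T B" "val T (A + B) = val T A + val T B" for A B by (simp_all add: val_def mm trace_sub trace_add)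
 let ?S = "%F. subm E F \<and> F ~= 0 \<and> F ~= mat 1"
 have pos: "f F > 0" if "?S F" for F
 proof -
  have "val T F > 0" using stE that by (simp add: stable_def)
  thus ?thesis using eps(2)[OF Pr_0_1(1) subm_Pr, of E F] that f0 by (simp add: f_def t_def val_0_1)
 qed
 have "f ` Pr = (%c. Re (\<Sum>g\<in>UNIV. t $ g $ ge * c g)) ` (ch ` Pr)"
  unfolding image_image f_def val_def by (rule image_cong) (simp_all add: cen_trace[OF t])
 hence "finite (f ` Pr)" using finite_classes by simp
 hence fin: "finite (f ` {F. ?S F})" by (rule finite_subset[rotated]) (use subm_Pr in blast)
 have ne: "f ` {F. ?S F} ~= {}" using F0 by blast
 have "Min (f ` {F. ?S F}) \<in> f ` {F. ?S F}" by (rule Min_in[OF fin ne])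
 then obtain P where P: "?S P" and mP: "f P = Min (f ` {F. ?S F})" by auto
 have min: "f P \<le> f F" if "?S F" for F unfolding mP by (rule Min_le[OF fin]) (use that in blast)
 have PP: "P \<in> Pr" using P subm_Pr by blast
 define Q where "Q = mat 1 - P"
 have QP: "Q \<in> Pr" unfolding Q_def by (rule Pr_compl[OF PP])
 have PQ: "P ** Q = 0" "Q ** P = 0" unfolding Q_def by (rule Pr_compl_simps[OF PP])+
 have Q0: "Q ~= 0" using P by (auto simp: Q_def)
 have p0: "f P > 0" by (rule pos[OF P])
 have fQ: "f Q = - f P" by (simp add: Q_def f_diff f1)
 have eqcase: "f A ~= f B" if "A \<in> Pr" "B \<in> Pr" "B ** A = A" "A ~= B" "A ~= 0" for A B
 proof
  assume e: "f A = f B"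
  have D: "B - A \<in> Pr" by (rule Pr_diff[OF that(2,1,3)])
  have "val T A = val T B" using mono[OF that(1,2)] mono[OF that(2,1)] e by simp
  hence "\<epsilon> * val tie (B - A) = 0" using f_diff(1)[of B A] vd(1)[of B A] e unfolding f_def t_def val_lin by linarith
  hence "val tie (B - A) = 0" using eps(1) by auto
  moreover have "B - A ~= mat 1"
  proof
   assume 1: "B - A = mat 1"
   have "(B - A) ** A = 0" using that(3) PrD(3)[OF that(1)] by (simp add: mm)
   thus False using 1 that(5) by simp
  qed
  ultimately show False using val_tie(4)[OF D] that(4) by auto
 qed
 have below: "f K > f P" if K: "subm E K" "P ** K = K" "K ~= 0" "K ~= P" for K
 proof -
  have "K ~= mat 1" using K(2) P by auto
  hence "f P \<le> f K" using min[of K] K by blast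
  thus ?thesis using eqcase[OF subm_Pr[OF K(1)] PP K(2,4,3)] by simp
 qed
 have above: "f K > f P" if K: "subm E K" "K ** P = P" "K ~= mat 1" "K ~= P" for K
 proof -
  have "K ~= 0" using K(2) P by auto
  hence "f P \<le> f K" using min[of K] K by blast
  thus ?thesis using eqcase[OF PP subm_Pr[OF K(1)] K(2)] K(4) P by force
 qed
 define S where "S = E <| P"
 define U where "U = Q |> E"
 have sP: "subm E P" using P by blast
 have S: "S \<in> corM P P" and U: "U \<in> corM Q Q" using subm_corM[OF EM sP] by (simp_all add: S_def U_def Q_def)
 have omS: "om S S = L ** P" and omU: "om U U = Q ** L" using subm_om[OF sP] by (simp_all add: S_def U_def Q_def omE)
 have subS: "subm E K" if "subm S K" "P ** K = K" for K using subm_of_sub[OF that(1)[unfolded S_def] PP that(2)] .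
 have subU: "subm E (P + K)" if "subm U K" "Q ** K = K" for K using subm_of_quot(1)[OF sP] that unfolding U_def Q_def by blast
 have subU_pos: "f K > 0" if K: "subm U K" "Q ** K = K" "K ~= 0" "K ~= Q" for K
 proof -
  have KP: "K ** P = 0"
  proof -
   have "K = K ** Q" using K(2) Pr_le_adj[OF QP subm_Pr[OF K(1)]] by simp
   hence "K ** P = K ** (Q ** P)" by (simp add: mm_assoc)
   thus ?thesis by (simp add: PQ)
  qed
  have "f (P + K) > f P" by (rule above[OF subU[OF K(1,2)]]) (use K(3,4) KP PrD[OF PP] in \<open>auto simp: mm Q_def algebra_simps\<close>)
  thus ?thesis by (simp add: f_diff)
 qed
 have cS: "om S S ** X = X ** om S S" if "X \<in> cor P P" for X unfolding omS by (rule cen_corner(1)[OF L PP that])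
 have brS: "\<exists>c. X = c \<odot> P" if "X \<in> cor P P" "DD S S X = 0" for X
  by (rule brick_criterion[OF t PP _ S _ that]) (use P below[OF subS] p0 in \<open>force simp: f_def\<close>)+
 have brU: "\<exists>c. X = c \<odot> Q" if "X \<in> cor Q Q" "DD U U X = 0" for X
  by (rule brick_criterion[OF t QP Q0 U _ that]) (use subU_pos p0 fQ in \<open>force simp: f_def\<close>)
 have "N P P \<le> 2" by (rule brick_N_le[OF PP S cS brS])
 hence N2: "N P P = 2" using N_eq_2[OF PP] P by blast
 have N8: "N K K = 8" if K: "K \<in> Pr" "!!g. g ~= ge ==> cmod (ch K g) = 2 * cmod (ch P g)" for K
 proof -
  have "N K K = avg (%g. (2 - ch2 g) * (cmod (ch K g))\<^sup>2)" by (rule N_self[OF K(1)])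
  also have "(%g. (2 - ch2 g) * (cmod (ch K g))\<^sup>2) = (%g. 4 * ((2 - ch2 g) * (cmod (ch P g))\<^sup>2))"
  proof
   fix g
   have "ch2 ge = 2" by (simp add: ch2_def \<gamma>_ge mat_def)
   thus "(2 - ch2 g) * (cmod (ch K g))\<^sup>2 = 4 * ((2 - ch2 g) * (cmod (ch P g))\<^sup>2)"
    by (cases "g = ge") (simp_all add: K(2) power_mult_distrib)
  qed
  also have "avg ... = 4 * N P P" unfolding N_self[OF PP] by (rule avg_cmult)
  finally show ?thesis by (simp add: N2)
 qed
 have chQ: "ch Q g = - ch P g" if "g ~= ge" for g using ch_compl[of P g] that by (simp add: Q_def)
 have tr0: "A = 0" if "A \<in> Pr" "!!g. ch A g = 0" for A using Pr_norm[OF that(1)] that(2)[of ge] by (simp add: ch_def reg_ge)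
\<comment> \<open>A nonzero homomorphism from the submodule to the quotient would produce a submodule or a quotient of \<open>E\<close>
 whose class is twice that of \<open>P\<close>: again a brick, but of norm eight.\<close>
 have homPQ: "X = 0" if X: "X \<in> cor P Q" "DD U S X = 0" for X
 proof (rule ccontr)
  assume "X ~= 0"
  obtain K I where KI: "subm S K" "P ** K = K" "!!v. K *v v = v \<longleftrightarrow> P *v v = v \<and> X *v v = 0"
   "subm U I" "Q ** I = I" "!!v. I *v v = v \<longleftrightarrow> v \<in> range ((*v) X)" "!!g. ch P g = ch K g + ch I g"
   by (rule hom_kernel_image[OF PP QP S U X]) blast
  note Kp = subm_Pr[OF KI(1)] and Ip = subm_Pr[OF KI(4)]
  have I0: "I ~= 0"
  proof
   assume "I = 0"
   hence "X *v v = 0 *v v" for v using KI(6)[of "X *v v"] by simp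
   thus False using matrix_eqI[of X 0] \<open>X ~= 0\<close> by blast
  qed
  have KP: "K ~= P" using KI(7) tr0[OF Ip] I0 by auto
  have add: "f P = f K + f I" unfolding f_def by (rule val_add[OF t KI(7)])
  show False
  proof (cases "K = 0")
   case False
   have "f K > f P" by (rule below[OF subS[OF KI(1,2)] KI(2) False KP])
   hence "I = Q" using subU_pos[OF KI(4,5) I0] add by force
   have chK: "ch K g = 2 * ch P g" if "g ~= ge" for g using KI(7)[of g] chQ[OF that] \<open>I = Q\<close> by simp
   have fK: "f K = 2 * f P" using add fQ \<open>I = Q\<close> by simp
   have sK: "subm E K" by (rule subS[OF KI(1,2)])
   have K2: "f G > f P" if G: "subm (E <| K) G" "K ** G = G" "G ~= 0" "G ~= K" for G
   proof (rule below[OF subm_of_sub[OF G(1) Kp G(2)] _ G(3)])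
    show PG: "P ** G = G" by (rule absorb(1)[OF KI(2) G(2)])
    show "G ~= P"
    proof
     assume "G = P"
     hence "K ** P = P" using G(2) by simp
     moreover have "K ** P = K" using Pr_le_adj[OF PP Kp] KI(2) by simp
     ultimately show False using KP by simp
    qed
   qed
   have cK: "E <| K \<in> corM K K" by (rule subm_corM(1)[OF EM sK])
   have oK: "om (E <| K) (E <| K) ** Y = Y ** om (E <| K) (E <| K)" if "Y \<in> cor K K" for Y
    unfolding subm_om(1)[OF sK] omE by (rule cen_corner(1)[OF L Kp that])
   have bK: "\<exists>c. Y = c \<odot> K" if "Y \<in> cor K K" "DD (E <| K) (E <| K) Y = 0" for Y
    by (rule brick_criterion[OF t Kp False cK _ that]) (use K2 fK in \<open>force simp: f_def\<close>)
   have "N K K \<le> 2" by (rule brick_N_le[OF Kp cK oK bK])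
   moreover have "N K K = 8" by (rule N8[OF Kp]) (simp add: chK norm_mult)
   ultimately show False by simp
  next
   case True
   hence chI: "ch I g = ch P g" for g using KI(7)[of g] by (simp add: ch_0)
   have fI: "f I = f P" using add True f0 by simp
   define G where "G = P + I"
   have sG: "subm E G" unfolding G_def by (rule subU[OF KI(4,5)])
   have Gp: "G \<in> Pr" by (rule subm_Pr[OF sG])
   define Q' where "Q' = mat 1 - G"
   have Q'p: "Q' \<in> Pr" unfolding Q'_def by (rule Pr_compl[OF Gp])
   have IQ: "I ** Q = I" using Pr_le_adj[OF QP Ip] KI(5) by simp
   have IP: "I ** P = 0" by (rule absorb(2)[OF IQ PQ(2)])
   have PI: "P ** I = 0" by (rule absorb(3)[OF KI(5) PQ(1)])
   have Q'P: "Q' ** P = 0" "I ** Q' = 0" using IP by (simp_all add: Q'_def G_def mm PrD[OF PP] PrD[OF Ip])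
   have fG: "f G = 2 * f P" by (simp add: G_def f_diff fI)
   have Q'0: "Q' ~= 0" using fG f1 p0 by (auto simp: Q'_def)
   have fQ': "f Q' = - 2 * f P" by (simp add: Q'_def f_diff f1 fG)
   have cQ': "Q' |> E \<in> corM Q' Q'" unfolding Q'_def by (rule subm_corM(2)[OF EM sG])
   have K2: "f K2 > - f P" if K2: "subm (Q' |> E) K2" "Q' ** K2 = K2" "K2 ~= 0" "K2 ~= Q'" for K2
   proof -
    have KQ: "K2 ** Q' = K2" using Pr_le_adj[OF Q'p subm_Pr[OF K2(1)]] K2(2) by simp
    have KP: "K2 ** P = 0" by (rule absorb(2)[OF KQ Q'P(1)])
    have IK: "I ** K2 = 0" by (rule absorb(3)[OF K2(2) Q'P(2)])
    have "f (G + K2) > f P"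
    proof (rule above)
     show "subm E (G + K2)" using subm_of_quot(1)[OF sG] K2(1,2) unfolding Q'_def by blast
     show "(G + K2) ** P = P" by (simp add: G_def mm PrD[OF PP] IP KP)
     show "G + K2 ~= mat 1" using K2(4) by (auto simp: Q'_def algebra_simps)
     show "G + K2 ~= P"
     proof
      assume "G + K2 = P"
      hence "I + K2 = 0" by (simp add: G_def)
      hence "I ** (I + K2) = 0" by simp
      thus False using I0 by (simp add: mm PrD[OF Ip] IK)
     qed
    qed
    thus ?thesis by (simp add: f_diff fG)
   qed
   have oQ: "om (Q' |> E) (Q' |> E) ** Y = Y ** om (Q' |> E) (Q' |> E)" if "Y \<in> cor Q' Q'" for Y
    unfolding subm_om(2)[OF sG, folded Q'_def] omE by (rule cen_corner(2)[OF L Q'p that])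
   have bQ: "\<exists>c. Y = c \<odot> Q'" if "Y \<in> cor Q' Q'" "DD (Q' |> E) (Q' |> E) Y = 0" for Y
    by (rule brick_criterion[OF t Q'p Q'0 cQ' _ that]) (use K2 fQ' in \<open>force simp: f_def\<close>)
   have "N Q' Q' \<le> 2" by (rule brick_N_le[OF Q'p cQ' oQ bQ])
   moreover have "N Q' Q' = 8"
   proof (rule N8[OF Q'p])
    fix g assume "g ~= ge"
    hence "ch Q' g = - 2 * ch P g" using ch_compl[of G g] chI[of g] by (simp add: Q'_def G_def ch_def mm trace_add)
    thus "cmod (ch Q' g) = 2 * cmod (ch P g)" by (simp add: norm_mult)
   qed
   ultimately show False by simp
  qed
 qed
\<comment> \<open>In the other direction the values of kernel and image are too large.\<close>
 have homQP: "X = 0" if X: "X \<in> cor Q P" "DD S U X = 0" for X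
 proof (rule ccontr)
  assume "X ~= 0"
  obtain K I where KI: "subm U K" "Q ** K = K" "!!v. K *v v = v \<longleftrightarrow> Q *v v = v \<and> X *v v = 0"
   "subm S I" "P ** I = I" "!!v. I *v v = v \<longleftrightarrow> v \<in> range ((*v) X)" "!!g. ch Q g = ch K g + ch I g"
   by (rule hom_kernel_image[OF QP PP U S X]) blast
  have I0: "I ~= 0"
  proof
   assume "I = 0"
   hence "X *v v = 0 *v v" for v using KI(6)[of "X *v v"] by simp
   thus False using matrix_eqI[of X 0] \<open>X ~= 0\<close> by blast
  qed
  have KQ: "K ~= Q" using KI(7) tr0[OF subm_Pr[OF KI(4)]] I0 by auto
  have "f I \<ge> f P" using below[OF subS[OF KI(4,5)] KI(5) I0] by (cases "I = P") auto
  moreover have "f K \<ge> 0" using subU_pos[OF KI(1,2) _ KQ] f0 by (cases "K = 0") auto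
  moreover have "f Q = f K + f I" unfolding f_def by (rule val_add[OF t KI(7)])
  ultimately show False using fQ p0 by linarith
 qed
 define m where "m = S + U"
 note SD = corMD[OF S PP PP] and UD = corMD[OF U QP QP]
 have zz: "P |> U = 0" "U <| P = 0" "Q |> S = 0" "S <| Q = 0"
  using absorb_pair(1)[OF UD(2) PQ(1)] absorb_pair(2)[OF UD(3) PQ(2)] absorb_pair(1)[OF SD(2) PQ(2)] absorb_pair(2)[OF SD(3) PQ(1)] by simp_all
 have mM: "m \<in> \<M>" using SD UD by (simp add: m_def M_closed)
 have mS: "P |> m = S" "m <| P = S" "Q |> m = U" "m <| Q = U" using SD UD zz by (simp_all add: m_def lm_distribs)
 have omm: "om m m = L"
 proof -
  have "om S U = om (S <| P) U" "om U S = om (U <| Q) S" using SD UD by simp_all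
  hence "om S U = 0" "om U S = 0" unfolding om_mult(3) using zz by (simp_all add: om_distribs)
  hence "om m m = L ** P + Q ** L" by (simp add: m_def om_distribs omS omU)
  also have "... = L" using cenD(2)[OF L PrD(1)[OF QP]] by (simp add: Q_def mm)
  finally show ?thesis .
 qed
 have comm: "\<exists>c d. X = c \<odot> P + d \<odot> Q" if X: "X \<in> \<C>" "X |> m = m <| X" for X
 proof -
  have blk: "DD n n' (A ** X ** B) = 0" if "m <| A = n" "A |> m = n" "m <| B = n'" "B |> m = n'" "A \<in> Pr" "B \<in> Pr" for A B n n'
  proof -
   have nA: "n <| A = n" using that(1) PrD(3)[OF that(5)] by (metis lm_simps(2))
   have Bn: "B |> n' = n'" using that(4) PrD(3)[OF that(6)] by (metis lm_simps(1))
   have "n <| (A ** X ** B) = n <| A <| X <| B" by (simp only: lm_simps(2) assoc_r)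
   also have "... = (A |> m) <| X <| B" by (simp only: nA that(2))
   also have "... = A |> ((X |> m) <| B)" by (simp only: lm_simps(3) X(2))
   also have "... = A |> (X |> (B |> n'))" by (simp only: lm_simps(3) that(3) Bn)
   also have "... = (A ** X ** B) |> n'" by (simp only: lm_simps(1) assoc_r)
   finally show ?thesis by (simp add: DD_def)
  qed
  obtain c where c: "P ** X ** P = c \<odot> P" using brS[OF cor_mult[OF X(1) PP PP] blk] mS PP by blast
  obtain d where d: "Q ** X ** Q = d \<odot> Q" using brU[OF cor_mult[OF X(1) QP QP] blk] mS QP by blast
  have z1: "Q ** X ** P = 0" using homPQ[OF cor_mult[OF X(1) PP QP] blk] mS QP PP by blast
  have z2: "P ** X ** Q = 0" using homQP[OF cor_mult[OF X(1) QP PP] blk] mS QP PP by blast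
  have "X = P ** X ** P + Q ** X ** P + (P ** X ** Q + Q ** X ** Q)" by (simp add: Q_def mm)
  hence "X = c \<odot> P + d \<odot> Q" unfolding c d z1 z2 by simp
  thus ?thesis by blast
 qed
 have bp: "brick_pair L P m" unfolding brick_pair_def using PP P N2 mM mS omm comm unfolding Q_def by auto
 \<comment> \<open>the given point is an extension, up to a unipotent gauge transformation\<close>
 define e' where "e' = P |> E <| Q"
 have QEP: "Q |> E <| P = 0" using sP by (simp add: subm_def Q_def lm_distribs lm_simps)
 have Em: "E = m + e'"
 proof -
  have "U = Q |> E <| Q" using UD(3) by (simp add: U_def lm_simps)
  moreover have "E = E <| P + (P |> E <| Q + Q |> E <| Q)" by (simp add: Q_def lm_distribs lm_simps)
  ultimately show ?thesis unfolding m_def S_def e'_def by (metis add.assoc add.commute)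
 qed
 have e'c: "e' \<in> corM Q P" unfolding e'_def by (rule corM_mult[OF EM QP PP])
 let ?B = "(%Y. Y |> m - m <| Y) ` cor Q P"
 have linB: "linear (%Y. Y |> m - m <| Y)" by (rule linearI) (simp_all add: lm_distribs lm_scale scaleR_diff_right)
 have sB: "subspace ?B" by (rule linear_subspace_image[OF linB subspace_cor[OF QP PP]])
 obtain Y where Y: "Y \<in> cor Q P" and Yo: "!!z. z \<in> ?B ==> (e' - (Y |> m - m <| Y)) \<bullet> z = 0"
  by (rule orthogonal_decomposition[OF sB, of e']) blast
 note YD = corD[OF Y QP PP]
 have QY: "Q ** Y = 0" by (rule absorb(3)[OF YD(2) PQ(2)])
 have YP: "Y ** P = 0" by (rule absorb(2)[OF YD(3) PQ(2)])
 have YY: "Y ** Y = 0" by (rule absorb(2)[OF YD(3) QY])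
 define e where "e = e' - (Y |> m - m <| Y)"
 have Yc: "Y |> m - m <| Y \<in> corM Q P"
 proof (rule corMI)
  show "Y |> m - m <| Y \<in> \<M>" using mM YD(1) by (simp add: M_closed M_mult)
  have "P |> (Y |> m) = Y |> m" by (simp only: lm_simps(1) YD(2))
  moreover have "P |> (m <| Y) = m <| P <| Y" by (simp only: lm_simps(3)[symmetric] mS)
  hence "P |> (m <| Y) = m <| Y" by (simp only: lm_simps(2) YD(2))
  ultimately show "P |> (Y |> m - m <| Y) = Y |> m - m <| Y" by (simp only: lm_distribs)
  have "(Y |> m) <| Q = Y |> (Q |> m)" by (simp only: lm_simps(3) mS)
  hence "(Y |> m) <| Q = Y |> m" by (simp only: lm_simps(1) YD(3))
  moreover have "m <| Y <| Q = m <| Y" by (simp only: lm_simps(2) YD(3))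
  ultimately show "(Y |> m - m <| Y) <| Q = Y |> m - m <| Y" by (simp only: lm_distribs)
 qed
 have ec: "e \<in> corM Q P" unfolding e_def using subspace_diff[OF subspace_corM[OF QP PP] e'c Yc] .
 have GLY: "(mat 1 - Y, mat 1 + Y) \<in> GL" using YD(1) by (simp add: GL_def C_closed mm YY)
 have ge: "m + e = (mat 1 - Y) |> (E <| (mat 1 + Y))"
 proof -
  have Ye: "Y |> e' = 0" "e' <| Y = 0" using absorb_pair(1)[OF corMD(2)[OF e'c QP PP] YP] absorb_pair(2)[OF corMD(3)[OF e'c QP PP] QY] by simp_all
  have YmY: "Y |> (m <| Y) = 0"
  proof -
   have "m <| Y = m <| P <| Y" unfolding lm_simps(2) YD(2) ..
   hence "Y |> (m <| Y) = (Y |> S) <| Y" by (simp add: mS lm_simps(3))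
   thus ?thesis using absorb_pair(1)[OF SD(2) YP] by (simp add: lm_simps(9))
  qed
  have "(mat 1 - Y) |> (E <| (mat 1 + Y)) = m + e' + m <| Y + e' <| Y - (Y |> m + Y |> e' + Y |> (m <| Y) + Y |> (e' <| Y))"
   unfolding Em by (simp add: lm_distribs lm_simps)
  also have "... = m + e' - (Y |> m - m <| Y)" unfolding Ye YmY by (simp add: lm_simps)
  finally show ?thesis by (simp add: e_def)
 qed
 have ome: "om (m + e) (m + e) = L" unfolding ge by (rule gauge_om[OF GLY omE L])
 have eext: "e \<in> ext P m" unfolding ext_def Q_def[symmetric]
 proof (intro CollectI conjI ballI)
  show "e \<in> corM Q P" by (rule ec)
  show "om m e + om e m = 0" using ome omm corM_off(5)[OF ec[unfolded Q_def] PP] by (simp add: om_distribs algebra_simps)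
  fix X assume "X \<in> cor Q P"
  hence "X |> m - m <| X \<in> ?B" by blast
  from Yo[OF this] show "e \<bullet> (X |> m - m <| X) = 0" unfolding e_def .
 qed
 have e0: "e ~= 0"
 proof
  assume "e = 0"
  hence "brick m" using brick_gauge[OF GLY stable_is_brick[OF stE]] ge by simp
  moreover have "P |> m = m <| P" by (simp add: mS)
  ultimately obtain c where "P = mat c" using PrD(1)[OF PP] by (auto simp: brick_def)
  hence c: "P = c \<odot> mat 1" using mat_mult_eq_cs[of c "mat 1 :: 'g End"] by simp
  hence "(c * c - c) \<odot> (mat 1 :: 'g End) = 0" using PrD(3)[OF PP] by (simp add: mm cs_distribs)
  hence "c * c - c = 0" using mat_1_neq_0 by (simp only: cs_eq_0_iff) blast
  hence "c = 0 \<or> c = 1" by simp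
  thus False using c P by auto
 qed
 have sole: "sol T (m + e) ~= {}"
 proof -
  have "E \<in> sol T E" using sol_I[OF GL_1 EM, of T] rE by (simp add: lm_simps)
  thus ?thesis unfolding ge sol_gauge[OF GLY] by blast
 qed
\<comment> \<open>A submodule of an extension is itself an extension of a submodule of the quotient by one of \<open>P\<close>. Only a
 copy of the quotient could have negative value, but it would split the extension.\<close>
 have st: "stable T (mat 1) (m + x)" if x: "x \<in> ext P m" "x ~= 0" for x
 proof (rule semistable_stable)
  note xc = corM_off[OF ext_corM[OF x(1)] PP, folded Q_def]
  show "m + x \<in> \<M>" using mM xc by (simp add: M_closed)
  show "om (m + x) (m + x) = L" using ext_om[OF x(1) PP] omm by simp
  fix G assume G: "subm (m + x) G"
  have Gp: "G \<in> Pr" by (rule subm_Pr[OF G])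
  obtain K I where KI: "K \<in> Pr" "!!v. K *v v = v \<longleftrightarrow> G *v v = v \<and> Q *v v = 0" "G ** K = K"
   "I \<in> Pr" "!!v. I *v v = v \<longleftrightarrow> v \<in> range ((*v) (Q ** G))" "!!g. ch G g = ch K g + ch I g"
   by (rule ch_ker_image[OF Gp PrD(1)[OF QP]]) blast
  have QP0: "Q *v v = 0 \<longleftrightarrow> P *v v = v" for v by (simp add: Q_def mv_diff) (metis)
  have PK: "P ** K = K" unfolding Pr_le_iff[OF KI(1)] using KI(2) QP0 by blast
  have QK: "Q ** K = 0" by (rule absorb(3)[OF PK PQ(2)])
  have sK: "subm S K"
  proof -
   have "x <| K = 0" by (rule absorb_pair(2)[OF xc(2) QK])
   moreover have "m <| K = m <| P <| K" unfolding lm_simps(2) PK ..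
   ultimately have mK: "(m + x) <| K = S <| K" by (simp add: lm_distribs mS)
   have "G |> ((m + x) <| G) = (m + x) <| G" using G by (simp add: subm_def)
   hence "(G |> ((m + x) <| G)) <| K = ((m + x) <| G) <| K" by simp
   hence GS: "G |> (S <| K) = S <| K" by (simp add: lm_simps KI(3) mK)
   have PS: "Q |> (S <| K) = 0" by (simp only: lm_simps(3)[symmetric] zz lm_simps(9))
   have vecs: "K *v (A *v v) = A *v v" if "K *v v = v" "G ** (A ** K) = A ** K" "Q ** (A ** K) = 0" for A v
   proof -
    have "A *v v = (A ** K) *v v" using that(1) by (simp flip: mv_assoc)
    hence "G *v (A *v v) = A *v v" "Q *v (A *v v) = 0" using that(2,3) by (simp_all add: mv_assoc)
    thus ?thesis using KI(2) by blast
   qed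
   show ?thesis unfolding subm_iff[OF KI(1)] using vecs GS PS by (simp add: prod_eq_iff)
  qed
  have QI: "Q ** I = I" unfolding Pr_le_iff[OF KI(4)] KI(5) by (auto simp: mv_assoc mm_assoc PrD[OF QP])
  have sI: "subm U I"
  proof -
   have "Q |> (m + x) = U" using xc(4) mS by (simp add: lm_distribs)
   moreover have gg: "G |> ((m + x) <| G) = (m + x) <| G" using G by (simp add: subm_def)
   have "(Q ** G) |> ((m + x) <| G) = Q |> ((m + x) <| G)" by (simp only: lm_simps(1)[symmetric] gg)
   ultimately have "(Q ** G) |> ((m + x) <| G) = U <| G" by (simp only: lm_simps(3)[symmetric])
   moreover have "U <| (Q ** G) = U <| G" by (simp only: lm_simps(2)[symmetric] UD(3))
   ultimately have *: "U <| (Q ** G) = (Q ** G) |> ((m + x) <| G)" by simp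
   have vecs: "I *v (A *v v) = A *v v" if "I *v v = v" "A ** (Q ** G) = (Q ** G) ** B" for A B v
   proof -
    obtain w where w: "v = (Q ** G) *v w" using KI(5) \<open>I *v v = v\<close> by blast
    have "A *v v = (Q ** G) *v (B *v w)" unfolding w mv_assoc that(2) ..
    thus ?thesis using KI(5) by blast
   qed
   show ?thesis unfolding subm_iff[OF KI(4)] using vecs * by (simp add: prod_eq_iff)
  qed
  have add: "val T G = val T K + val T I" by (rule val_add[OF T(1) KI(6)])
  have vK: "val T K \<ge> val T P" if "K ~= 0" using mono[OF PP KI(1)] below[OF subS[OF sK PK] PK that] by (cases "K = P") auto
  have vI: "val T I \<ge> 0" if "I ~= Q"
  proof (cases "I = 0")
   case False
   have sI': "subm E (P + I)" by (rule subU[OF sI QI])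
   have "f (P + I) \<ge> f P" using subU_pos[OF sI QI False that] by (simp add: f_diff)
   from mono[OF PP subm_Pr[OF sI'] this] show ?thesis by (simp add: vd)
  qed (simp add: val_0_1)
  have vQ: "val T Q = - val T P" by (simp add: Q_def vd val_T_1)
  have vP: "val T P > 0" using stE P by (simp add: stable_def)
  show "val T G \<ge> 0"
  proof (cases "K = 0")
   case False
   thus ?thesis using vK vI vQ vP add by (cases "I = Q") auto
  next
   case True
   have "I ~= Q"
   proof
    assume IQ: "I = Q"
    have inj: "v = 0" if "G *v v = v" "Q *v v = 0" for v using KI(2)[of v] that True by simp
    obtain Z where Z: "Z \<in> \<C>" "Z ** (Q ** G) = G" "G ** Z = Z" by (rule left_inverse_C[OF PrD(1)[OF QP] Gp inj]) blast
    define s where "s = Z ** Q"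
    have sC: "s \<in> \<C>" unfolding s_def by (intro C_closed Z PrD(1)[OF QP])
    have rQ: "\<exists>w. Q *v v = (Q ** G) *v w" for v using KI(5)[of "Q *v v"] IQ Pr_fix[OF QP] by blast
    have Qs: "Q ** s = Q"
    proof (rule matrix_eqI)
     fix v
     obtain w where w: "Q *v v = (Q ** G) *v w" using rQ by blast
     have "Q ** s *v v = Q ** Z *v (Q *v v)" by (simp add: s_def mv_assoc assoc_r)
     also have "... = Q ** (Z ** (Q ** G)) *v w" unfolding w by (simp add: mv_assoc assoc_r)
     also have "... = Q *v v" unfolding Z(2) w ..
     finally show "Q ** s *v v = Q *v v" .
    qed
    have Gs: "G ** s = s" by (simp add: s_def mm_assoc Z(3))
    have sG: "s ** G = G" by (simp add: s_def assoc_r Z(2))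
    have sQ: "s ** Q = s" by (simp add: s_def assoc_r PrD[OF QP])
    let ?Y = "P ** s"
    have "s - ?Y = Q" using Qs by (simp add: Q_def mm)
    hence Ys: "s = Q + ?Y" by (metis diff_add_cancel)
    have Yc: "?Y \<in> cor Q P" by (rule corI) (simp_all add: C_closed sC PrD[OF PP] assoc_r sQ)
    have xs: "(m + x) <| s = s |> (m <| Q)"
    proof -
     have "G |> ((m + x) <| G) = (m + x) <| G" using G by (simp add: subm_def)
     hence "(G |> ((m + x) <| G)) <| s = ((m + x) <| G) <| s" by simp
     hence "G |> ((m + x) <| s) = (m + x) <| s" by (simp add: lm_simps Gs)
     hence "s |> ((m + x) <| s) = (s ** G) |> ((m + x) <| s)" by (simp only: lm_simps(1)[symmetric])
     hence "(m + x) <| s = s |> ((m + x) <| s)" by (simp only: sG \<open>G |> ((m + x) <| s) = (m + x) <| s\<close>)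
     also have "... = (s ** Q) |> ((m + x) <| s)" by (simp only: sQ)
     also have "... = s |> (Q |> ((m + x) <| s))" by (simp only: lm_simps(1))
     also have "Q |> ((m + x) <| s) = (Q |> (m + x)) <| s" by (simp add: lm_simps)
     also have "... = (m <| Q) <| s" using xc(4) mS by (simp add: lm_distribs)
     also have "... = m <| Q" by (simp add: lm_simps Qs)
     finally show ?thesis .
    qed
    have xY: "x <| ?Y = 0" by (simp only: lm_simps(2)[symmetric] xc(3) lm_simps(9))
    have "?Y |> (m <| Q) = (?Y ** Q) |> m" unfolding lm_simps(1)[symmetric] mS ..
    also have "?Y ** Q = ?Y" by (simp add: assoc_r sQ)
    finally have YmQ: "?Y |> (m <| Q) = ?Y |> m" .
    have "m <| Q + m <| ?Y + x = m <| Q + ?Y |> m"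
    proof -
     have "(m + x) <| s = (m + x) <| (Q + ?Y)" using Ys by simp
     also have "... = m <| Q + m <| ?Y + x" by (simp add: lm_distribs xY xc(2))
     finally have 1: "(m + x) <| s = m <| Q + m <| ?Y + x" .
     have "s |> (m <| Q) = (Q + ?Y) |> (m <| Q)" using Ys by simp
     also have "... = Q |> (m <| Q) + ?Y |> m" by (simp only: lm_distribs YmQ)
     also have "Q |> (m <| Q) = m <| Q" using mS UD by simp
     finally show ?thesis using 1 xs by simp
    qed
    hence "x = ?Y |> m - m <| ?Y" by (simp add: algebra_simps)
    hence "x \<bullet> x = 0" using x(1) Yc unfolding ext_def Q_def[symmetric] by force
    thus False using x(2) by simp
   qed
   thus ?thesis using vI add True by (simp add: val_0_1)
  qed
 qed
 show ?thesis by (rule that[OF bp eext e0 sole st])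
qed

text \<open>The extensions by multiples of one class are gauge equivalent; otherwise two classes are joined by a
 segment of nonzero classes, along which solvability is an open and closed condition.\<close>

theorem good_pair_exists:
 assumes E: "E \<in> Lev T L" and F0: "subm E F0" "F0 ~= 0" "F0 ~= mat 1"
 obtains P m where "good T L P m"
proof -
 obtain P m e0 where bp: "brick_pair L P m" and e0: "e0 \<in> ext P m" "e0 ~= 0" "sol T (m + e0) ~= {}"
  and st: "!!e. e \<in> ext P m ==> e ~= 0 ==> stable T (mat 1) (m + e)" by (rule least_submodule[OF E F0]) blast
 have PP: "P \<in> Pr" and mM: "m \<in> \<M>" and Pm: "P |> m = m <| P" using bp by (simp_all add: brick_pair_def)
 have br: "brick (m + e)" if "e \<in> ext P m" "e ~= 0" for e by (rule stable_is_brick[OF st[OF that]])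
 have eM: "m + e \<in> \<M>" if "e \<in> ext P m" for e using corM_off(6)[OF ext_corM[OF that] PP] mM by (simp add: M_closed)
 have Th: "T \<in> herm0" using T cenD(1) by (simp add: herm0_def)
 have sol: "sol T (m + e1) ~= {}" if e1: "e1 \<in> ext P m" "e1 ~= 0" for e1
 proof (cases "\<exists>c. e1 = c \<cdot> e0")
  case True
  then obtain c where c: "e1 = c \<cdot> e0" by blast
  hence "c ~= 0" using e1(2) by auto
  from scale_gauge[OF PP Pm ext_corM[OF e0(1)] this] obtain g h where "(g, h) \<in> GL" "m + e1 = g |> ((m + e0) <| h)" unfolding c by metis
  thus ?thesis using sol_gauge e0(3) by metis
 next
  case False
  let ?e = "%s::real. (1 - s) *\<^sub>R e0 + s *\<^sub>R e1"
  have ex: "?e s \<in> ext P m" for s using subspace_ext[OF PP] e0(1) e1(1) by (simp add: subspace_add subspace_scale)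
  have ne: "?e s ~= 0" for s
  proof
   assume z: "?e s = 0"
   show False
   proof (cases "s = 0")
    case True thus False using z e0(2) by simp
   next
    case s: False
    have "s *\<^sub>R e1 = (s - 1) *\<^sub>R e0" using z by (simp add: eq_neg_iff_add_eq_0[symmetric] add_eq_0_iff2 scaleR_diff_left algebra_simps)
    hence "(1 / s) *\<^sub>R s *\<^sub>R e1 = (1 / s) *\<^sub>R (s - 1) *\<^sub>R e0" by simp
    hence "e1 = ((s - 1) / s) *\<^sub>R e0" using s by simp
    thus False using False ps_of_real by metis
   qed
  qed
  define \<Sigma> where "\<Sigma> = {s \<in> {0..1::real}. sol T (m + ?e s) ~= {}}"
  have lim: "((%s. m + ?e s) \<longlongrightarrow> m + ?e s0) (at s0 within A)" for s0 A by (intro tendsto_intros)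
  have op: "openin (top_of_set {0..1}) \<Sigma>"
  proof (subst openin_subopen, intro ballI)
   fix s0 assume s0: "s0 \<in> \<Sigma>"
   have "\<forall>\<^sub>F s in at s0. sol T (m + ?e s) ~= {}"
    by (rule solvable_open[OF br[OF ex ne] eM[OF ex] _ lim tendsto_const eM[OF ex] Th]) (use s0 in \<open>simp add: \<Sigma>_def\<close>)
   then obtain U where U: "open U" "s0 \<in> U" "!!s. s \<in> U ==> s ~= s0 ==> sol T (m + ?e s) ~= {}" unfolding eventually_at_topological by blast
   have "openin (top_of_set {0..1}) ({0..1} \<inter> U)" by (rule openin_open_Int[OF U(1)])
   moreover have "{0..1} \<inter> U \<subseteq> \<Sigma>" using U(3) s0 by (auto simp: \<Sigma>_def)
   ultimately show "\<exists>V. openin (top_of_set {0..1}) V \<and> s0 \<in> V \<and> V \<subseteq> \<Sigma>"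
    using U(2) s0 by (intro exI[of _ "{0..1} \<inter> U"]) (auto simp: \<Sigma>_def)
  qed
  have cl: "closedin (top_of_set {0..1}) \<Sigma>"
  proof (rule closed_subset)
   show "\<Sigma> \<subseteq> {0..1}" by (auto simp: \<Sigma>_def)
   show "closed \<Sigma>" unfolding closed_sequential_limits
   proof (intro allI impI)
    fix x l assume x: "(\<forall>n. x n \<in> \<Sigma>) \<and> x \<longlonglongrightarrow> l"
    have "l \<in> {0..1}" by (rule closed_sequentially[of _ x]) (use x in \<open>auto simp: \<Sigma>_def\<close>)
    have "(%n. m + ?e (x n)) \<longlonglongrightarrow> m + ?e l" using x by (intro tendsto_intros) auto
    hence "sol T (m + ?e l) ~= {}" by (rule solvable_closed[OF _ eM[OF ex] T(1) st[OF ex ne]]) (use x in \<open>auto simp: \<Sigma>_def\<close>)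
    thus "l \<in> \<Sigma>" using \<open>l \<in> {0..1}\<close> by (simp add: \<Sigma>_def)
   qed
  qed
  have "\<forall>A. openin (top_of_set {0..1::real}) A \<and> closedin (top_of_set {0..1}) A --> A = {} \<or> A = {0..1}"
   using connected_Icc[of "0::real" 1] by (simp only: connected_clopen)
  from mp[OF spec[OF this] conjI[OF op cl]] have "\<Sigma> = {} \<or> \<Sigma> = {0..1}" .
  moreover have "0 \<in> \<Sigma>" using e0(3) by (simp add: \<Sigma>_def)
  ultimately have "\<Sigma> = {0..1}" by blast
  hence "1 \<in> \<Sigma>" by simp
  thus ?thesis by (simp add: \<Sigma>_def)
 qed
 have "good T L P m" unfolding good_def by (intro conjI ballI impI bp) (erule (1) br, erule (1) sol)
 thus ?thesis by (rule that)
qed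

end

context mckay
begin

section \<open>Deformation of brick pairs\<close>

lemma commutant_open:
 assumes lim: "E \<longlonglongrightarrow> E0" and U: "subspace U" "U \<subseteq> \<C>"
  and UE: "!!n::nat. !!Y. Y \<in> U ==> Y |> E n = E n <| Y"
  and E0: "!!X. X \<in> \<C> ==> X |> E0 = E0 <| X ==> X \<in> U"
 shows "\<forall>\<^sub>F n in sequentially. \<forall>X\<in>\<C>. X |> E n = E n <| X --> X \<in> U"
proof (rule ccontr)
 assume "\<not> ?thesis"
 from not_eventually_sequentiallyD[OF this] obtain r :: "nat => nat"
  where r0: "strict_mono r" "\<forall>n. \<not> (\<forall>X\<in>\<C>. X |> E (r n) = E (r n) <| X --> X \<in> U)" by blast
 have r: "strict_mono r" "!!n. \<exists>X\<in>\<C>. X |> E (r n) = E (r n) <| X \<and> X \<notin> U" using r0 by blast+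
 obtain p where p: "linear p" "!!x. p x \<in> U" "!!x. x \<in> U ==> p x = x" "!!x y. p x \<bullet> y = x \<bullet> p y"
  by (rule orth_projection[OF U(1)]) blast
 have "\<exists>X. X \<in> \<C> \<and> X |> E (r n) = E (r n) <| X \<and> norm X = 1 \<and> p X = 0" for n
 proof -
  obtain X where X: "X \<in> \<C>" "X |> E (r n) = E (r n) <| X" "X \<notin> U" using r(2) by blast
  define Z where "Z = X - p X"
  have Z0: "Z ~= 0" using X(3) p(2)[of X] by (auto simp: Z_def)
  have ZC: "Z \<in> \<C>" unfolding Z_def using X(1) U(2) p(2)[of X] by (intro C_closed) auto
  have Zc: "Z |> E (r n) = E (r n) <| Z" unfolding Z_def using X(2) UE[OF p(2)] by (simp add: lm_distribs)
  have pZ: "p Z = 0" by (simp add: Z_def linear_diff[OF p(1)] p(2,3))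
  let ?W = "(1 / norm Z) *\<^sub>R Z"
  have "?W \<in> \<C> \<and> ?W |> E (r n) = E (r n) <| ?W \<and> norm ?W = 1 \<and> p ?W = 0"
   using Z0 by (simp add: C_closed ZC lm_scale Zc linear_scale[OF p(1)] pZ)
  thus ?thesis by blast
 qed
 hence "\<forall>n. \<exists>X. X \<in> \<C> \<and> X |> E (r n) = E (r n) <| X \<and> norm X = 1 \<and> p X = 0" by blast
 from choice[OF this] obtain X where X: "!!n. X n \<in> \<C>" "!!n. X n |> E (r n) = E (r n) <| X n" "!!n. norm (X n) = 1" "!!n. p (X n) = 0" by blast
 have S: "\<forall>n. X n \<in> sphere 0 1" using X(3) by simp
 obtain X0 s where s: "X0 \<in> sphere 0 1" "strict_mono s" "(X \<circ> s) \<longlonglongrightarrow> X0"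
  by (rule seq_compactE[OF compact_imp_seq_compact[OF compact_sphere] S]) blast
 have Xl: "(%n. X (s n)) \<longlonglongrightarrow> X0" using s(3) by (simp add: o_def)
 have El: "(%n. E (r (s n))) \<longlonglongrightarrow> E0" using LIMSEQ_subseq_LIMSEQ[OF LIMSEQ_subseq_LIMSEQ[OF lim r(1)] s(2)] by (simp add: o_def)
 have X0C: "X0 \<in> \<C>" by (rule closed_sequentially[OF closed_C _ Xl]) (rule X)
 have "(%n. X (s n) |> E (r (s n))) \<longlonglongrightarrow> X0 |> E0" by (rule bounded_bilinear.tendsto[OF bb_lm Xl El])
 moreover have "(%n. X (s n) |> E (r (s n))) \<longlonglongrightarrow> E0 <| X0" unfolding X(2) by (rule bounded_bilinear.tendsto[OF bb_rm El Xl])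
 ultimately have "X0 \<in> U" using E0[OF X0C] LIMSEQ_unique by blast
 have blp: "bounded_linear p" using p(1) linear_conv_bounded_linear by blast
 have "p X0 = 0" using LIMSEQ_unique[OF bounded_linear.tendsto[OF blp Xl]] by (simp add: X(4))
 hence "X0 = 0" using p(3)[OF \<open>X0 \<in> U\<close>] by simp
 thus False using s(1) by simp
qed

lemma ext_closed:
 assumes P: "P \<in> Pr" and m: "m \<longlonglongrightarrow> m0" and e: "e \<longlonglongrightarrow> e0" and ext: "!!n::nat. e n \<in> ext P (m n)"
 shows "e0 \<in> ext P m0" unfolding ext_def
proof (intro CollectI conjI ballI)
 show "e0 \<in> corM (mat 1 - P) P"
  by (rule closed_sequentially[OF closed_subspace[OF subspace_corM[OF Pr_compl[OF P] P]] _ e]) (rule ext_corM[OF ext])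
 have "(%n. om (m n) (e n) + om (e n) (m n)) \<longlonglongrightarrow> om m0 e0 + om e0 m0"
  by (intro tendsto_add bounded_bilinear.tendsto[OF bb_om] m e)
 moreover have "om (m n) (e n) + om (e n) (m n) = 0" for n using ext[of n] by (simp add: ext_def)
 ultimately show "om m0 e0 + om e0 m0 = 0" by (simp add: LIMSEQ_const_iff)
 fix X assume X: "X \<in> cor (mat 1 - P) P"
 have "(%n. e n \<bullet> (X |> m n - m n <| X)) \<longlonglongrightarrow> e0 \<bullet> (X |> m0 - m0 <| X)"
  by (intro tendsto_inner tendsto_diff bounded_bilinear.tendsto[OF bb_lm] bounded_bilinear.tendsto[OF bb_rm] tendsto_const m e)
 moreover have "e n \<bullet> (X |> m n - m n <| X) = 0" for n using ext[of n] X by (simp add: ext_def)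
 ultimately show "e0 \<bullet> (X |> m0 - m0 <| X) = 0" by (simp add: LIMSEQ_const_iff)
qed

lemma scalars_subspace: "subspace (range (%c. c \<odot> (mat 1 :: 'g End)))" by (rule linear_subspace_image[OF _ subspace_UNIV])
   (auto intro!: linearI simp: cs_distribs scaleR_conv_of_real[where 'a = complex] vec_eq_iff)

lemma brick_iff: "brick m \<longleftrightarrow> (\<forall>X\<in>\<C>. X |> m = m <| X --> X \<in> range (%c. c \<odot> (mat 1 :: 'g End)))"
proof -
 have "mat c = c \<odot> (mat 1 :: 'g End)" for c using mat_mult_eq_cs[of c "mat 1 :: 'g End"] by simp
 hence f: "mat = (%c. c \<odot> (mat 1 :: 'g End))" by (rule HOL.ext)
 have "(\<exists>c. X = mat c) \<longleftrightarrow> X \<in> range (%c. c \<odot> (mat 1 :: 'g End))" for X unfolding arg_cong[OF f, of range, symmetric] by blast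
 thus ?thesis by (simp only: brick_def)
qed

text \<open>The moment map of the block diagonal points is a submersion onto the block diagonal matrices of
 blockwise vanishing trace, because only the block scalars commute with a brick pair.\<close>

lemma deform_brick_pair:
 assumes bp: "brick_pair L0 P m0" and \<epsilon>: "\<epsilon> > 0"
 obtains \<delta> where "\<delta> > 0" "!!L. L \<in> cen ==> trace L = 0 ==> trace (L ** P) = 0 ==> dist L L0 < \<delta> ==>
  \<exists>m\<in>\<M>. P |> m = m <| P \<and> om m m = L \<and> dist m m0 < \<epsilon>"
proof -
 have P: "P \<in> Pr" "P ~= 0" "P ~= mat 1" and m0: "m0 \<in> \<M>" "P |> m0 = m0 <| P" "om m0 m0 = L0"
  and comm: "!!X. X \<in> \<C> ==> X |> m0 = m0 <| X ==> \<exists>c d. X = c \<odot> P + d \<odot> (mat 1 - P)"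
  using bp by (auto simp: brick_pair_def)
 note PD = PrD[OF P(1)]
 let ?V = "{m \<in> \<M>. P |> m = m <| P}"
 let ?W = "{X \<in> \<C>. P ** X = X ** P \<and> trace X = 0 \<and> trace (X ** P) = 0}"
 have sV: "subspace ?V" by (auto simp: subspace_def M_closed M_scaleR lm_distribs lm_scale lm_simps)
 have sW: "subspace ?W" by (auto simp: subspace_def C_closed mm trace_add)
 obtain p where p: "linear p" "!!x. p x \<in> ?V" "!!x. x \<in> ?V ==> p x = x" "!!x y. p x \<bullet> y = x \<bullet> p y"
  by (rule orth_projection[OF sV]) blast
 obtain w where w: "linear w" "!!x. w x \<in> ?W" "!!x. x \<in> ?W ==> w x = x" "!!x y. w x \<bullet> y = x \<bullet> w y"
  by (rule orth_projection[OF sW]) blast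
 have blp: "bounded_linear p" and blw: "bounded_linear w" using p(1) w(1) linear_conv_bounded_linear by blast+
 have omW: "om m m \<in> ?W" if m: "m \<in> ?V" for m
 proof -
  have s: "subm m P" using m PD P(1) by (simp add: subm_def lm_simps(2) flip: lm_simps(3))
  have "P ** om m m = om (P |> m) m" by (simp add: om_mult)
  also have "... = om m (P |> m)" using m by (simp add: om_mult)
  also have "... = om m m ** P" using m by (simp add: om_mult)
  finally show ?thesis using m om_C trace_om[of m] subm_trace_om[OF s] by simp
 qed
 let ?f = "%x :: 'g pair \<times> 'g End. om (p (fst x)) (p (fst x)) + (snd x - w (snd x))"
 let ?f' = "%h :: 'g pair \<times> 'g End. om m0 (p (fst h)) + om (p (fst h)) m0 + (snd h - w (snd h))"
 have m0V: "m0 \<in> ?V" using m0 by simp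
 have w0: "w 0 = 0" using linear_0[OF w(1)] .
 have dp: "((%x :: 'g pair \<times> 'g End. p (fst x)) has_derivative (%h. p (fst h))) (at x)" for x
  by (rule bounded_linear.has_derivative[OF blp has_derivative_fst[OF has_derivative_ident]])
 have df: "(?f has_derivative ?f') (at (m0, 0))"
 proof -
  have "(?f has_derivative (%h. (om (p (fst (m0, 0 :: 'g End))) (p (fst h)) + om (p (fst h)) (p (fst (m0, 0 :: 'g End)))) + (snd h - w (snd h)))) (at (m0, 0))"
   by (intro has_derivative_add bounded_bilinear.FDERIV[OF bb_om dp dp] has_derivative_diff
     bounded_linear.has_derivative[OF blw] has_derivative_snd has_derivative_ident)
  thus ?thesis by (simp add: p(3)[OF m0V])
 qed
 have lf: "linear ?f'" using df has_derivative_linear by blast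
 have surj: "surj ?f'"
 proof (rule ccontr)
  assume ns: "\<not> surj ?f'"
  have sR: "subspace (range ?f')" by (rule linear_subspace_image[OF lf subspace_UNIV])
  obtain y0 where y0: "y0 \<notin> range ?f'" using ns by blast
  obtain s where s: "s \<in> range ?f'" "!!z. z \<in> range ?f' ==> (y0 - s) \<bullet> z = 0" by (rule orthogonal_decomposition[OF sR, of y0]) blast
  define y where "y = y0 - s"
  have yn: "y ~= 0" using s(1) y0 by (auto simp: y_def)
  have yo: "y \<bullet> ?f' h = 0" for h unfolding y_def by (rule s(2)) blast
  have "y \<bullet> (y - w y) = 0" using yo[of "(0, y)"] linear_0[OF p(1)] by (simp add: om_distribs)
  moreover have "w (y - w y) = 0" using w(3)[OF w(2)[of y]] by (simp add: linear_diff[OF w(1)])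
  hence "w y \<bullet> (y - w y) = 0" unfolding w(4) by simp
  ultimately have "(y - w y) \<bullet> (y - w y) = 0" by (simp add: inner_diff_left)
  hence yW: "y \<in> ?W" using w(2)[of y] by simp
  have yH: "y\<^sup>H \<in> \<C>" "P ** y\<^sup>H = y\<^sup>H ** P" "trace (y\<^sup>H) = 0" "trace (P ** y\<^sup>H) = 0"
  proof -
   show "y\<^sup>H \<in> \<C>" using yW by (simp add: C_adj)
   have "(P ** y)\<^sup>H = (y ** P)\<^sup>H" using yW by simp
   thus "P ** y\<^sup>H = y\<^sup>H ** P" by (simp add: adj_mult PD)
   show "trace (y\<^sup>H) = 0" using yW by (simp add: trace_adj)
   have "trace ((y ** P)\<^sup>H) = 0" unfolding trace_adj using yW by simp
   thus "trace (P ** y\<^sup>H) = 0" by (simp add: adj_mult PD)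
  qed
  have D: "J_op (DD m0 m0 (y\<^sup>H)) \<in> ?V"
  proof -
   have c: "P |> DD m0 m0 (y\<^sup>H) = DD m0 m0 (y\<^sup>H) <| P"
   proof -
    have a: "P |> (m0 <| y\<^sup>H) = m0 <| (y\<^sup>H ** P)" by (simp only: lm_simps(3)[symmetric] m0(2) lm_simps(2) yH(2))
    have "P |> (y\<^sup>H |> m0) = (y\<^sup>H ** P) |> m0" by (simp only: lm_simps(1) yH(2))
    also have "... = y\<^sup>H |> (m0 <| P)" by (simp only: lm_simps(1)[symmetric] m0(2))
    finally have b: "P |> (y\<^sup>H |> m0) = y\<^sup>H |> (m0 <| P)" .
    show ?thesis by (simp only: DD_def lm_distribs a b lm_simps(2,3))
   qed
   have "P |> J_op (DD m0 m0 (y\<^sup>H)) = J_op (DD m0 m0 (y\<^sup>H) <| P)" by (simp add: J_mult PD)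
   also have "... = J_op (DD m0 m0 (y\<^sup>H)) <| P" unfolding c[symmetric] by (simp add: J_mult PD)
   finally show ?thesis using m0(1) yH(1) by (simp add: M_J DD_def M_closed M_mult)
  qed
  have "v \<bullet> J_op (DD m0 m0 (y\<^sup>H)) = 0" if v: "v \<in> ?V" for v
  proof -
   have "y \<bullet> (om m0 v + om v m0) = 0" using yo[of "(v, 0)"] p(3)[OF v] w0 by simp
   thus ?thesis unfolding inner_J_DD by (simp add: add.commute)
  qed
  from this[OF D] have "DD m0 m0 (y\<^sup>H) = 0" using inner_J(1)[of "DD m0 m0 (y\<^sup>H)" "DD m0 m0 (y\<^sup>H)"] by simp
  hence "y\<^sup>H |> m0 = m0 <| y\<^sup>H" by (simp add: DD_def)
  from comm[OF yH(1) this] obtain c d where cd: "y\<^sup>H = c \<odot> P + d \<odot> (mat 1 - P)" by blast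
  have trP: "trace P ~= 0" using Pr_norm[OF P(1)] P(2) by auto
  have trQ: "trace (mat 1 - P) ~= 0" using Pr_norm[OF Pr_compl[OF P(1)]] P(3) by auto
  have "c * trace P = 0" using yH(4) unfolding cd by (simp add: mm PD)
  hence c0: "c = 0" using trP by simp
  have "d * trace (mat 1 - P) = 0" using yH(3) unfolding cd c0 by (simp add: trace_add)
  hence "d = 0" using trQ by simp
  hence "y\<^sup>H = 0" unfolding cd c0 by simp
  hence "(y\<^sup>H)\<^sup>H = 0" by (simp only: adj_0)
  thus False using yn by simp
 qed
 obtain k where k: "linear k" "?f' \<circ> k = id" using linear_surjective_right_inverse[OF lf surj] by blast
 have blk: "bounded_linear k" using k(1) linear_conv_bounded_linear by blast
 have cf: "continuous_on UNIV ?f" by (intro continuous_on_add bounded_bilinear.continuous_on[OF bb_om] bounded_linear.continuous_on[OF blp]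
    continuous_on_diff bounded_linear.continuous_on[OF blw] continuous_on_fst continuous_on_snd continuous_on_id)
 have "?f (m0, 0) \<in> interior (?f ` ball (m0, 0) \<epsilon>)"
  by (rule sussmann_open_mapping[OF open_UNIV cf UNIV_I df blk k(2) subset_UNIV]) (simp add: \<epsilon> interior_open)
 moreover have "?f (m0, 0) = L0" by (simp add: p(3)[OF m0V] m0(3) w0)
 ultimately obtain \<delta> where d: "\<delta> > 0" "ball L0 \<delta> \<subseteq> ?f ` ball (m0, 0) \<epsilon>" by (auto simp: mem_interior)
 show ?thesis
 proof (rule that[OF d(1)])
  fix L assume L: "L \<in> cen" "trace L = 0" "trace (L ** P) = 0" "dist L L0 < \<delta>"
  have "L \<in> ball L0 \<delta>" using L(4) by (simp add: dist_commute)
  then obtain m Z where mZ: "(m, Z) \<in> ball (m0, 0) \<epsilon>" "L = om (p m) (p m) + (Z - w Z)" using d(2) by fastforce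
  have LW: "L \<in> ?W" using L cenD[OF L(1)] cenD(2)[OF L(1) PD(1)] by simp
  have "w L = om (p m) (p m)" unfolding mZ(2) linear_add[OF w(1)] linear_diff[OF w(1)] using w(3)[OF omW[OF p(2)]] w(3)[OF w(2)] by simp
  hence "om (p m) (p m) = L" using w(3)[OF LW] by simp
  moreover have "dist (p m) m0 < \<epsilon>"
  proof -
   have np: "norm (p v) \<le> norm v" for v
   proof (cases "p v = 0")
    case False
    have "norm (p v) * norm (p v) = p v \<bullet> p v" by (simp only: power2_norm_eq_inner[symmetric] power2_eq_square)
    also have "... = v \<bullet> p (p v)" by (rule p(4))
    also have "... = v \<bullet> p v" using p(3)[OF p(2)] by simp
    also have "... \<le> norm v * norm (p v)" by (rule norm_cauchy_schwarz)
    finally show ?thesis using False by simp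
   qed simp
   have "dist (p m) m0 = norm (p (m - m0))" using p(3)[OF m0V] by (simp add: dist_norm linear_diff[OF p(1)])
   also have "... \<le> dist m m0" using np by (simp add: dist_norm)
   also have "... \<le> dist (m, Z) (m0, 0)" using dist_fst_le[of "(m, Z)" "(m0, 0)"] by simp
   also have "... < \<epsilon>" using mZ(1) by (simp add: dist_commute)
   finally show ?thesis .
  qed
  ultimately show "\<exists>m\<in>\<M>. P |> m = m <| P \<and> om m m = L \<and> dist m m0 < \<epsilon>" using p(2)[of m] by blast
 qed
qed

text \<open>Extension classes of norm one form a compact set, so a sequence of bad classes would have a bad limit.\<close>

lemma good_seq:
 assumes g: "good T0 L0 P m0" and m: "m \<longlonglongrightarrow> m0" and T: "T \<longlonglongrightarrow> T0" "!!n::nat. T n \<in> herm0"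
  and mn: "!!n. m n \<in> \<M>" "!!n. P |> m n = m n <| P"
 shows "\<forall>\<^sub>F n in sequentially. good (T n) (om (m n) (m n)) P (m n)"
proof -
 have bp: "brick_pair L0 P m0" using g by (simp add: good_def)
 hence P: "P \<in> Pr" "P ~= 0" "P ~= mat 1" "N P P = 2"
  and comm: "!!X. X \<in> \<C> ==> X |> m0 = m0 <| X ==> \<exists>c d. X = c \<odot> P + d \<odot> (mat 1 - P)" by (auto simp: brick_pair_def)
 have m0M: "m0 \<in> \<M>" using bp by (simp add: brick_pair_def)
 let ?U = "(%(c, d). c \<odot> P + d \<odot> (mat 1 - P)) ` UNIV"
 have sU: "subspace ?U"
  by (rule linear_subspace_image[OF _ subspace_UNIV]) (rule linearI; auto simp: cs_distribs scaleR_conv_of_real[where 'a = complex] vec_eq_iff algebra_simps)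
 have "\<forall>\<^sub>F n in sequentially. \<forall>X\<in>\<C>. X |> m n = m n <| X --> X \<in> ?U"
 proof (rule commutant_open[OF m sU])
  show "?U \<subseteq> \<C>" using PrD(1)[OF P(1)] by (auto intro!: C_closed)
  show "Y |> m n = m n <| Y" if "Y \<in> ?U" for n Y using that mn(2)[of n] by (auto simp: lm_distribs lm_scale lm_simps)
  show "X \<in> ?U" if "X \<in> \<C>" "X |> m0 = m0 <| X" for X using comm[OF that] by auto
 qed
 hence 1: "\<forall>\<^sub>F n in sequentially. brick_pair (om (m n) (m n)) P (m n)"
 proof (rule eventually_mono)
  fix n assume a: "\<forall>X\<in>\<C>. X |> m n = m n <| X --> X \<in> ?U"
  have "\<exists>c d. X = c \<odot> P + d \<odot> (mat 1 - P)" if "X \<in> \<C>" "X |> m n = m n <| X" for X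
  proof -
   have "X \<in> ?U" using a that by blast
   thus ?thesis by (elim imageE) (metis case_prod_beta)
  qed
  thus "brick_pair (om (m n) (m n)) P (m n)" unfolding brick_pair_def using P mn(1)[of n] mn(2)[of n] by blast
 qed
 have 2: "\<forall>\<^sub>F n in sequentially. \<forall>e\<in>ext P (m n). norm e = 1 --> brick (m n + e) \<and> sol (T n) (m n + e) ~= {}"
 proof (rule ccontr)
  assume "\<not> ?thesis"
  from not_eventually_sequentiallyD[OF this] obtain r :: "nat => nat"
   where r: "strict_mono r" "\<forall>n. \<not> (\<forall>e\<in>ext P (m (r n)). norm e = 1 --> brick (m (r n) + e) \<and> sol (T (r n)) (m (r n) + e) ~= {})"
   by blast
  hence "\<forall>n. \<exists>e. e \<in> ext P (m (r n)) \<and> norm e = 1 \<and> \<not> (brick (m (r n) + e) \<and> sol (T (r n)) (m (r n) + e) ~= {})" by blast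
  from choice[OF this] obtain e where e: "!!n. e n \<in> ext P (m (r n))" "!!n. norm (e n) = 1"
   "!!n. \<not> (brick (m (r n) + e n) \<and> sol (T (r n)) (m (r n) + e n) ~= {})" by blast
  have S: "\<forall>n. e n \<in> sphere 0 1" using e(2) by simp
  obtain e0 s where s: "e0 \<in> sphere 0 1" "strict_mono s" "(e \<circ> s) \<longlonglongrightarrow> e0"
   by (rule seq_compactE[OF compact_imp_seq_compact[OF compact_sphere] S]) blast
  have el: "(%n. e (s n)) \<longlonglongrightarrow> e0" using s(3) by (simp add: o_def)
  have ml: "(%n. m (r (s n))) \<longlonglongrightarrow> m0" and Tl: "(%n. T (r (s n))) \<longlonglongrightarrow> T0"
   using LIMSEQ_subseq_LIMSEQ[OF LIMSEQ_subseq_LIMSEQ[OF m r(1)] s(2)]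
    LIMSEQ_subseq_LIMSEQ[OF LIMSEQ_subseq_LIMSEQ[OF T(1) r(1)] s(2)] by (simp_all add: o_def)
  have e0: "e0 \<in> ext P m0" by (rule ext_closed[OF P(1) ml el]) (rule e)
  have "e0 ~= 0" using s(1) by auto
  hence br: "brick (m0 + e0)" and so: "sol T0 (m0 + e0) ~= {}" using g e0 by (simp_all add: good_def)
  have lim: "(%n. m (r (s n)) + e (s n)) \<longlonglongrightarrow> m0 + e0" by (intro tendsto_add ml el)
  have eM: "m (r (s n)) + e (s n) \<in> \<M>" for n using corM_off(6)[OF ext_corM[OF e(1)] P(1)] mn(1) by (simp add: M_closed)
  have e0M: "m0 + e0 \<in> \<M>" using corM_off(6)[OF ext_corM[OF e0] P(1)] m0M by (simp add: M_closed)
  have "\<forall>\<^sub>F n in sequentially. \<forall>X\<in>\<C>. X |> (m (r (s n)) + e (s n)) = (m (r (s n)) + e (s n)) <| X --> X \<in> range (%c. c \<odot> (mat 1 :: 'g End))"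
  proof (rule commutant_open[OF lim scalars_subspace])
   show "range (%c. c \<odot> (mat 1 :: 'g End)) \<subseteq> \<C>" by (auto intro!: C_closed)
   show "Y |> (m (r (s n)) + e (s n)) = (m (r (s n)) + e (s n)) <| Y" if "Y \<in> range (%c. c \<odot> (mat 1 :: 'g End))" for n Y
    using that by (auto simp: lm_scale lm_simps)
   show "X \<in> range (%c. c \<odot> (mat 1 :: 'g End))" if "X \<in> \<C>" "X |> (m0 + e0) = (m0 + e0) <| X" for X
    using br that unfolding brick_iff by blast
  qed
  hence "\<forall>\<^sub>F n in sequentially. brick (m (r (s n)) + e (s n))" unfolding brick_iff .
  moreover have "\<forall>\<^sub>F n in sequentially. sol (T (r (s n))) (m (r (s n)) + e (s n)) ~= {}"
   by (rule solvable_open[OF br e0M so lim Tl eM T(2)])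
  ultimately have "\<forall>\<^sub>F n in sequentially. False" by eventually_elim (use e(3) in blast)
  thus False by simp
 qed
 from 1 2 show ?thesis
 proof eventually_elim
  case (elim n)
  show ?case unfolding good_def
  proof (intro conjI ballI impI elim(1))
   fix e assume e: "e \<in> ext P (m n)" "e ~= 0"
   let ?e = "(1 / norm e) *\<^sub>R e"
   have x: "?e \<in> ext P (m n)" by (rule subspace_scale[OF subspace_ext[OF P(1)] e(1)])
   have "norm ?e = 1" using e(2) by simp
   hence b: "brick (m n + ?e)" "sol (T n) (m n + ?e) ~= {}" using elim(2) x by blast+
   have nz: "complex_of_real (norm e) ~= 0" using e(2) by simp
   obtain a h where ah: "(a, h) \<in> GL" "m n + complex_of_real (norm e) \<cdot> ?e = a |> ((m n + ?e) <| h)"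
    by (rule scale_gauge[OF P(1) mn(2) ext_corM[OF x] nz]) blast
   have "complex_of_real (norm e) \<cdot> ?e = e" using e(2) by (simp add: ps_of_real)
   hence eq: "m n + e = a |> ((m n + ?e) <| h)" using ah(2) by simp
   show "brick (m n + e)" unfolding eq by (rule brick_gauge[OF ah(1) b(1)])
   show "sol (T n) (m n + e) ~= {}" unfolding eq sol_gauge[OF ah(1)] by (rule b(2))
  qed
 qed
qed

text \<open>Otherwise a sequence of levels without good pairs would converge to the given one, along which the pair
 of bricks can be deformed.\<close>

theorem good_open:
 assumes g: "good T0 L0 P m0"
 obtains \<delta> where "\<delta> > 0" "!!T L. T \<in> herm0 ==> L \<in> cen ==> trace L = 0 ==> trace (L ** P) = 0 ==>
  dist T T0 < \<delta> ==> dist L L0 < \<delta> ==> \<exists>m. good T L P m"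
proof -
 have bp: "brick_pair L0 P m0" using g by (simp add: good_def)
 let ?A = "%T L. T \<in> herm0 \<and> L \<in> cen \<and> trace L = 0 \<and> trace (L ** P) = 0 \<and> \<not> (\<exists>m. good T L P m)"
 have "\<exists>\<delta>>0. \<forall>T L. dist T T0 < \<delta> \<and> dist L L0 < \<delta> --> \<not> ?A T L"
 proof (rule ccontr)
  assume n: "\<not> ?thesis"
  have "\<exists>x. fst x \<in> herm0 \<and> dist (fst x) T0 < 1 / (real n + 1) \<and> snd x \<in> \<M> \<and> P |> snd x = snd x <| P \<and>
    dist (snd x) m0 < 1 / (real n + 1) \<and> \<not> good (fst x) (om (snd x) (snd x)) P (snd x)" for n
  proof -
   have e: "1 / (real n + 1) > 0" by simp
   obtain \<delta> where d: "\<delta> > 0" "!!L. L \<in> cen ==> trace L = 0 ==> trace (L ** P) = 0 ==> dist L L0 < \<delta> ==>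
     \<exists>m\<in>\<M>. P |> m = m <| P \<and> om m m = L \<and> dist m m0 < 1 / (real n + 1)" by (rule deform_brick_pair[OF bp e]) blast
   have "min \<delta> (1 / (real n + 1)) > 0" using d(1) e by simp
   then obtain T L where TL: "dist T T0 < min \<delta> (1 / (real n + 1))" "dist L L0 < min \<delta> (1 / (real n + 1))" "?A T L" using n by blast
   then obtain m where m: "m \<in> \<M>" "P |> m = m <| P" "om m m = L" "dist m m0 < 1 / (real n + 1)" using d(2)[of L] by auto
   have "\<not> good T L P m" using TL(3) by blast
   thus ?thesis by (intro exI[of _ "(T, m)"]) (use TL(1,3) m in simp)
  qed
  hence "\<forall>n. \<exists>x. fst x \<in> herm0 \<and> dist (fst x) T0 < 1 / (real n + 1) \<and> snd x \<in> \<M> \<and> P |> snd x = snd x <| P \<and>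
    dist (snd x) m0 < 1 / (real n + 1) \<and> \<not> good (fst x) (om (snd x) (snd x)) P (snd x)" by blast
  from choice[OF this] obtain x where x: "!!n. fst (x n) \<in> herm0" "!!n. dist (fst (x n)) T0 < 1 / (real n + 1)"
    "!!n. snd (x n) \<in> \<M>" "!!n. P |> snd (x n) = snd (x n) <| P"
    "!!n. dist (snd (x n)) m0 < 1 / (real n + 1)" "!!n. \<not> good (fst (x n)) (om (snd (x n)) (snd (x n))) P (snd (x n))" by blast
  have lim: "y \<longlonglongrightarrow> y0" if "!!n. dist (y n) y0 < 1 / (real n + 1)" for y and y0 :: "'b::metric_space"
  proof -
   have "(%n. dist (y n) y0) \<longlonglongrightarrow> 0"
   proof (rule tendsto_sandwich[OF _ _ tendsto_const LIMSEQ_inverse_real_of_nat])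
    show "\<forall>\<^sub>F n in sequentially. dist (y n) y0 \<le> inverse (real (Suc n))"
     using that by (intro always_eventually allI) (simp add: less_imp_le inverse_eq_divide add.commute)
   qed simp
   thus ?thesis using tendsto_dist_iff by blast
  qed
  have "\<forall>\<^sub>F n in sequentially. good (fst (x n)) (om (snd (x n)) (snd (x n))) P (snd (x n))"
   by (rule good_seq[OF g lim lim x(1,3,4)]) (fact x(5), fact x(2))
  thus False using x(6) by (simp add: eventually_sequentially)
 qed
 then obtain \<delta> where "\<delta> > 0" "\<forall>T L. dist T T0 < \<delta> \<and> dist L L0 < \<delta> --> \<not> ?A T L" by blast
 thus ?thesis using that by blast
qed

end

lemma derivative_in_subspace:
 fixes f :: "'a::real_normed_vector => 'b::euclidean_space"
 assumes V: "subspace V" and f: "(f has_derivative f') (at x)" and S: "open S" "x \<in> S" "!!z. z \<in> S ==> f z \<in> V"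
 shows "f' w \<in> V"
proof -
 obtain p where p: "linear p" "!!x. p x \<in> V" "!!x. x \<in> V ==> p x = x" "!!x y. p x \<bullet> y = x \<bullet> p y"
  by (rule orth_projection[OF V]) blast
 have "bounded_linear p" using p(1) linear_conv_bounded_linear by blast
 from bounded_linear.has_derivative[OF this f] have "((%z. p (f z)) has_derivative (%w. p (f' w))) (at x)" .
 hence "(f has_derivative (%w. p (f' w))) (at x)" by (rule has_derivative_transform_within_open[OF _ S(1,2)]) (simp add: p(3) S(3))
 from fun_cong[OF has_derivative_unique[OF f this], of w] show ?thesis using p(2)[of "f' w"] by simp
qed

context mckay
begin

section \<open>The projective line of extensions\<close>

lemma ext_ps: assumes e: "e \<in> ext P m" and P: "P \<in> Pr" shows "c \<cdot> e \<in> ext P m" unfolding ext_def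
proof (intro CollectI conjI ballI)
 show "c \<cdot> e \<in> corM (mat 1 - P) P" by (rule corM_ps[OF ext_corM[OF e]])
 have "om m (c \<cdot> e) + om (c \<cdot> e) m = c \<odot> (om m e + om e m)" by (simp add: om_distribs cs_distribs)
 thus "om m (c \<cdot> e) + om (c \<cdot> e) m = 0" using e by (simp add: ext_def)
 fix X assume X: "X \<in> cor (mat 1 - P) P"
 have "(c \<cdot> e) \<bullet> (X |> m - m <| X) = e \<bullet> ((cnj c \<odot> X) |> m - m <| (cnj c \<odot> X))"
  by (simp add: inner_ps lm_scale ps_distribs)
 thus "(c \<cdot> e) \<bullet> (X |> m - m <| X) = 0" using e cor_cs[OF X] by (simp add: ext_def)
qed

text \<open>The space of pairs is larger than the spaces of coboundaries and of obstructions by the Euler form.\<close>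

lemma dim_ext:
 assumes bp: "brick_pair L P m"
 shows "dim (ext P m) \<ge> 4"
proof -
 have P: "P \<in> Pr" and N2: "N P P = 2" and m: "m \<in> \<M>" "P |> m = m <| P" using bp by (simp_all add: brick_pair_def)
 define Q where "Q = mat 1 - P"
 have QP: "Q \<in> Pr" unfolding Q_def by (rule Pr_compl[OF P])
 have mQ: "Q |> m = m <| Q" using m by (simp add: Q_def lm_distribs lm_simps)
 let ?B = "(%Y. Y |> m - m <| Y) ` cor Q P"
 have linB: "linear (%Y. Y |> m - m <| Y)" by (rule linearI) (simp_all add: lm_distribs lm_scale scaleR_diff_right)
 have sB: "subspace ?B" by (rule linear_subspace_image[OF linB subspace_cor[OF QP P]])
 obtain p where p: "linear p" "!!x. p x \<in> ?B" "!!x. x \<in> ?B ==> p x = x" "!!x y. p x \<bullet> y = x \<bullet> p y"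
  by (rule orth_projection[OF sB]) blast
 let ?f = "%e. (om m e + om e m, p e)"
 have lf: "linear ?f" using p(1) by (intro linearI) (simp_all add: om_distribs linear_add linear_scale scaleR_add_right)
 have om: "om m e + om e m \<in> cor Q P" if e: "e \<in> corM Q P" for e
 proof (rule corI)
  note ec = corMD[OF e QP P]
  show "om m e + om e m \<in> \<C>" using m ec by (simp add: C_closed om_C)
  have "P ** om m e = om m (P |> e)" by (simp only: om_mult(1)[symmetric] m(2) om_mult(3))
  moreover have "P ** om e m = om (P |> e) m" by (simp only: om_mult(1))
  ultimately show "P ** (om m e + om e m) = om m e + om e m" by (simp add: matrix_add_ldistrib ec)
  have "om e m ** Q = om (e <| Q) m" by (simp only: om_mult(2)[symmetric] mQ[symmetric] om_mult(3))
  moreover have "om m e ** Q = om m (e <| Q)" by (simp only: om_mult(2))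
  ultimately show "(om m e + om e m) ** Q = om m e + om e m" by (simp add: matrix_add_rdistrib ec)
 qed
 have "{e \<in> corM Q P. ?f e = 0} \<subseteq> ext P m"
 proof
  fix e assume e': "e \<in> {e \<in> corM Q P. ?f e = 0}"
  hence "?f e = 0" by blast
  hence "fst (?f e) = 0" "snd (?f e) = 0" by (simp_all only: fst_zero snd_zero)
  hence e: "e \<in> corM Q P" "om m e + om e m = 0" "p e = 0" using e' by simp_all
  have "e \<bullet> (X |> m - m <| X) = 0" if X: "X \<in> cor Q P" for X
  proof -
   have "X |> m - m <| X \<in> ?B" using X by blast
   from p(3)[OF this] have "e \<bullet> (X |> m - m <| X) = p e \<bullet> (X |> m - m <| X)" unfolding p(4) by simp
   thus ?thesis by (simp add: e(3))
  qed
  thus "e \<in> ext P m" using e by (simp add: ext_def Q_def)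
 qed
 hence 1: "dim {e \<in> corM Q P. ?f e = 0} \<le> dim (ext P m)" by (rule dim_subset)
 have 2: "dim {e \<in> corM Q P. ?f e = 0} + dim (?f ` corM Q P) = dim (corM Q P)" by (rule dim_kernel_image[OF lf subspace_corM[OF QP P]])
 have "?f ` corM Q P \<subseteq> cor Q P \<times> ?B" using om p(2) by blast
 hence "dim (?f ` corM Q P) \<le> dim (cor Q P \<times> ?B)" by (rule dim_subset)
 also have "... = dim (cor Q P) + dim ?B" by (rule dim_product[OF subspace_cor[OF QP P] sB])
 also have "... \<le> dim (cor Q P) + dim (cor Q P)" using dim_image_le[OF linB] by simp
 finally have 3: "dim (?f ` corM Q P) \<le> 2 * dim (cor Q P)" by simp
 have "N Q P = - 2" using N_commute[OF QP P] N_compl[OF P P] N2 by (simp add: Q_def)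
 hence "real (dim (corM Q P)) = 2 * real (dim (cor Q P)) + 4" by (simp add: N_def)
 hence "dim (corM Q P) = 2 * dim (cor Q P) + 4" by linarith
 thus ?thesis using 1 2 3 by linarith
qed

text \<open>Homomorphisms and infinitesimal homomorphisms between extensions are block triangular with scalar
 diagonal blocks, so they only rescale the extension classes.\<close>

lemma ext_hom:
 assumes bp: "brick_pair L P m" and e: "e \<in> ext P m" "e' \<in> ext P m" "e'' \<in> ext P m"
  and k: "k \<in> \<C>" and eq: "k |> (m + e) - (m + e') <| k = e''"
 obtains c d where "c \<cdot> e - d \<cdot> e' = e''" "k = c \<odot> P + d \<odot> (mat 1 - P) + P ** k ** (mat 1 - P)"
proof -
 have P: "P \<in> Pr" and m: "m \<in> \<M>" "P |> m = m <| P"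
  and comm: "!!X. X \<in> \<C> ==> X |> m = m <| X ==> \<exists>c d. X = c \<odot> P + d \<odot> (mat 1 - P)" using bp by (auto simp: brick_pair_def)
 define Q where "Q = mat 1 - P"
 have QP: "Q \<in> Pr" unfolding Q_def by (rule Pr_compl[OF P])
 have PQ: "P ** Q = 0" "Q ** P = 0" unfolding Q_def by (rule Pr_compl_simps[OF P])+
 have PQ': "P ** (Q ** A) = 0" "Q ** (P ** A) = 0" for A :: "'g End" by (simp_all add: mm_assoc PQ)
 have mQ: "Q |> m = m <| Q" using m by (simp add: Q_def lm_distribs lm_simps)
 note PD = PrD[OF P] PrD[OF QP]
 note x = corM_off[OF ext_corM[OF e(1)] P, folded Q_def] 
 note x' = corM_off[OF ext_corM[OF e(2)] P, folded Q_def]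
 note x'' = corM_off[OF ext_corM[OF e(3)] P, folded Q_def]
 have blk: "A |> (e'' <| B) = (A ** k ** B) |> m + (A ** k) |> (e <| B) - (m <| (A ** k ** B) + (A |> e') <| (k ** B))"
  if A: "A |> m = m <| A" and B: "B |> m = m <| B" for A B
 proof -
  have "A |> (e'' <| B) = A |> (k |> (m <| B)) + A |> (k |> (e <| B)) - ((A |> m) <| k <| B + (A |> e') <| k <| B)"
   unfolding eq[symmetric] by (simp add: lm_distribs lm_simps)
  also have "A |> (k |> (m <| B)) = (A ** k ** B) |> m" by (simp only: B[symmetric] lm_simps(1) assoc_r)
  also have "(A |> m) <| k <| B = m <| (A ** k ** B)" by (simp only: A lm_simps(2) assoc_r)
  finally show ?thesis by (simp add: lm_simps)
 qed
 have z: "Q ** k ** P = 0"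
 proof -
  let ?Y = "Q ** k ** P"
  have "?Y |> m = m <| ?Y" using blk[OF mQ m(2)] x(3) x'(4) x''(3) by (simp add: lm_simps)
  moreover have "?Y \<in> \<C>" using k PD by (simp add: C_closed)
  ultimately obtain c d where "?Y = c \<odot> P + d \<odot> Q" using comm unfolding Q_def by blast
  hence "Q ** ?Y ** P = Q ** (c \<odot> P + d \<odot> Q) ** P" by simp
  thus ?thesis by (simp add: mm PD PQ PQ')
 qed
 have "(P ** k ** P) |> m = m <| (P ** k ** P)"
 proof -
  have "(P |> e') <| (k ** P) = e' <| (Q ** k ** P)" using x'(1,2) by (metis lm_simps(2) assoc_r)
  thus ?thesis using blk[OF m(2) m(2)] x(3) x''(3) z by (simp add: lm_simps)
 qed
 moreover have "(Q ** k ** Q) |> m = m <| (Q ** k ** Q)"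
 proof -
  have "(Q ** k) |> (e <| Q) = (Q ** k ** P) |> e" using x(1,2) by (metis lm_simps(1) assoc_r)
  thus ?thesis using blk[OF mQ mQ] x'(4) x''(2,4) z by (simp add: lm_simps)
 qed
 ultimately have "(P ** k ** P + Q ** k ** Q) |> m = m <| (P ** k ** P + Q ** k ** Q)" by (simp add: lm_distribs)
 moreover have "P ** k ** P + Q ** k ** Q \<in> \<C>" using k PD by (simp add: C_closed)
 ultimately obtain c d where cd: "P ** k ** P + Q ** k ** Q = c \<odot> P + d \<odot> Q" using comm unfolding Q_def by blast
 from arg_cong[OF cd, of "%X. P ** X ** P"] have cP: "P ** k ** P = c \<odot> P" by (simp add: mm PD PQ PQ')
 from arg_cong[OF cd, of "%X. Q ** X ** Q"] have dQ: "Q ** k ** Q = d \<odot> Q" by (simp add: mm PD PQ PQ')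
 let ?W = "P ** k ** Q"
 have W: "?W \<in> cor Q P" by (rule cor_mult[OF k QP P])
 have "(P ** k) |> (e <| Q) = (P ** k ** P) |> e" using x(1,2) by (metis lm_simps(1) assoc_r)
 also have "... = c \<cdot> e" unfolding cP by (simp add: lm_scale x(1))
 finally have 1: "(P ** k) |> (e <| Q) = c \<cdot> e" .
 have "(P |> e') <| (k ** Q) = e' <| (Q ** k ** Q)" using x'(1,2) by (metis lm_simps(2) assoc_r)
 also have "... = d \<cdot> e'" unfolding dQ by (simp add: lm_scale x'(2))
 finally have 2: "(P |> e') <| (k ** Q) = d \<cdot> e'" .
 have "P |> (e'' <| Q) = e''" using x'' by simp
 hence "e'' = ?W |> m + c \<cdot> e - (m <| ?W + d \<cdot> e')" using blk[OF m(2) mQ] unfolding 1 2 by simp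
 hence W': "?W |> m - m <| ?W = e'' - (c \<cdot> e - d \<cdot> e')" by (simp add: algebra_simps)
 let ?D = "e'' - (c \<cdot> e - d \<cdot> e')"
 have D: "?D \<in> ext P m" using subspace_ext[OF P] e ext_ps[OF e(1) P] ext_ps[OF e(2) P] by (intro subspace_diff) auto
 hence "?D \<bullet> (?W |> m - m <| ?W) = 0" using W unfolding ext_def Q_def[symmetric] by blast
 hence "?D = 0" unfolding W' by simp
 hence a: "c \<cdot> e - d \<cdot> e' = e''" by simp
 have "k = P ** k ** P + Q ** k ** P + (P ** k ** Q + Q ** k ** Q)" by (simp add: Q_def mm)
 hence "k = c \<odot> P + d \<odot> Q + ?W" unfolding cP dQ z by (simp only: add_0_right add.assoc add.commute[of ?W])
 thus ?thesis using that[OF a] unfolding Q_def by blast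
qed

lemma sol_ext_eq:
 assumes bp: "brick_pair L P m" and e: "e \<in> ext P m" "e' \<in> ext P m" "e ~= 0" "e' ~= 0"
  and n: "n \<in> sol T (m + e)" "n \<in> sol T (m + e')"
 obtains c where "e' = c \<cdot> e"
proof -
 have P: "P \<in> Pr" using bp by (simp add: brick_pair_def)
 obtain g h where gh: "(g, h) \<in> GL" "n = g |> ((m + e) <| h)" using n by (auto simp: sol_def)
 obtain g' h' where gh': "(g', h') \<in> GL" "n = g' |> ((m + e') <| h')" using n by (auto simp: sol_def)
 have k: "(h' ** g, h ** g') \<in> GL" by (rule GL_mult[OF gh(1) GL_inv[OF gh'(1)]])
 have "m + e' = h' |> (n <| g')" unfolding gh'(2) by (simp add: prod_eq_iff mm GLD[OF gh'(1)])
 also have "... = (h' ** g) |> ((m + e) <| (h ** g'))" unfolding gh(2) gauge_simps ..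
 finally have eq: "(h' ** g) |> (m + e) = (m + e') <| (h' ** g)" by (rule gauge_intertwine[OF k])
 have z: "0 \<in> ext P m" by (rule subspace_0[OF subspace_ext[OF P]])
 have eq': "(h' ** g) |> (m + e) - (m + e') <| (h' ** g) = 0" using eq by simp
 obtain c d where cd: "c \<cdot> e - d \<cdot> e' = 0" "h' ** g = c \<odot> P + d \<odot> (mat 1 - P) + P ** (h' ** g) ** (mat 1 - P)"
  by (rule ext_hom[OF bp e(1,2) z GLD(1)[OF k] eq']) blast
 have "d ~= 0"
 proof
  assume d: "d = 0"
  hence "c = 0" using cd(1) e(3) by (simp add: ps_eq_0_iff)
  hence w: "h' ** g = P ** (h' ** g) ** (mat 1 - P)" using cd(2) d by simp
  have "(h' ** g) ** (h' ** g) = 0"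
  proof -
   have "(h' ** g) ** (h' ** g) = (P ** (h' ** g) ** (mat 1 - P)) ** (P ** (h' ** g) ** (mat 1 - P))" using w by simp
   also have "... = P ** (h' ** g) ** (((mat 1 - P) ** P) ** ((h' ** g) ** (mat 1 - P)))" by (simp only: assoc_r)
   finally show ?thesis by (simp add: Pr_compl_simps[OF P])
  qed
  hence "(h ** g') ** ((h' ** g) ** (h' ** g)) = 0" by simp
  hence "h' ** g = 0" using GLD(6)[OF k, of "h' ** g"] by simp
  thus False using GLD(3)[OF k] mat_1_neq_0 by simp
 qed
 have "d \<cdot> e' = c \<cdot> e" using cd(1) by simp
 hence "(1 / d) \<cdot> d \<cdot> e' = (1 / d) \<cdot> c \<cdot> e" by simp
 hence "e' = (c / d) \<cdot> e" using \<open>d ~= 0\<close> by simp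
 thus ?thesis by (rule that)
qed

section \<open>Horizontal lifts\<close>

lemma drm_vertical:
 assumes A: "A\<^sup>H = - A"
 shows "drm m (A |> m - m <| A) = A ** rmom m - rmom m ** A" unfolding drm_lip rmom_def by (simp add: lip_def rip_def adj_mult A mm)

text \<open>The differential of a lift differs from a multiple of a fixed vector by an infinitesimal complex gauge
 transformation; as the lift stays in a level of the real moment map, the part of that transformation
 along the Hermitian directions can be absorbed into the horizontal projection.\<close>

lemma hp_gauge:
 assumes n: "rmom n = T" "T \<in> cen" and X: "X \<in> \<C>" and v: "v = u + (X |> n - n <| X)" and tan: "drm n v = 0"
  and u: "!!Y. Y \<in> \<C> ==> u \<bullet> (Y |> n - n <| Y) = 0"
 shows "hp n v = u"
proof -
 define A where "A = (1 / 2) *\<^sub>R (X - X\<^sup>H)"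
 define B where "B = (1 / 2) *\<^sub>R (X + X\<^sup>H)"
 have AB: "A \<in> \<C>" "B \<in> \<C>" "A\<^sup>H = - A" "B\<^sup>H = B" "X = A + B"
 proof -
  show "A \<in> \<C>" "B \<in> \<C>" unfolding A_def B_def using X by (simp_all add: C_closed C_adj)
  show "A\<^sup>H = - A" "B\<^sup>H = B" by (simp_all add: A_def B_def scaleR_diff_right add.commute)
  have "A + B = (1 / 2) *\<^sub>R (X + X)" by (simp add: A_def B_def flip: scaleR_add_right)
  also have "... = X" by (simp only: scaleR_half_double)
  finally show "X = A + B" by simp
 qed
 let ?a = "A |> n - n <| A" and ?b = "B |> n - n <| B"
 have v': "v = u + ?a + ?b" unfolding v AB(5) by (simp add: lm_distribs)
 have "drm n ?a = 0" unfolding drm_vertical[OF AB(3)] n(1) using cenD(2)[OF n(2) AB(1)] by simp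
 hence ba: "?b \<bullet> ?a = 0" using inner_drm[OF AB(4), of n ?a] by simp
 have bu: "?b \<bullet> u = 0" using u[OF AB(2)] by (simp add: inner_commute)
 have "?b \<bullet> v = 0" using inner_drm[OF AB(4), of n v] tan by simp
 hence "?b \<bullet> ?b = 0" unfolding v' inner_add_right using ba bu by simp
 hence b0: "?b = 0" by simp
 show ?thesis
 proof (rule hp_unique)
  show "u \<in> orthogonal_comp (vert n)" using u lieD(1) by (auto simp: orthogonal_comp_def orthogonal_def vertical_def inf_act_eq inner_commute)
  show "v - u \<in> vert n" unfolding v' b0 vertical_def using AB(1,3) by (auto simp: inf_act_eq intro!: image_eqI[of _ _ A] lieI)
 qed
qed

text \<open>The local solutions of the real moment map equation give smooth lifts; their horizontal derivative is
 complex linear, and it is injective because the extension class changes.\<close>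

lemma curve_lift:
 assumes T: "T \<in> cen" "T \<in> herm0" and L: "L \<in> cen" and g: "good T L P m"
  and e: "e1 \<in> ext P m" "e2 \<in> ext P m" and ind: "!!a b. a \<cdot> e1 = b \<cdot> e2 ==> a = 0 \<and> b = 0"
 shows "holo T L (%z. sol T (m + (e1 + z \<cdot> e2)))" unfolding holo_def
proof
 fix z0
 have bp: "brick_pair L P m" using g by (simp add: good_def)
 have P: "P \<in> Pr" and mM: "m \<in> \<M>" and omm: "om m m = L" using bp by (simp_all add: brick_pair_def)
 define E where "E z = m + (e1 + z \<cdot> e2)" for z
 have x: "e1 + z \<cdot> e2 \<in> ext P m" for z using subspace_ext[OF P] e ext_ps[OF e(2) P] by (simp add: subspace_add)
 have x0: "e1 + z \<cdot> e2 ~= 0" for z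
 proof
  assume "e1 + z \<cdot> e2 = 0"
  thus False using ind[of 1 "- z"] by (simp add: eq_neg_iff_add_eq_0)
 qed
 have EM: "E z \<in> \<M>" for z unfolding E_def using corM_off(6)[OF ext_corM[OF x] P] mM by (simp add: M_closed)
 have omE: "om (E z) (E z) = L" for z unfolding E_def ext_om[OF x P] by (rule omm)
 have br: "brick (E z)" and ne: "sol T (E z) ~= {}" for z using g x x0 by (simp_all add: good_def E_def)
 obtain m0 g0 h0 where m0: "m0 \<in> \<M>" "rmom m0 = T" "(g0, h0) \<in> GL" "m0 = g0 |> (E z0 <| h0)" using ne[of z0] by (auto simp: sol_def)
 have brm: "brick m0" using brick_gauge[OF m0(3) br] m0(4) by simp
 obtain S G H where S: "open S" "(m0, rmom m0) \<in> S"
  "!!m T. (m, T) \<in> S ==> m \<in> \<M> ==> T \<in> herm0 ==> (G (m, T), H (m, T)) \<in> GL \<and> rmom (G (m, T) |> (m <| H (m, T))) = T"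
  "!!p. p \<in> S ==> \<exists>G' H'. (G has_derivative G') (at p) \<and> (H has_derivative H') (at p)" by (rule local_solution[OF m0(1) brm]) blast
 define v where "v = g0 |> (e2 <| h0)"
 define E' where "E' z = g0 |> (E z <| h0)" for z
 have E'M: "E' z \<in> \<M>" for z unfolding E'_def by (rule gauge_M[OF m0(3) EM])
 have bps: "bounded_linear (%w::complex. w \<cdot> x)" for x :: "'g pair" by (intro linear_conv_bounded_linear[THEN iffD1] linearI)
    (simp_all add: ps_distribs scaleR_conv_of_real[where 'a = complex] flip: ps_of_real)
 have dE': "(E' has_derivative (%w. w \<cdot> v)) (at z)" for z
 proof -
  have "E' = (%z. g0 |> ((m + e1) <| h0) + z \<cdot> v)" by (rule HOL.ext) (simp add: E'_def E_def v_def lm_distribs lm_scale)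
  thus ?thesis using has_derivative_add[OF has_derivative_const bounded_linear_imp_has_derivative[OF bps]] by simp
 qed
 have dET: "((%z. (E' z, T)) has_derivative (%w. (w \<cdot> v, 0))) (at z)" for z by (rule has_derivative_Pair[OF dE' has_derivative_const])
 define U where "U = (%z. (E' z, T)) -` S"
 have cont: "continuous_on UNIV (%z. (E' z, T))" by (rule has_derivative_continuous_on) (use dET has_derivative_at_withinI in blast)
 have U: "open U" "z0 \<in> U" unfolding U_def using open_vimage[OF S(1) cont] S(2) m0 by (simp_all add: E'_def)
 define Gz where "Gz z = G (E' z, T)" for z
 define Hz where "Hz z = H (E' z, T)" for z
 define F where "F z = Gz z |> (E' z <| Hz z)" for z
 have GH: "(Gz z, Hz z) \<in> GL" "rmom (F z) = T" if "z \<in> U" for z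
  using S(3)[of "E' z" T] E'M T(2) that by (simp_all add: U_def Gz_def Hz_def F_def)
 have Fg: "F z = (Gz z ** g0) |> (E z <| (h0 ** Hz z))" for z unfolding F_def E'_def gauge_simps ..
 have GLg: "(Gz z ** g0, h0 ** Hz z) \<in> GL" if "z \<in> U" for z by (rule GL_mult[OF m0(3) GH(1)[OF that]])
 have FM: "F z \<in> \<M>" if "z \<in> U" for z unfolding Fg by (rule gauge_M[OF GLg[OF that] EM])
 have omF: "om (F z) (F z) = L" if "z \<in> U" for z unfolding Fg by (rule gauge_om[OF GLg[OF that] omE L])
 have Fsol: "F z \<in> sol T (E z)" if "z \<in> U" for z using sol_I[OF GLg[OF that] EM, of z T] GH(2)[OF that] unfolding Fg by blast
 show "\<exists>S F. open S \<and> z0 \<in> S \<and>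
   (\<forall>z\<in>S. F z \<in> Lev T L \<and> sol T (m + (e1 + z \<cdot> e2)) = orb (F z) \<and>
    (\<exists>F'. (F has_derivative F') (at z) \<and>
      (\<forall>w. hp (F z) (F' (\<i> * w)) = I_op (hp (F z) (F' w))) \<and>
      (\<forall>w. w ~= 0 --> hp (F z) (F' w) ~= 0)))"
 proof (rule exI[of _ U], rule exI[of _ F], intro conjI ballI U)
  fix z assume z: "z \<in> U"
  show "F z \<in> Lev T L" using FM[OF z] GH(2)[OF z] omF[OF z] by (simp add: Lev_def)
  show "sol T (m + (e1 + z \<cdot> e2)) = orb (F z)" using sol_orbit[OF T(1) br Fsol[OF z]] by (simp add: E_def)
  have "(E' z, T) \<in> S" using z by (simp add: U_def)
  from S(4)[OF this] obtain G' H' where GH': "(G has_derivative G') (at (E' z, T))" "(H has_derivative H') (at (E' z, T))" by blast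
  define Gd where "Gd w = G' (w \<cdot> v, 0)" for w
  define Hd where "Hd w = H' (w \<cdot> v, 0)" for w
  have dG: "(Gz has_derivative Gd) (at z)" unfolding Gz_def[abs_def] Gd_def[abs_def] by (rule has_derivative_compose[OF dET GH'(1)])
  have dH: "(Hz has_derivative Hd) (at z)" unfolding Hz_def[abs_def] Hd_def[abs_def] by (rule has_derivative_compose[OF dET GH'(2)])
  let ?g = "Gz z" and ?h = "Hz z"
  note gl = GLD[OF GH(1)[OF z]]
  have GdC: "Gd w \<in> \<C>" for w by (rule derivative_in_subspace[OF subspace_C dG U(1) z]) (rule GLD(1)[OF GH(1)])
  have rel: "?g ** Hd w + Gd w ** ?h = 0" for w
  proof -
   have 1: "((%z. Gz z ** Hz z) has_derivative (%w. ?g ** Hd w + Gd w ** ?h)) (at z)" by (rule bounded_bilinear.FDERIV[OF bb_mult dG dH])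
   have "((%z. mat 1) has_derivative (%w. ?g ** Hd w + Gd w ** ?h)) (at z)"
    by (rule has_derivative_transform_within_open[OF 1 U(1) z]) (simp add: GLD(3)[OF GH(1)])
   from fun_cong[OF has_derivative_unique[OF this has_derivative_const], of w] show ?thesis .
  qed
  have Hd: "Hd w = - (?h ** Gd w ** ?h)" for w
  proof -
   have "?g ** Hd w = - (Gd w ** ?h)" using rel[of w] by (simp add: eq_neg_iff_add_eq_0)
   hence "?h ** (?g ** Hd w) = ?h ** (- (Gd w ** ?h))" by simp
   thus ?thesis by (simp add: gl mult_neg mm_assoc)
  qed
  define u where "u = ?g |> (v <| ?h)"
  define F' where "F' w = ?g |> (E' z <| Hd w + (w \<cdot> v) <| ?h) + Gd w |> (E' z <| ?h)" for w
  have dF: "(F has_derivative F') (at z)" unfolding F_def[abs_def] F'_def[abs_def]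
   by (rule bounded_bilinear.FDERIV[OF bb_lm dG bounded_bilinear.FDERIV[OF bb_rm dE' dH]])
  have F': "F' w = w \<cdot> u + ((Gd w ** ?h) |> F z - F z <| (Gd w ** ?h))" for w
  proof -
   have "(Gd w ** ?h) |> F z = Gd w |> (E' z <| ?h)" by (simp add: F_def prod_eq_iff mm gl)
   moreover have "F z <| (Gd w ** ?h) = - (?g |> (E' z <| Hd w))" by (simp add: F_def Hd prod_eq_iff mm)
   moreover have "?g |> ((w \<cdot> v) <| ?h) = w \<cdot> u" by (simp add: u_def lm_scale)
   ultimately show ?thesis by (simp add: F'_def lm_distribs)
  qed
  let ?K = "(%X. X |> F z - F z <| X) ` \<C>"
  have sK: "subspace ?K" by (rule linear_subspace_image[OF _ subspace_C]) (rule linearI; simp add: lm_distribs lm_scale scaleR_diff_right)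
  obtain X0 where X0: "X0 \<in> \<C>" and u'o: "!!Y. Y \<in> \<C> ==> (u - (X0 |> F z - F z <| X0)) \<bullet> (Y |> F z - F z <| Y) = 0"
   by (rule orthogonal_decomposition[OF sK, of u]) blast
  define u' where "u' = u - (X0 |> F z - F z <| X0)"
  have hpF: "hp (F z) (F' w) = w \<cdot> u'" for w
  proof (rule hp_gauge[OF GH(2)[OF z] T(1)])
   show "w \<odot> X0 + Gd w ** ?h \<in> \<C>" by (intro C_closed X0 GdC gl(2))
   have "w \<cdot> u = w \<cdot> u' + w \<cdot> (X0 |> F z - F z <| X0)" by (simp add: u'_def ps_distribs)
   thus "F' w = w \<cdot> u' + ((w \<odot> X0 + Gd w ** ?h) |> F z - F z <| (w \<odot> X0 + Gd w ** ?h))"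
    unfolding F' by (simp add: lm_distribs lm_scale ps_distribs)
   show "drm (F z) (F' w) = 0"
   proof -
    have 1: "((%z. rmom (F z)) has_derivative (%w. drm (F z) (F' w))) (at z)" by (rule has_derivative_rmom[OF dF])
    have "((%z. T) has_derivative (%w. drm (F z) (F' w))) (at z)" by (rule has_derivative_transform_within_open[OF 1 U(1) z]) (simp add: GH(2))
    from fun_cong[OF has_derivative_unique[OF this has_derivative_const], of w] show ?thesis .
   qed
   fix Y assume "Y \<in> \<C>"
   hence "cnj w \<odot> Y \<in> \<C>" by (simp add: C_closed)
   from u'o[OF this, folded u'_def] show "(w \<cdot> u') \<bullet> (Y |> F z - F z <| Y) = 0" by (simp add: inner_ps lm_scale ps_distribs)
  qed
  have u'0: "u' ~= 0"
  proof
   assume "u' = 0"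
   hence uX: "u = X0 |> F z - F z <| X0" by (simp add: u'_def)
   let ?a = "?g ** g0" and ?b = "h0 ** ?h"
   note ab = GLD[OF GLg[OF z]]
   let ?X = "?b ** X0 ** ?a"
   have ue: "u = ?a |> (e2 <| ?b)" unfolding u_def v_def gauge_simps ..
   have "e2 = ?b |> (u <| ?a)" unfolding ue by (simp add: prod_eq_iff mm) (simp add: ab[unfolded assoc_r] assoc_r gl GLD[OF m0(3)])
   also have "... = ?X |> E z - E z <| ?X" unfolding uX Fg by (simp add: prod_eq_iff mm gl GLD[OF m0(3)])
   finally have e2: "?X |> (m + (e1 + z \<cdot> e2)) - (m + (e1 + z \<cdot> e2)) <| ?X = e2" by (simp add: E_def)
   have "?X \<in> \<C>" by (intro C_closed ab X0)
   obtain c d where "c \<cdot> (e1 + z \<cdot> e2) - d \<cdot> (e1 + z \<cdot> e2) = e2"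
    by (rule ext_hom[OF bp x x e(2) \<open>?X \<in> \<C>\<close> e2]) blast
   hence "(c - d) \<cdot> (e1 + z \<cdot> e2) = e2" by (simp only: ps_distribs(4))
   hence "(c - d) \<cdot> e1 = (1 - (c - d) * z) \<cdot> e2" by (simp add: ps_distribs algebra_simps)
   from ind[OF this] show False by auto
  qed
  show "\<exists>F'. (F has_derivative F') (at z) \<and>
      (\<forall>w. hp (F z) (F' (\<i> * w)) = I_op (hp (F z) (F' w))) \<and>
      (\<forall>w. w ~= 0 --> hp (F z) (F' w) ~= 0)"
  proof (rule exI[of _ F'], intro conjI allI impI dF)
   show "hp (F z) (F' (\<i> * w)) = I_op (hp (F z) (F' w))" for w by (simp add: hpF I_op_eq)
   show "hp (F z) (F' w) ~= 0" if "w ~= 0" for w using that u'0 by (simp add: hpF ps_eq_0_iff)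
  qed
 qed
qed

text \<open>Proportional extension classes give gauge equivalent modules, other ones do not, so a plane of classes
 gives an injective image of the projective line.\<close>

theorem rational_curve_of_good:
 assumes T: "T \<in> cen" "T \<in> herm0" and L: "L \<in> cen" and g: "good T L P m"
 obtains f where "rational_curve T L f"
proof -
 have bp: "brick_pair L P m" using g by (simp add: good_def)
 have P: "P \<in> Pr" and Pm: "P |> m = m <| P" using bp by (simp_all add: brick_pair_def)
 have se: "subspace (ext P m)" by (rule subspace_ext[OF P])
 have d4: "dim (ext P m) \<ge> 4" by (rule dim_ext[OF bp])
 have "\<not> ext P m \<subseteq> {0}"
 proof
  assume "ext P m \<subseteq> {0}"
  hence "dim (ext P m) \<le> card ({} :: 'g pair set)" by (intro dim_le_card) auto
  thus False using d4 unfolding card.empty by linarith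
 qed
 then obtain a where a: "a \<in> ext P m" "a ~= 0" by blast
 have "\<not> ext P m \<subseteq> span {a, \<i> \<cdot> a}"
 proof
  assume "ext P m \<subseteq> span {a, \<i> \<cdot> a}"
  hence "dim (ext P m) \<le> card {a, \<i> \<cdot> a}" by (intro dim_le_card) auto
  also have "... \<le> 2" by (simp add: card_insert_if)
  finally show False using d4 by simp
 qed
 then obtain b where b: "b \<in> ext P m" "b \<notin> span {a, \<i> \<cdot> a}" by blast
 have i1: "b ~= c \<cdot> a" for c
 proof
  assume "b = c \<cdot> a"
  also have "c = of_real (Re c) + of_real (Im c) * \<i>" by (simp add: complex_eq_iff)
  finally have "b = Re c *\<^sub>R a + Im c *\<^sub>R (\<i> \<cdot> a)" by (simp only: ps_distribs ps_of_real[symmetric] ps_simps(4))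
  also have "... \<in> span {a, \<i> \<cdot> a}" by (intro span_add span_scale span_base) auto
  finally show False using b(2) by simp
 qed
 have ind: "c = 0 \<and> d = 0" if e: "c \<cdot> a = d \<cdot> b" for c d
 proof -
  have "d = 0"
  proof (rule ccontr)
   assume "d ~= 0"
   hence "b = (1 / d) \<cdot> d \<cdot> b" by simp
   thus False using i1[of "1 / d * c"] unfolding e[symmetric] by simp
  qed
  thus ?thesis using e a(2) by (simp add: ps_eq_0_iff)
 qed
 have xa: "a + z \<cdot> b \<in> ext P m" "b + z \<cdot> a \<in> ext P m" for z
  using se a(1) b(1) ext_ps[OF a(1) P] ext_ps[OF b(1) P] by (simp_all add: subspace_add)
 have xa0: "a + z \<cdot> b ~= 0" "b ~= 0" for z using ind[of 1 "- z"] ind[of 0 1] by (auto simp: eq_neg_iff_add_eq_0)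
 let ?e = "%p. case p of None => b | Some z => a + z \<cdot> b"
 define f where "f p = sol T (m + ?e p)" for p
 have ep: "?e p \<in> ext P m" "?e p ~= 0" for p using xa(1) xa0 b(1) by (cases p; simp)+
 have c0: "f \<circ> P1_chart0 = (%z. sol T (m + (a + z \<cdot> b)))" by (rule HOL.ext) (simp add: f_def P1_chart0_def)
 have ci: "f \<circ> P1_chart_infinity = (%z. sol T (m + (b + z \<cdot> a)))"
 proof (rule HOL.ext)
  fix z :: complex
  show "(f \<circ> P1_chart_infinity) z = sol T (m + (b + z \<cdot> a))"
  proof (cases "z = 0")
   case True thus ?thesis by (simp add: f_def P1_chart_infinity_def)
  next
   case False
   have "z \<cdot> (a + (1 / z) \<cdot> b) = b + z \<cdot> a" using False by (simp add: ps_distribs add.commute)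
   moreover obtain g h where "(g, h) \<in> GL" "m + z \<cdot> (a + (1 / z) \<cdot> b) = g |> ((m + (a + (1 / z) \<cdot> b)) <| h)"
    by (rule scale_gauge[OF P Pm ext_corM[OF xa(1)] False]) blast
   ultimately show ?thesis using False sol_gauge by (simp add: f_def P1_chart_infinity_def)
  qed
 qed
 have "inj f"
 proof (rule injI)
  fix p q assume fpq: "f p = f q"
  have "f p ~= {}" using g ep by (simp add: good_def f_def)
  then obtain n where "n \<in> sol T (m + ?e p)" "n \<in> sol T (m + ?e q)" using fpq by (auto simp: f_def)
  then obtain c where c: "?e q = c \<cdot> ?e p" by (rule sol_ext_eq[OF bp ep(1) ep(1) ep(2) ep(2)])
  show "p = q"
  proof (cases p)
   case None
   show ?thesis
   proof (cases q)
    case (Some z)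
    hence "1 \<cdot> a = (c - z) \<cdot> b" using c None by (simp add: ps_distribs eq_diff_eq)
    from ind[OF this] show ?thesis by simp
   qed (use None in simp)
  next
   case (Some z)
   show ?thesis
   proof (cases q)
    case None
    hence "b = c \<cdot> a + (c * z) \<cdot> b" using c Some by (simp add: ps_distribs)
    hence "c \<cdot> a = (1 - c * z) \<cdot> b" by (simp add: ps_distribs eq_diff_eq)
    from ind[OF this] show ?thesis by auto
   next
    case q: (Some y)
    hence "a + y \<cdot> b = c \<cdot> a + (c * z) \<cdot> b" using c Some by (simp add: ps_distribs)
    hence "(1 - c) \<cdot> a = (c * z - y) \<cdot> b" by (simp add: ps_distribs algebra_simps)
    from ind[OF this] show ?thesis using Some q by auto
   qed
  qed
 qed
 moreover have "holo T L (f \<circ> P1_chart0)" unfolding c0 by (rule curve_lift[OF T L g a(1) b(1) ind])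
 moreover have "holo T L (f \<circ> P1_chart_infinity)" unfolding ci by (rule curve_lift[OF T L g b(1) a(1)]) (use ind in metis)
 ultimately have "rational_curve T L f" by (simp add: rational_curve_def)
 thus ?thesis by (rule that)
qed

section \<open>Characters of simple points\<close>

definition simple_point :: "'g pair => bool" where
 "simple_point E \<longleftrightarrow> E \<in> \<M> \<and> (\<forall>F. subm E F --> F = 0 \<or> F = mat 1)"

lemma triv_proper: "triv ~= 0" "triv ~= mat 1"
proof -
 show "triv ~= 0" using trace_triv by (metis trace_zero zero_neq_one)
 show "triv ~= mat 1"
 proof
  assume "triv = mat 1"
  hence "of_nat CARD('g) = (1::complex)" using trace_triv trace_mat[of 1, where 'n = 'g] by simp
  hence "CARD('g) = 1" by (metis of_nat_eq_1_iff)
  then obtain x :: 'g where "UNIV = {x}" using card_1_singletonE by blast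
  hence "g = ge" for g by (metis UNIV_I singletonD)
  hence "\<gamma> g = mat 1" for g using \<gamma>_ge by metis
  thus False using nontrivial by auto
 qed
qed

lemma zero_not_simple: "\<not> simple_point 0"
proof
 assume "simple_point 0"
 moreover have "subm 0 triv" using triv_Pr by (simp add: subm_def lm_simps)
 ultimately show False using triv_proper by (auto simp: simple_point_def)
qed

text \<open>The values of the words on a vector form a submodule.\<close>

lemma simple_transitive:
 assumes s: "simple_point E" and v: "v ~= 0"
 obtains w where "w \<in> words" "w E *v v = x"
proof -
 have EM: "E \<in> \<M>" using s by (simp add: simple_point_def)
 obtain F where F: "F \<in> Pr" "!!x. F *v x = x \<longleftrightarrow> x \<in> (%w. w E *v v) ` words" "subm E F"
  "fst E *v v \<in> (%w. w E *v v) ` words" "snd E *v v \<in> (%w. w E *v v) ` words" by (rule words_submodule[of E v]) blast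
 have "F = 0 \<or> F = mat 1" using s F(3) by (simp add: simple_point_def)
 thus ?thesis
 proof
  assume "F = mat 1"
  hence "x \<in> (%w. w E *v v) ` words" using F(2)[of x] by simp
  thus ?thesis using that by blast
 next
  assume F0: "F = 0"
  define Z where "Z = {v. fst E *v v = 0 \<and> snd E *v v = 0}"
  have "fst E *v v = 0" "snd E *v v = 0" using F(2)[of "fst E *v v"] F(2)[of "snd E *v v"] F(4,5) F0 by simp_all
  hence vZ: "v \<in> Z" by (simp add: Z_def)
  have "R g *v w \<in> Z" if "w \<in> Z" for g w
  proof -
   have w: "fst E *v w = 0" "snd E *v w = 0" using that by (simp_all add: Z_def)
   have "fst E *v (R g *v w) = (fst E ** R g) *v w" "snd E *v (R g *v w) = (snd E ** R g) *v w" by (simp_all add: mv_assoc)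
   thus ?thesis unfolding MD[OF EM] Z_def by (simp add: matrix_vector_mult_add_rdistrib cs_vec flip: mv_assoc) (simp add: w)
  qed
  moreover have "vec.subspace Z" unfolding vec.subspace_def Z_def by (simp add: mv_add_right vec.scale)
  ultimately have "inv_sub Z" by (simp add: inv_sub_def)
  from Pr_exists[OF this] obtain K where K: "K \<in> Pr" "!!v. K *v v = v \<longleftrightarrow> v \<in> Z" by blast
  have "subm E K" unfolding subm_iff[OF K(1)] K(2) by (simp add: Z_def)
  moreover have "K ~= 0"
  proof
   assume "K = 0"
   thus False using K(2)[of v] vZ v by simp
  qed
  ultimately have "K = mat 1" using s by (auto simp: simple_point_def)
  hence "v \<in> Z" for v using K(2)[of v] by simp
  hence "fst E = 0" "snd E = 0" by (auto intro!: matrix_eqI simp: Z_def)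
  hence "E = 0" by (simp add: prod_eq_iff)
  thus ?thesis using s zero_not_simple by simp
 qed
qed

lemma words_mult: "a \<in> words ==> b \<in> words ==> (%m. a m ** b m) \<in> words"
proof (induction rule: words.induct)
 case (add a a') thus ?case using words.add by (simp add: matrix_add_rdistrib)
next
 case (scale a c) thus ?case using words.scale by (simp add: mult_cs)
next
 case (grp a g) thus ?case using words.grp by (simp add: assoc_r)
next
 case (fst_mult a) thus ?case using words.fst_mult by (simp add: assoc_r)
next
 case (snd_mult a) thus ?case using words.snd_mult by (simp add: assoc_r)
qed (simp_all add: words.fst_mult words.snd_mult)

lemma words_0_mem: "(%m. 0) \<in> words" using words.scale[OF words.fst, of 0] by simp

lemma words_diff: "a \<in> words ==> b \<in> words ==> (%m. a m - c \<odot> b m) \<in> words"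
 using words.add[OF _ words.scale[of b "- c"], of a] by simp

lemma words_sum: "finite A ==> (!!j. j \<in> A ==> u j \<in> words) ==> (%m. \<Sum>j\<in>A. u j m) \<in> words"
 by (induction A rule: finite_induct) (auto intro: words_0_mem words.add)

text \<open>Burnside's argument: a nonzero word of least rank has rank one.\<close>

lemma rank_one_word:
 assumes s: "simple_point E"
 obtains X x where "X \<in> words" "x ~= 0" "X E *v x = x" "!!v. \<exists>c. X E *v v = c *s x"
proof -
 let ?S = "%X. X \<in> words \<and> X E ~= 0"
 let ?r = "%X :: 'g pair => 'g End. dim (range ((*v) (X E)))"
 have E0: "E ~= 0" using s zero_not_simple by auto
 hence "?S (%m. fst m) \<or> ?S (%m. snd m)" using words.fst words.snd by (auto simp: prod_eq_iff)
 then obtain X0 where "?S X0" by blast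
 then obtain X where X: "?S X" and min: "!!Y. ?S Y ==> ?r X \<le> ?r Y" using ex_has_least_nat[of ?S X0 ?r] by blast
 obtain v1 where v1: "X E *v v1 ~= 0" using X matrix_eqI[of "X E" 0] by auto
 define x where "x = X E *v v1"
 have x0: "x ~= 0" using v1 by (simp add: x_def)
 have dep: "\<exists>c. X E *v v2 = c *s x" for v2
 proof (rule ccontr)
  assume n: "\<not> ?thesis"
  obtain u where u: "u \<in> words" "u E *v x = v2" by (rule simple_transitive[OF s x0]) blast
  let ?V = "range ((*v) (X E))"
  have "x \<in> ?V" by (simp add: x_def)
  hence V: "?V ~= {0}" using x0 by blast
  have sV: "vec.subspace ?V" unfolding vec.subspace_def image_iff by (auto intro: exI[of _ 0] simp flip: mv_add_right vec.scale)
  obtain c y where y: "y \<in> ?V" "y ~= 0" "(X E ** u E) *v y = c *s y"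
   by (rule eigenvector_exists[OF sV V, of "X E ** u E"]) (auto simp flip: mv_assoc)
  define Y where "Y m = X m ** (u m ** X m) - c \<odot> X m" for m
  have YW: "Y \<in> words" unfolding Y_def[abs_def] using X u by (intro words_diff words_mult) auto
  have "Y E *v v1 = X E *v v2 - c *s x" by (simp add: Y_def mv_diff cs_vec x_def u(2)[unfolded x_def] flip: mv_assoc)
  hence "Y E *v v1 ~= 0" using n by auto
  hence YE: "Y E ~= 0" by auto
  define Z where "Z = X E ** u E - c \<odot> mat 1"
  have YZ: "Y E = Z ** X E" by (simp add: Y_def Z_def mm)
  have Zy: "Z *v y = 0" using y(3) by (simp add: Z_def mv_diff cs_vec)
  have ZV: "Z *v t \<in> ?V" if "t \<in> ?V" for t
  proof -
   have "Z *v t = X E *v (u E *v t) - c *s t" by (simp add: Z_def mv_diff cs_vec mv_assoc)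
   thus ?thesis using sV that by (simp add: vec.subspace_diff vec.subspace_scale)
  qed
  have rY: "range ((*v) (Y E)) = (*v) Z ` ?V" unfolding YZ by (auto simp: image_image simp flip: mv_assoc)
  have lZ: "linear ((*v) Z)" by (intro linearI) (simp_all add: mv_add_right vec_scaleR_eq vec.scale)
  have "dim {t \<in> ?V. Z *v t = 0} + dim ((*v) Z ` ?V) = dim ?V" by (rule dim_kernel_image[OF lZ vec_subspace_real[OF sV]])
  moreover have "dim {t \<in> ?V. Z *v t = 0} > 0"
  proof (rule ccontr)
   assume "\<not> ?thesis"
   hence "dim {t \<in> ?V. Z *v t = 0} = 0" by (simp only: neq0_conv[symmetric] not_not)
   hence sub: "{t \<in> ?V. Z *v t = 0} \<subseteq> {0}" by (rule dim_eq_0[THEN iffD1])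
   have "y \<in> {t \<in> ?V. Z *v t = 0}" using y(1) Zy by (intro CollectI conjI)
   from subsetD[OF sub this] show False using y(2) by (simp only: singleton_iff)
  qed
  ultimately have "?r Y < ?r X" unfolding rY by linarith
  thus False using min[of Y] YW YE by auto
 qed
 obtain a where a: "a \<in> words" "a E *v x = v1" by (rule simple_transitive[OF s x0]) blast
 show ?thesis
 proof (rule that[of "%m. X m ** a m" x])
  show "(%m. X m ** a m) \<in> words" using X a by (intro words_mult) auto
  show "x ~= 0" by (rule x0)
  have "(X E ** a E) *v x = X E *v (a E *v x)" by (simp only: mv_assoc)
  thus "(X E ** a E) *v x = x" by (simp only: a(2) x_def[symmetric])
  show "\<exists>c. (X E ** a E) *v v = c *s x" for v using dep by (simp flip: mv_assoc)
 qed
qed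

lemma trace_rank_one:
 fixes Z :: "'g End"
 assumes x: "x ~= 0" "Z *v x = x" and r: "!!v. \<exists>c. Z *v v = c *s x"
 shows "trace Z = 1"
proof -
 have "\<forall>j. \<exists>c. Z *v axis j (1::complex) = c *s x" using r by blast
 from choice[OF this] obtain l where l: "!!j. Z *v axis j (1::complex) = l j *s x" by blast
 have Zij: "Z $ i $ j = l j * x $ i" for i j
 proof -
  have "(Z *v axis j (1::complex)) $ i = (\<Sum>k\<in>UNIV. Z $ i $ k * (if k = j then 1 else 0))" unfolding matrix_vector_mult_def axis_def by simp
  also have "... = (\<Sum>k\<in>UNIV. if k = j then Z $ i $ k else 0)" by (rule sum.cong) simp_all
  also have "... = Z $ i $ j" by simp
  finally have "Z $ i $ j = (Z *v axis j (1::complex)) $ i" by (rule sym)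
  thus ?thesis by (simp add: l)
 qed
 obtain i where i: "x $ i ~= 0" using x(1) by (auto simp: vec_eq_iff)
 have "x $ i = (Z *v x) $ i" by (simp add: x(2))
 also have "... = (\<Sum>j\<in>UNIV. (l j * x $ j) * x $ i)" by (simp add: matrix_vector_mult_def Zij mult_ac)
 also have "... = (\<Sum>j\<in>UNIV. l j * x $ j) * x $ i" by (rule sum_distrib_right[symmetric])
 finally have "(\<Sum>j\<in>UNIV. l j * x $ j) = 1" using i by simp
 thus ?thesis by (simp add: trace_def Zij)
qed

lemma simple_trace_form:
 assumes s: "simple_point E" and w: "w \<in> words" "w E ~= 0"
 obtains u where "u \<in> words" "trace (w E ** u E) ~= 0"
proof -
 obtain X x where X: "X \<in> words" "x ~= 0" "X E *v x = x" "!!v. \<exists>c. X E *v v = c *s x" by (rule rank_one_word[OF s]) blast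
 obtain y where y: "w E *v y ~= 0" using w(2) matrix_eqI[of "w E" 0] by auto
 obtain a where a: "a \<in> words" "a E *v x = y" by (rule simple_transitive[OF s X(2)]) blast
 obtain b where b: "b \<in> words" "b E *v (w E *v y) = x" by (rule simple_transitive[OF s y]) blast
 let ?Z = "X E ** (b E ** (w E ** a E))"
 have "trace ?Z = 1"
 proof (rule trace_rank_one[OF X(2)])
  show "?Z *v x = x" by (simp add: a(2) b(2) X(3) flip: mv_assoc)
  show "\<exists>c. ?Z *v v = c *s x" for v using X(4) by (simp flip: mv_assoc)
 qed
 moreover have "trace ?Z = trace (w E ** (a E ** (X E ** b E)))" using trace_mul_sym[of "X E ** b E" "w E ** a E"] by (simp add: assoc_r)
 ultimately have "trace (w E ** (a E ** (X E ** b E))) ~= 0" by simp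
 moreover have "(%m. a m ** (X m ** b m)) \<in> words" by (intro words_mult a b X)
 ultimately show ?thesis using that by blast
qed

text \<open>By nondegeneracy of the trace form, traces decide which words vanish. So a rank one idempotent word has
 the same properties at the other point, and matching fixed vectors of the two extends to an isomorphism.\<close>

lemma simple_determined_by_traces:
 assumes s: "simple_point E" "simple_point E'" and tr: "!!w. w \<in> words ==> trace (w E) = trace (w E')"
 obtains k l where "(k, l) \<in> GL" "E' = k |> (E <| l)"
proof -
 have z: "w E' = 0 \<longleftrightarrow> w E = 0" if w: "w \<in> words" for w
 proof -
  have *: "w E2 = 0" if s2: "simple_point E2" and e: "w E1 = 0" and t: "!!w. w \<in> words ==> trace (w E1) = trace (w E2)" for E1 E2
  proof (rule ccontr)
   assume "w E2 ~= 0"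
   obtain u where u: "u \<in> words" "trace (w E2 ** u E2) ~= 0" by (rule simple_trace_form[OF s2 w \<open>w E2 ~= 0\<close>]) blast
   have "trace (w E1 ** u E1) = trace (w E2 ** u E2)" by (rule t[OF words_mult[OF w u(1)]])
   thus False using u(2) e by simp
  qed
  show ?thesis using *[of E' E] *[of E E'] s tr by metis
 qed
 obtain X x where X: "X \<in> words" "x ~= 0" "X E *v x = x" "!!v. \<exists>c. X E *v v = c *s x" by (rule rank_one_word[OF s(1)]) blast
 have "X E ** X E - 1 \<odot> X E = 0"
 proof (rule matrix_eqI)
  fix v
  obtain c where "X E *v v = c *s x" using X(4) by blast
  thus "(X E ** X E - 1 \<odot> X E) *v v = 0 *v v" by (simp add: mv_diff vec.scale X(3) flip: mv_assoc)
 qed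
 hence "X E' ** X E' - 1 \<odot> X E' = 0" using z[OF words_diff[OF words_mult[OF X(1) X(1)] X(1), of 1]] by simp
 hence idem: "X E' ** X E' = X E'" by simp
 have "X E ~= 0" using X(2,3) by auto
 hence "X E' ~= 0" using z[OF X(1)] by simp
 then obtain y where y: "X E' *v y ~= 0" using matrix_eqI[of "X E'" 0] by auto
 define v where "v = X E' *v y"
 have v: "v ~= 0" "X E' *v v = v" using y by (simp_all add: v_def mv_assoc idem)
 have wd: "u E' *v v = 0" if u: "u \<in> words" "u E *v x = 0" for u
 proof -
  have "u E ** X E = 0"
  proof (rule matrix_eqI)
   fix t
   obtain c where "X E *v t = c *s x" using X(4) by blast
   thus "(u E ** X E) *v t = 0 *v t" by (simp add: vec.scale u(2) flip: mv_assoc)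
  qed
  hence "u E' ** X E' = 0" using z[OF words_mult[OF u(1) X(1)]] by simp
  hence "(u E' ** X E') *v v = 0" by simp
  thus ?thesis using v(2) by (simp flip: mv_assoc)
 qed
 have "\<exists>u. u \<in> words \<and> u E *v x = axis j 1" for j by (rule simple_transitive[OF s(1) X(2)]) blast
 then obtain u where u: "!!j. u j \<in> words" "!!j. u j E *v x = axis j 1" by metis
 define k where "k = (\<chi> i j. (u j E' *v v) $ i)"
 have kw: "k *v (w E *v x) = w E' *v v" if w: "w \<in> words" for w
 proof -
  let ?c = "w E *v x"
  let ?w = "%m. \<Sum>j\<in>UNIV. (?c $ j) \<odot> u j m"
  have W: "?w \<in> words" by (intro words_sum words.scale u) simp
  have sv: "(\<Sum>j\<in>A. f j) *v t = (\<Sum>j\<in>A. f j *v t)" if "finite A" for A :: "'g set" and f :: "'g => 'g End" and t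
   using that by (induction A rule: finite_induct) (simp_all add: matrix_vector_mult_add_rdistrib)
  have "?w E *v x = (\<Sum>j\<in>UNIV. ?c $ j *s axis j 1)" by (simp add: sv cs_vec u(2))
  also have "... = ?c" by (rule basis_expansion)
  finally have "(w E - 1 \<odot> ?w E) *v x = 0" by (simp add: mv_diff)
  from wd[OF words_diff[OF w W, of 1] this] have "w E' *v v = ?w E' *v v" by (simp add: mv_diff)
  also have "... = (\<Sum>j\<in>UNIV. ?c $ j *s (u j E' *v v))" by (simp add: sv cs_vec)
  also have "... = k *v ?c"
  proof -
   have "(k *v ?c) $ i = (\<Sum>j\<in>UNIV. (u j E' *v v) $ i * ?c $ j)" for i unfolding matrix_vector_mult_def[of k] by (simp add: k_def)
   thus ?thesis by (simp add: vec_eq_iff mult.commute)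
  qed
  finally show ?thesis ..
 qed
 have int: "k ** A E = A E' ** k" if A: "!!w. w \<in> words ==> (%m. A m ** w m) \<in> words" for A
 proof (rule matrix_eqI)
  fix t
  obtain w where w: "w \<in> words" "w E *v x = t" by (rule simple_transitive[OF s(1) X(2)]) blast
  have "(k ** A E) *v t = k *v ((A E ** w E) *v x)" by (simp add: w(2)[symmetric] flip: mv_assoc)
  also have "... = (A E' ** w E') *v v" by (rule kw[OF A[OF w(1)]])
  also have "... = A E' *v (k *v t)" by (simp add: w(2)[symmetric] kw[OF w(1)] flip: mv_assoc)
  finally show "(k ** A E) *v t = (A E' ** k) *v t" by (simp flip: mv_assoc)
 qed
 have kC: "k \<in> \<C>" using int[of "%m. R g" for g] words.grp by (simp add: commutant_def)
 have kE: "k |> E = E' <| k" using int[OF words.fst_mult] int[OF words.snd_mult] by (simp add: prod_eq_iff)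
 have "k *v x = v" using kw[OF X(1)] X(3) v(2) by simp
 hence k0: "k ~= 0" using v(1) by auto
 have EM: "E \<in> \<M>" "E' \<in> \<M>" using s by (simp_all add: simple_point_def)
 have c1: "E \<in> corM (mat 1) (mat 1)" "E' \<in> corM (mat 1) (mat 1)" "k \<in> cor (mat 1) (mat 1)"
  using EM kC by (auto intro!: corMI corI simp: lm_simps)
 have dd: "DD E' E k = 0" by (simp add: DD_def kE)
 obtain F where F: "subm E F" "!!v. F *v v = v \<longleftrightarrow> mat 1 *v v = v \<and> k *v v = 0"
  by (rule hom_kernel_image[OF Pr_0_1(2) Pr_0_1(2) c1 dd]) blast
 have "F = 0 \<or> F = mat 1" using s(1) F(1) by (simp add: simple_point_def)
 moreover have "F ~= mat 1"
 proof
  assume "F = mat 1"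
  hence "k *v v = 0 *v v" for v using F(2)[of v] by simp
  thus False using matrix_eqI[of k 0] k0 by blast
 qed
 ultimately have "F = 0" by blast
 hence inj: "v = 0" if "k *v v = 0" for v using F(2)[of v] that by simp
 obtain l where l: "l \<in> \<C>" "l ** k = mat 1" "k ** l = mat 1" by (rule inverse_C[OF kC inj]) blast
 hence "(k, l) \<in> GL" using kC by (simp add: GL_def)
 thus ?thesis using that gauge_of_intertwine[OF _ kE] by blast
qed

section \<open>Invariant functions on rational curves\<close>

lemma words_derivative:
 assumes "w \<in> words"
 shows "\<exists>D. (w has_derivative D) (at m) \<and> (\<forall>c v. D (c \<cdot> v) = c \<odot> D v) \<and>
  (\<forall>A\<in>\<C>. D (A |> m - m <| A) = A ** w m - w m ** A)" using assms
proof induction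
 case fst show ?case by (rule exI[of _ fst]) (simp add: bounded_linear_imp_has_derivative[OF bounded_linear_fst])
next
 case snd show ?case by (rule exI[of _ snd]) (simp add: bounded_linear_imp_has_derivative[OF bounded_linear_snd])
next
 case (add a b)
 then obtain D D' where D: "(a has_derivative D) (at m)" "\<forall>c v. D (c \<cdot> v) = c \<odot> D v" "\<forall>A\<in>\<C>. D (A |> m - m <| A) = A ** a m - a m ** A"
  "(b has_derivative D') (at m)" "\<forall>c v. D' (c \<cdot> v) = c \<odot> D' v" "\<forall>A\<in>\<C>. D' (A |> m - m <| A) = A ** b m - b m ** A" by blast
 show ?case by (rule exI[of _ "%h. D h + D' h"]) (use D in \<open>simp add: has_derivative_add cs_distribs mm\<close>)
next
 case (scale a c)
 then obtain D where D: "(a has_derivative D) (at m)" "\<forall>c v. D (c \<cdot> v) = c \<odot> D v" "\<forall>A\<in>\<C>. D (A |> m - m <| A) = A ** a m - a m ** A" by blast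
 have "((%m. c \<odot> a m) has_derivative (%h. c \<odot> D h)) (at m)"
  by (rule bounded_linear.has_derivative[OF linear_conv_bounded_linear[THEN iffD1, OF linear_cs] D(1)])
 thus ?case by (intro exI[of _ "%h. c \<odot> D h"]) (use D in \<open>simp add: mult.commute mm cs_distribs\<close>)
next
 case (grp a g)
 then obtain D where D: "(a has_derivative D) (at m)" "\<forall>c v. D (c \<cdot> v) = c \<odot> D v" "\<forall>A\<in>\<C>. D (A |> m - m <| A) = A ** a m - a m ** A" by blast
 have "((%m. R g ** a m) has_derivative (%h. R g ** D h)) (at m)"
  by (rule bounded_linear.has_derivative[OF bounded_bilinear.bounded_linear_right[OF bb_mult] D(1)])
 thus ?case by (intro exI[of _ "%h. R g ** D h"]) (use D in \<open>simp add: mm C_left\<close>)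
next
 case (fst_mult a)
 then obtain D where D: "(a has_derivative D) (at m)" "\<forall>c v. D (c \<cdot> v) = c \<odot> D v" "\<forall>A\<in>\<C>. D (A |> m - m <| A) = A ** a m - a m ** A" by blast
 have "((%m. fst m ** a m) has_derivative (%h. fst m ** D h + fst h ** a m)) (at m)"
  by (rule bounded_bilinear.FDERIV[OF bb_mult bounded_linear_imp_has_derivative[OF bounded_linear_fst] D(1)])
 thus ?case by (intro exI[of _ "%h. fst m ** D h + fst h ** a m"]) (use D in \<open>simp add: mm cs_distribs\<close>)
next
 case (snd_mult a)
 then obtain D where D: "(a has_derivative D) (at m)" "\<forall>c v. D (c \<cdot> v) = c \<odot> D v" "\<forall>A\<in>\<C>. D (A |> m - m <| A) = A ** a m - a m ** A" by blast
 have "((%m. snd m ** a m) has_derivative (%h. snd m ** D h + snd h ** a m)) (at m)"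
  by (rule bounded_bilinear.FDERIV[OF bb_mult bounded_linear_imp_has_derivative[OF bounded_linear_snd] D(1)])
 thus ?case by (intro exI[of _ "%h. snd m ** D h + snd h ** a m"]) (use D in \<open>simp add: mm cs_distribs\<close>)
qed

lemma words_orbit: "w \<in> words ==> n \<in> orb m ==> trace (w n) = trace (w m)"
proof -
 assume w: "w \<in> words" and "n \<in> orb m"
 then obtain u where u: "u \<in> unitaries \<gamma>" "n = u |> (m <| u\<^sup>H)" by (auto simp: orbit_def act_eq)
 have "w n = u ** w m ** u\<^sup>H" unfolding u(2) by (rule words_gauge[OF w unitary_GL[OF u(1)]])
 thus ?thesis by (simp add: trace_rotate[of u] trace_mul_sym[of "w m ** u\<^sup>H"] assoc_r unitariesD[OF u(1)])
   (simp add: unitariesD[OF u(1)] trace_mul_sym[of u] assoc_r)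
qed

definition tr_on :: "('g pair => 'g End) => 'g pair set => complex" where
 "tr_on w A = trace (w (SOME m. m \<in> A))"

lemma orbit_self: "m \<in> orb m"
proof -
 have u: "mat 1 \<in> unitaries \<gamma>" by (simp add: unitaries_def C_closed adj_mat)
 have "act (mat 1) m = m" unfolding act_eq[OF u] by (simp add: adj_mat lm_simps)
 thus ?thesis unfolding orbit_def using u by (metis imageI)
qed

lemma tr_on_orbit: "w \<in> words ==> tr_on w (orb m) = trace (w m)"
 unfolding tr_on_def by (rule words_orbit) (use someI[of "%n. n \<in> orb m" m] orbit_self in auto)

lemma holo_trace:
 assumes h: "holo T L \<phi>" and w: "w \<in> words"
 shows "(%z. tr_on w (\<phi> z)) holomorphic_on UNIV"
proof (subst holomorphic_on_open[OF open_UNIV], intro ballI)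
 fix z0
 from h[unfolded holo_def, THEN spec, of z0]
 obtain S F where S: "open S" "z0 \<in> S" and F: "\<forall>z\<in>S. F z \<in> Lev T L \<and> \<phi> z = orb (F z) \<and>
    (\<exists>F'. (F has_derivative F') (at z) \<and>
      (\<forall>w. hp (F z) (F' (\<i> * w)) = I_op (hp (F z) (F' w))) \<and>
      (\<forall>w. w ~= 0 --> hp (F z) (F' w) ~= 0))" by blast
 obtain F' where F': "(F has_derivative F') (at z0)" "\<forall>w. hp (F z0) (F' (\<i> * w)) = I_op (hp (F z0) (F' w))" using F S(2) by blast
 obtain D where D: "(w has_derivative D) (at (F z0))" "\<forall>c v. D (c \<cdot> v) = c \<odot> D v"
  "\<forall>A\<in>\<C>. D (A |> F z0 - F z0 <| A) = A ** w (F z0) - w (F z0) ** A" using words_derivative[OF w, of "F z0"] by blast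
 have blt: "bounded_linear (trace :: 'g End => complex)" using linear_trace linear_conv_bounded_linear by blast
 define t where "t h = trace (D (F' h))" for h
 have lD: "linear D" by (rule has_derivative_linear[OF D(1)])
 have th: "t h = trace (D (hp (F z0) (F' h)))" for h
 proof -
  obtain X where X: "X \<in> lieG" "F' h = hp (F z0) (F' h) + inf_act X (F z0)" by (rule hp_diff) blast
  have "D (F' h) = D (hp (F z0) (F' h)) + (X ** w (F z0) - w (F z0) ** X)"
   using D(3) lieD(1)[OF X(1)] linear_add[OF lD, of "hp (F z0) (F' h)" "inf_act X (F z0)"] X(2) by (simp add: inf_act_eq)
  thus ?thesis by (simp add: t_def trace_add trace_sub trace_mul_sym[of X])
 qed
 have "((%z. trace (w (F z))) has_derivative t) (at z0)" unfolding t_def[abs_def]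
  by (rule bounded_linear.has_derivative[OF blt has_derivative_compose[OF F'(1) D(1)]])
 hence d: "((%z. tr_on w (\<phi> z)) has_derivative t) (at z0)"
 proof (rule has_derivative_transform_within_open[OF _ S])
  fix z assume "z \<in> S"
  hence "\<phi> z = orb (F z)" using F by blast
  thus "trace (w (F z)) = tr_on w (\<phi> z)" by (simp add: tr_on_orbit[OF w])
 qed
 have lt: "linear t" by (rule has_derivative_linear[OF d])
 have ti: "t (\<i> * h) = \<i> * t h" for h
 proof -
  have 1: "hp (F z0) (F' (\<i> * h)) = \<i> \<cdot> hp (F z0) (F' h)" using spec[OF F'(2), of h] by (simp only: I_op_eq)
  show ?thesis unfolding th 1 using D(2) by (simp only: trace_cs)
 qed
 have "t h = t 1 * h" for h
 proof -
  have "h = Re h *\<^sub>R 1 + Im h *\<^sub>R (\<i> * 1)" by (simp add: complex_eq_iff)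
  hence "t h = t (Re h *\<^sub>R 1 + Im h *\<^sub>R (\<i> * 1))" by (rule arg_cong)
  also have "... = Re h *\<^sub>R t 1 + Im h *\<^sub>R (\<i> * t 1)" by (simp only: linear_add[OF lt] linear_scale[OF lt] ti)
  also have "... = t 1 * h" by (simp add: complex_eq_iff algebra_simps)
  finally show ?thesis .
 qed
 hence "t = (%h. t 1 * h)" by (rule HOL.ext)
 from d[unfolded arg_cong[OF this, of "%t. ((%z. tr_on w (\<phi> z)) has_derivative t) (at z0)"]]
 have "((%z. tr_on w (\<phi> z)) has_field_derivative t 1) (at z0)" unfolding has_field_derivative_def .
 thus "\<exists>f'. ((%z. tr_on w (\<phi> z)) has_field_derivative f') (at z0)" by blast
qed

text \<open>The entire function tends to the value of the curve at infinity.\<close>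

lemma trace_constant:
 assumes c: "rational_curve T L f" and w: "w \<in> words"
 shows "tr_on w (f (Some z)) = tr_on w (f None)"
proof -
 let ?g = "%z. tr_on w ((f \<circ> P1_chart0) z)" and ?h = "%z. tr_on w ((f \<circ> P1_chart_infinity) z)"
 have hc: "holo T L (f \<circ> P1_chart0)" "holo T L (f \<circ> P1_chart_infinity)" using c by (simp_all only: rational_curve_def)
 have g: "?g holomorphic_on UNIV" by (rule holo_trace[OF hc(1) w])
 have h: "?h holomorphic_on UNIV" by (rule holo_trace[OF hc(2) w])
 have gh: "?g z = ?h (inverse z)" if "z ~= 0" for z using that by (simp add: P1_chart0_def P1_chart_infinity_def inverse_eq_divide)
 have ch: "continuous_on UNIV ?h" by (rule holomorphic_on_imp_continuous_on[OF h])
 have "((%z. ?h (inverse z)) \<longlongrightarrow> ?h 0) at_infinity" by (rule continuous_on_tendsto_compose[OF ch tendsto_inverse_0]) simp_all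
 moreover have "\<forall>\<^sub>F z in at_infinity. ?h (inverse z) = ?g z" unfolding eventually_at_infinity
 proof (intro exI[of _ 1] allI impI)
  fix z :: complex assume "1 \<le> norm z"
  hence "z ~= 0" by auto
  from gh[OF this] show "?h (inverse z) = ?g z" by (rule sym)
 qed
 ultimately have "(?g \<longlongrightarrow> ?h 0) at_infinity" by (rule Lim_transform_eventually)
 from Liouville_weak[OF g this, of z] have "?g z = ?h 0" .
 thus ?thesis by (simp only: o_apply P1_chart0_def P1_chart_infinity_def if_True refl)
qed

end

context mckay_level
begin

text \<open>The points of a rational curve have the same invariants, so they cannot be simple.\<close>

theorem rational_curve_not_simple:
 assumes c: "rational_curve T L f"
 obtains E F where "E \<in> Lev T L" "subm E F" "F ~= 0" "F ~= mat 1"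
proof -
 note witness = that
 have pt: "\<exists>E. E \<in> Lev T L \<and> f (Some z) = orb E" for z
 proof -
  have "holo T L (f \<circ> P1_chart0)" using c by (simp add: rational_curve_def)
  from this[unfolded holo_def, THEN spec, of z]
  obtain S F where S: "z \<in> S" and F: "\<forall>z\<in>S. F z \<in> Lev T L \<and> (f \<circ> P1_chart0) z = orb (F z) \<and>
    (\<exists>F'. (F has_derivative F') (at z) \<and>
      (\<forall>w. hp (F z) (F' (\<i> * w)) = I_op (hp (F z) (F' w))) \<and>
      (\<forall>w. w ~= 0 --> hp (F z) (F' w) ~= 0))" by blast
  hence "F z \<in> Lev T L" "f (Some z) = orb (F z)" by (auto simp: P1_chart0_def)
  thus ?thesis by blast
 qed
 obtain E E' where E: "E \<in> Lev T L" "f (Some 0) = orb E" and E': "E' \<in> Lev T L" "f (Some 1) = orb E'" using pt by metis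
 show ?thesis
 proof (rule ccontr)
  assume n: "\<not> thesis"
  have s: "simple_point A" if "A \<in> Lev T L" for A unfolding simple_point_def
  proof (intro conjI allI impI)
   show "A \<in> \<M>" using that by (simp add: Lev_def)
   show "F = 0 \<or> F = mat 1" if "subm A F" for F using witness[OF \<open>A \<in> Lev T L\<close> that] n by blast
  qed
  have tr: "trace (w E) = trace (w E')" if w: "w \<in> words" for w
   using trace_constant[OF c w, of 0] trace_constant[OF c w, of 1] by (simp add: E(2) E'(2) tr_on_orbit[OF w])
  obtain k l where kl: "(k, l) \<in> GL" "E' = k |> (E <| l)" by (rule simple_determined_by_traces[OF s[OF E(1)] s[OF E'(1)] tr]) blast
  have EM: "E \<in> \<M>" "rmom E = T" "rmom E' = T" using E(1) E'(1) by (simp_all add: Lev_def)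
  have br: "brick E" by (rule stable_is_brick[OF Lev_stable[OF E(1)]])
  have 1: "E \<in> sol T E" using sol_I[OF GL_1 EM(1), of T] EM(2) by (simp add: lm_simps)
  have 2: "E' \<in> sol T E" unfolding kl(2) by (rule sol_I[OF kl(1) EM(1)]) (use EM(3) kl(2) in simp)
  have "f (Some 0) = f (Some 1)" unfolding E(2) E'(2) sol_orbit[OF T(1) br 1] sol_orbit[OF T(1) br 2] ..
  moreover have "inj f" using c by (simp add: rational_curve_def)
  ultimately show False by (simp add: inj_eq)
 qed
qed

end

context mckay
begin

section \<open>Twistor lines of the roots\<close>

lemma cen_adj: assumes "t \<in> cen" shows "t\<^sup>H \<in> cen"
proof -
 have "t\<^sup>H ** X = X ** t\<^sup>H" if "X \<in> \<C>" for X
 proof -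
  have "(X\<^sup>H ** t)\<^sup>H = (t ** X\<^sup>H)\<^sup>H" using cenD(2)[OF assms C_adj[OF that]] by simp
  thus ?thesis by (simp add: adj_mult)
 qed
 thus ?thesis using assms by (simp add: cen_def C_adj)
qed

lemma tau_lam_cen:
 assumes "T \<in> cen" "L \<in> cen" "T\<^sup>H = T" "trace T = 0" "trace L = 0"
 shows "tau x y T L \<in> cen" "lam x y T L \<in> cen" "(tau x y T L)\<^sup>H = tau x y T L"
  "trace (tau x y T L) = 0" "trace (lam x y T L) = 0"
proof -
 show "tau x y T L \<in> cen" "lam x y T L \<in> cen" unfolding tau_def lam_def by (intro cen_closed cen_adj assms)+
 show "(tau x y T L)\<^sup>H = tau x y T L" unfolding tau_def by (simp add: adj_cs assms(3)) (simp add: vec_eq_iff mult_ac)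
 show "trace (tau x y T L) = 0" "trace (lam x y T L) = 0" by (simp_all add: tau_def lam_def trace_sub trace_add trace_adj assms)
qed

lemma trace_adj_Pr: "t \<in> cen ==> P \<in> Pr ==> trace (t\<^sup>H ** P) = cnj (trace (t ** P))"
 using trace_adj[of "t ** P"] trace_mul_sym[of P "t\<^sup>H"] by (simp add: adj_mult PrD)

text \<open>The values of the three moment map components on a class.\<close>

definition dirv :: "('g End => real) \<times> ('g End => real) \<times> ('g End => real) => 'g End => real^3" where
 "dirv \<zeta> P = vector [- Re (trace (TT \<zeta> ** P)) / 2, Re (\<i> * trace (LL \<zeta> ** P)), Im (\<i> * trace (LL \<zeta> ** P))]"

lemma vec3_eqI: "a $ 1 = b $ 1 ==> a $ 2 = b $ 2 ==> a $ 3 = b $ 3 ==> a = b" for a b :: "real^3" by (simp add: vec_eq_iff forall_3)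

text \<open>The trace encodes the component, orthogonal to the point of the sphere, of the vector of values on the
 class.\<close>

lemma lam_zero_iff:
 assumes unit: "(cmod x)\<^sup>2 + (cmod y)\<^sup>2 = 1" and \<zeta>: "\<zeta> \<in> Z3" and P: "P \<in> Pr"
 shows "trace (lam x y (TT \<zeta>) (LL \<zeta>) ** P) = 0 \<longleftrightarrow> (\<exists>k. dirv \<zeta> P = k *\<^sub>R hopf x y)"
proof -
 define C where "C = \<i> * trace (LL \<zeta> ** P)"
 define w where "w = dirv \<zeta> P $ 1"
 have C: "Complex (dirv \<zeta> P $ 2) (dirv \<zeta> P $ 3) = C" by (simp add: dirv_def C_def complex_eq_iff)
 have trL: "trace (LL \<zeta> ** P) = - \<i> * C" by (simp add: C_def)
 have trT: "trace (TT \<zeta> ** P) = - 2 * of_real w" using trace_Pr_real[OF TT_LL(1,3)[OF \<zeta>] P] by (simp add: w_def dirv_def complex_eq_iff)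
 define Q where "Q = x\<^sup>2 * C - 2 * \<i> * x * y * of_real w + y\<^sup>2 * cnj C"
 have tQ: "trace (lam x y (TT \<zeta>) (LL \<zeta>) ** P) = - \<i> * Q" unfolding lam_def Q_def
  by (simp add: mm trace_sub trace_add trace_adj_Pr[OF TT_LL(2)[OF \<zeta>] P] trL trT algebra_simps)
 note u = unit'[OF unit]
 let ?h1 = "x * cnj x - y * cnj y" and ?c = "2 * \<i> * cnj x * y"
 have h: "complex_of_real (hopf x y $ 1) = ?h1" "Complex (hopf x y $ 2) (hopf x y $ 3) = ?c"
  by (simp_all add: hopf_def complex_norm_square[symmetric] complex_eq_iff)
 have iff: "dirv \<zeta> P = k *\<^sub>R hopf x y \<longleftrightarrow> of_real w = of_real k * ?h1 \<and> C = of_real k * ?c" for k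
 proof -
  have "dirv \<zeta> P = k *\<^sub>R hopf x y \<longleftrightarrow> dirv \<zeta> P $ 1 = k * hopf x y $ 1 \<and> dirv \<zeta> P $ 2 = k * hopf x y $ 2 \<and> dirv \<zeta> P $ 3 = k * hopf x y $ 3"
   by (simp add: vec_eq_iff forall_3)
  also have "dirv \<zeta> P $ 1 = k * hopf x y $ 1 \<longleftrightarrow> complex_of_real w = of_real k * ?h1"
   unfolding h(1)[symmetric] w_def by (simp flip: of_real_mult)
  also have "dirv \<zeta> P $ 2 = k * hopf x y $ 2 \<and> dirv \<zeta> P $ 3 = k * hopf x y $ 3 \<longleftrightarrow> C = of_real k * ?c"
   unfolding h(2)[symmetric] C[symmetric] by (simp add: complex_eq_iff)
  finally show ?thesis .
 qed
 show ?thesis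
 proof
  assume "trace (lam x y (TT \<zeta>) (LL \<zeta>) ** P) = 0"
  hence Q0: "Q = 0" using tQ by simp
  hence Q0': "cnj Q = 0" by simp
  define k where "k = Re (?h1 * of_real w - \<i> * x * cnj y * C + \<i> * y * cnj x * cnj C)"
  have k: "complex_of_real k = ?h1 * of_real w - \<i> * x * cnj y * C + \<i> * y * cnj x * cnj C" by (simp add: k_def complex_eq_iff algebra_simps)
  have one: "z = (x * cnj x + y * cnj y) * ((x * cnj x + y * cnj y) * z)" for z by (simp add: u)
  have "C - of_real k * ?c = (cnj x)\<^sup>2 * Q + y\<^sup>2 * cnj Q"
   unfolding k Q_def by (subst one[of C]) (simp add: power2_eq_square algebra_simps)
  hence "C = of_real k * ?c" by (simp add: Q0)
  moreover have "of_real w - of_real k * ?h1 = \<i> * cnj x * cnj y * Q + cnj (\<i> * cnj x * cnj y * Q)"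
   unfolding k Q_def by (subst one[of "of_real w"]) (simp add: power2_eq_square algebra_simps)
  hence "of_real w = of_real k * ?h1" by (simp add: Q0)
  ultimately show "\<exists>k. dirv \<zeta> P = k *\<^sub>R hopf x y" using iff by blast
 next
  assume "\<exists>k. dirv \<zeta> P = k *\<^sub>R hopf x y"
  then obtain k where k: "complex_of_real w = of_real k * ?h1" "C = of_real k * ?c" using iff by blast
  have "Q = 0" unfolding Q_def k by (simp add: power2_eq_square algebra_simps)
  thus "trace (lam x y (TT \<zeta>) (LL \<zeta>) ** P) = 0" using tQ by simp
 qed
qed

text \<open>Away from one point of the sphere there is an explicit section of the Hopf map; a rotation carries
 that point away from \<open>u0\<close>.\<close>

lemma hopf_section:
 assumes u0: "u0 \<in> sphere 0 1"
 obtains X Y :: "real^3 => complex" and U where "isCont X u0" "isCont Y u0" "open U" "u0 \<in> U"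
  "!!u. u \<in> U ==> u \<in> sphere 0 1 ==> (cmod (X u))\<^sup>2 + (cmod (Y u))\<^sup>2 = 1 \<and> hopf (X u) (Y u) = u"
proof -
 let ?r = "%u::real^3. sqrt (2 * (1 + u $ 1))"
 let ?X = "%u::real^3. complex_of_real ((1 + u $ 1) / ?r u)"
 let ?Y = "%u::real^3. complex_of_real (1 / ?r u) * (of_real (u $ 3) - \<i> * of_real (u $ 2))"
 let ?U = "{u::real^3. u $ 1 > - 1}"
 have cX: "isCont ?X u" and cY: "isCont ?Y u" if "u \<in> ?U" for u using that by (intro continuous_intros; simp)+
 have U: "open ?U" by (intro open_Collect_less continuous_intros)
 have S: "(cmod (?X u))\<^sup>2 + (cmod (?Y u))\<^sup>2 = 1" "hopf (?X u) (?Y u) = u" if u: "u \<in> ?U" "u \<in> sphere 0 1" for u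
 proof -
  let ?s = "1 + u $ 1"
  have s: "?s > 0" using u(1) by simp
  have "u \<bullet> u = 1" using u(2) by (simp add: dot_square_norm)
  hence e: "(u $ 2)\<^sup>2 + (u $ 3)\<^sup>2 = ?s * (1 - u $ 1)" by (simp add: inner_vec_def sum_3 algebra_simps power2_eq_square)
  have r: "(?r u)\<^sup>2 = 2 * ?s" using s by simp
  have a: "(cmod (?X u))\<^sup>2 = ?s / 2" unfolding norm_of_real power2_abs power_divide r using s by (simp add: field_simps power2_eq_square)
  have "(cmod (of_real (u $ 3) - \<i> * of_real (u $ 2)))\<^sup>2 = ?s * (1 - u $ 1)" unfolding e[symmetric] by (simp add: cmod_power2)
  hence b: "(cmod (?Y u))\<^sup>2 = (1 - u $ 1) / 2"
   unfolding norm_mult power_mult_distrib norm_of_real power2_abs power_divide r using s by (simp add: field_simps)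
  have "2 * (?s / ?r u * (1 / ?r u)) = 2 * ?s / (?r u)\<^sup>2" by (simp add: power2_eq_square del: real_sqrt_mult_self real_sqrt_abs2)
  hence sq: "2 * (?s / ?r u * (1 / ?r u)) = 1" unfolding r using s by simp
  have ac: "2 * \<i> * cnj (complex_of_real p) * (of_real q * z) = of_real (2 * (p * q)) * (\<i> * z)" for p q z by simp
  have c: "2 * \<i> * cnj (?X u) * ?Y u = Complex (u $ 2) (u $ 3)" unfolding ac sq by (simp add: complex_eq_iff)
  show "(cmod (?X u))\<^sup>2 + (cmod (?Y u))\<^sup>2 = 1" "hopf (?X u) (?Y u) = u"
   unfolding a b hopf_def c by (auto intro!: vec3_eqI simp: field_simps)
 qed
 let ?\<sigma> = "%u :: real^3. (vector [- u $ 1, - u $ 2, u $ 3] :: real^3)"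
 have swap: "hopf y x = ?\<sigma> (hopf x y)" for x y by (rule vec3_eqI) (simp_all add: hopf_def)
 have inv: "?\<sigma> (?\<sigma> u) = u" for u by (rule vec3_eqI) simp_all
 have n: "?\<sigma> u \<in> sphere 0 1" if "u \<in> sphere 0 1" for u using that by (simp add: norm_eq_1 inner_vec_def sum_3)
 show ?thesis
 proof (cases "u0 \<in> ?U")
  case True
  thus ?thesis using S by (intro that[OF cX cY U]) auto
 next
  case False
  have "linear ?\<sigma>" by (intro linearI vec3_eqI) simp_all
  hence c\<sigma>: "isCont ?\<sigma> u" for u by (simp add: linear_continuous_at linear_conv_bounded_linear)
  have u: "?\<sigma> u0 \<in> ?U" using False by simp
  show ?thesis
  proof (rule that[of "%u. ?Y (?\<sigma> u)" "%u. ?X (?\<sigma> u)" "?\<sigma> -` ?U"])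
   show "isCont (%u. ?Y (?\<sigma> u)) u0" "isCont (%u. ?X (?\<sigma> u)) u0"
    by (rule isCont_o2[OF c\<sigma>], rule cY[OF u], rule isCont_o2[OF c\<sigma>], rule cX[OF u])
   show "open (?\<sigma> -` ?U)" using U c\<sigma> by (intro open_vimage) (auto simp: continuous_on_eq_continuous_at)
   show "u0 \<in> ?\<sigma> -` ?U" using u by simp
   fix u assume "u \<in> ?\<sigma> -` ?U" "u \<in> sphere 0 1"
   hence "?\<sigma> u \<in> ?U" "?\<sigma> u \<in> sphere 0 1" using n by auto
   from S[OF this] show "(cmod (?Y (?\<sigma> u)))\<^sup>2 + (cmod (?X (?\<sigma> u)))\<^sup>2 = 1 \<and> hopf (?Y (?\<sigma> u)) (?X (?\<sigma> u)) = u"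
    unfolding swap[of "?Y (?\<sigma> u)"] by (simp only: inv add.commute)
  qed
 qed
qed
end

context mckay_irr
begin

abbreviation "\<Z> \<equiv> Z3_reg \<gamma> r Rep"

lemma reg_Z3: "\<zeta> \<in> \<Z> ==> \<zeta> \<in> Z3" by (auto simp: Z3_reg_def)

lemma level_locale:
 assumes \<zeta>: "\<zeta> \<in> \<Z>" and unit: "(cmod x)\<^sup>2 + (cmod y)\<^sup>2 = 1"
 shows "mckay_level \<gamma> r Rep (tau x y (TT \<zeta>) (LL \<zeta>)) (lam x y (TT \<zeta>) (LL \<zeta>))"
proof
 note c = TT_LL[OF reg_Z3[OF \<zeta>]]
 note t = tau_lam_cen[OF c(1-5), of x y]
 show "tau x y (TT \<zeta>) (LL \<zeta>) \<in> cen" "(tau x y (TT \<zeta>) (LL \<zeta>))\<^sup>H = tau x y (TT \<zeta>) (LL \<zeta>)"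
  "trace (tau x y (TT \<zeta>) (LL \<zeta>)) = 0" "lam x y (TT \<zeta>) (LL \<zeta>) \<in> cen" by (fact t)+
 fix P assume P: "P \<in> Pr" "N P P = 2"
 let ?T = "tau x y (TT \<zeta>) (LL \<zeta>)" and ?L = "lam x y (TT \<zeta>) (LL \<zeta>)"
 show "trace (?T ** P) ~= 0 \<or> trace (?L ** P) ~= 0"
 proof (rule ccontr)
  assume "\<not> ?thesis"
  hence z: "trace (?T ** P) = 0" "trace (?L ** P) = 0" by auto
  have zH: "trace (?L\<^sup>H ** P) = 0" using trace_adj_Pr[OF t(2) P(1)] z(2) by simp
  have "trace (lam (cnj x) (- y) ?T ?L ** P) = 0" "trace (tau (cnj x) (- y) ?T ?L ** P) = 0"
   by (simp_all add: lam_def[of "cnj x"] tau_def[of "cnj x"] mm trace_sub trace_add z zH)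
  thus False using regular[OF \<zeta> P] unfolding rot_levels[OF unit c(3)] by blast
 qed
qed

lemma dirv_nonzero:
 assumes \<zeta>: "\<zeta> \<in> \<Z>" and P: "P \<in> Pr" "N P P = 2" shows "dirv \<zeta> P ~= 0"
proof
 assume z: "dirv \<zeta> P = 0"
 hence z': "dirv \<zeta> P $ 1 = 0" "dirv \<zeta> P $ 2 = 0" "dirv \<zeta> P $ 3 = 0" by simp_all
 have "trace (TT \<zeta> ** P) = 0" using z'(1) trace_Pr_real[OF TT_LL(1,3)[OF reg_Z3[OF \<zeta>]] P(1)] by (simp add: dirv_def complex_eq_iff)
 moreover have "trace (LL \<zeta> ** P) = 0" using z'(2,3) by (simp add: dirv_def complex_eq_iff)
 ultimately show False using regular[OF \<zeta> P] by blast
qed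

text \<open>A fibre with a rational curve carries a good pair of bricks, so it lies in the direction of a
 class of norm two.\<close>

lemma fibre_good:
 assumes \<zeta>: "\<zeta> \<in> \<Z>" and unit: "(cmod x)\<^sup>2 + (cmod y)\<^sup>2 = 1" and u: "hopf x y \<in> rational_fibres \<gamma> \<zeta>"
 obtains P m k where "good (tau x y (TT \<zeta>) (LL \<zeta>)) (lam x y (TT \<zeta>) (LL \<zeta>)) P m" "P \<in> Pr" "N P P = 2"
  "k ~= 0" "dirv \<zeta> P = k *\<^sub>R hopf x y"
proof -
 let ?T = "tau x y (TT \<zeta>) (LL \<zeta>)" and ?L = "lam x y (TT \<zeta>) (LL \<zeta>)"
 interpret lv: mckay_level \<gamma> r Rep ?T ?L by (rule level_locale[OF \<zeta> unit])
 obtain f where "rational_curve ?T ?L f" using u rational_fibres_rot[OF reg_Z3[OF \<zeta>] unit] by blast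
 then obtain E F where EF: "E \<in> Lev ?T ?L" "subm E F" "F ~= 0" "F ~= mat 1" by (rule lv.rational_curve_not_simple) blast
 obtain P m where g: "good ?T ?L P m" by (rule lv.good_pair_exists[OF EF]) blast
 hence P: "P \<in> Pr" "N P P = 2" and m: "P |> m = m <| P" "om m m = ?L" by (simp_all add: good_def brick_pair_def)
 have "subm m P" using m(1) P(1) by (simp add: subm_def lm_simps(2) PrD flip: lm_simps(3))
 from subm_trace_om[OF this] have "trace (?L ** P) = 0" unfolding m(2) .
 then obtain k where k: "dirv \<zeta> P = k *\<^sub>R hopf x y" using lam_zero_iff[OF unit reg_Z3[OF \<zeta>] P(1)] by blast
 hence "k ~= 0" using dirv_nonzero[OF \<zeta> P] by auto
 thus ?thesis using that g P k by blast
qed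

theorem finite_rational_fibres:
 assumes \<zeta>: "\<zeta> \<in> \<Z>" shows "finite (rational_fibres \<gamma> \<zeta>)"
proof -
 let ?d = "%c. vector [- Re (\<Sum>g\<in>UNIV. TT \<zeta> $ g $ ge * c g) / 2, Re (\<i> * (\<Sum>g\<in>UNIV. LL \<zeta> $ g $ ge * c g)),
   Im (\<i> * (\<Sum>g\<in>UNIV. LL \<zeta> $ g $ ge * c g))] :: real^3"
 have d: "dirv \<zeta> P = ?d (ch P)" for P
  unfolding dirv_def cen_trace[OF TT_LL(1)[OF reg_Z3[OF \<zeta>]]] cen_trace[OF TT_LL(2)[OF reg_Z3[OF \<zeta>]]] ..
 have "rational_fibres \<gamma> \<zeta> \<subseteq> (%c. (1 / norm (?d c)) *\<^sub>R ?d c) ` (ch ` Pr) \<union> (%c. - (1 / norm (?d c)) *\<^sub>R ?d c) ` (ch ` Pr)"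
 proof
  fix u assume u: "u \<in> rational_fibres \<gamma> \<zeta>"
  hence us: "u \<in> sphere 0 1" by (simp add: rational_fibres_def)
  obtain X Y :: "real^3 => complex" and U where XY: "u \<in> U"
   "!!v. v \<in> U ==> v \<in> sphere 0 1 ==> (cmod (X v))\<^sup>2 + (cmod (Y v))\<^sup>2 = 1 \<and> hopf (X v) (Y v) = v"
   by (rule hopf_section[OF us]) blast
  have unit: "(cmod (X u))\<^sup>2 + (cmod (Y u))\<^sup>2 = 1" and h: "hopf (X u) (Y u) = u" using XY(2)[OF XY(1) us] by blast+
  obtain P k where P: "P \<in> Pr" "k ~= 0" "dirv \<zeta> P = k *\<^sub>R u" by (rule fibre_good[OF \<zeta> unit]) (use u h in auto)
  have nd: "norm (k *\<^sub>R u) = \<bar>k\<bar>" using us by simp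
  have "u = (1 / norm (?d (ch P))) *\<^sub>R ?d (ch P) \<or> u = - (1 / norm (?d (ch P))) *\<^sub>R ?d (ch P)"
   unfolding d[symmetric] P(3) nd using P(2) by (cases "k > 0") auto
  thus "u \<in> (%c. (1 / norm (?d c)) *\<^sub>R ?d c) ` (ch ` Pr) \<union> (%c. - (1 / norm (?d c)) *\<^sub>R ?d c) ` (ch ` Pr)" using P(1) by blast
 qed
 thus ?thesis by (rule finite_subset) (intro finite_UnI finite_imageI finite_classes)
qed

lemma tendsto_TT_LL: "(TT \<longlongrightarrow> TT \<zeta>0) (at \<zeta>0 within A)" "(LL \<longlongrightarrow> LL \<zeta>0) (at \<zeta>0 within A)"
proof -
 have tz: "((%x. tz (f x)) \<longlongrightarrow> tz a) F" if "(f \<longlongrightarrow> a) F" for f a F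
  by (rule continuous_on_tendsto_compose[OF continuous_tz that]) simp_all
 show "(TT \<longlongrightarrow> TT \<zeta>0) (at \<zeta>0 within A)" unfolding TT_def[abs_def] by (intro tendsto_cs tz tendsto_fst tendsto_ident_at)
 show "(LL \<longlongrightarrow> LL \<zeta>0) (at \<zeta>0 within A)" unfolding LL_def[abs_def]
  by (intro tendsto_diff tendsto_minus tendsto_cs tz tendsto_fst tendsto_snd tendsto_ident_at)
qed

lemma tendsto_cs2: "(c \<longlongrightarrow> c0) F ==> (f \<longlongrightarrow> a) F ==> ((%x. c x \<odot> f x :: 'g End) \<longlongrightarrow> c0 \<odot> a) F"
 unfolding mat_mult_eq_cs[symmetric] by (rule bounded_bilinear.tendsto[OF bb_mult])
   (simp_all add: mat_def tendsto_vec_lambda)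

text \<open>At a nearby parameter, the same class determines a fibre: the one in the direction of the values of the
 level on the class. The complex level still vanishes on the class there, so the good pair deforms.\<close>

theorem rational_fibre_persists:
 assumes \<zeta>0: "\<zeta>0 \<in> \<Z>" and u0: "u0 \<in> rational_fibres \<gamma> \<zeta>0" and \<epsilon>: "\<epsilon> > 0"
 shows "\<forall>\<^sub>F \<zeta> in at \<zeta>0 within \<Z>. \<exists>u\<in>rational_fibres \<gamma> \<zeta>. dist u u0 < \<epsilon>"
proof -
 let ?F = "at \<zeta>0 within \<Z>"
 have us: "u0 \<in> sphere 0 1" using u0 by (simp add: rational_fibres_def)
 obtain X Y :: "real^3 => complex" and U where XY: "isCont X u0" "isCont Y u0" "open U" "u0 \<in> U"
  "!!v. v \<in> U ==> v \<in> sphere 0 1 ==> (cmod (X v))\<^sup>2 + (cmod (Y v))\<^sup>2 = 1 \<and> hopf (X v) (Y v) = v"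
  by (rule hopf_section[OF us]) blast
 have unit0: "(cmod (X u0))\<^sup>2 + (cmod (Y u0))\<^sup>2 = 1" and h0: "hopf (X u0) (Y u0) = u0" using XY(5)[OF XY(4) us] by blast+
 define T0 where "T0 = tau (X u0) (Y u0) (TT \<zeta>0) (LL \<zeta>0)"
 define L0 where "L0 = lam (X u0) (Y u0) (TT \<zeta>0) (LL \<zeta>0)"
 obtain P m k where P: "good T0 L0 P m" "P \<in> Pr" "N P P = 2" "k ~= 0" "dirv \<zeta>0 P = k *\<^sub>R u0"
  unfolding T0_def L0_def by (rule fibre_good[OF \<zeta>0 unit0]) (use u0 h0 in auto)
 obtain \<delta> where \<delta>: "\<delta> > 0" "!!T L. T \<in> herm0 ==> L \<in> cen ==> trace L = 0 ==> trace (L ** P) = 0 ==>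
  dist T T0 < \<delta> ==> dist L L0 < \<delta> ==> \<exists>m. good T L P m" by (rule good_open[OF P(1)]) blast
 define u where "u \<zeta> = (sgn k / norm (dirv \<zeta> P)) *\<^sub>R dirv \<zeta> P" for \<zeta>
 have d0: "dirv \<zeta>0 P ~= 0" by (rule dirv_nonzero[OF \<zeta>0 P(2,3)])
 have blt: "bounded_linear (trace :: 'g End => complex)" using linear_trace linear_conv_bounded_linear by blast
 have dlim: "((%\<zeta>. dirv \<zeta> P) \<longlongrightarrow> dirv \<zeta>0 P) ?F"
 proof -
  have t: "((%\<zeta>. trace (TT \<zeta> ** P)) \<longlongrightarrow> trace (TT \<zeta>0 ** P)) ?F" "((%\<zeta>. trace (LL \<zeta> ** P)) \<longlongrightarrow> trace (LL \<zeta>0 ** P)) ?F"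
   by (intro bounded_linear.tendsto[OF blt] tendsto_mult_matrix tendsto_const tendsto_TT_LL)+
  have "((%\<zeta>. dirv \<zeta> P $ i) \<longlongrightarrow> dirv \<zeta>0 P $ i) ?F" for i using exhaust_3[of i] unfolding dirv_def
   by (elim disjE) (simp_all only: vector_3; intro tendsto_intros t; simp)+
  thus ?thesis by (rule vec_tendstoI)
 qed
 have u00: "u \<zeta>0 = u0"
 proof -
  have "norm (dirv \<zeta>0 P) = \<bar>k\<bar>" using P(5) us by simp
  hence "u \<zeta>0 = (sgn k / \<bar>k\<bar> * k) *\<^sub>R u0" by (simp add: u_def P(5))
  also have "sgn k / \<bar>k\<bar> * k = 1" using P(4) by (simp add: sgn_if)
  finally show ?thesis by simp
 qed
 have "(u \<longlongrightarrow> u \<zeta>0) ?F" unfolding u_def[abs_def]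
  by (intro tendsto_scaleR tendsto_divide tendsto_const tendsto_norm dlim) (use d0 in simp)
 hence ulim: "(u \<longlongrightarrow> u0) ?F" unfolding u00 .
 have Xl: "((%\<zeta>. X (u \<zeta>)) \<longlongrightarrow> X u0) ?F" and Yl: "((%\<zeta>. Y (u \<zeta>)) \<longlongrightarrow> Y u0) ?F"
  by (rule isCont_tendsto_compose[OF XY(1) ulim], rule isCont_tendsto_compose[OF XY(2) ulim])
 have adjl: "((%\<zeta>. (LL \<zeta>)\<^sup>H) \<longlongrightarrow> (LL \<zeta>0)\<^sup>H) ?F"
  by (rule bounded_linear.tendsto[OF linear_conv_bounded_linear[THEN iffD1, OF linear_adj] tendsto_TT_LL(2)])
 have Tl: "((%\<zeta>. tau (X (u \<zeta>)) (Y (u \<zeta>)) (TT \<zeta>) (LL \<zeta>)) \<longlongrightarrow> T0) ?F"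
  unfolding T0_def tau_def by (intro tendsto_diff tendsto_cs2 tendsto_mult tendsto_cnj tendsto_const Xl Yl tendsto_TT_LL adjl)
 have Ll: "((%\<zeta>. lam (X (u \<zeta>)) (Y (u \<zeta>)) (TT \<zeta>) (LL \<zeta>)) \<longlongrightarrow> L0) ?F"
  unfolding L0_def lam_def by (intro tendsto_diff tendsto_add tendsto_cs2 tendsto_mult tendsto_power tendsto_const Xl Yl tendsto_TT_LL adjl)
 have "\<forall>\<^sub>F \<zeta> in ?F. \<zeta> \<in> \<Z>" by (simp add: eventually_at_filter)
 moreover have "\<forall>\<^sub>F \<zeta> in ?F. u \<zeta> \<in> U" by (rule topological_tendstoD[OF ulim XY(3,4)])
 moreover have "\<forall>\<^sub>F \<zeta> in ?F. dist (u \<zeta>) u0 < \<epsilon>" by (rule tendstoD[OF ulim \<epsilon>])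
 moreover have "\<forall>\<^sub>F \<zeta> in ?F. dist (tau (X (u \<zeta>)) (Y (u \<zeta>)) (TT \<zeta>) (LL \<zeta>)) T0 < \<delta>" by (rule tendstoD[OF Tl \<delta>(1)])
 moreover have "\<forall>\<^sub>F \<zeta> in ?F. dist (lam (X (u \<zeta>)) (Y (u \<zeta>)) (TT \<zeta>) (LL \<zeta>)) L0 < \<delta>" by (rule tendstoD[OF Ll \<delta>(1)])
 ultimately show ?thesis
 proof eventually_elim
  case (elim \<zeta>)
  note \<zeta> = elim(1)
  let ?x = "X (u \<zeta>)" and ?y = "Y (u \<zeta>)"
  let ?T = "tau ?x ?y (TT \<zeta>) (LL \<zeta>)" and ?L = "lam ?x ?y (TT \<zeta>) (LL \<zeta>)"
  have dn: "dirv \<zeta> P ~= 0" by (rule dirv_nonzero[OF \<zeta> P(2,3)])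
  have "u \<zeta> \<in> sphere 0 1" using dn P(4) by (simp add: u_def abs_sgn_eq)
  hence unit: "(cmod ?x)\<^sup>2 + (cmod ?y)\<^sup>2 = 1" and h: "hopf ?x ?y = u \<zeta>" using XY(5)[OF elim(2)] by blast+
  have "dirv \<zeta> P = (norm (dirv \<zeta> P) * sgn k) *\<^sub>R hopf ?x ?y"
  proof -
   have "norm (dirv \<zeta> P) * sgn k * (sgn k / norm (dirv \<zeta> P)) = 1" using dn P(4) by (simp add: sgn_if)
   thus ?thesis unfolding h unfolding u_def scaleR_scaleR by simp
  qed
  hence trL: "trace (?L ** P) = 0" using lam_zero_iff[OF unit reg_Z3[OF \<zeta>] P(2)] by blast
  note c = TT_LL[OF reg_Z3[OF \<zeta>]]
  note t = tau_lam_cen[OF c(1-5), of ?x ?y]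
  have Th: "?T \<in> herm0" using t cenD(1)[OF t(1)] by (simp add: herm0_def)
  obtain m' where g: "good ?T ?L P m'" using \<delta>(2)[OF Th t(2,5) trL elim(4,5)] by blast
  obtain f where "rational_curve ?T ?L f" by (rule rational_curve_of_good[OF t(1) Th t(2) g]) blast
  hence "u \<zeta> \<in> rational_fibres \<gamma> \<zeta>" using rational_fibres_rot[OF reg_Z3[OF \<zeta>] unit] h by metis
  thus ?case using elim(3) by blast
 qed
qed

text \<open>Balls of half the least distance around the fibres of the given parameter are disjoint.\<close>

theorem card_rational_fibres:
 assumes \<zeta>0: "\<zeta>0 \<in> \<Z>"
 shows "\<forall>\<^sub>F \<zeta> in at \<zeta>0 within \<Z>. card (rational_fibres \<gamma> \<zeta>0) \<le> card (rational_fibres \<gamma> \<zeta>)"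
proof -
 let ?A = "rational_fibres \<gamma> \<zeta>0"
 have fA: "finite ?A" by (rule finite_rational_fibres[OF \<zeta>0])
 let ?D = "insert 1 ((%(u, v). dist u v) ` {(u, v) \<in> ?A \<times> ?A. u ~= v})"
 have fD: "finite ?D" using fA by (auto intro: finite_subset[of _ "?A \<times> ?A"])
 define \<epsilon> where "\<epsilon> = Min ?D / 2"
 have pos: "Min ?D > 0" using fD by (subst Min_gr_iff) auto
 hence \<epsilon>: "\<epsilon> > 0" by (simp add: \<epsilon>_def)
 have sep: "2 * \<epsilon> \<le> dist u v" if "u \<in> ?A" "v \<in> ?A" "u ~= v" for u v
  unfolding \<epsilon>_def using Min_le[OF fD, of "dist u v"] that by force
 have "\<forall>\<^sub>F \<zeta> in at \<zeta>0 within \<Z>. \<forall>u0\<in>?A. \<exists>u\<in>rational_fibres \<gamma> \<zeta>. dist u u0 < \<epsilon>"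
  by (rule eventually_ball_finite[OF fA]) (use rational_fibre_persists[OF \<zeta>0 _ \<epsilon>] in blast)
 moreover have "\<forall>\<^sub>F \<zeta> in at \<zeta>0 within \<Z>. \<zeta> \<in> \<Z>" by (simp add: eventually_at_filter)
 ultimately show ?thesis
 proof eventually_elim
  case (elim \<zeta>)
  have "\<forall>u0\<in>?A. \<exists>u. u \<in> rational_fibres \<gamma> \<zeta> \<and> dist u u0 < \<epsilon>" using elim(1) by blast
  from bchoice[OF this] obtain g where g: "!!u0. u0 \<in> ?A ==> g u0 \<in> rational_fibres \<gamma> \<zeta>" "!!u0. u0 \<in> ?A ==> dist (g u0) u0 < \<epsilon>"
   by blast
  have "inj_on g ?A"
  proof (rule inj_onI, rule ccontr)
   fix u v assume a: "u \<in> ?A" "v \<in> ?A" "g u = g v" "u ~= v"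
   have "dist u v \<le> dist (g u) u + dist (g v) v" using a(3) by (metis dist_commute dist_triangle)
   thus False using sep[OF a(1,2,4)] g(2)[OF a(1)] g(2)[OF a(2)] by linarith
  qed
  thus ?case using g(1) finite_rational_fibres[OF elim(2)] by (intro card_inj_on_le[of g]) auto
 qed
qed

end

theorem theorem1p4:
  fixes \<Gamma> :: "(complex^2^2) set"
    and \<gamma> :: "'g::finite \<Rightarrow> complex^2^2"
    and r :: nat
    and Rep :: "nat \<Rightarrow> (complex^'g) set"
  assumes "subgroup \<Gamma> SU2" and "finite \<Gamma>" and "\<Gamma> \<noteq> {mat 1}"
    and "bij_betw \<gamma> UNIV \<Gamma>"
    and "nontrivial_irreps \<gamma> r Rep"
  shows "(\<forall>\<zeta>\<in>Z3_reg \<gamma> r Rep. finite (rational_fibres \<gamma> \<zeta>)) \<and>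
    (\<forall>\<zeta>\<^sub>0\<in>Z3_reg \<gamma> r Rep.
      Liminf (at \<zeta>\<^sub>0 within Z3_reg \<gamma> r Rep) (\<lambda>\<zeta>. ereal (real_of_int (Q1 \<gamma> \<zeta>)))
        \<ge> ereal (real_of_int (Q1 \<gamma> \<zeta>\<^sub>0)))"
proof -
 have rg: "range \<gamma> = \<Gamma>" and inj: "inj \<gamma>" using assms(4) by (simp_all add: bij_betw_def)
 have carr: "A \<in> \<Gamma> ==> conj_transpose A ** A = mat 1 \<and> det A = 1" for A using subgroup.mem_carrier[OF assms(1)] by (simp add: SU2_def)
 interpret mckay_irr \<gamma> r Rep
 proof
  show "inj \<gamma>" by (rule inj)
  show "\<exists>k. \<gamma> k = \<gamma> g ** \<gamma> h" for g h
  proof -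
   have "\<gamma> g \<otimes>\<^bsub>SU2\<^esub> \<gamma> h \<in> \<Gamma>" using rg by (intro subgroup.m_closed[OF assms(1)]) auto
   hence "\<gamma> g ** \<gamma> h \<in> range \<gamma>" by (simp add: SU2_def rg)
   thus ?thesis by (metis imageE)
  qed
  show "\<exists>e. \<gamma> e = mat 1"
  proof -
   have "\<one>\<^bsub>SU2\<^esub> \<in> \<Gamma>" by (rule subgroup.one_closed[OF assms(1)])
   hence "mat 1 \<in> range \<gamma>" by (simp add: SU2_def rg)
   thus ?thesis by (metis imageE)
  qed
  show "conj_transpose (\<gamma> g) ** \<gamma> g = mat 1" "det (\<gamma> g) = 1" for g using carr[of "\<gamma> g"] rg by auto
  show "range \<gamma> ~= {mat 1}" using assms(3) rg by simp
  show "nontrivial_irreps \<gamma> r Rep" by (rule assms(5))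
 qed
 show ?thesis
 proof (intro conjI ballI)
  show "finite (rational_fibres \<gamma> \<zeta>)" if "\<zeta> \<in> Z3_reg \<gamma> r Rep" for \<zeta> by (rule finite_rational_fibres[OF that])
  fix \<zeta>\<^sub>0 assume z: "\<zeta>\<^sub>0 \<in> Z3_reg \<gamma> r Rep"
  have "\<forall>\<^sub>F \<zeta> in at \<zeta>\<^sub>0 within Z3_reg \<gamma> r Rep. ereal (real_of_int (Q1 \<gamma> \<zeta>\<^sub>0)) \<le> ereal (real_of_int (Q1 \<gamma> \<zeta>))"
   using card_rational_fibres[OF z] by (rule eventually_mono) (simp add: Q1_def)
  thus "Liminf (at \<zeta>\<^sub>0 within Z3_reg \<gamma> r Rep) (%\<zeta>. ereal (real_of_int (Q1 \<gamma> \<zeta>))) \<ge> ereal (real_of_int (Q1 \<gamma> \<zeta>\<^sub>0))"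
   by (rule Liminf_bounded)
 qed
qed

end
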